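(* Let $\mathcal{C}$ be a rigid C*-tensor category with simple unit object. There is an equivalence of categories $$\{\text{$*$-algebra objects in }\mathsf{Vec}(\mathcal{C})\}\;\cong\;\{\text{cyclic }\mathcal{C}\text{-module dagger categories}\},$$ where the morphisms on the left are $*$-algebra natural transformations and the morphisms on the right are cyclic $\mathcal{C}$-module dagger functors.
   Context: **Category.** $\mathcal{C}$ is a rigid C*-tensor category with simple unit $1_{\mathcal{C}}$, admitting finite direct sums and subobjects. Each $a\in\mathcal{C}$ has a conjugate $\overline{a}$ with $\mathrm{ev}_a:\overline a\otimes a\to 1_{\mathcal{C}}$, $\mathrm{coev}_a:1_{\mathcal{C}}\to a\otimes\overline a$ satisfying the zig-zag equations and the balancing condition $\mathrm{coev}_a^*(\psi\otimes \mathrm{id}_{\overline a})\mathrm{coev}_a=\mathrm{ev}_a(\mathrm{id}_{\overline a}\otimes\psi)\mathrm{ev}_a^*$ for $\psi\in\mathcal{C}(a,a)$. For $\psi\in\mathcal{C}(a,b)$, $\overline\psi=(\psi^* )^\vee:\overline a\to\overline b$. There are canonical unitary isomorphisms $\nu_{a,b}:\overline a\otimes\overline b\to\overline{b\otimes a}$, $\varphi_a:a\to\overline{\overline a}$, $r:1_{\mathcal{C}}\to\overline{1_{\mathcal{C}}}$. **$*$-algebra objects.** $\mathsf{Vec}(\mathcal{C})$ is the category of linear functors $\mathcal{C}^{\rm op}\to\mathsf{Vec}$ (complex vector spaces, possibly infinite dimensional) and natural transformations. An algebra object is $\mathbf{A}\in\mathsf{Vec}(\mathcal{C})$ with natural,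 associative maps $\mu_{a,b}:\mathbf{A}(a)\otimes\mathbf{A}(b)\to\mathbf{A}(a\otimes b)$ and a unit $i\in\mathbf{A}(1_{\mathcal{C}})$ (i.e. a lax tensor functor $\mathcal{C}^{\rm op}\to\mathsf{Vec}$). A $*$-structure is a family of conjugate linear maps $j_a:\mathbf{A}(a)\to\mathbf{A}(\overline a)$ with $j_b\circ\mathbf{A}(\psi)=\mathbf{A}(\overline\psi)\circ j_a$ for $\psi\in\mathcal{C}(b,a)$, $\mathbf{A}(\varphi_a)\circ j_{\overline a}\circ j_a=\mathrm{id}$, $j_{1_{\mathcal{C}}}(i)=\mathbf{A}(r^{-1})(i)$, and $j_{a\otimes b}(\mu_{a,b}(f\otimes g))=\mathbf{A}(\nu_{b,a}^{-1})(\mu_{\overline b,\overline a}(j_b(g)\otimes j_a(f)))$. A $*$-algebra object is an algebra object together with a $*$-structure. A $*$-algebra natural transformation $\theta:\mathbf{A}\Rightarrow\mathbf{B}$ is a natural transformation compatible with multiplications and units and with $\theta_{\overline a}\circ j^{\mathbf{A}}_a=j^{\mathbf{B}}_a\circ\theta_a$. **Module categories.** A $\mathcal{C}$-module category is a linear category $\mathcal{M}$ with a bilinear bifunctor $\otimes:\mathcal{C}\times\mathcal{M}\to\mathcal{M}$ and unitor and associator natural isomorphisms satisfying the usual pentagon and triangle axioms. It is a $\mathcal{C}$-module dagger category if $\mathcal{M}$ is a dagger category, the associators and unitors are unitary, and $(\psi\otimes\phi)^*=\psi^*\otimes\phi^*$ for morphisms $\psi$ of $\mathcal{C}$, $\phi$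 of $\mathcal{M}$. It is cyclic with basepoint $m\in\mathcal{M}$ if its objects are exactly the $c\otimes m$, $c\in\mathcal{C}$. A $\mathcal{C}$-module functor $(\mathbf{F},\omega):\mathcal{M}\to\mathcal{N}$ is a linear functor with natural isomorphisms $\omega_{c,m}:c\otimes\mathbf{F}(m)\to\mathbf{F}(c\otimes m)$ satisfying the usual associativity and unitality axioms. A cyclic $\mathcal{C}$-module functor $(\mathcal{M},m)\to(\mathcal{N},n)$ also carries an isomorphism $\varpi:n\to\mathbf{F}(m)$. It is a cyclic $\mathcal{C}$-module dagger functor if $\mathbf{F}(f^* )=\mathbf{F}(f)^*$ for all morphisms $f$ and all $\omega_{c,m}$ and $\varpi$ are unitary.
   Formalization: Cyclic C-module dagger functors are taken up to unitary module natural isomorphism compatible with basepoints; with strict equality of triples the claim fails, since rescaling the basepoint isomorphism by a phase gives a different morphism and leaves no initial object on the right. *)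

theory Defs
  imports Complex_Main "HOL-Algebra.Module"
begin

section \<open>Categories, functors, equivalences\<close>

record ('o, 'a) cat =
  Obj :: "'o set"
  Hom :: "'o \<Rightarrow> 'o \<Rightarrow> 'a set"
  Idn :: "'o \<Rightarrow> 'a"
  Cmp :: "'a \<Rightarrow> 'a \<Rightarrow> 'a"  (infixr \<open>\<cdot>\<index>\<close> 70)

text \<open>
  Composition is written in the usual order: \<open>g \<cdot> f\<close> is \<open>f\<close> followed by \<open>g\<close>.
  Values of the fields outside of their mathematical domain are irrelevant.
\<close>

locale category =
  fixes C :: "('o, 'a, 'z) cat_scheme" (structure)
  assumes Idn_in: "a \<in> Obj C \<Longrightarrow> Idn C a \<in> Hom C a a"
    and Cmp_in: "\<lbrakk>a \<in> Obj C; b \<in> Obj C; c \<in> Obj C; f \<in> Hom C a b; g \<in> Hom C b c\<rbrakk>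
      \<Longrightarrow> g \<cdot> f \<in> Hom C a c"
    and Cmp_Idn_left: "\<lbrakk>a \<in> Obj C; b \<in> Obj C; f \<in> Hom C a b\<rbrakk> \<Longrightarrow> Idn C b \<cdot> f = f"
    and Cmp_Idn_right: "\<lbrakk>a \<in> Obj C; b \<in> Obj C; f \<in> Hom C a b\<rbrakk> \<Longrightarrow> f \<cdot> Idn C a = f"
    and Cmp_assoc: "\<lbrakk>a \<in> Obj C; b \<in> Obj C; c \<in> Obj C; d \<in> Obj C;
        f \<in> Hom C a b; g \<in> Hom C b c; h \<in> Hom C c d\<rbrakk> \<Longrightarrow> (h \<cdot> g) \<cdot> f = h \<cdot> (g \<cdot> f)"
    and Hom_disjoint: "\<lbrakk>a \<in> Obj C; b \<in> Obj C; a' \<in> Obj C; b' \<in> Obj C;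
        f \<in> Hom C a b; f \<in> Hom C a' b'\<rbrakk> \<Longrightarrow> a = a' \<and> b = b'"

definition mutually_inverse :: "('o, 'a, 'z) cat_scheme \<Rightarrow> 'o \<Rightarrow> 'o \<Rightarrow> 'a \<Rightarrow> 'a \<Rightarrow> bool" where
  "mutually_inverse C a b f g \<longleftrightarrow> f \<in> Hom C a b \<and> g \<in> Hom C b a \<and>
     g \<cdot>\<^bsub>C\<^esub> f = Idn C a \<and> f \<cdot>\<^bsub>C\<^esub> g = Idn C b"

definition iso_arr :: "('o, 'a, 'z) cat_scheme \<Rightarrow> 'o \<Rightarrow> 'o \<Rightarrow> 'a \<Rightarrow> bool" where
  "iso_arr C a b f \<longleftrightarrow> (\<exists>g. mutually_inverse C a b f g)"

definition inv_arr :: "('o, 'a, 'z) cat_scheme \<Rightarrow> 'o \<Rightarrow> 'o \<Rightarrow> 'a \<Rightarrow> 'a" where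
  "inv_arr C a b f = (THE g. mutually_inverse C a b f g)"

locale functor_between =
  fixes C :: "('o, 'a, 'z) cat_scheme" and D :: "('p, 'b, 'y) cat_scheme"
    and Fo :: "'o \<Rightarrow> 'p" and Fa :: "'a \<Rightarrow> 'b"
  assumes Fo_in: "a \<in> Obj C \<Longrightarrow> Fo a \<in> Obj D"
    and Fa_in: "\<lbrakk>a \<in> Obj C; b \<in> Obj C; f \<in> Hom C a b\<rbrakk> \<Longrightarrow> Fa f \<in> Hom D (Fo a) (Fo b)"
    and Fa_Idn: "a \<in> Obj C \<Longrightarrow> Fa (Idn C a) = Idn D (Fo a)"
    and Fa_Cmp: "\<lbrakk>a \<in> Obj C; b \<in> Obj C; c \<in> Obj C; f \<in> Hom C a b; g \<in> Hom C b c\<rbrakk>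
      \<Longrightarrow> Fa (g \<cdot>\<^bsub>C\<^esub> f) = Fa g \<cdot>\<^bsub>D\<^esub> Fa f"

definition natural_iso ::
  "('o, 'a, 'z) cat_scheme \<Rightarrow> ('p, 'b, 'y) cat_scheme \<Rightarrow> ('o \<Rightarrow> 'p) \<Rightarrow> ('a \<Rightarrow> 'b) \<Rightarrow>
   ('o \<Rightarrow> 'p) \<Rightarrow> ('a \<Rightarrow> 'b) \<Rightarrow> ('o \<Rightarrow> 'b) \<Rightarrow> bool" where
  "natural_iso C D Fo Fa Go Ga \<eta> \<longleftrightarrow>
     (\<forall>a\<in>Obj C. iso_arr D (Fo a) (Go a) (\<eta> a)) \<and>
     (\<forall>a\<in>Obj C. \<forall>b\<in>Obj C. \<forall>f\<in>Hom C a b. Ga f \<cdot>\<^bsub>D\<^esub> \<eta> a = \<eta> b \<cdot>\<^bsub>D\<^esub> Fa f)"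

definition equivalent_categories ::
  "('o, 'a, 'z) cat_scheme \<Rightarrow> ('p, 'b, 'y) cat_scheme \<Rightarrow> bool" where
  "equivalent_categories C D \<longleftrightarrow> category C \<and> category D \<and>
     (\<exists>Fo Fa Go Ga \<eta> \<epsilon>. functor_between C D Fo Fa \<and> functor_between D C Go Ga \<and>
        natural_iso C C id id (Go \<circ> Fo) (Ga \<circ> Fa) \<eta> \<and>
        natural_iso D D (Fo \<circ> Go) (Fa \<circ> Ga) id id \<epsilon>)"


section \<open>Complex linear structure\<close>

definition complex_field :: "complex ring" where
  "complex_field = \<lparr>carrier = UNIV, mult = (*), one = 1, zero = 0, add = (+)\<rparr>"

abbreviation cvector_space :: "(complex, 'v, 'z) module_scheme \<Rightarrow> bool" where
  "cvector_space V \<equiv> module complex_field V"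

text \<open>\<open>\<sigma>\<close> is \<open>id\<close> for linear and \<open>cnj\<close> for conjugate linear maps.\<close>

definition semilinear_map ::
  "(complex \<Rightarrow> complex) \<Rightarrow> (complex, 'v) module \<Rightarrow> (complex, 'w) module \<Rightarrow> ('v \<Rightarrow> 'w) \<Rightarrow> bool" where
  "semilinear_map \<sigma> V W f \<longleftrightarrow> f \<in> carrier V \<rightarrow> carrier W \<and>
     (\<forall>x\<in>carrier V. \<forall>y\<in>carrier V. f (x \<oplus>\<^bsub>V\<^esub> y) = f x \<oplus>\<^bsub>W\<^esub> f y) \<and>
     (\<forall>z. \<forall>x\<in>carrier V. f (z \<odot>\<^bsub>V\<^esub> x) = \<sigma> z \<odot>\<^bsub>W\<^esub> f x)"

abbreviation "linear_map \<equiv> semilinear_map id"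
abbreviation "conj_linear_map \<equiv> semilinear_map cnj"

definition bilinear_map ::
  "(complex, 'u) module \<Rightarrow> (complex, 'v) module \<Rightarrow> (complex, 'w) module \<Rightarrow> ('u \<Rightarrow> 'v \<Rightarrow> 'w) \<Rightarrow> bool"
where
  "bilinear_map U V W f \<longleftrightarrow> (\<forall>x\<in>carrier U. linear_map V W (f x)) \<and>
     (\<forall>y\<in>carrier V. linear_map U W (\<lambda>x. f x y))"

record ('o, 'a) lin_cat = "('o, 'a) cat" +
  HZero :: "'o \<Rightarrow> 'o \<Rightarrow> 'a"
  HAdd :: "'a \<Rightarrow> 'a \<Rightarrow> 'a"
  HScale :: "complex \<Rightarrow> 'a \<Rightarrow> 'a"

text \<open>
  The fields \<open>mult\<close> and \<open>one\<close> are there only because the record of modules extends the one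
  of rings; the locale \<open>module\<close> does not constrain them.
\<close>

definition hom_space :: "('o, 'a, 'z) lin_cat_scheme \<Rightarrow> 'o \<Rightarrow> 'o \<Rightarrow> (complex, 'a) module" where
  "hom_space C a b = \<lparr>carrier = Hom C a b, mult = undefined, one = undefined,
     zero = HZero C a b, add = HAdd C, smult = HScale C\<rparr>"

locale linear_category = category C for C :: "('o, 'a, 'z) lin_cat_scheme" (structure) +
  assumes hom_vector_space: "\<lbrakk>a \<in> Obj C; b \<in> Obj C\<rbrakk> \<Longrightarrow> cvector_space (hom_space C a b)"
    and Cmp_bilinear: "\<lbrakk>a \<in> Obj C; b \<in> Obj C; c \<in> Obj C\<rbrakk> \<Longrightarrow>
      bilinear_map (hom_space C b c) (hom_space C a b) (hom_space C a c) (\<lambda>g f. g \<cdot> f)"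

locale linear_functor = functor_between C D Fo Fa
  for C :: "('o, 'a, 'z) lin_cat_scheme" and D :: "('p, 'b, 'y) lin_cat_scheme" and Fo Fa +
  assumes Fa_linear: "\<lbrakk>a \<in> Obj C; b \<in> Obj C\<rbrakk> \<Longrightarrow>
      linear_map (hom_space C a b) (hom_space D (Fo a) (Fo b)) Fa"

record ('o, 'a) dag_cat = "('o, 'a) lin_cat" +
  Dag :: "'a \<Rightarrow> 'a"  (\<open>_\<dagger>\<index>\<close> [1000] 1000)

locale dagger_category = linear_category C for C :: "('o, 'a, 'z) dag_cat_scheme" (structure) +
  assumes Dag_conj_linear: "\<lbrakk>a \<in> Obj C; b \<in> Obj C\<rbrakk> \<Longrightarrow>
      conj_linear_map (hom_space C a b) (hom_space C b a) (\<lambda>f. f\<dagger>)"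
    and Dag_Dag: "\<lbrakk>a \<in> Obj C; b \<in> Obj C; f \<in> Hom C a b\<rbrakk> \<Longrightarrow> f\<dagger>\<dagger> = f"
    and Dag_Cmp: "\<lbrakk>a \<in> Obj C; b \<in> Obj C; c \<in> Obj C; f \<in> Hom C a b; g \<in> Hom C b c\<rbrakk> \<Longrightarrow>
      (g \<cdot> f)\<dagger> = f\<dagger> \<cdot> g\<dagger>"

definition unitary_arr :: "('o, 'a, 'z) dag_cat_scheme \<Rightarrow> 'o \<Rightarrow> 'o \<Rightarrow> 'a \<Rightarrow> bool" where
  "unitary_arr C a b u \<longleftrightarrow> mutually_inverse C a b u (u\<dagger>\<^bsub>C\<^esub>)"


section \<open>Rigid C*-tensor categories\<close>

definition cstar_norm :: "('o, 'a, 'z) dag_cat_scheme \<Rightarrow> ('a \<Rightarrow> real) \<Rightarrow> bool" where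
  "cstar_norm C nrm \<longleftrightarrow>
     (\<forall>a\<in>Obj C. \<forall>b\<in>Obj C.
        (\<forall>f\<in>Hom C a b. nrm f = 0 \<longleftrightarrow> f = HZero C a b) \<and>
        (\<forall>f\<in>Hom C a b. \<forall>g\<in>Hom C a b. nrm (HAdd C f g) \<le> nrm f + nrm g) \<and>
        (\<forall>z. \<forall>f\<in>Hom C a b. nrm (HScale C z f) = cmod z * nrm f) \<and>
        (\<forall>X. (\<forall>n. X n \<in> Hom C a b) \<and>
             (\<forall>e>0. \<exists>K. \<forall>m\<ge>K. \<forall>n\<ge>K. nrm (X m \<ominus>\<^bsub>hom_space C a b\<^esub> X n) < e) \<longrightarrow>
             (\<exists>L\<in>Hom C a b. (\<lambda>n::nat. nrm (X n \<ominus>\<^bsub>hom_space C a b\<^esub> L)) \<longlonglongrightarrow> 0)) \<and>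
        (\<forall>f\<in>Hom C a b. nrm (f\<dagger>\<^bsub>C\<^esub> \<cdot>\<^bsub>C\<^esub> f) = (nrm f)\<^sup>2)) \<and>
     (\<forall>a\<in>Obj C. \<forall>b\<in>Obj C. \<forall>c\<in>Obj C. \<forall>f\<in>Hom C a b. \<forall>g\<in>Hom C b c.
        nrm (g \<cdot>\<^bsub>C\<^esub> f) \<le> nrm g * nrm f)"

text \<open>
  The C*-norm on the hom-spaces is unique, hence it is a property and not part of the data.
  The axiom \<open>Dag_positive\<close> says that \<open>f\<dagger> \<cdot> f\<close> is a positive element of the C*-algebra of
  endomorphisms of the source of \<open>f\<close>.
\<close>

locale cstar_category = dagger_category C for C :: "('o, 'a, 'z) dag_cat_scheme" (structure) +
  assumes ex_cstar_norm: "\<exists>nrm. cstar_norm C nrm"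
    and Dag_positive: "\<lbrakk>a \<in> Obj C; b \<in> Obj C; f \<in> Hom C a b\<rbrakk> \<Longrightarrow>
      \<exists>g\<in>Hom C a a. f\<dagger> \<cdot> f = g\<dagger> \<cdot> g"

record ('o, 'a) ten_cat = "('o, 'a) dag_cat" +
  TOb :: "'o \<Rightarrow> 'o \<Rightarrow> 'o"  (infixr \<open>\<otimes>\<^sub>o\<index>\<close> 75)
  TAr :: "'a \<Rightarrow> 'a \<Rightarrow> 'a"  (infixr \<open>\<otimes>\<^sub>a\<index>\<close> 75)
  Unt :: 'o
  Asc :: "'o \<Rightarrow> 'o \<Rightarrow> 'o \<Rightarrow> 'a"
  LUn :: "'o \<Rightarrow> 'a"
  RUn :: "'o \<Rightarrow> 'a"

text \<open>
  The structural isomorphisms are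
  \<open>Asc C a b c : (a \<otimes> b) \<otimes> c \<rightarrow> a \<otimes> (b \<otimes> c)\<close>, \<open>LUn C a : 1 \<otimes> a \<rightarrow> a\<close>, \<open>RUn C a : a \<otimes> 1 \<rightarrow> a\<close>;
  they are unitary, so that their inverses can be written with the dagger.
\<close>

locale cstar_tensor_category = cstar_category C
  for C :: "('o, 'a, 'z) ten_cat_scheme" (structure) +
  assumes TOb_in: "\<lbrakk>a \<in> Obj C; b \<in> Obj C\<rbrakk> \<Longrightarrow> a \<otimes>\<^sub>o b \<in> Obj C"
    and TAr_bilinear: "\<lbrakk>a \<in> Obj C; b \<in> Obj C; c \<in> Obj C; d \<in> Obj C\<rbrakk> \<Longrightarrow>
      bilinear_map (hom_space C a b) (hom_space C c d) (hom_space C (a \<otimes>\<^sub>o c) (b \<otimes>\<^sub>o d))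
        (\<lambda>f g. f \<otimes>\<^sub>a g)"
    and TAr_Idn: "\<lbrakk>a \<in> Obj C; b \<in> Obj C\<rbrakk> \<Longrightarrow> Idn C a \<otimes>\<^sub>a Idn C b = Idn C (a \<otimes>\<^sub>o b)"
    and TAr_Cmp: "\<lbrakk>a \<in> Obj C; b \<in> Obj C; c \<in> Obj C; a' \<in> Obj C; b' \<in> Obj C; c' \<in> Obj C;
        f \<in> Hom C a b; g \<in> Hom C b c; f' \<in> Hom C a' b'; g' \<in> Hom C b' c'\<rbrakk> \<Longrightarrow>
      (g \<cdot> f) \<otimes>\<^sub>a (g' \<cdot> f') = (g \<otimes>\<^sub>a g') \<cdot> (f \<otimes>\<^sub>a f')"
    and TAr_Dag: "\<lbrakk>a \<in> Obj C; b \<in> Obj C; c \<in> Obj C; d \<in> Obj C; f \<in> Hom C a b; g \<in> Hom C c d\<rbrakk> \<Longrightarrow>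
      (f \<otimes>\<^sub>a g)\<dagger> = f\<dagger> \<otimes>\<^sub>a g\<dagger>"
    and Unt_in: "Unt C \<in> Obj C"
    and Asc_unitary: "\<lbrakk>a \<in> Obj C; b \<in> Obj C; c \<in> Obj C\<rbrakk> \<Longrightarrow>
      unitary_arr C ((a \<otimes>\<^sub>o b) \<otimes>\<^sub>o c) (a \<otimes>\<^sub>o (b \<otimes>\<^sub>o c)) (Asc C a b c)"
    and LUn_unitary: "a \<in> Obj C \<Longrightarrow> unitary_arr C (Unt C \<otimes>\<^sub>o a) a (LUn C a)"
    and RUn_unitary: "a \<in> Obj C \<Longrightarrow> unitary_arr C (a \<otimes>\<^sub>o Unt C) a (RUn C a)"
    and Asc_natural: "\<lbrakk>a \<in> Obj C; b \<in> Obj C; c \<in> Obj C; a' \<in> Obj C; b' \<in> Obj C; c' \<in> Obj C;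
        f \<in> Hom C a a'; g \<in> Hom C b b'; h \<in> Hom C c c'\<rbrakk> \<Longrightarrow>
      Asc C a' b' c' \<cdot> ((f \<otimes>\<^sub>a g) \<otimes>\<^sub>a h) = (f \<otimes>\<^sub>a (g \<otimes>\<^sub>a h)) \<cdot> Asc C a b c"
    and LUn_natural: "\<lbrakk>a \<in> Obj C; b \<in> Obj C; f \<in> Hom C a b\<rbrakk> \<Longrightarrow>
      LUn C b \<cdot> (Idn C (Unt C) \<otimes>\<^sub>a f) = f \<cdot> LUn C a"
    and RUn_natural: "\<lbrakk>a \<in> Obj C; b \<in> Obj C; f \<in> Hom C a b\<rbrakk> \<Longrightarrow>
      RUn C b \<cdot> (f \<otimes>\<^sub>a Idn C (Unt C)) = f \<cdot> RUn C a"
    and pentagon: "\<lbrakk>a \<in> Obj C; b \<in> Obj C; c \<in> Obj C; d \<in> Obj C\<rbrakk> \<Longrightarrow>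
      (Idn C a \<otimes>\<^sub>a Asc C b c d) \<cdot> Asc C a (b \<otimes>\<^sub>o c) d \<cdot> (Asc C a b c \<otimes>\<^sub>a Idn C d)
      = Asc C a b (c \<otimes>\<^sub>o d) \<cdot> Asc C (a \<otimes>\<^sub>o b) c d"
    and triangle: "\<lbrakk>a \<in> Obj C; b \<in> Obj C\<rbrakk> \<Longrightarrow>
      (Idn C a \<otimes>\<^sub>a LUn C b) \<cdot> Asc C a (Unt C) b = RUn C a \<otimes>\<^sub>a Idn C b"

record ('o, 'a) rigid_cat = "('o, 'a) ten_cat" +
  Cj :: "'o \<Rightarrow> 'o"
  Ev :: "'o \<Rightarrow> 'a"
  Coev :: "'o \<Rightarrow> 'a"

text \<open>
  A zero object exists because the projection \<open>0\<close> splits; thus binary direct sums give all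
  finite ones. Since projections split, simplicity of the unit means that its endomorphism
  algebra is one-dimensional.
\<close>

locale rigid_cstar_tensor_category = cstar_tensor_category C
  for C :: "('o, 'a, 'z) rigid_cat_scheme" (structure) +
  assumes simple_unit:
      "Idn C (Unt C) \<noteq> HZero C (Unt C) (Unt C)"
      "Hom C (Unt C) (Unt C) = range (\<lambda>z. HScale C z (Idn C (Unt C)))"
    and direct_sums: "\<lbrakk>a \<in> Obj C; b \<in> Obj C\<rbrakk> \<Longrightarrow>
      \<exists>c\<in>Obj C. \<exists>v\<in>Hom C a c. \<exists>w\<in>Hom C b c. v\<dagger> \<cdot> v = Idn C a \<and> w\<dagger> \<cdot> w = Idn C b \<and>
        HAdd C (v \<cdot> v\<dagger>) (w \<cdot> w\<dagger>) = Idn C c"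
    and subobjects: "\<lbrakk>a \<in> Obj C; p \<in> Hom C a a; p \<cdot> p = p; p\<dagger> = p\<rbrakk> \<Longrightarrow>
      \<exists>b\<in>Obj C. \<exists>v\<in>Hom C b a. v\<dagger> \<cdot> v = Idn C b \<and> v \<cdot> v\<dagger> = p"
    and Cj_in: "a \<in> Obj C \<Longrightarrow> Cj C a \<in> Obj C"
    and Ev_in: "a \<in> Obj C \<Longrightarrow> Ev C a \<in> Hom C (Cj C a \<otimes>\<^sub>o a) (Unt C)"
    and Coev_in: "a \<in> Obj C \<Longrightarrow> Coev C a \<in> Hom C (Unt C) (a \<otimes>\<^sub>o Cj C a)"
    and zigzag: "a \<in> Obj C \<Longrightarrow>
      RUn C a \<cdot> (Idn C a \<otimes>\<^sub>a Ev C a) \<cdot> Asc C a (Cj C a) a \<cdot> (Coev C a \<otimes>\<^sub>a Idn C a) = LUn C a"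
    and zigzag_conj: "a \<in> Obj C \<Longrightarrow>
      LUn C (Cj C a) \<cdot> (Ev C a \<otimes>\<^sub>a Idn C (Cj C a)) \<cdot> (Asc C (Cj C a) a (Cj C a))\<dagger>
        \<cdot> (Idn C (Cj C a) \<otimes>\<^sub>a Coev C a) = RUn C (Cj C a)"
    and balanced: "\<lbrakk>a \<in> Obj C; f \<in> Hom C a a\<rbrakk> \<Longrightarrow>
      (Coev C a)\<dagger> \<cdot> (f \<otimes>\<^sub>a Idn C (Cj C a)) \<cdot> Coev C a = Ev C a \<cdot> (Idn C (Cj C a) \<otimes>\<^sub>a f) \<cdot> (Ev C a)\<dagger>"

context
  fixes C :: "('o, 'a, 'z) rigid_cat_scheme" (structure)
begin

text \<open>\<open>dual_arr C a b f\<close> is the dual \<open>Cj C b \<rightarrow> Cj C a\<close> of \<open>f : a \<rightarrow> b\<close>.\<close>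

definition dual_arr :: "'o \<Rightarrow> 'o \<Rightarrow> 'a \<Rightarrow> 'a" where
  "dual_arr a b f =
     LUn C (Cj C a) \<cdot> (Ev C b \<otimes>\<^sub>a Idn C (Cj C a)) \<cdot> ((Idn C (Cj C b) \<otimes>\<^sub>a f) \<otimes>\<^sub>a Idn C (Cj C a))
     \<cdot> (Asc C (Cj C b) a (Cj C a))\<dagger> \<cdot> (Idn C (Cj C b) \<otimes>\<^sub>a Coev C a) \<cdot> (RUn C (Cj C b))\<dagger>"

definition conj_arr :: "'o \<Rightarrow> 'o \<Rightarrow> 'a \<Rightarrow> 'a" where
  "conj_arr a b f = dual_arr b a (f\<dagger>)"

text \<open>
  The canonical isomorphisms \<open>phi C a : a \<rightarrow> Cj C (Cj C a)\<close>, \<open>unit_conj C : 1 \<rightarrow> Cj C 1\<close> and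
  \<open>nu C a b : Cj C a \<otimes> Cj C b \<rightarrow> Cj C (b \<otimes> a)\<close> are the comparison maps between two duals of the
  same object. The arrow \<open>nested_ev C a b : (Cj C a \<otimes> Cj C b) \<otimes> (b \<otimes> a) \<rightarrow> 1\<close> is the evaluation
  which exhibits \<open>Cj C a \<otimes> Cj C b\<close> as a dual of \<open>b \<otimes> a\<close>.
\<close>

definition phi :: "'o \<Rightarrow> 'a" where
  "phi a =
     LUn C (Cj C (Cj C a)) \<cdot> ((Coev C a)\<dagger> \<otimes>\<^sub>a Idn C (Cj C (Cj C a)))
     \<cdot> (Asc C a (Cj C a) (Cj C (Cj C a)))\<dagger> \<cdot> (Idn C a \<otimes>\<^sub>a Coev C (Cj C a)) \<cdot> (RUn C a)\<dagger>"

definition unit_conj :: 'a where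
  "unit_conj = LUn C (Cj C (Unt C)) \<cdot> Coev C (Unt C)"

definition nested_ev :: "'o \<Rightarrow> 'o \<Rightarrow> 'a" where
  "nested_ev a b =
     Ev C a \<cdot> (Idn C (Cj C a) \<otimes>\<^sub>a (LUn C a \<cdot> (Ev C b \<otimes>\<^sub>a Idn C a) \<cdot> (Asc C (Cj C b) b a)\<dagger>))
     \<cdot> Asc C (Cj C a) (Cj C b) (b \<otimes>\<^sub>o a)"

definition nu :: "'o \<Rightarrow> 'o \<Rightarrow> 'a" where
  "nu a b =
     (let x = Cj C a \<otimes>\<^sub>o Cj C b; y = b \<otimes>\<^sub>o a in
      LUn C (Cj C y) \<cdot> (nested_ev a b \<otimes>\<^sub>a Idn C (Cj C y)) \<cdot> (Asc C x y (Cj C y))\<dagger>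
      \<cdot> (Idn C x \<otimes>\<^sub>a Coev C y) \<cdot> (RUn C x)\<dagger>)"

end


section \<open>*-algebra objects\<close>

text \<open>
  For \<open>f : a \<rightarrow> b\<close> the map \<open>VAr A f\<close> goes from \<open>VOb A b\<close> to \<open>VOb A a\<close>. The maps on algebraic
  tensor products are given by bilinear maps. All vector spaces have their carrier in the
  arbitrary type \<open>'v\<close>, which plays the role of the universe.
\<close>

record ('o, 'a, 'v) vec_object =
  VOb :: "'o \<Rightarrow> (complex, 'v) module"
  VAr :: "'a \<Rightarrow> 'v \<Rightarrow> 'v"

record ('o, 'a, 'v) alg_object = "('o, 'a, 'v) vec_object" +
  AMul :: "'o \<Rightarrow> 'o \<Rightarrow> 'v \<Rightarrow> 'v \<Rightarrow> 'v"
  AUnit :: 'v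

record ('o, 'a, 'v) star_alg_object = "('o, 'a, 'v) alg_object" +
  AStar :: "'o \<Rightarrow> 'v \<Rightarrow> 'v"

locale vec_functor =
  fixes C :: "('o, 'a, 'z) lin_cat_scheme" (structure)
    and A :: "('o, 'a, 'v, 'w) vec_object_scheme"
  assumes VOb_vector_space: "a \<in> Obj C \<Longrightarrow> cvector_space (VOb A a)"
    and VAr_bilinear: "\<lbrakk>a \<in> Obj C; b \<in> Obj C\<rbrakk> \<Longrightarrow>
      bilinear_map (hom_space C a b) (VOb A b) (VOb A a) (VAr A)"
    and VAr_Idn: "\<lbrakk>a \<in> Obj C; x \<in> carrier (VOb A a)\<rbrakk> \<Longrightarrow> VAr A (Idn C a) x = x"
    and VAr_Cmp: "\<lbrakk>a \<in> Obj C; b \<in> Obj C; c \<in> Obj C; f \<in> Hom C a b; g \<in> Hom C b c;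
        x \<in> carrier (VOb A c)\<rbrakk> \<Longrightarrow> VAr A (g \<cdot> f) x = VAr A f (VAr A g x)"

locale algebra_object = vec_functor C A
  for C :: "('o, 'a, 'z) rigid_cat_scheme" (structure)
    and A :: "('o, 'a, 'v, 'w) alg_object_scheme" +
  assumes AMul_bilinear: "\<lbrakk>a \<in> Obj C; b \<in> Obj C\<rbrakk> \<Longrightarrow>
      bilinear_map (VOb A a) (VOb A b) (VOb A (a \<otimes>\<^sub>o b)) (AMul A a b)"
    and AMul_natural: "\<lbrakk>a \<in> Obj C; b \<in> Obj C; a' \<in> Obj C; b' \<in> Obj C;
        f \<in> Hom C a' a; g \<in> Hom C b' b; x \<in> carrier (VOb A a); y \<in> carrier (VOb A b)\<rbrakk> \<Longrightarrow>
      AMul A a' b' (VAr A f x) (VAr A g y) = VAr A (f \<otimes>\<^sub>a g) (AMul A a b x y)"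
    and AMul_assoc: "\<lbrakk>a \<in> Obj C; b \<in> Obj C; c \<in> Obj C;
        x \<in> carrier (VOb A a); y \<in> carrier (VOb A b); z \<in> carrier (VOb A c)\<rbrakk> \<Longrightarrow>
      AMul A (a \<otimes>\<^sub>o b) c (AMul A a b x y) z
      = VAr A (Asc C a b c) (AMul A a (b \<otimes>\<^sub>o c) x (AMul A b c y z))"
    and AUnit_in: "AUnit A \<in> carrier (VOb A (Unt C))"
    and AUnit_left: "\<lbrakk>a \<in> Obj C; x \<in> carrier (VOb A a)\<rbrakk> \<Longrightarrow>
      AMul A (Unt C) a (AUnit A) x = VAr A (LUn C a) x"
    and AUnit_right: "\<lbrakk>a \<in> Obj C; x \<in> carrier (VOb A a)\<rbrakk> \<Longrightarrow>
      AMul A a (Unt C) x (AUnit A) = VAr A (RUn C a) x"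

locale star_algebra_object = algebra_object C A
  for C :: "('o, 'a, 'z) rigid_cat_scheme" (structure)
    and A :: "('o, 'a, 'v, 'w) star_alg_object_scheme" +
  assumes AStar_conj_linear: "a \<in> Obj C \<Longrightarrow>
      conj_linear_map (VOb A a) (VOb A (Cj C a)) (AStar A a)"
    and AStar_natural: "\<lbrakk>a \<in> Obj C; b \<in> Obj C; f \<in> Hom C b a; x \<in> carrier (VOb A a)\<rbrakk> \<Longrightarrow>
      AStar A b (VAr A f x) = VAr A (conj_arr C b a f) (AStar A a x)"
    and AStar_AStar: "\<lbrakk>a \<in> Obj C; x \<in> carrier (VOb A a)\<rbrakk> \<Longrightarrow>
      VAr A (phi C a) (AStar A (Cj C a) (AStar A a x)) = x"
    and AStar_AUnit:
      "AStar A (Unt C) (AUnit A) = VAr A (inv_arr C (Unt C) (Cj C (Unt C)) (unit_conj C)) (AUnit A)"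
    and AStar_AMul: "\<lbrakk>a \<in> Obj C; b \<in> Obj C; x \<in> carrier (VOb A a); y \<in> carrier (VOb A b)\<rbrakk> \<Longrightarrow>
      AStar A (a \<otimes>\<^sub>o b) (AMul A a b x y)
      = VAr A (inv_arr C (Cj C b \<otimes>\<^sub>o Cj C a) (Cj C (a \<otimes>\<^sub>o b)) (nu C b a))
          (AMul A (Cj C b) (Cj C a) (AStar A b y) (AStar A a x))"

text \<open>Transformations are extensional, so that equal ones are equal as HOL functions.\<close>

locale star_algebra_transformation =
  fixes C :: "('o, 'a, 'z) rigid_cat_scheme" (structure)
    and A B :: "('o, 'a, 'v) star_alg_object"
    and \<theta> :: "'o \<Rightarrow> 'v \<Rightarrow> 'v"
  assumes extensional: "\<theta> \<in> extensional (Obj C)"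
      "a \<in> Obj C \<Longrightarrow> \<theta> a \<in> extensional (carrier (VOb A a))"
    and linear: "a \<in> Obj C \<Longrightarrow> linear_map (VOb A a) (VOb B a) (\<theta> a)"
    and natural: "\<lbrakk>a \<in> Obj C; b \<in> Obj C; f \<in> Hom C a b; x \<in> carrier (VOb A b)\<rbrakk> \<Longrightarrow>
      \<theta> a (VAr A f x) = VAr B f (\<theta> b x)"
    and multiplicative: "\<lbrakk>a \<in> Obj C; b \<in> Obj C; x \<in> carrier (VOb A a); y \<in> carrier (VOb A b)\<rbrakk> \<Longrightarrow>
      \<theta> (a \<otimes>\<^sub>o b) (AMul A a b x y) = AMul B a b (\<theta> a x) (\<theta> b y)"
    and unital: "\<theta> (Unt C) (AUnit A) = AUnit B"
    and star_preserving: "\<lbrakk>a \<in> Obj C; x \<in> carrier (VOb A a)\<rbrakk> \<Longrightarrow>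
      \<theta> (Cj C a) (AStar A a x) = AStar B a (\<theta> a x)"

definition star_algebra_category ::
  "('o, 'a, 'z) rigid_cat_scheme \<Rightarrow>
   (('o, 'a, 'v) star_alg_object,
    ('o, 'a, 'v) star_alg_object \<times> ('o, 'a, 'v) star_alg_object \<times> ('o \<Rightarrow> 'v \<Rightarrow> 'v)) cat" where
  "star_algebra_category C =
     \<lparr>Obj = {A. star_algebra_object C A},
      Hom = (\<lambda>A B. {(A, B, \<theta>) | \<theta>. star_algebra_transformation C A B \<theta>}),
      Idn = (\<lambda>A. (A, A, \<lambda>a\<in>Obj C. \<lambda>x\<in>carrier (VOb A a). x)),
      Cmp = (\<lambda>(B', D, \<tau>) (A, B, \<theta>). (A, D, \<lambda>a\<in>Obj C. \<lambda>x\<in>carrier (VOb A a). \<tau> a (\<theta> a x)))\<rparr>"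


section \<open>Cyclic module dagger categories\<close>

record ('m, 'y, 'o, 'a) mod_cat = "('m, 'y) dag_cat" +
  ActOb :: "'o \<Rightarrow> 'm \<Rightarrow> 'm"  (infixr \<open>\<triangleright>\<^sub>o\<index>\<close> 75)
  ActAr :: "'a \<Rightarrow> 'y \<Rightarrow> 'y"  (infixr \<open>\<triangleright>\<^sub>a\<index>\<close> 75)
  MAsc :: "'o \<Rightarrow> 'o \<Rightarrow> 'm \<Rightarrow> 'y"
  MUn :: "'m \<Rightarrow> 'y"
  Base :: 'm

text \<open>
  \<open>MAsc M a b x : (a \<otimes> b) \<triangleright> x \<rightarrow> a \<triangleright> (b \<triangleright> x)\<close> and \<open>MUn M x : 1 \<triangleright> x \<rightarrow> x\<close>.
\<close>

locale module_category = linear_category M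
  for C :: "('o, 'a, 'z) ten_cat_scheme"
    and M :: "('m, 'y, 'o, 'a, 'w) mod_cat_scheme" (structure) +
  assumes ActOb_in: "\<lbrakk>a \<in> Obj C; x \<in> Obj M\<rbrakk> \<Longrightarrow> a \<triangleright>\<^sub>o x \<in> Obj M"
    and ActAr_bilinear: "\<lbrakk>a \<in> Obj C; b \<in> Obj C; x \<in> Obj M; y \<in> Obj M\<rbrakk> \<Longrightarrow>
      bilinear_map (hom_space C a b) (hom_space M x y) (hom_space M (a \<triangleright>\<^sub>o x) (b \<triangleright>\<^sub>o y))
        (\<lambda>f g. f \<triangleright>\<^sub>a g)"
    and ActAr_Idn: "\<lbrakk>a \<in> Obj C; x \<in> Obj M\<rbrakk> \<Longrightarrow> Idn C a \<triangleright>\<^sub>a Idn M x = Idn M (a \<triangleright>\<^sub>o x)"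
    and ActAr_Cmp: "\<lbrakk>a \<in> Obj C; b \<in> Obj C; c \<in> Obj C; x \<in> Obj M; y \<in> Obj M; z \<in> Obj M;
        f \<in> Hom C a b; g \<in> Hom C b c; f' \<in> Hom M x y; g' \<in> Hom M y z\<rbrakk> \<Longrightarrow>
      (g \<cdot>\<^bsub>C\<^esub> f) \<triangleright>\<^sub>a (g' \<cdot> f') = (g \<triangleright>\<^sub>a g') \<cdot> (f \<triangleright>\<^sub>a f')"
    and MAsc_iso: "\<lbrakk>a \<in> Obj C; b \<in> Obj C; x \<in> Obj M\<rbrakk> \<Longrightarrow>
      iso_arr M ((a \<otimes>\<^sub>o\<^bsub>C\<^esub> b) \<triangleright>\<^sub>o x) (a \<triangleright>\<^sub>o (b \<triangleright>\<^sub>o x)) (MAsc M a b x)"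
    and MUn_iso: "x \<in> Obj M \<Longrightarrow> iso_arr M (Unt C \<triangleright>\<^sub>o x) x (MUn M x)"
    and MAsc_natural: "\<lbrakk>a \<in> Obj C; b \<in> Obj C; x \<in> Obj M; a' \<in> Obj C; b' \<in> Obj C; x' \<in> Obj M;
        f \<in> Hom C a a'; g \<in> Hom C b b'; h \<in> Hom M x x'\<rbrakk> \<Longrightarrow>
      MAsc M a' b' x' \<cdot> ((f \<otimes>\<^sub>a\<^bsub>C\<^esub> g) \<triangleright>\<^sub>a h) = (f \<triangleright>\<^sub>a (g \<triangleright>\<^sub>a h)) \<cdot> MAsc M a b x"
    and MUn_natural: "\<lbrakk>x \<in> Obj M; y \<in> Obj M; h \<in> Hom M x y\<rbrakk> \<Longrightarrow>
      MUn M y \<cdot> (Idn C (Unt C) \<triangleright>\<^sub>a h) = h \<cdot> MUn M x"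
    and module_pentagon: "\<lbrakk>a \<in> Obj C; b \<in> Obj C; c \<in> Obj C; x \<in> Obj M\<rbrakk> \<Longrightarrow>
      (Idn C a \<triangleright>\<^sub>a MAsc M b c x) \<cdot> MAsc M a (b \<otimes>\<^sub>o\<^bsub>C\<^esub> c) x \<cdot> (Asc C a b c \<triangleright>\<^sub>a Idn M x)
      = MAsc M a b (c \<triangleright>\<^sub>o x) \<cdot> MAsc M (a \<otimes>\<^sub>o\<^bsub>C\<^esub> b) c x"
    and module_triangle: "\<lbrakk>a \<in> Obj C; x \<in> Obj M\<rbrakk> \<Longrightarrow>
      (Idn C a \<triangleright>\<^sub>a MUn M x) \<cdot> MAsc M a (Unt C) x = RUn C a \<triangleright>\<^sub>a Idn M x"

locale module_dagger_category = module_category C M + dagger_category M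
  for C :: "('o, 'a, 'z) ten_cat_scheme"
    and M :: "('m, 'y, 'o, 'a, 'w) mod_cat_scheme" (structure) +
  assumes MAsc_unitary: "\<lbrakk>a \<in> Obj C; b \<in> Obj C; x \<in> Obj M\<rbrakk> \<Longrightarrow>
      unitary_arr M ((a \<otimes>\<^sub>o\<^bsub>C\<^esub> b) \<triangleright>\<^sub>o x) (a \<triangleright>\<^sub>o (b \<triangleright>\<^sub>o x)) (MAsc M a b x)"
    and MUn_unitary: "x \<in> Obj M \<Longrightarrow> unitary_arr M (Unt C \<triangleright>\<^sub>o x) x (MUn M x)"
    and ActAr_Dag: "\<lbrakk>a \<in> Obj C; b \<in> Obj C; x \<in> Obj M; y \<in> Obj M; f \<in> Hom C a b; g \<in> Hom M x y\<rbrakk> \<Longrightarrow>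
      (f \<triangleright>\<^sub>a g)\<dagger> = f\<dagger>\<^bsub>C\<^esub> \<triangleright>\<^sub>a g\<dagger>"

locale cyclic_module_dagger_category = module_dagger_category C M
  for C :: "('o, 'a, 'z) ten_cat_scheme"
    and M :: "('m, 'y, 'o, 'a, 'w) mod_cat_scheme" (structure) +
  assumes Base_in: "Base M \<in> Obj M"
    and cyclic: "Obj M = (\<lambda>c. c \<triangleright>\<^sub>o Base M) ` Obj C"

record ('m, 'y, 'n, 'x, 'o) mod_fun =
  FOb :: "'m \<Rightarrow> 'n"
  FAr :: "'y \<Rightarrow> 'x"
  FOm :: "'o \<Rightarrow> 'm \<Rightarrow> 'x"
  FBs :: 'x

text \<open>
  \<open>FOm F c x : c \<triangleright> F x \<rightarrow> F (c \<triangleright> x)\<close> is the family \<open>\<omega>\<close>, and \<open>FBs F : Base N \<rightarrow> F (Base M)\<close> is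
  the isomorphism of basepoints.
\<close>

locale cyclic_module_functor = linear_functor M N "FOb F" "FAr F"
  for C :: "('o, 'a, 'z) ten_cat_scheme"
    and M :: "('m, 'y, 'o, 'a, 'v) mod_cat_scheme" and N :: "('n, 'x, 'o, 'a, 'w) mod_cat_scheme"
    and F :: "('m, 'y, 'n, 'x, 'o) mod_fun" +
  assumes FOm_iso: "\<lbrakk>c \<in> Obj C; x \<in> Obj M\<rbrakk> \<Longrightarrow>
      iso_arr N (c \<triangleright>\<^sub>o\<^bsub>N\<^esub> FOb F x) (FOb F (c \<triangleright>\<^sub>o\<^bsub>M\<^esub> x)) (FOm F c x)"
    and FOm_natural: "\<lbrakk>c \<in> Obj C; d \<in> Obj C; x \<in> Obj M; y \<in> Obj M; f \<in> Hom C c d; g \<in> Hom M x y\<rbrakk> \<Longrightarrow>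
      FAr F (f \<triangleright>\<^sub>a\<^bsub>M\<^esub> g) \<cdot>\<^bsub>N\<^esub> FOm F c x = FOm F d y \<cdot>\<^bsub>N\<^esub> (f \<triangleright>\<^sub>a\<^bsub>N\<^esub> FAr F g)"
    and FOm_assoc: "\<lbrakk>a \<in> Obj C; b \<in> Obj C; x \<in> Obj M\<rbrakk> \<Longrightarrow>
      FAr F (MAsc M a b x) \<cdot>\<^bsub>N\<^esub> FOm F (a \<otimes>\<^sub>o\<^bsub>C\<^esub> b) x
      = FOm F a (b \<triangleright>\<^sub>o\<^bsub>M\<^esub> x) \<cdot>\<^bsub>N\<^esub> (Idn C a \<triangleright>\<^sub>a\<^bsub>N\<^esub> FOm F b x) \<cdot>\<^bsub>N\<^esub> MAsc N a b (FOb F x)"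
    and FOm_unit: "x \<in> Obj M \<Longrightarrow>
      FAr F (MUn M x) \<cdot>\<^bsub>N\<^esub> FOm F (Unt C) x = MUn N (FOb F x)"
    and FBs_iso: "iso_arr N (Base N) (FOb F (Base M)) (FBs F)"

locale cyclic_module_dagger_functor = cyclic_module_functor C M N F
  for C :: "('o, 'a, 'z) ten_cat_scheme"
    and M :: "('m, 'y, 'o, 'a, 'v) mod_cat_scheme" and N :: "('n, 'x, 'o, 'a, 'w) mod_cat_scheme"
    and F :: "('m, 'y, 'n, 'x, 'o) mod_fun" +
  assumes FAr_Dag: "\<lbrakk>x \<in> Obj M; y \<in> Obj M; f \<in> Hom M x y\<rbrakk> \<Longrightarrow> FAr F (f\<dagger>\<^bsub>M\<^esub>) = (FAr F f)\<dagger>\<^bsub>N\<^esub>"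
    and FOm_unitary: "\<lbrakk>c \<in> Obj C; x \<in> Obj M\<rbrakk> \<Longrightarrow>
      unitary_arr N (c \<triangleright>\<^sub>o\<^bsub>N\<^esub> FOb F x) (FOb F (c \<triangleright>\<^sub>o\<^bsub>M\<^esub> x)) (FOm F c x)"
    and FBs_unitary: "unitary_arr N (Base N) (FOb F (Base M)) (FBs F)"

definition mod_fun_id :: "('m, 'y, 'o, 'a, 'v) mod_cat_scheme \<Rightarrow> ('m, 'y, 'm, 'y, 'o) mod_fun" where
  "mod_fun_id M = \<lparr>FOb = id, FAr = id, FOm = (\<lambda>c x. Idn M (c \<triangleright>\<^sub>o\<^bsub>M\<^esub> x)), FBs = Idn M (Base M)\<rparr>"

definition mod_fun_comp ::
  "('p, 'w, 'o, 'a, 'u) mod_cat_scheme \<Rightarrow> ('n, 'x, 'p, 'w, 'o) mod_fun \<Rightarrow>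
   ('m, 'y, 'n, 'x, 'o) mod_fun \<Rightarrow> ('m, 'y, 'p, 'w, 'o) mod_fun" where
  "mod_fun_comp P G F =
     \<lparr>FOb = FOb G \<circ> FOb F, FAr = FAr G \<circ> FAr F,
      FOm = (\<lambda>c x. FAr G (FOm F c x) \<cdot>\<^bsub>P\<^esub> FOm G c (FOb F x)),
      FBs = FAr G (FBs F) \<cdot>\<^bsub>P\<^esub> FBs G\<rparr>"

text \<open>
  Cyclic module categories form a 2-category, whose 2-morphisms are the module natural
  transformations compatible with the basepoint isomorphisms. There is at most one 2-morphism
  between two given cyclic module functors, and it is invertible (and unitary in the dagger
  case); the 2-category is regarded as a category by identifying 2-isomorphic functors.
  Without this identification there would be no equivalence with *-algebra objects: functors
  that differ in \<open>FBs\<close> by a phase would be different morphisms, while they induce the same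
  morphism of *-algebra objects.
\<close>

definition mod_fun_iso ::
  "('o, 'a, 'z) ten_cat_scheme \<Rightarrow> ('m, 'y, 'o, 'a, 'v) mod_cat_scheme \<Rightarrow>
   ('n, 'x, 'o, 'a, 'w) mod_cat_scheme \<Rightarrow>
   ('m, 'y, 'n, 'x, 'o) mod_fun \<Rightarrow> ('m, 'y, 'n, 'x, 'o) mod_fun \<Rightarrow> bool" where
  "mod_fun_iso C M N F G \<longleftrightarrow> (\<exists>\<theta>.
     natural_iso M N (FOb F) (FAr F) (FOb G) (FAr G) \<theta> \<and>
     (\<forall>x\<in>Obj M. unitary_arr N (FOb F x) (FOb G x) (\<theta> x)) \<and>
     (\<forall>c\<in>Obj C. \<forall>x\<in>Obj M. \<theta> (c \<triangleright>\<^sub>o\<^bsub>M\<^esub> x) \<cdot>\<^bsub>N\<^esub> FOm F c x = FOm G c x \<cdot>\<^bsub>N\<^esub> (Idn C c \<triangleright>\<^sub>a\<^bsub>N\<^esub> \<theta> x)) \<and>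
     \<theta> (Base M) \<cdot>\<^bsub>N\<^esub> FBs F = FBs G)"

definition mod_fun_class ::
  "('o, 'a, 'z) ten_cat_scheme \<Rightarrow> ('m, 'y, 'o, 'a, 'v) mod_cat_scheme \<Rightarrow>
   ('n, 'x, 'o, 'a, 'w) mod_cat_scheme \<Rightarrow>
   ('m, 'y, 'n, 'x, 'o) mod_fun \<Rightarrow> ('m, 'y, 'n, 'x, 'o) mod_fun set" where
  "mod_fun_class C M N F = {G. cyclic_module_dagger_functor C M N G \<and> mod_fun_iso C M N F G}"

text \<open>
  Morphisms are tagged with their source and target. To keep the size of hom-spaces on the two
  sides of the equivalence the same, the morphisms of a module category are of the form
  \<open>(x, y, v)\<close> with source \<open>x\<close>, target \<open>y\<close> and \<open>v :: 'v\<close>, so that a hom-space is a complex vector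
  space on an arbitrary subset of \<open>'v\<close>, as the value of a *-algebra object is. Every module
  category can be brought into this form for a sufficiently large type \<open>'v\<close>. Objects
  of a cyclic module category are the \<open>c \<triangleright> Base M\<close>, so there are at most as many of them as objects of
  \<open>C\<close>; an object type \<open>'m\<close> is large enough if \<open>Obj C\<close> injects into it.
\<close>

type_synonym ('m, 'v, 'o, 'a) tagged_mod_cat = "('m, 'm \<times> 'm \<times> 'v, 'o, 'a) mod_cat"

type_synonym ('m, 'v, 'o) tagged_mod_fun =
  "('m, 'm \<times> 'm \<times> 'v, 'm, 'm \<times> 'm \<times> 'v, 'o) mod_fun"

definition tagged_homs :: "('m, 'm \<times> 'm \<times> 'v, 'z) cat_scheme \<Rightarrow> bool" where
  "tagged_homs M \<longleftrightarrow> (\<forall>x\<in>Obj M. \<forall>y\<in>Obj M. Hom M x y \<subseteq> {x} \<times> {y} \<times> UNIV)"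

definition category_of_cyclic_module_dagger_categories ::
  "('o, 'a, 'z) ten_cat_scheme \<Rightarrow>
   (('m, 'v, 'o, 'a) tagged_mod_cat,
    ('m, 'v, 'o, 'a) tagged_mod_cat \<times> ('m, 'v, 'o, 'a) tagged_mod_cat \<times>
      ('m, 'v, 'o) tagged_mod_fun set) cat" where
  "category_of_cyclic_module_dagger_categories C =
     \<lparr>Obj = {M. cyclic_module_dagger_category C M \<and> tagged_homs M},
      Hom = (\<lambda>M N. {(M, N, mod_fun_class C M N F) | F. cyclic_module_dagger_functor C M N F}),
      Idn = (\<lambda>M. (M, M, mod_fun_class C M M (mod_fun_id M))),
      Cmp = (\<lambda>(N', P, Y) (M, N, X).
        (M, P, \<Union>G\<in>Y. \<Union>F\<in>X. mod_fun_class C M P (mod_fun_comp P G F)))\<rparr>"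

end

theory Submission
  imports Defs
begin

text \<open>
  A cyclic module category \<open>M\<close> with basepoint \<open>m\<close> gives the algebra object \<open>c \<mapsto> M(c \<triangleright> m, m)\<close>: up to structural
  isomorphisms, the product of \<open>f : a \<triangleright> m \<rightarrow> m\<close> and \<open>g : b \<triangleright> m \<rightarrow> m\<close> is \<open>f \<cdot> (a \<triangleright> g)\<close>, and the star of \<open>f\<close> is obtained from the dagger
  \<open>m \<rightarrow> a \<triangleright> m\<close> by bending \<open>a\<close> to the other side with the evaluation. This is a functor from cyclic module dagger
  categories to star algebra objects. It is shown to be full, faithful and essentially surjective
  (\<open>equivalent_categories_if_fully_faithful\<close>).

  The objects of \<open>M\<close> are the \<open>c \<triangleright> m\<close>, and so all information about \<open>M\<close> is in its orbit category
  (\<open>orbit_category\<close>): its objects are those of \<open>C\<close>, its arrows \<open>a \<rightarrow> b\<close> are the arrows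
  \<open>a \<triangleright> m \<rightarrow> b \<triangleright> m\<close>, and \<open>C\<close> acts on it with structural isomorphisms coming from \<open>C\<close>. Cyclic module dagger functors,
  up to isomorphism, are the same as dagger preserving maps between orbit categories
  (\<open>orbit_map_mod_fun_iso\<close>, \<open>orbit_map_extend\<close>): the isomorphism of basepoints identifies \<open>F (c \<triangleright> m)\<close> with
  \<open>c \<triangleright> n\<close>.

  Rigidity reduces arrows of the orbit category to elements of the algebra: bending turns
  \<open>T : a \<rightarrow> b\<close> into \<open>hat T : Cj C b \<otimes> a \<rightarrow> 1\<close>, and composition becomes multiplication up to arrows of \<open>C\<close>
  (\<open>mul_hat\<close>). Hence a map of the algebra objects extends uniquely to the orbit categories
  (\<open>orbit_functor_extension\<close>, \<open>orbit_functor_eqI\<close>). The same extension theorem handles the dagger. The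
  axioms of a star, except involutivity, say that it is, after unbending, a map of algebra objects from \<open>K(_, 1)\<close> to the algebra object of the
  conjugate opposite of \<open>K\<close>; its extension is a functor reversing the arrows, and the remaining axiom makes it an
  involution (\<open>orbit_dagger_dagger\<close>). Daggers on \<open>K\<close> and stars on \<open>K(_, 1)\<close> thus determine each other, and a
  functor preserves one if it preserves the other (\<open>Theta_dag\<close>). Together this gives fullness and faithfulness.

  For essential surjectivity a star algebra object \<open>A\<close> has to be realised. The orbit category is that of free modules
  over \<open>A\<close>, with natural left \<open>A\<close>-linear families of maps as arrows (\<open>operator\<close>); by a Yoneda argument the arrows
  \<open>c \<rightarrow> 1\<close> are the elements of \<open>A(c)\<close> (\<open>orbit_presentation_op_cat\<close>). The star gives the dagger. To make a cyclic
  module category out of it (\<open>realisation\<close>), objects and arrows are named in the prescribed types, and \<open>c\<close> is made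
  to act on the basepoint by \<open>c\<close> itself rather than by \<open>c \<otimes> 1\<close>.

  The canonical isomorphisms \<open>phi\<close>, \<open>nu\<close> and \<open>unit_conj\<close> enter through one principle: an arrow into \<open>Cj C y\<close> is determined by
  its pairing with \<open>y\<close> (\<open>pairing_eqI\<close>).
\<close>

section \<open>Categories with typed arrows\<close>

definition arr :: "('o, 'a, 'z) cat_scheme \<Rightarrow> 'a \<Rightarrow> bool" where
  "arr C f \<longleftrightarrow> (\<exists>a\<in>Obj C. \<exists>b\<in>Obj C. f \<in> Hom C a b)"

definition src :: "('o, 'a, 'z) cat_scheme \<Rightarrow> 'a \<Rightarrow> 'o" where
  "src C f = (THE a. a \<in> Obj C \<and> (\<exists>b\<in>Obj C. f \<in> Hom C a b))"

definition tgt :: "('o, 'a, 'z) cat_scheme \<Rightarrow> 'a \<Rightarrow> 'o" where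
  "tgt C f = (THE b. b \<in> Obj C \<and> (\<exists>a\<in>Obj C. f \<in> Hom C a b))"

context category
begin

lemma typed_arrow:
  assumes "a \<in> Obj C" "b \<in> Obj C" "f \<in> Hom C a b"
  shows "arr C f" "src C f = a" "tgt C f = b"
proof -
  show "arr C f" using assms by (auto simp: arr_def)
  show "src C f = a" unfolding src_def
    by (rule the_equality) (use assms Hom_disjoint in \<open>blast+\<close>)
  show "tgt C f = b" unfolding tgt_def
    by (rule the_equality) (use assms Hom_disjoint in \<open>blast+\<close>)
qed

lemma arr_in_Hom:
  assumes "arr C f"
  shows "src C f \<in> Obj C" "tgt C f \<in> Obj C" "f \<in> Hom C (src C f) (tgt C f)"
  using assms typed_arrow by (auto simp: arr_def)

lemma src_Obj [simp]: "arr C f \<Longrightarrow> src C f \<in> Obj C"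
  and tgt_Obj [simp]: "arr C f \<Longrightarrow> tgt C f \<in> Obj C"
  by (simp_all add: arr_in_Hom)

lemma Hom_iff:
  "\<lbrakk>a \<in> Obj C; b \<in> Obj C\<rbrakk> \<Longrightarrow> f \<in> Hom C a b \<longleftrightarrow> arr C f \<and> src C f = a \<and> tgt C f = b"
  using typed_arrow[of a b f] arr_in_Hom(3)[of f] by auto

lemma typed_Cmp [simp]:
  assumes "arr C f" "arr C g" "tgt C f = src C g"
  shows "arr C (g \<cdot> f)" "src C (g \<cdot> f) = src C f" "tgt C (g \<cdot> f) = tgt C g"
proof -
  have "g \<cdot> f \<in> Hom C (src C f) (tgt C g)"
    using Cmp_in[of "src C f" "tgt C f" "tgt C g" f g] assms arr_in_Hom by metis
  from typed_arrow[OF _ _ this] assms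
  show "arr C (g \<cdot> f)" "src C (g \<cdot> f) = src C f" "tgt C (g \<cdot> f) = tgt C g" by auto
qed

lemma typed_Idn [simp]:
  assumes "a \<in> Obj C"
  shows "arr C (Idn C a)" "src C (Idn C a) = a" "tgt C (Idn C a) = a"
  using typed_arrow[OF assms assms Idn_in[OF assms]] by auto

lemma comp_Idn_left [simp]: "\<lbrakk>arr C f; tgt C f = b\<rbrakk> \<Longrightarrow> Idn C b \<cdot> f = f"
  using Cmp_Idn_left arr_in_Hom by blast

lemma comp_Idn_right [simp]: "\<lbrakk>arr C f; src C f = a\<rbrakk> \<Longrightarrow> f \<cdot> Idn C a = f"
  using Cmp_Idn_right arr_in_Hom by blast

lemma comp_assoc [simp]:
  "\<lbrakk>arr C f; arr C g; arr C h; tgt C f = src C g; tgt C g = src C h\<rbrakk>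
    \<Longrightarrow> (h \<cdot> g) \<cdot> f = h \<cdot> (g \<cdot> f)"
  using Cmp_assoc[of "src C f" "src C g" "src C h" "tgt C h" f g h] arr_in_Hom[of f] arr_in_Hom[of g]
    arr_in_Hom[of h] by simp

text \<open>The form in which an equation rewrites the head of a right-nested composite.\<close>

lemma rewrite_head:
  "\<lbrakk>g \<cdot> f = h; arr C f; arr C g; tgt C f = src C g; arr C k; tgt C k = src C f\<rbrakk>
    \<Longrightarrow> g \<cdot> (f \<cdot> k) = h \<cdot> k"
  by (simp flip: comp_assoc)

lemma rewrite_head2:
  "\<lbrakk>g \<cdot> f = h \<cdot> h'; arr C f; arr C g; tgt C f = src C g; arr C k; tgt C k = src C f;
    arr C h; arr C h'; tgt C h' = src C h; src C h' = src C f\<rbrakk>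
    \<Longrightarrow> g \<cdot> (f \<cdot> k) = h \<cdot> (h' \<cdot> k)"
  by (simp flip: comp_assoc)

lemma mutually_inverse_iff:
  "\<lbrakk>a \<in> Obj C; b \<in> Obj C\<rbrakk> \<Longrightarrow> mutually_inverse C a b f g \<longleftrightarrow>
    arr C f \<and> arr C g \<and> src C f = a \<and> tgt C f = b \<and> src C g = b \<and> tgt C g = a \<and>
    g \<cdot> f = Idn C a \<and> f \<cdot> g = Idn C b"
  by (auto simp: mutually_inverse_def Hom_iff)

lemma inverse_unique:
  assumes "a \<in> Obj C" "b \<in> Obj C" "mutually_inverse C a b f g" "mutually_inverse C a b f h"
  shows "g = h"
proof -
  have "g = (h \<cdot> f) \<cdot> g" using assms by (simp add: mutually_inverse_iff)
  also have "\<dots> = h \<cdot> (f \<cdot> g)" by (rule comp_assoc) (use assms in \<open>auto simp: mutually_inverse_iff\<close>)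
  also have "\<dots> = h" using assms by (simp add: mutually_inverse_iff)
  finally show ?thesis .
qed

lemma inv_arr_eq:
  assumes "a \<in> Obj C" "b \<in> Obj C" "mutually_inverse C a b f g"
  shows "inv_arr C a b f = g"
  unfolding inv_arr_def by (rule the_equality) (use assms inverse_unique in \<open>blast+\<close>)

lemma comp_inverse_cancel:
  assumes "g \<cdot> f = Idn C (src C f)" "arr C f" "arr C g" "src C g = tgt C f" "arr C k" "tgt C k = src C f"
  shows "g \<cdot> (f \<cdot> k) = k"
  using rewrite_head[OF assms(1)] assms by simp

lemma mono_cancel:
  assumes "f \<cdot> k = f \<cdot> k'" "g \<cdot> f = Idn C (src C f)" "arr C f" "arr C g" "src C g = tgt C f"
    "arr C k" "tgt C k = src C f" "arr C k'" "tgt C k' = src C f"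
  shows "k = k'"
proof -
  have "k = g \<cdot> (f \<cdot> k)" using assms(2-) by (simp add: comp_inverse_cancel[of g f])
  also have "\<dots> = k'" unfolding assms(1) using assms(2-) by (simp add: comp_inverse_cancel[of g f])
  finally show ?thesis .
qed

lemma epi_cancel:
  assumes "k \<cdot> f = k' \<cdot> f" "f \<cdot> g = Idn C (tgt C f)" "arr C f" "arr C g" "src C g = tgt C f"
    "tgt C g = src C f" "arr C k" "src C k = tgt C f" "arr C k'" "src C k' = tgt C f"
  shows "k = k'"
proof -
  have "k = (k \<cdot> f) \<cdot> g" using assms(2-) by simp
  also have "\<dots> = k'" unfolding assms(1) using assms(2-) by simp
  finally show ?thesis .
qed

end

lemma (in dagger_category) typed_Dag [simp]:
  assumes "arr C f"
  shows "arr C (f\<dagger>)" "src C (f\<dagger>) = tgt C f" "tgt C (f\<dagger>) = src C f"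
proof -
  have "f\<dagger> \<in> Hom C (tgt C f) (src C f)"
    using Dag_conj_linear[of "src C f" "tgt C f"] arr_in_Hom[OF assms]
    by (auto simp: semilinear_map_def hom_space_def)
  from typed_arrow[OF _ _ this] assms
  show "arr C (f\<dagger>)" "src C (f\<dagger>) = tgt C f" "tgt C (f\<dagger>) = src C f" by auto
qed

context dagger_category
begin

lemma dag_dag [simp]: "arr C f \<Longrightarrow> f\<dagger>\<dagger> = f"
  using Dag_Dag arr_in_Hom by blast

lemma dag_comp [simp]: "\<lbrakk>arr C f; arr C g; tgt C f = src C g\<rbrakk> \<Longrightarrow> (g \<cdot> f)\<dagger> = f\<dagger> \<cdot> g\<dagger>"
  using Dag_Cmp[of "src C f" "tgt C f" "tgt C g" f g] arr_in_Hom[of f] arr_in_Hom[of g] by simp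

lemma dag_Idn [simp]: "a \<in> Obj C \<Longrightarrow> (Idn C a)\<dagger> = Idn C a"
proof -
  assume a: "a \<in> Obj C"
  have "Idn C a = ((Idn C a)\<dagger> \<cdot> Idn C a)\<dagger>" using a by simp
  also have "\<dots> = (Idn C a)\<dagger> \<cdot> (Idn C a)\<dagger>\<dagger>" using a by (intro dag_comp) auto
  finally show ?thesis using a by simp
qed

lemma unitary_iff:
  "\<lbrakk>a \<in> Obj C; b \<in> Obj C\<rbrakk> \<Longrightarrow> unitary_arr C a b u \<longleftrightarrow>
    arr C u \<and> src C u = a \<and> tgt C u = b \<and> u\<dagger> \<cdot> u = Idn C a \<and> u \<cdot> u\<dagger> = Idn C b"
  by (auto simp: unitary_arr_def mutually_inverse_iff)

lemma unitary_Dag: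
  "\<lbrakk>a \<in> Obj C; b \<in> Obj C; unitary_arr C a b u\<rbrakk> \<Longrightarrow> unitary_arr C b a (u\<dagger>)"
  by (simp add: unitary_iff)

lemma unitary_Cmp:
  assumes "a \<in> Obj C" "b \<in> Obj C" "c \<in> Obj C" "unitary_arr C a b u" "unitary_arr C b c v"
  shows "unitary_arr C a c (v \<cdot> u)"
  using assms comp_inverse_cancel[of "v\<dagger>" v u] comp_inverse_cancel[of u "u\<dagger>" "v\<dagger>"]
  by (simp add: unitary_iff)

lemma unitary_Idn: "a \<in> Obj C \<Longrightarrow> unitary_arr C a a (Idn C a)"
  by (simp add: unitary_iff)

end

section \<open>Monoidal coherence\<close>

context cstar_tensor_category
begin

lemma TOb_Obj [simp]: "\<lbrakk>a \<in> Obj C; b \<in> Obj C\<rbrakk> \<Longrightarrow> a \<otimes>\<^sub>o b \<in> Obj C"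
  by (rule TOb_in)

lemma Unt_Obj [simp]: "Unt C \<in> Obj C"
  by (rule Unt_in)

lemma typed_TAr [simp]:
  assumes "arr C f" "arr C g"
  shows "arr C (f \<otimes>\<^sub>a g)" "src C (f \<otimes>\<^sub>a g) = src C f \<otimes>\<^sub>o src C g" "tgt C (f \<otimes>\<^sub>a g) = tgt C f \<otimes>\<^sub>o tgt C g"
proof -
  have "f \<otimes>\<^sub>a g \<in> Hom C (src C f \<otimes>\<^sub>o src C g) (tgt C f \<otimes>\<^sub>o tgt C g)"
    using TAr_bilinear[of "src C f" "tgt C f" "src C g" "tgt C g"] arr_in_Hom[of f] arr_in_Hom[of g] assms
    by (auto simp: bilinear_map_def semilinear_map_def hom_space_def)
  from typed_arrow[OF _ _ this] assms
  show "arr C (f \<otimes>\<^sub>a g)" "src C (f \<otimes>\<^sub>a g) = src C f \<otimes>\<^sub>o src C g" "tgt C (f \<otimes>\<^sub>a g) = tgt C f \<otimes>\<^sub>o tgt C g"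
    by auto
qed

lemma interchange:
  "\<lbrakk>arr C f; arr C g; arr C f'; arr C g'; tgt C f = src C g; tgt C f' = src C g'\<rbrakk>
    \<Longrightarrow> (g \<otimes>\<^sub>a g') \<cdot> (f \<otimes>\<^sub>a f') = (g \<cdot> f) \<otimes>\<^sub>a (g' \<cdot> f')"
  using TAr_Cmp[of "src C f" "src C g" "tgt C g" "src C f'" "src C g'" "tgt C g'" f g f' g']
    arr_in_Hom[of f] arr_in_Hom[of g] arr_in_Hom[of f'] arr_in_Hom[of g'] by simp

lemma interchange_head:
  "\<lbrakk>arr C f; arr C g; arr C f'; arr C g'; tgt C f = src C g; tgt C f' = src C g';
    arr C k; tgt C k = src C f \<otimes>\<^sub>o src C f'\<rbrakk>
    \<Longrightarrow> (g \<otimes>\<^sub>a g') \<cdot> ((f \<otimes>\<^sub>a f') \<cdot> k) = ((g \<cdot> f) \<otimes>\<^sub>a (g' \<cdot> f')) \<cdot> k"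
  by (rule rewrite_head[OF interchange]) auto

lemma TAr_Idn_Idn [simp]: "\<lbrakk>a \<in> Obj C; b \<in> Obj C\<rbrakk> \<Longrightarrow> Idn C a \<otimes>\<^sub>a Idn C b = Idn C (a \<otimes>\<^sub>o b)"
  by (rule TAr_Idn)

lemma dag_TAr [simp]: "\<lbrakk>arr C f; arr C g\<rbrakk> \<Longrightarrow> (f \<otimes>\<^sub>a g)\<dagger> = f\<dagger> \<otimes>\<^sub>a g\<dagger>"
  using TAr_Dag[of "src C f" "tgt C f" "src C g" "tgt C g" f g] arr_in_Hom[of f] arr_in_Hom[of g] by simp

lemma typed_Asc [simp]:
  assumes "a \<in> Obj C" "b \<in> Obj C" "c \<in> Obj C"
  shows "arr C (Asc C a b c)" "src C (Asc C a b c) = (a \<otimes>\<^sub>o b) \<otimes>\<^sub>o c" "tgt C (Asc C a b c) = a \<otimes>\<^sub>o (b \<otimes>\<^sub>o c)"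
  and Asc_dag_Asc [simp]: "(Asc C a b c)\<dagger> \<cdot> Asc C a b c = Idn C ((a \<otimes>\<^sub>o b) \<otimes>\<^sub>o c)"
  and Asc_Asc_dag [simp]: "Asc C a b c \<cdot> (Asc C a b c)\<dagger> = Idn C (a \<otimes>\<^sub>o (b \<otimes>\<^sub>o c))"
  using Asc_unitary[OF assms] assms by (simp_all add: unitary_iff)

lemma typed_LUn [simp]:
  assumes "a \<in> Obj C"
  shows "arr C (LUn C a)" "src C (LUn C a) = Unt C \<otimes>\<^sub>o a" "tgt C (LUn C a) = a"
  and LUn_dag_LUn [simp]: "(LUn C a)\<dagger> \<cdot> LUn C a = Idn C (Unt C \<otimes>\<^sub>o a)"
  and LUn_LUn_dag [simp]: "LUn C a \<cdot> (LUn C a)\<dagger> = Idn C a"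
  using LUn_unitary[OF assms] assms by (simp_all add: unitary_iff)

lemma typed_RUn [simp]:
  assumes "a \<in> Obj C"
  shows "arr C (RUn C a)" "src C (RUn C a) = a \<otimes>\<^sub>o Unt C" "tgt C (RUn C a) = a"
  and RUn_dag_RUn [simp]: "(RUn C a)\<dagger> \<cdot> RUn C a = Idn C (a \<otimes>\<^sub>o Unt C)"
  and RUn_RUn_dag [simp]: "RUn C a \<cdot> (RUn C a)\<dagger> = Idn C a"
  using RUn_unitary[OF assms] assms by (simp_all add: unitary_iff)

lemma structure_cancel [simp]:
  "\<lbrakk>a \<in> Obj C; b \<in> Obj C; c \<in> Obj C; arr C k; tgt C k = (a \<otimes>\<^sub>o b) \<otimes>\<^sub>o c\<rbrakk>
    \<Longrightarrow> (Asc C a b c)\<dagger> \<cdot> (Asc C a b c \<cdot> k) = k"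
  "\<lbrakk>a \<in> Obj C; b \<in> Obj C; c \<in> Obj C; arr C k; tgt C k = a \<otimes>\<^sub>o (b \<otimes>\<^sub>o c)\<rbrakk>
    \<Longrightarrow> Asc C a b c \<cdot> ((Asc C a b c)\<dagger> \<cdot> k) = k"
  "\<lbrakk>a \<in> Obj C; arr C k; tgt C k = Unt C \<otimes>\<^sub>o a\<rbrakk> \<Longrightarrow> (LUn C a)\<dagger> \<cdot> (LUn C a \<cdot> k) = k"
  "\<lbrakk>a \<in> Obj C; arr C k; tgt C k = a\<rbrakk> \<Longrightarrow> LUn C a \<cdot> ((LUn C a)\<dagger> \<cdot> k) = k"
  "\<lbrakk>a \<in> Obj C; arr C k; tgt C k = a \<otimes>\<^sub>o Unt C\<rbrakk> \<Longrightarrow> (RUn C a)\<dagger> \<cdot> (RUn C a \<cdot> k) = k"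
  "\<lbrakk>a \<in> Obj C; arr C k; tgt C k = a\<rbrakk> \<Longrightarrow> RUn C a \<cdot> ((RUn C a)\<dagger> \<cdot> k) = k"
  by (rule comp_inverse_cancel; simp)+

lemma Asc_nat:
  "\<lbrakk>arr C f; arr C g; arr C h; a = src C f; b = src C g; c = src C h; a' = tgt C f; b' = tgt C g; c' = tgt C h\<rbrakk>
    \<Longrightarrow> Asc C a' b' c' \<cdot> ((f \<otimes>\<^sub>a g) \<otimes>\<^sub>a h) = (f \<otimes>\<^sub>a (g \<otimes>\<^sub>a h)) \<cdot> Asc C a b c"
  using Asc_natural[of "src C f" "src C g" "src C h" "tgt C f" "tgt C g" "tgt C h" f g h]
    arr_in_Hom[of f] arr_in_Hom[of g] arr_in_Hom[of h] by simp

lemma LUn_nat: "\<lbrakk>arr C f; a = src C f; b = tgt C f\<rbrakk> \<Longrightarrow> LUn C b \<cdot> (Idn C (Unt C) \<otimes>\<^sub>a f) = f \<cdot> LUn C a"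
  using LUn_natural[of "src C f" "tgt C f" f] arr_in_Hom[of f] by simp

lemma RUn_nat: "\<lbrakk>arr C f; a = src C f; b = tgt C f\<rbrakk> \<Longrightarrow> RUn C b \<cdot> (f \<otimes>\<^sub>a Idn C (Unt C)) = f \<cdot> RUn C a"
  using RUn_natural[of "src C f" "tgt C f" f] arr_in_Hom[of f] by simp

lemma unitary_square:
  assumes sq: "v \<cdot> f = g \<cdot> u"
    and "arr C u" "arr C v" "arr C f" "arr C g" "src C f = src C u" "tgt C f = src C v"
      "src C g = tgt C u" "tgt C g = tgt C v"
    and "u \<cdot> u\<dagger> = Idn C (tgt C u)" "v\<dagger> \<cdot> v = Idn C (src C v)"
  shows "f \<cdot> u\<dagger> = v\<dagger> \<cdot> g"
proof -
  have "f \<cdot> u\<dagger> = v\<dagger> \<cdot> (v \<cdot> (f \<cdot> u\<dagger>))"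
    using assms(2-) by (simp add: comp_inverse_cancel[of "v\<dagger>" v])
  also have "\<dots> = v\<dagger> \<cdot> ((v \<cdot> f) \<cdot> u\<dagger>)" using assms(2-) by simp
  also have "\<dots> = v\<dagger> \<cdot> g" unfolding sq using assms(2-) by simp
  finally show ?thesis .
qed

lemma Asc_dag_nat:
  "\<lbrakk>arr C f; arr C g; arr C h; a = src C f; b = src C g; c = src C h; a' = tgt C f; b' = tgt C g; c' = tgt C h\<rbrakk>
    \<Longrightarrow> ((f \<otimes>\<^sub>a g) \<otimes>\<^sub>a h) \<cdot> (Asc C a b c)\<dagger> = (Asc C a' b' c')\<dagger> \<cdot> (f \<otimes>\<^sub>a (g \<otimes>\<^sub>a h))"
  by (rule unitary_square[OF Asc_nat]) auto

lemma LUn_dag_nat: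
  "\<lbrakk>arr C f; a = src C f; b = tgt C f\<rbrakk> \<Longrightarrow> (Idn C (Unt C) \<otimes>\<^sub>a f) \<cdot> (LUn C a)\<dagger> = (LUn C b)\<dagger> \<cdot> f"
  by (rule unitary_square[OF LUn_nat]) auto

lemma RUn_dag_nat:
  "\<lbrakk>arr C f; a = src C f; b = tgt C f\<rbrakk> \<Longrightarrow> (f \<otimes>\<^sub>a Idn C (Unt C)) \<cdot> (RUn C a)\<dagger> = (RUn C b)\<dagger> \<cdot> f"
  by (rule unitary_square[OF RUn_nat]) auto

lemma tensor_unit_left_inj:
  assumes "Idn C (Unt C) \<otimes>\<^sub>a f = Idn C (Unt C) \<otimes>\<^sub>a g" "arr C f" "arr C g"
    "src C f = src C g" "tgt C f = tgt C g"
  shows "f = g"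
proof -
  have "f \<cdot> LUn C (src C f) = g \<cdot> LUn C (src C f)"
    using assms LUn_nat[of f "src C f" "tgt C f"] LUn_nat[of g "src C g" "tgt C g"] by simp
  then show ?thesis by (rule epi_cancel[where g = "(LUn C (src C f))\<dagger>"]) (use assms in auto)
qed

lemma tensor_unit_right_inj:
  assumes "f \<otimes>\<^sub>a Idn C (Unt C) = g \<otimes>\<^sub>a Idn C (Unt C)" "arr C f" "arr C g"
    "src C f = src C g" "tgt C f = tgt C g"
  shows "f = g"
proof -
  have "f \<cdot> RUn C (src C f) = g \<cdot> RUn C (src C f)"
    using assms RUn_nat[of f "src C f" "tgt C f"] RUn_nat[of g "src C g" "tgt C g"] by simp
  then show ?thesis by (rule epi_cancel[where g = "(RUn C (src C f))\<dagger>"]) (use assms in auto)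
qed

lemma whisker_left:
  "\<lbrakk>a \<in> Obj C; arr C f; arr C g; tgt C f = src C g\<rbrakk>
    \<Longrightarrow> Idn C a \<otimes>\<^sub>a (g \<cdot> f) = (Idn C a \<otimes>\<^sub>a g) \<cdot> (Idn C a \<otimes>\<^sub>a f)"
  by (simp add: interchange)

lemma whisker_right:
  "\<lbrakk>a \<in> Obj C; arr C f; arr C g; tgt C f = src C g\<rbrakk>
    \<Longrightarrow> (g \<cdot> f) \<otimes>\<^sub>a Idn C a = (g \<otimes>\<^sub>a Idn C a) \<cdot> (f \<otimes>\<^sub>a Idn C a)"
  by (simp add: interchange)

text \<open>
  Kelly's argument: tensoring with the unit is faithful, and after tensoring the two sides become
  the two paths around the pentagon.
\<close>

lemma LUn_TOb:
  assumes [simp]: "a \<in> Obj C" "b \<in> Obj C"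
  shows "LUn C (a \<otimes>\<^sub>o b) \<cdot> Asc C (Unt C) a b = LUn C a \<otimes>\<^sub>a Idn C b"
proof (rule tensor_unit_left_inj)
  let ?I = "Unt C" and ?w = "Asc C (Unt C) (Unt C \<otimes>\<^sub>o a) b \<cdot> (Asc C (Unt C) (Unt C) a \<otimes>\<^sub>a Idn C b)"
  have "(Idn C ?I \<otimes>\<^sub>a (LUn C (a \<otimes>\<^sub>o b) \<cdot> Asc C ?I a b)) \<cdot> ?w
      = (Idn C ?I \<otimes>\<^sub>a LUn C (a \<otimes>\<^sub>o b)) \<cdot> (Idn C ?I \<otimes>\<^sub>a Asc C ?I a b) \<cdot> ?w"
    by (simp add: whisker_left)
  also have "\<dots> = (Idn C ?I \<otimes>\<^sub>a LUn C (a \<otimes>\<^sub>o b)) \<cdot> Asc C ?I ?I (a \<otimes>\<^sub>o b) \<cdot> Asc C (?I \<otimes>\<^sub>o ?I) a b"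
    by (simp add: pentagon)
  also have "\<dots> = (RUn C ?I \<otimes>\<^sub>a Idn C (a \<otimes>\<^sub>o b)) \<cdot> Asc C (?I \<otimes>\<^sub>o ?I) a b"
    by (simp add: rewrite_head[OF triangle])
  also have "\<dots> = Asc C ?I a b \<cdot> ((RUn C ?I \<otimes>\<^sub>a Idn C a) \<otimes>\<^sub>a Idn C b)"
    by (subst Asc_nat) auto
  also have "\<dots> = Asc C ?I a b \<cdot> (((Idn C ?I \<otimes>\<^sub>a LUn C a) \<otimes>\<^sub>a Idn C b) \<cdot> (Asc C ?I ?I a \<otimes>\<^sub>a Idn C b))"
    by (simp add: triangle interchange)
  also have "\<dots> = (Idn C ?I \<otimes>\<^sub>a (LUn C a \<otimes>\<^sub>a Idn C b)) \<cdot> ?w"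
    by (subst rewrite_head2[OF Asc_nat[where f = "Idn C ?I" and g = "LUn C a" and h = "Idn C b"]]) auto
  finally show "Idn C ?I \<otimes>\<^sub>a (LUn C (a \<otimes>\<^sub>o b) \<cdot> Asc C ?I a b) = Idn C ?I \<otimes>\<^sub>a (LUn C a \<otimes>\<^sub>a Idn C b)"
    by (rule epi_cancel[where g = "(Asc C ?I ?I a \<otimes>\<^sub>a Idn C b)\<dagger> \<cdot> (Asc C ?I (?I \<otimes>\<^sub>o a) b)\<dagger>"])
      (simp_all add: interchange_head)
qed auto

lemma RUn_TOb:
  assumes [simp]: "a \<in> Obj C" "b \<in> Obj C"
  shows "(Idn C a \<otimes>\<^sub>a RUn C b) \<cdot> Asc C a b (Unt C) = RUn C (a \<otimes>\<^sub>o b)"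
proof (rule tensor_unit_right_inj)
  let ?I = "Unt C"
  have "Asc C a b ?I \<cdot> (RUn C (a \<otimes>\<^sub>o b) \<otimes>\<^sub>a Idn C ?I)
     = Asc C a b ?I \<cdot> ((Idn C (a \<otimes>\<^sub>o b) \<otimes>\<^sub>a LUn C ?I) \<cdot> Asc C (a \<otimes>\<^sub>o b) ?I ?I)"
    by (simp add: triangle)
  also have "\<dots> = (Idn C a \<otimes>\<^sub>a (Idn C b \<otimes>\<^sub>a LUn C ?I)) \<cdot> (Asc C a b (?I \<otimes>\<^sub>o ?I) \<cdot> Asc C (a \<otimes>\<^sub>o b) ?I ?I)"
    using rewrite_head2[OF Asc_nat[of "Idn C a" "Idn C b" "LUn C ?I"],
        where k = "Asc C (a \<otimes>\<^sub>o b) ?I ?I"] by simp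
  also have "\<dots> = (Idn C a \<otimes>\<^sub>a (Idn C b \<otimes>\<^sub>a LUn C ?I)) \<cdot> (Idn C a \<otimes>\<^sub>a Asc C b ?I ?I) \<cdot>
      Asc C a (b \<otimes>\<^sub>o ?I) ?I \<cdot> (Asc C a b ?I \<otimes>\<^sub>a Idn C ?I)"
    by (simp add: pentagon)
  also have "\<dots> = (Idn C a \<otimes>\<^sub>a (RUn C b \<otimes>\<^sub>a Idn C ?I)) \<cdot>
      Asc C a (b \<otimes>\<^sub>o ?I) ?I \<cdot> (Asc C a b ?I \<otimes>\<^sub>a Idn C ?I)"
    by (simp add: interchange_head triangle)
  also have "\<dots> = Asc C a b ?I \<cdot> (((Idn C a \<otimes>\<^sub>a RUn C b) \<cdot> Asc C a b ?I) \<otimes>\<^sub>a Idn C ?I)"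
    using rewrite_head2[OF Asc_nat[of "Idn C a" "RUn C b" "Idn C ?I"],
        where k = "Asc C a b ?I \<otimes>\<^sub>a Idn C ?I"]
    by (simp add: whisker_right)
  finally show "((Idn C a \<otimes>\<^sub>a RUn C b) \<cdot> Asc C a b ?I) \<otimes>\<^sub>a Idn C ?I = RUn C (a \<otimes>\<^sub>o b) \<otimes>\<^sub>a Idn C ?I"
    by (rule mono_cancel[OF sym, where f = "Asc C a b ?I" and g = "(Asc C a b ?I)\<dagger>"]) auto
qed auto

lemma LUn_Unt: "LUn C (Unt C) = RUn C (Unt C)"
proof (rule tensor_unit_right_inj)
  let ?I = "Unt C"
  have "LUn C (?I \<otimes>\<^sub>o ?I) = Idn C ?I \<otimes>\<^sub>a LUn C ?I"
    by (rule mono_cancel[where f = "LUn C ?I" and g = "(LUn C ?I)\<dagger>"])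
      (auto simp: LUn_nat[of "LUn C ?I" "?I \<otimes>\<^sub>o ?I"])
  then show "LUn C ?I \<otimes>\<^sub>a Idn C ?I = RUn C ?I \<otimes>\<^sub>a Idn C ?I"
    using LUn_TOb[of ?I ?I] triangle[of ?I ?I] by simp
qed auto

end

section \<open>Duality calculus\<close>

context rigid_cstar_tensor_category
begin

lemmas merge = interchange interchange_head

lemma Cj_Obj [simp]: "a \<in> Obj C \<Longrightarrow> Cj C a \<in> Obj C"
  by (rule Cj_in)

lemma typed_Ev [simp]:
  assumes "a \<in> Obj C"
  shows "arr C (Ev C a)" "src C (Ev C a) = Cj C a \<otimes>\<^sub>o a" "tgt C (Ev C a) = Unt C"
  using Ev_in[OF assms] assms by (simp_all add: Hom_iff)

lemma typed_Coev [simp]: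
  assumes "a \<in> Obj C"
  shows "arr C (Coev C a)" "src C (Coev C a) = Unt C" "tgt C (Coev C a) = a \<otimes>\<^sub>o Cj C a"
  using Coev_in[OF assms] assms by (simp_all add: Hom_iff)

lemma pentagon_dag:
  assumes [simp]: "a \<in> Obj C" "b \<in> Obj C" "c \<in> Obj C" "d \<in> Obj C"
  shows "(Asc C a b (c \<otimes>\<^sub>o d))\<dagger> \<cdot> (Idn C a \<otimes>\<^sub>a Asc C b c d)
    = Asc C (a \<otimes>\<^sub>o b) c d \<cdot> ((Asc C a b c)\<dagger> \<otimes>\<^sub>a Idn C d) \<cdot> (Asc C a (b \<otimes>\<^sub>o c) d)\<dagger>"
proof -
  have "(Asc C a b (c \<otimes>\<^sub>o d))\<dagger> \<cdot> (Idn C a \<otimes>\<^sub>a Asc C b c d)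
      = (Asc C a b (c \<otimes>\<^sub>o d))\<dagger> \<cdot> ((Idn C a \<otimes>\<^sub>a Asc C b c d) \<cdot> Asc C a (b \<otimes>\<^sub>o c) d \<cdot> (Asc C a b c \<otimes>\<^sub>a Idn C d))
        \<cdot> ((Asc C a b c)\<dagger> \<otimes>\<^sub>a Idn C d) \<cdot> (Asc C a (b \<otimes>\<^sub>o c) d)\<dagger>"
    by (simp add: merge)
  also have "\<dots> = Asc C (a \<otimes>\<^sub>o b) c d \<cdot> ((Asc C a b c)\<dagger> \<otimes>\<^sub>a Idn C d) \<cdot> (Asc C a (b \<otimes>\<^sub>o c) d)\<dagger>"
    by (subst pentagon) simp_all
  finally show ?thesis .
qed

text \<open>
  The adjunction between tensoring with \<open>a\<close> and with \<open>Cj C a\<close>, as endofunctors. In this form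
  the zigzag equations contain no structural isomorphisms.
\<close>

definition eps :: "'o \<Rightarrow> 'o \<Rightarrow> 'a" where
  "eps a x = LUn C x \<cdot> (Ev C a \<otimes>\<^sub>a Idn C x) \<cdot> (Asc C (Cj C a) a x)\<dagger>"

definition eta :: "'o \<Rightarrow> 'o \<Rightarrow> 'a" where
  "eta a x = Asc C a (Cj C a) x \<cdot> (Coev C a \<otimes>\<^sub>a Idn C x) \<cdot> (LUn C x)\<dagger>"

lemma typed_eps [simp]:
  assumes "a \<in> Obj C" "x \<in> Obj C"
  shows "arr C (eps a x)" "src C (eps a x) = Cj C a \<otimes>\<^sub>o (a \<otimes>\<^sub>o x)" "tgt C (eps a x) = x"
  using assms by (simp_all add: eps_def)

lemma typed_eta [simp]:
  assumes "a \<in> Obj C" "x \<in> Obj C"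
  shows "arr C (eta a x)" "src C (eta a x) = x" "tgt C (eta a x) = a \<otimes>\<^sub>o (Cj C a \<otimes>\<^sub>o x)"
  using assms by (simp_all add: eta_def)

lemma zigzag_eta:
  assumes [simp]: "a \<in> Obj C"
  shows "RUn C a \<cdot> (Idn C a \<otimes>\<^sub>a Ev C a) \<cdot> eta a a = Idn C a"
proof -
  have "RUn C a \<cdot> (Idn C a \<otimes>\<^sub>a Ev C a) \<cdot> eta a a
      = (RUn C a \<cdot> (Idn C a \<otimes>\<^sub>a Ev C a) \<cdot> Asc C a (Cj C a) a \<cdot> (Coev C a \<otimes>\<^sub>a Idn C a)) \<cdot> (LUn C a)\<dagger>"
    by (simp add: eta_def)
  then show ?thesis by (simp add: zigzag)
qed

lemma zigzag_eps:
  assumes [simp]: "a \<in> Obj C"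
  shows "eps a (Cj C a) \<cdot> (Idn C (Cj C a) \<otimes>\<^sub>a Coev C a) \<cdot> (RUn C (Cj C a))\<dagger> = Idn C (Cj C a)"
proof -
  have "eps a (Cj C a) \<cdot> (Idn C (Cj C a) \<otimes>\<^sub>a Coev C a) \<cdot> (RUn C (Cj C a))\<dagger>
      = (LUn C (Cj C a) \<cdot> (Ev C a \<otimes>\<^sub>a Idn C (Cj C a)) \<cdot> (Asc C (Cj C a) a (Cj C a))\<dagger>
        \<cdot> (Idn C (Cj C a) \<otimes>\<^sub>a Coev C a)) \<cdot> (RUn C (Cj C a))\<dagger>"
    by (simp add: eps_def)
  then show ?thesis by (simp add: zigzag_conj)
qed

lemma eps_TOb:
  assumes [simp]: "a \<in> Obj C" "x \<in> Obj C" "z \<in> Obj C"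
  shows "eps a x \<otimes>\<^sub>a Idn C z
    = eps a (x \<otimes>\<^sub>o z) \<cdot> (Idn C (Cj C a) \<otimes>\<^sub>a Asc C a x z) \<cdot> Asc C (Cj C a) (a \<otimes>\<^sub>o x) z"
proof -
  let ?b = "Cj C a" and ?I = "Unt C"
  have "eps a (x \<otimes>\<^sub>o z) \<cdot> (Idn C ?b \<otimes>\<^sub>a Asc C a x z) \<cdot> Asc C ?b (a \<otimes>\<^sub>o x) z
      = LUn C (x \<otimes>\<^sub>o z) \<cdot> (Ev C a \<otimes>\<^sub>a Idn C (x \<otimes>\<^sub>o z)) \<cdot>
        ((Asc C ?b a (x \<otimes>\<^sub>o z))\<dagger> \<cdot> (Idn C ?b \<otimes>\<^sub>a Asc C a x z)) \<cdot> Asc C ?b (a \<otimes>\<^sub>o x) z"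
    by (simp add: eps_def)
  also have "\<dots> = LUn C (x \<otimes>\<^sub>o z) \<cdot> ((Ev C a \<otimes>\<^sub>a Idn C (x \<otimes>\<^sub>o z)) \<cdot>
        Asc C (?b \<otimes>\<^sub>o a) x z) \<cdot> ((Asc C ?b a x)\<dagger> \<otimes>\<^sub>a Idn C z)"
    by (subst pentagon_dag) simp_all
  also have "(Ev C a \<otimes>\<^sub>a Idn C (x \<otimes>\<^sub>o z)) \<cdot> Asc C (?b \<otimes>\<^sub>o a) x z
      = Asc C ?I x z \<cdot> ((Ev C a \<otimes>\<^sub>a Idn C x) \<otimes>\<^sub>a Idn C z)"
    by (subst Asc_nat) simp_all
  also have "LUn C (x \<otimes>\<^sub>o z) \<cdot> (Asc C ?I x z \<cdot> ((Ev C a \<otimes>\<^sub>a Idn C x) \<otimes>\<^sub>a Idn C z)) \<cdot> ((Asc C ?b a x)\<dagger> \<otimes>\<^sub>a Idn C z)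
      = (LUn C (x \<otimes>\<^sub>o z) \<cdot> Asc C ?I x z) \<cdot> ((Ev C a \<otimes>\<^sub>a Idn C x) \<otimes>\<^sub>a Idn C z) \<cdot> ((Asc C ?b a x)\<dagger> \<otimes>\<^sub>a Idn C z)"
    by simp
  also have "\<dots> = eps a x \<otimes>\<^sub>a Idn C z"
    by (subst LUn_TOb) (simp_all add: merge eps_def)
  finally show ?thesis ..
qed

lemma zigzag_functor1:
  assumes [simp]: "a \<in> Obj C" "x \<in> Obj C"
  shows "(Idn C a \<otimes>\<^sub>a eps a x) \<cdot> eta a (a \<otimes>\<^sub>o x) = Idn C (a \<otimes>\<^sub>o x)"
proof -
  let ?b = "Cj C a" and ?I = "Unt C"
  have coev: "(Coev C a \<otimes>\<^sub>a Idn C (a \<otimes>\<^sub>o x)) \<cdot> Asc C ?I a x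
      = Asc C (a \<otimes>\<^sub>o ?b) a x \<cdot> ((Coev C a \<otimes>\<^sub>a Idn C a) \<otimes>\<^sub>a Idn C x)"
    by (subst Asc_nat) simp_all
  have ev: "(Idn C a \<otimes>\<^sub>a (Ev C a \<otimes>\<^sub>a Idn C x)) \<cdot> Asc C a (?b \<otimes>\<^sub>o a) x
      = Asc C a ?I x \<cdot> ((Idn C a \<otimes>\<^sub>a Ev C a) \<otimes>\<^sub>a Idn C x)"
    by (subst Asc_nat) simp_all
  have lun: "(LUn C (a \<otimes>\<^sub>o x))\<dagger> = Asc C ?I a x \<cdot> ((LUn C a)\<dagger> \<otimes>\<^sub>a Idn C x)"
  proof (rule mono_cancel[where f = "(Asc C ?I a x)\<dagger>" and g = "Asc C ?I a x"])
    have "(LUn C (a \<otimes>\<^sub>o x) \<cdot> Asc C ?I a x)\<dagger> = (LUn C a \<otimes>\<^sub>a Idn C x)\<dagger>" by (simp only: LUn_TOb assms)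
    then show "(Asc C ?I a x)\<dagger> \<cdot> (LUn C (a \<otimes>\<^sub>o x))\<dagger> = (Asc C ?I a x)\<dagger> \<cdot> Asc C ?I a x \<cdot> ((LUn C a)\<dagger> \<otimes>\<^sub>a Idn C x)"
      by simp
  qed simp_all
  have "(Idn C a \<otimes>\<^sub>a eps a x) \<cdot> eta a (a \<otimes>\<^sub>o x)
      = (Idn C a \<otimes>\<^sub>a LUn C x) \<cdot> (Idn C a \<otimes>\<^sub>a (Ev C a \<otimes>\<^sub>a Idn C x)) \<cdot> (Idn C a \<otimes>\<^sub>a (Asc C ?b a x)\<dagger>) \<cdot>
        Asc C a ?b (a \<otimes>\<^sub>o x) \<cdot> ((Coev C a \<otimes>\<^sub>a Idn C (a \<otimes>\<^sub>o x)) \<cdot> Asc C ?I a x) \<cdot> ((LUn C a)\<dagger> \<otimes>\<^sub>a Idn C x)"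
    by (simp add: eps_def eta_def lun whisker_left)
  also have "\<dots> = (Idn C a \<otimes>\<^sub>a LUn C x) \<cdot> (Idn C a \<otimes>\<^sub>a (Ev C a \<otimes>\<^sub>a Idn C x)) \<cdot> (Idn C a \<otimes>\<^sub>a (Asc C ?b a x)\<dagger>) \<cdot>
        (Asc C a ?b (a \<otimes>\<^sub>o x) \<cdot> Asc C (a \<otimes>\<^sub>o ?b) a x) \<cdot> ((Coev C a \<otimes>\<^sub>a Idn C a) \<otimes>\<^sub>a Idn C x) \<cdot> ((LUn C a)\<dagger> \<otimes>\<^sub>a Idn C x)"
    unfolding coev by simp
  also have "\<dots> = (Idn C a \<otimes>\<^sub>a LUn C x) \<cdot> ((Idn C a \<otimes>\<^sub>a (Ev C a \<otimes>\<^sub>a Idn C x)) \<cdot> Asc C a (?b \<otimes>\<^sub>o a) x) \<cdot>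
        (Asc C a ?b a \<otimes>\<^sub>a Idn C x) \<cdot> ((Coev C a \<otimes>\<^sub>a Idn C a) \<otimes>\<^sub>a Idn C x) \<cdot> ((LUn C a)\<dagger> \<otimes>\<^sub>a Idn C x)"
    by (subst pentagon[symmetric]) (simp_all add: interchange_head)
  also have "\<dots> = ((Idn C a \<otimes>\<^sub>a LUn C x) \<cdot> Asc C a ?I x) \<cdot> ((Idn C a \<otimes>\<^sub>a Ev C a) \<otimes>\<^sub>a Idn C x) \<cdot>
        (Asc C a ?b a \<otimes>\<^sub>a Idn C x) \<cdot> ((Coev C a \<otimes>\<^sub>a Idn C a) \<otimes>\<^sub>a Idn C x) \<cdot> ((LUn C a)\<dagger> \<otimes>\<^sub>a Idn C x)"
    unfolding ev by simp
  also have "\<dots> = (RUn C a \<cdot> (Idn C a \<otimes>\<^sub>a Ev C a) \<cdot> eta a a) \<otimes>\<^sub>a Idn C x"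
    by (subst triangle) (simp_all add: merge eta_def)
  finally show ?thesis by (simp add: zigzag_eta)
qed

lemma zigzag_functor2:
  assumes [simp]: "a \<in> Obj C" "x \<in> Obj C"
  shows "eps a (Cj C a \<otimes>\<^sub>o x) \<cdot> (Idn C (Cj C a) \<otimes>\<^sub>a eta a x) = Idn C (Cj C a \<otimes>\<^sub>o x)"
proof -
  let ?b = "Cj C a" and ?I = "Unt C"
  have coev: "(Asc C ?b (a \<otimes>\<^sub>o ?b) x)\<dagger> \<cdot> (Idn C ?b \<otimes>\<^sub>a (Coev C a \<otimes>\<^sub>a Idn C x))
      = ((Idn C ?b \<otimes>\<^sub>a Coev C a) \<otimes>\<^sub>a Idn C x) \<cdot> (Asc C ?b ?I x)\<dagger>"
    by (subst Asc_dag_nat) simp_all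
  have ev: "(Ev C a \<otimes>\<^sub>a Idn C (?b \<otimes>\<^sub>o x)) \<cdot> Asc C (?b \<otimes>\<^sub>o a) ?b x
      = Asc C ?I ?b x \<cdot> ((Ev C a \<otimes>\<^sub>a Idn C ?b) \<otimes>\<^sub>a Idn C x)"
    by (subst Asc_nat) simp_all
  have run: "(RUn C ?b)\<dagger> \<otimes>\<^sub>a Idn C x = (Asc C ?b ?I x)\<dagger> \<cdot> (Idn C ?b \<otimes>\<^sub>a (LUn C x)\<dagger>)"
  proof -
    have "((Idn C ?b \<otimes>\<^sub>a LUn C x) \<cdot> Asc C ?b ?I x)\<dagger> = (RUn C ?b \<otimes>\<^sub>a Idn C x)\<dagger>"
      by (simp only: triangle assms Cj_Obj)
    then show ?thesis by simp
  qed
  have "eps a (?b \<otimes>\<^sub>o x) \<cdot> (Idn C ?b \<otimes>\<^sub>a eta a x)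
      = LUn C (?b \<otimes>\<^sub>o x) \<cdot> (Ev C a \<otimes>\<^sub>a Idn C (?b \<otimes>\<^sub>o x)) \<cdot> ((Asc C ?b a (?b \<otimes>\<^sub>o x))\<dagger> \<cdot> (Idn C ?b \<otimes>\<^sub>a Asc C a ?b x)) \<cdot>
        (Idn C ?b \<otimes>\<^sub>a (Coev C a \<otimes>\<^sub>a Idn C x)) \<cdot> (Idn C ?b \<otimes>\<^sub>a (LUn C x)\<dagger>)"
    by (simp add: eps_def eta_def whisker_left)
  also have "\<dots> = LUn C (?b \<otimes>\<^sub>o x) \<cdot> ((Ev C a \<otimes>\<^sub>a Idn C (?b \<otimes>\<^sub>o x)) \<cdot> Asc C (?b \<otimes>\<^sub>o a) ?b x) \<cdot> ((Asc C ?b a ?b)\<dagger> \<otimes>\<^sub>a Idn C x) \<cdot>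
        ((Asc C ?b (a \<otimes>\<^sub>o ?b) x)\<dagger> \<cdot> (Idn C ?b \<otimes>\<^sub>a (Coev C a \<otimes>\<^sub>a Idn C x))) \<cdot> (Idn C ?b \<otimes>\<^sub>a (LUn C x)\<dagger>)"
    by (subst pentagon_dag) simp_all
  also have "\<dots> = (LUn C (?b \<otimes>\<^sub>o x) \<cdot> Asc C ?I ?b x) \<cdot> ((Ev C a \<otimes>\<^sub>a Idn C ?b) \<otimes>\<^sub>a Idn C x) \<cdot> ((Asc C ?b a ?b)\<dagger> \<otimes>\<^sub>a Idn C x) \<cdot>
        ((Idn C ?b \<otimes>\<^sub>a Coev C a) \<otimes>\<^sub>a Idn C x) \<cdot> ((RUn C ?b)\<dagger> \<otimes>\<^sub>a Idn C x)"
    unfolding ev coev run by simp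
  also have "\<dots> = (eps a ?b \<cdot> (Idn C ?b \<otimes>\<^sub>a Coev C a) \<cdot> (RUn C ?b)\<dagger>) \<otimes>\<^sub>a Idn C x"
    by (subst LUn_TOb) (simp_all add: merge eps_def)
  finally show ?thesis by (simp add: zigzag_eps)
qed

lemma zigzag_right:
  assumes [simp]: "x \<in> Obj C" "y \<in> Obj C"
  shows "RUn C (x \<otimes>\<^sub>o y) \<cdot> (Idn C (x \<otimes>\<^sub>o y) \<otimes>\<^sub>a Ev C y) \<cdot> Asc C (x \<otimes>\<^sub>o y) (Cj C y) y \<cdot>
    (((Asc C x y (Cj C y))\<dagger> \<cdot> (Idn C x \<otimes>\<^sub>a Coev C y) \<cdot> (RUn C x)\<dagger>) \<otimes>\<^sub>a Idn C y) = Idn C (x \<otimes>\<^sub>o y)"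
proof -
  let ?v = "Cj C y" and ?I = "Unt C"
  have 4: "RUn C (x \<otimes>\<^sub>o y) \<cdot> (Idn C (x \<otimes>\<^sub>o y) \<otimes>\<^sub>a Ev C y)
      = (Idn C x \<otimes>\<^sub>a RUn C y) \<cdot> (Idn C x \<otimes>\<^sub>a (Idn C y \<otimes>\<^sub>a Ev C y)) \<cdot> Asc C x y (?v \<otimes>\<^sub>o y)"
    using Asc_nat[of "Idn C x" "Idn C y" "Ev C y"] by (simp flip: RUn_TOb)
  have 5: "Asc C x (y \<otimes>\<^sub>o ?v) y \<cdot> ((Idn C x \<otimes>\<^sub>a Coev C y) \<otimes>\<^sub>a Idn C y)
      = (Idn C x \<otimes>\<^sub>a (Coev C y \<otimes>\<^sub>a Idn C y)) \<cdot> Asc C x ?I y"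
    by (subst Asc_nat) simp_all
  have "RUn C (x \<otimes>\<^sub>o y) \<cdot> (Idn C (x \<otimes>\<^sub>o y) \<otimes>\<^sub>a Ev C y) \<cdot> Asc C (x \<otimes>\<^sub>o y) ?v y \<cdot>
      (((Asc C x y ?v)\<dagger> \<cdot> (Idn C x \<otimes>\<^sub>a Coev C y) \<cdot> (RUn C x)\<dagger>) \<otimes>\<^sub>a Idn C y)
    = (RUn C (x \<otimes>\<^sub>o y) \<cdot> (Idn C (x \<otimes>\<^sub>o y) \<otimes>\<^sub>a Ev C y)) \<cdot> Asc C (x \<otimes>\<^sub>o y) ?v y \<cdot> ((Asc C x y ?v)\<dagger> \<otimes>\<^sub>a Idn C y) \<cdot>
         ((Idn C x \<otimes>\<^sub>a Coev C y) \<otimes>\<^sub>a Idn C y) \<cdot> ((RUn C x)\<dagger> \<otimes>\<^sub>a Idn C y)"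
    by (simp add: whisker_right)
  also have "\<dots> = (Idn C x \<otimes>\<^sub>a RUn C y) \<cdot> (Idn C x \<otimes>\<^sub>a (Idn C y \<otimes>\<^sub>a Ev C y)) \<cdot> (Asc C x y (?v \<otimes>\<^sub>o y) \<cdot> Asc C (x \<otimes>\<^sub>o y) ?v y) \<cdot>
         ((Asc C x y ?v)\<dagger> \<otimes>\<^sub>a Idn C y) \<cdot> ((Idn C x \<otimes>\<^sub>a Coev C y) \<otimes>\<^sub>a Idn C y) \<cdot> ((RUn C x)\<dagger> \<otimes>\<^sub>a Idn C y)"
    unfolding 4 by simp
  also have "\<dots> = (Idn C x \<otimes>\<^sub>a RUn C y) \<cdot> (Idn C x \<otimes>\<^sub>a (Idn C y \<otimes>\<^sub>a Ev C y)) \<cdot> (Idn C x \<otimes>\<^sub>a Asc C y ?v y) \<cdot>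
         (Asc C x (y \<otimes>\<^sub>o ?v) y \<cdot> ((Idn C x \<otimes>\<^sub>a Coev C y) \<otimes>\<^sub>a Idn C y)) \<cdot> ((RUn C x)\<dagger> \<otimes>\<^sub>a Idn C y)"
    by (subst pentagon[symmetric]) (simp_all add: interchange_head)
  also have "\<dots> = (Idn C x \<otimes>\<^sub>a (RUn C y \<cdot> (Idn C y \<otimes>\<^sub>a Ev C y) \<cdot> Asc C y ?v y \<cdot> (Coev C y \<otimes>\<^sub>a Idn C y))) \<cdot>
         Asc C x ?I y \<cdot> ((RUn C x)\<dagger> \<otimes>\<^sub>a Idn C y)"
    unfolding 5 by (simp add: interchange_head)
  also have "\<dots> = (Idn C x \<otimes>\<^sub>a LUn C y) \<cdot> Asc C x ?I y \<cdot> ((RUn C x)\<dagger> \<otimes>\<^sub>a Idn C y)"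
    by (simp add: zigzag)
  also have "\<dots> = Idn C (x \<otimes>\<^sub>o y)"
    by (simp add: rewrite_head[OF triangle] interchange)
  finally show ?thesis .
qed

text \<open>
  A pairing \<open>E : x \<otimes> y \<rightarrow> 1\<close> factors uniquely through the evaluation of \<open>y\<close>. All the canonical
  arrows between conjugates are instances: each is the factorisation of its own pairing, and
  equations between them are proved by comparing pairings.
\<close>

definition pairing_factor :: "'o \<Rightarrow> 'o \<Rightarrow> 'a \<Rightarrow> 'a" where
  "pairing_factor x y E = LUn C (Cj C y) \<cdot> (E \<otimes>\<^sub>a Idn C (Cj C y)) \<cdot> (Asc C x y (Cj C y))\<dagger> \<cdot>
     (Idn C x \<otimes>\<^sub>a Coev C y) \<cdot> (RUn C x)\<dagger>"

lemma typed_pairing_factor [simp]: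
  assumes "x \<in> Obj C" "y \<in> Obj C" "arr C E" "src C E = x \<otimes>\<^sub>o y" "tgt C E = Unt C"
  shows "arr C (pairing_factor x y E)" "src C (pairing_factor x y E) = x" "tgt C (pairing_factor x y E) = Cj C y"
  using assms by (simp_all add: pairing_factor_def)

lemma pairing_factor:
  assumes [simp]: "x \<in> Obj C" "y \<in> Obj C" "arr C E" "src C E = x \<otimes>\<^sub>o y" "tgt C E = Unt C"
  shows "Ev C y \<cdot> (pairing_factor x y E \<otimes>\<^sub>a Idn C y) = E"
proof -
  let ?v = "Cj C y" and ?I = "Unt C"
  let ?h = "(Asc C x y ?v)\<dagger> \<cdot> (Idn C x \<otimes>\<^sub>a Coev C y) \<cdot> (RUn C x)\<dagger>"
  have 1: "Ev C y \<cdot> LUn C (?v \<otimes>\<^sub>o y) = RUn C ?I \<cdot> (Idn C ?I \<otimes>\<^sub>a Ev C y)"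
    by (subst LUn_Unt[symmetric], subst LUn_nat) simp_all
  have 2: "Asc C ?I ?v y \<cdot> ((E \<otimes>\<^sub>a Idn C ?v) \<otimes>\<^sub>a Idn C y) = (E \<otimes>\<^sub>a Idn C (?v \<otimes>\<^sub>o y)) \<cdot> Asc C (x \<otimes>\<^sub>o y) ?v y"
    by (subst Asc_nat) simp_all
  have 3: "RUn C ?I \<cdot> (E \<otimes>\<^sub>a Ev C y) = E \<cdot> RUn C (x \<otimes>\<^sub>o y) \<cdot> (Idn C (x \<otimes>\<^sub>o y) \<otimes>\<^sub>a Ev C y)"
  proof -
    have "RUn C ?I \<cdot> (E \<otimes>\<^sub>a Ev C y) = (RUn C ?I \<cdot> (E \<otimes>\<^sub>a Idn C ?I)) \<cdot> (Idn C (x \<otimes>\<^sub>o y) \<otimes>\<^sub>a Ev C y)"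
      by (simp add: merge)
    then show ?thesis by (simp add: RUn_nat)
  qed
  have "Ev C y \<cdot> (pairing_factor x y E \<otimes>\<^sub>a Idn C y)
      = Ev C y \<cdot> (LUn C ?v \<otimes>\<^sub>a Idn C y) \<cdot> ((E \<otimes>\<^sub>a Idn C ?v) \<otimes>\<^sub>a Idn C y) \<cdot> (?h \<otimes>\<^sub>a Idn C y)"
    by (simp add: pairing_factor_def whisker_right)
  also have "\<dots> = (Ev C y \<cdot> LUn C (?v \<otimes>\<^sub>o y)) \<cdot> (Asc C ?I ?v y \<cdot> ((E \<otimes>\<^sub>a Idn C ?v) \<otimes>\<^sub>a Idn C y)) \<cdot> (?h \<otimes>\<^sub>a Idn C y)"
    by (subst LUn_TOb[symmetric]) simp_all
  also have "\<dots> = (RUn C ?I \<cdot> (E \<otimes>\<^sub>a Ev C y)) \<cdot> Asc C (x \<otimes>\<^sub>o y) ?v y \<cdot> (?h \<otimes>\<^sub>a Idn C y)"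
    unfolding 1 2 by (simp add: interchange_head)
  also have "\<dots> = E \<cdot> (RUn C (x \<otimes>\<^sub>o y) \<cdot> (Idn C (x \<otimes>\<^sub>o y) \<otimes>\<^sub>a Ev C y) \<cdot> Asc C (x \<otimes>\<^sub>o y) ?v y \<cdot> (?h \<otimes>\<^sub>a Idn C y))"
    unfolding 3 by simp
  also have "\<dots> = E"
    by (subst zigzag_right) simp_all
  finally show ?thesis .
qed

lemma pairing_factor_unique:
  assumes [simp]: "y \<in> Obj C" "arr C h" "tgt C h = Cj C y"
  shows "pairing_factor (src C h) y (Ev C y \<cdot> (h \<otimes>\<^sub>a Idn C y)) = h"
proof -
  let ?v = "Cj C y" and ?x = "src C h"
  have 1: "((h \<otimes>\<^sub>a Idn C y) \<otimes>\<^sub>a Idn C ?v) \<cdot> (Asc C ?x y ?v)\<dagger> = (Asc C ?v y ?v)\<dagger> \<cdot> (h \<otimes>\<^sub>a Idn C (y \<otimes>\<^sub>o ?v))"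
    by (subst Asc_dag_nat) simp_all
  have "pairing_factor ?x y (Ev C y \<cdot> (h \<otimes>\<^sub>a Idn C y))
      = LUn C ?v \<cdot> (Ev C y \<otimes>\<^sub>a Idn C ?v) \<cdot> (((h \<otimes>\<^sub>a Idn C y) \<otimes>\<^sub>a Idn C ?v) \<cdot> (Asc C ?x y ?v)\<dagger>) \<cdot>
        (Idn C ?x \<otimes>\<^sub>a Coev C y) \<cdot> (RUn C ?x)\<dagger>"
    by (simp add: pairing_factor_def whisker_right)
  also have "\<dots> = eps y ?v \<cdot> (Idn C ?v \<otimes>\<^sub>a Coev C y) \<cdot> ((h \<otimes>\<^sub>a Idn C (Unt C)) \<cdot> (RUn C ?x)\<dagger>)"
    unfolding 1 by (simp add: eps_def interchange_head)
  also have "\<dots> = (eps y ?v \<cdot> (Idn C ?v \<otimes>\<^sub>a Coev C y) \<cdot> (RUn C ?v)\<dagger>) \<cdot> h"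
    by (subst RUn_dag_nat) simp_all
  finally show ?thesis by (simp add: zigzag_eps)
qed

lemma pairing_eqI:
  assumes "Ev C y \<cdot> (h \<otimes>\<^sub>a Idn C y) = Ev C y \<cdot> (k \<otimes>\<^sub>a Idn C y)"
    "y \<in> Obj C" "arr C h" "tgt C h = Cj C y" "arr C k" "tgt C k = Cj C y" "src C h = src C k"
  shows "h = k"
proof -
  have "h = pairing_factor (src C h) y (Ev C y \<cdot> (h \<otimes>\<^sub>a Idn C y))"
    using assms(2-4) by (simp add: pairing_factor_unique)
  also have "\<dots> = pairing_factor (src C k) y (Ev C y \<cdot> (k \<otimes>\<^sub>a Idn C y))"
    by (simp only: assms(1,7))
  also have "\<dots> = k" using assms(2-) by (simp add: pairing_factor_unique)
  finally show ?thesis .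
qed

lemma dual_arr_eq:
  assumes "a \<in> Obj C" "b \<in> Obj C" "arr C f" "src C f = a" "tgt C f = b"
  shows "dual_arr C a b f = pairing_factor (Cj C b) a (Ev C b \<cdot> (Idn C (Cj C b) \<otimes>\<^sub>a f))"
  using assms by (simp add: dual_arr_def pairing_factor_def whisker_right)

lemma typed_dual_arr [simp]:
  assumes "a \<in> Obj C" "b \<in> Obj C" "arr C f" "src C f = a" "tgt C f = b"
  shows "arr C (dual_arr C a b f)" "src C (dual_arr C a b f) = Cj C b" "tgt C (dual_arr C a b f) = Cj C a"
  using assms by (simp_all add: dual_arr_eq)

lemma Ev_dual_arr:
  assumes "a \<in> Obj C" "b \<in> Obj C" "arr C f" "src C f = a" "tgt C f = b"
  shows "Ev C a \<cdot> (dual_arr C a b f \<otimes>\<^sub>a Idn C a) = Ev C b \<cdot> (Idn C (Cj C b) \<otimes>\<^sub>a f)"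
  using assms by (simp add: dual_arr_eq pairing_factor)

lemma phi_eq: "phi C a = pairing_factor a (Cj C a) ((Coev C a)\<dagger>)"
  by (simp add: phi_def pairing_factor_def)

lemma typed_phi [simp]:
  assumes "a \<in> Obj C"
  shows "arr C (phi C a)" "src C (phi C a) = a" "tgt C (phi C a) = Cj C (Cj C a)"
  using assms by (simp_all add: phi_eq)

lemma Ev_phi: "a \<in> Obj C \<Longrightarrow> Ev C (Cj C a) \<cdot> (phi C a \<otimes>\<^sub>a Idn C (Cj C a)) = (Coev C a)\<dagger>"
  by (simp add: phi_eq pairing_factor)

lemma typed_nested_ev [simp]:
  assumes "a \<in> Obj C" "b \<in> Obj C"
  shows "arr C (nested_ev C a b)" "src C (nested_ev C a b) = (Cj C a \<otimes>\<^sub>o Cj C b) \<otimes>\<^sub>o (b \<otimes>\<^sub>o a)"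
    "tgt C (nested_ev C a b) = Unt C"
  using assms by (simp_all add: nested_ev_def)

lemma nu_eq: "nu C a b = pairing_factor (Cj C a \<otimes>\<^sub>o Cj C b) (b \<otimes>\<^sub>o a) (nested_ev C a b)"
  by (simp add: nu_def pairing_factor_def Let_def)

lemma typed_nu [simp]:
  assumes "a \<in> Obj C" "b \<in> Obj C"
  shows "arr C (nu C a b)" "src C (nu C a b) = Cj C a \<otimes>\<^sub>o Cj C b" "tgt C (nu C a b) = Cj C (b \<otimes>\<^sub>o a)"
  using assms by (simp_all add: nu_eq)

lemma Ev_nu: "\<lbrakk>a \<in> Obj C; b \<in> Obj C\<rbrakk> \<Longrightarrow> Ev C (b \<otimes>\<^sub>o a) \<cdot> (nu C a b \<otimes>\<^sub>a Idn C (b \<otimes>\<^sub>o a)) = nested_ev C a b"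
  by (simp add: nu_eq pairing_factor)

lemma typed_unit_conj [simp]:
  "arr C (unit_conj C)" "src C (unit_conj C) = Unt C" "tgt C (unit_conj C) = Cj C (Unt C)"
  by (simp_all add: unit_conj_def)

lemma Ev_unit_conj: "Ev C (Unt C) \<cdot> (unit_conj C \<otimes>\<^sub>a Idn C (Unt C)) = RUn C (Unt C)"
proof -
  let ?I = "Unt C" and ?J = "Cj C (Unt C)"
  have "Ev C ?I \<cdot> (unit_conj C \<otimes>\<^sub>a Idn C ?I) = Ev C ?I \<cdot> (LUn C ?J \<otimes>\<^sub>a Idn C ?I) \<cdot> (Coev C ?I \<otimes>\<^sub>a Idn C ?I)"
    by (simp add: unit_conj_def whisker_right)
  also have "\<dots> = (Ev C ?I \<cdot> LUn C (?J \<otimes>\<^sub>o ?I)) \<cdot> Asc C ?I ?J ?I \<cdot> (Coev C ?I \<otimes>\<^sub>a Idn C ?I)"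
    by (subst LUn_TOb[symmetric]) simp_all
  also have "\<dots> = RUn C ?I \<cdot> (Idn C ?I \<otimes>\<^sub>a Ev C ?I) \<cdot> Asc C ?I ?J ?I \<cdot> (Coev C ?I \<otimes>\<^sub>a Idn C ?I)"
    by (subst LUn_nat[symmetric, of "Ev C ?I" _ ?I]) (simp_all add: LUn_Unt)
  finally show ?thesis using zigzag[of ?I] by (simp add: LUn_Unt)
qed

lemma inverse_unit_conj:
  "mutually_inverse C (Unt C) (Cj C (Unt C)) (unit_conj C) (Ev C (Unt C) \<cdot> (RUn C (Cj C (Unt C)))\<dagger>)"
proof -
  let ?I = "Unt C" and ?J = "Cj C (Unt C)"
  let ?e = "Ev C ?I \<cdot> (RUn C ?J)\<dagger>"
  have left: "?e \<cdot> unit_conj C = Idn C ?I"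
    using RUn_dag_nat[of "unit_conj C"] rewrite_head[OF Ev_unit_conj, of "(RUn C ?I)\<dagger>"] by simp
  have "unit_conj C \<cdot> ?e = Idn C ?J"
  proof (rule pairing_eqI[of ?I])
    have "Ev C ?I \<cdot> ((unit_conj C \<cdot> ?e) \<otimes>\<^sub>a Idn C ?I) = RUn C ?I \<cdot> (?e \<otimes>\<^sub>a Idn C ?I)"
      using rewrite_head[OF Ev_unit_conj, of "?e \<otimes>\<^sub>a Idn C ?I"] by (simp add: whisker_right)
    also have "\<dots> = Ev C ?I \<cdot> (RUn C ?J)\<dagger> \<cdot> RUn C ?J"
      using RUn_nat[of ?e ?J ?I] by simp
    finally show "Ev C ?I \<cdot> ((unit_conj C \<cdot> ?e) \<otimes>\<^sub>a Idn C ?I) = Ev C ?I \<cdot> (Idn C ?J \<otimes>\<^sub>a Idn C ?I)"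
      by simp
  qed simp_all
  with left show ?thesis by (simp add: mutually_inverse_iff)
qed

text \<open>
  Precomposition with \<open>nu b a\<close> turns bending along \<open>a \<otimes> b\<close> into bending along \<open>a\<close>, then along
  \<open>b\<close>; both are bijective, so \<open>nu b a\<close> is invertible.
\<close>

lemma nested_ev_TOb:
  assumes [simp]: "a \<in> Obj C" "b \<in> Obj C" "z \<in> Obj C"
  shows "LUn C z \<cdot> (nested_ev C b a \<otimes>\<^sub>a Idn C z) \<cdot> (Asc C (Cj C b \<otimes>\<^sub>o Cj C a) (a \<otimes>\<^sub>o b) z)\<dagger>
    = eps b z \<cdot> (Idn C (Cj C b) \<otimes>\<^sub>a (eps a (b \<otimes>\<^sub>o z) \<cdot> (Idn C (Cj C a) \<otimes>\<^sub>a Asc C a b z))) \<cdot>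
      Asc C (Cj C b) (Cj C a) ((a \<otimes>\<^sub>o b) \<otimes>\<^sub>o z)"
proof -
  let ?A = "Cj C a" and ?B = "Cj C b" and ?y = "a \<otimes>\<^sub>o b"
  have 1: "LUn C z \<cdot> (Ev C b \<otimes>\<^sub>a Idn C z) = eps b z \<cdot> Asc C ?B b z"
    by (simp add: eps_def)
  have 2: "Asc C ?B b z \<cdot> ((Idn C ?B \<otimes>\<^sub>a eps a b) \<otimes>\<^sub>a Idn C z)
      = (Idn C ?B \<otimes>\<^sub>a (eps a b \<otimes>\<^sub>a Idn C z)) \<cdot> Asc C ?B (?A \<otimes>\<^sub>o ?y) z"
    by (subst Asc_nat) simp_all
  have "LUn C z \<cdot> (nested_ev C b a \<otimes>\<^sub>a Idn C z)
      = (LUn C z \<cdot> (Ev C b \<otimes>\<^sub>a Idn C z)) \<cdot> ((Idn C ?B \<otimes>\<^sub>a eps a b) \<otimes>\<^sub>a Idn C z) \<cdot> (Asc C ?B ?A ?y \<otimes>\<^sub>a Idn C z)"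
    by (simp add: nested_ev_def eps_def whisker_right)
  also have "\<dots> = eps b z \<cdot> (Asc C ?B b z \<cdot> ((Idn C ?B \<otimes>\<^sub>a eps a b) \<otimes>\<^sub>a Idn C z)) \<cdot> (Asc C ?B ?A ?y \<otimes>\<^sub>a Idn C z)"
    unfolding 1 by simp
  also have "\<dots> = eps b z \<cdot> (Idn C ?B \<otimes>\<^sub>a (eps a (b \<otimes>\<^sub>o z) \<cdot> (Idn C ?A \<otimes>\<^sub>a Asc C a b z))) \<cdot>
      ((Idn C ?B \<otimes>\<^sub>a Asc C ?A ?y z) \<cdot> Asc C ?B (?A \<otimes>\<^sub>o ?y) z \<cdot> (Asc C ?B ?A ?y \<otimes>\<^sub>a Idn C z))"
    unfolding 2 by (simp add: eps_TOb interchange_head)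
  also have "\<dots> = eps b z \<cdot> (Idn C ?B \<otimes>\<^sub>a (eps a (b \<otimes>\<^sub>o z) \<cdot> (Idn C ?A \<otimes>\<^sub>a Asc C a b z))) \<cdot>
      Asc C ?B ?A (?y \<otimes>\<^sub>o z) \<cdot> Asc C (?B \<otimes>\<^sub>o ?A) ?y z"
    by (subst pentagon) simp_all
  finally have eq: "LUn C z \<cdot> (nested_ev C b a \<otimes>\<^sub>a Idn C z) =
     eps b z \<cdot> (Idn C ?B \<otimes>\<^sub>a (eps a (b \<otimes>\<^sub>o z) \<cdot> (Idn C ?A \<otimes>\<^sub>a Asc C a b z))) \<cdot>
      Asc C ?B ?A (?y \<otimes>\<^sub>o z) \<cdot> Asc C (?B \<otimes>\<^sub>o ?A) ?y z" .
  have "LUn C z \<cdot> (nested_ev C b a \<otimes>\<^sub>a Idn C z) \<cdot> (Asc C (?B \<otimes>\<^sub>o ?A) ?y z)\<dagger>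
     = (LUn C z \<cdot> (nested_ev C b a \<otimes>\<^sub>a Idn C z)) \<cdot> (Asc C (?B \<otimes>\<^sub>o ?A) ?y z)\<dagger>"
    by simp
  then show ?thesis unfolding eq by simp
qed

text \<open>The arrow \<open>Cj C c \<rightarrow> z\<close> obtained by bending the leg \<open>c\<close> of \<open>g : 1 \<rightarrow> c \<otimes> z\<close>, and its inverse.\<close>

definition bend :: "'o \<Rightarrow> 'o \<Rightarrow> 'a \<Rightarrow> 'a" where
  "bend c z g = eps c z \<cdot> (Idn C (Cj C c) \<otimes>\<^sub>a g) \<cdot> (RUn C (Cj C c))\<dagger>"

definition unbend :: "'o \<Rightarrow> 'a \<Rightarrow> 'a" where
  "unbend c h = (Idn C c \<otimes>\<^sub>a h) \<cdot> Coev C c"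

lemma typed_bend [simp]:
  assumes "c \<in> Obj C" "z \<in> Obj C" "arr C g" "src C g = Unt C" "tgt C g = c \<otimes>\<^sub>o z"
  shows "arr C (bend c z g)" "src C (bend c z g) = Cj C c" "tgt C (bend c z g) = z"
  using assms by (simp_all add: bend_def)

lemma typed_unbend [simp]:
  assumes "c \<in> Obj C" "arr C h" "src C h = Cj C c"
  shows "arr C (unbend c h)" "src C (unbend c h) = Unt C" "tgt C (unbend c h) = c \<otimes>\<^sub>o tgt C h"
  using assms by (simp_all add: unbend_def)

lemma eps_nat:
  assumes [simp]: "a \<in> Obj C" "arr C f"
  shows "eps a (tgt C f) \<cdot> (Idn C (Cj C a) \<otimes>\<^sub>a (Idn C a \<otimes>\<^sub>a f)) = f \<cdot> eps a (src C f)"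
proof -
  let ?A = "Cj C a"
  have 1: "(Asc C ?A a (tgt C f))\<dagger> \<cdot> (Idn C ?A \<otimes>\<^sub>a (Idn C a \<otimes>\<^sub>a f)) = (Idn C (?A \<otimes>\<^sub>o a) \<otimes>\<^sub>a f) \<cdot> (Asc C ?A a (src C f))\<dagger>"
    using Asc_dag_nat[of "Idn C ?A" "Idn C a" f ?A a "src C f" ?A a "tgt C f"] by simp
  have "eps a (tgt C f) \<cdot> (Idn C ?A \<otimes>\<^sub>a (Idn C a \<otimes>\<^sub>a f))
      = LUn C (tgt C f) \<cdot> (Ev C a \<otimes>\<^sub>a Idn C (tgt C f)) \<cdot> ((Asc C ?A a (tgt C f))\<dagger> \<cdot> (Idn C ?A \<otimes>\<^sub>a (Idn C a \<otimes>\<^sub>a f)))"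
    by (simp add: eps_def)
  also have "\<dots> = (LUn C (tgt C f) \<cdot> (Idn C (Unt C) \<otimes>\<^sub>a f)) \<cdot> (Ev C a \<otimes>\<^sub>a Idn C (src C f)) \<cdot> (Asc C ?A a (src C f))\<dagger>"
    unfolding 1 by (simp add: interchange_head)
  also have "\<dots> = f \<cdot> eps a (src C f)"
    by (subst LUn_nat[of f "src C f" "tgt C f"]) (simp_all add: eps_def)
  finally show ?thesis .
qed

lemma bend_unbend:
  assumes [simp]: "c \<in> Obj C" "arr C h" "src C h = Cj C c"
  shows "bend c (tgt C h) (unbend c h) = h"
proof -
  have "bend c (tgt C h) (unbend c h) = (eps c (tgt C h) \<cdot> (Idn C (Cj C c) \<otimes>\<^sub>a (Idn C c \<otimes>\<^sub>a h))) \<cdot>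
      (Idn C (Cj C c) \<otimes>\<^sub>a Coev C c) \<cdot> (RUn C (Cj C c))\<dagger>"
    by (simp add: bend_def unbend_def whisker_left)
  also have "\<dots> = h \<cdot> (eps c (Cj C c) \<cdot> (Idn C (Cj C c) \<otimes>\<^sub>a Coev C c) \<cdot> (RUn C (Cj C c))\<dagger>)"
    by (subst eps_nat) simp_all
  finally show ?thesis by (simp add: zigzag_eps)
qed

lemma Coev_RUn:
  assumes [simp]: "c \<in> Obj C"
  shows "(Idn C c \<otimes>\<^sub>a (RUn C (Cj C c))\<dagger>) \<cdot> Coev C c = eta c (Unt C)"
proof -
  let ?A = "Cj C c" and ?I = "Unt C"
  have "(RUn C (c \<otimes>\<^sub>o ?A))\<dagger> = ((Idn C c \<otimes>\<^sub>a RUn C ?A) \<cdot> Asc C c ?A ?I)\<dagger>" by (simp only: RUn_TOb assms Cj_Obj)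
  then have 1: "Asc C c ?A ?I \<cdot> (RUn C (c \<otimes>\<^sub>o ?A))\<dagger> = Idn C c \<otimes>\<^sub>a (RUn C ?A)\<dagger>" by simp
  have "eta c ?I = Asc C c ?A ?I \<cdot> ((Coev C c \<otimes>\<^sub>a Idn C ?I) \<cdot> (RUn C ?I)\<dagger>)"
    by (simp add: eta_def LUn_Unt)
  also have "\<dots> = (Asc C c ?A ?I \<cdot> (RUn C (c \<otimes>\<^sub>o ?A))\<dagger>) \<cdot> Coev C c"
    by (subst RUn_dag_nat[of "Coev C c" ?I "c \<otimes>\<^sub>o ?A"]) simp_all
  finally show ?thesis unfolding 1 by simp
qed

lemma eta_nat:
  assumes [simp]: "a \<in> Obj C" "arr C f"
  shows "(Idn C a \<otimes>\<^sub>a (Idn C (Cj C a) \<otimes>\<^sub>a f)) \<cdot> eta a (src C f) = eta a (tgt C f) \<cdot> f"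
proof -
  let ?A = "Cj C a" and ?x = "src C f" and ?y = "tgt C f"
  have 1: "(Idn C a \<otimes>\<^sub>a (Idn C ?A \<otimes>\<^sub>a f)) \<cdot> Asc C a ?A ?x = Asc C a ?A ?y \<cdot> (Idn C (a \<otimes>\<^sub>o ?A) \<otimes>\<^sub>a f)"
    using Asc_nat[of "Idn C a" "Idn C ?A" f a ?A ?x a ?A ?y] by simp
  have "(Idn C a \<otimes>\<^sub>a (Idn C ?A \<otimes>\<^sub>a f)) \<cdot> eta a ?x
      = ((Idn C a \<otimes>\<^sub>a (Idn C ?A \<otimes>\<^sub>a f)) \<cdot> Asc C a ?A ?x) \<cdot> (Coev C a \<otimes>\<^sub>a Idn C ?x) \<cdot> (LUn C ?x)\<dagger>"
    by (simp add: eta_def)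
  also have "\<dots> = Asc C a ?A ?y \<cdot> (Coev C a \<otimes>\<^sub>a Idn C ?y) \<cdot> ((Idn C (Unt C) \<otimes>\<^sub>a f) \<cdot> (LUn C ?x)\<dagger>)"
    unfolding 1 by (simp add: interchange_head)
  also have "\<dots> = eta a ?y \<cdot> f"
    by (subst LUn_dag_nat[of f ?x ?y]) (simp_all add: eta_def)
  finally show ?thesis .
qed

lemma unbend_bend:
  assumes [simp]: "c \<in> Obj C" "z \<in> Obj C" "arr C g" "src C g = Unt C" "tgt C g = c \<otimes>\<^sub>o z"
  shows "unbend c (bend c z g) = g"
proof -
  have "unbend c (bend c z g) = (Idn C c \<otimes>\<^sub>a eps c z) \<cdot> (Idn C c \<otimes>\<^sub>a (Idn C (Cj C c) \<otimes>\<^sub>a g)) \<cdot>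
      ((Idn C c \<otimes>\<^sub>a (RUn C (Cj C c))\<dagger>) \<cdot> Coev C c)"
    by (simp add: unbend_def bend_def whisker_left)
  also have "\<dots> = (Idn C c \<otimes>\<^sub>a eps c z) \<cdot> (eta c (c \<otimes>\<^sub>o z) \<cdot> g)"
    using eta_nat[of c g] by (simp add: Coev_RUn)
  also have "\<dots> = g"
    using rewrite_head[OF zigzag_functor1[of c z], of g] by simp
  finally show ?thesis .
qed

lemma bend_nu:
  assumes [simp]: "a \<in> Obj C" "b \<in> Obj C" "z \<in> Obj C"
    and [simp]: "arr C g" "src C g = Unt C" "tgt C g = (a \<otimes>\<^sub>o b) \<otimes>\<^sub>o z"
  shows "bend (a \<otimes>\<^sub>o b) z g \<cdot> nu C b a = eps b z \<cdot> (Idn C (Cj C b) \<otimes>\<^sub>a bend a (b \<otimes>\<^sub>o z) (Asc C a b z \<cdot> g))"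
proof -
  let ?A = "Cj C a" and ?B = "Cj C b" and ?y = "a \<otimes>\<^sub>o b" and ?n = "nu C b a"
  let ?x = "?B \<otimes>\<^sub>o ?A"
  have 1: "(Asc C (Cj C ?y) ?y z)\<dagger> \<cdot> (?n \<otimes>\<^sub>a Idn C (?y \<otimes>\<^sub>o z)) = ((?n \<otimes>\<^sub>a Idn C ?y) \<otimes>\<^sub>a Idn C z) \<cdot> (Asc C ?x ?y z)\<dagger>"
    using Asc_dag_nat[of ?n "Idn C ?y" "Idn C z" ?x ?y z "Cj C ?y" ?y z] by simp
  have 2: "(RUn C (Cj C ?y))\<dagger> \<cdot> ?n = (?n \<otimes>\<^sub>a Idn C (Unt C)) \<cdot> (RUn C ?x)\<dagger>"
    using RUn_dag_nat[of ?n ?x "Cj C ?y"] by simp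
  have 3: "(RUn C ?x)\<dagger> = (Asc C ?B ?A (Unt C))\<dagger> \<cdot> (Idn C ?B \<otimes>\<^sub>a (RUn C ?A)\<dagger>)"
  proof -
    have "(RUn C ?x)\<dagger> = ((Idn C ?B \<otimes>\<^sub>a RUn C ?A) \<cdot> Asc C ?B ?A (Unt C))\<dagger>" by (simp only: RUn_TOb assms Cj_Obj)
    then show ?thesis by simp
  qed
  have 4: "Asc C ?B ?A (?y \<otimes>\<^sub>o z) \<cdot> (Idn C ?x \<otimes>\<^sub>a g) = (Idn C ?B \<otimes>\<^sub>a (Idn C ?A \<otimes>\<^sub>a g)) \<cdot> Asc C ?B ?A (Unt C)"
    using Asc_nat[of "Idn C ?B" "Idn C ?A" g ?B ?A "Unt C" ?B ?A "?y \<otimes>\<^sub>o z"] by simp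
  have "bend ?y z g \<cdot> ?n = eps ?y z \<cdot> (Idn C (Cj C ?y) \<otimes>\<^sub>a g) \<cdot> ((RUn C (Cj C ?y))\<dagger> \<cdot> ?n)"
    by (simp add: bend_def)
  also have "\<dots> = LUn C z \<cdot> (Ev C ?y \<otimes>\<^sub>a Idn C z) \<cdot> ((Asc C (Cj C ?y) ?y z)\<dagger> \<cdot> (?n \<otimes>\<^sub>a Idn C (?y \<otimes>\<^sub>o z))) \<cdot>
      (Idn C ?x \<otimes>\<^sub>a g) \<cdot> (RUn C ?x)\<dagger>"
    unfolding 2 by (simp add: eps_def interchange_head)
  also have "\<dots> = (LUn C z \<cdot> ((Ev C ?y \<cdot> (?n \<otimes>\<^sub>a Idn C ?y)) \<otimes>\<^sub>a Idn C z) \<cdot> (Asc C ?x ?y z)\<dagger>) \<cdot>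
      (Idn C ?x \<otimes>\<^sub>a g) \<cdot> (RUn C ?x)\<dagger>"
    unfolding 1 by (simp add: whisker_right)
  also have "\<dots> = eps b z \<cdot> (Idn C ?B \<otimes>\<^sub>a (eps a (b \<otimes>\<^sub>o z) \<cdot> (Idn C ?A \<otimes>\<^sub>a Asc C a b z))) \<cdot>
      (Asc C ?B ?A (?y \<otimes>\<^sub>o z) \<cdot> (Idn C ?x \<otimes>\<^sub>a g)) \<cdot> (RUn C ?x)\<dagger>"
    by (simp only: Ev_nu assms nested_ev_TOb) simp
  also have "\<dots> = eps b z \<cdot> (Idn C ?B \<otimes>\<^sub>a (eps a (b \<otimes>\<^sub>o z) \<cdot> (Idn C ?A \<otimes>\<^sub>a Asc C a b z))) \<cdot>
      (Idn C ?B \<otimes>\<^sub>a (Idn C ?A \<otimes>\<^sub>a g)) \<cdot> (Idn C ?B \<otimes>\<^sub>a (RUn C ?A)\<dagger>)"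
    unfolding 4 3 by simp
  also have "\<dots> = eps b z \<cdot> (Idn C ?B \<otimes>\<^sub>a bend a (b \<otimes>\<^sub>o z) (Asc C a b z \<cdot> g))"
    by (simp add: bend_def merge)
  finally show ?thesis .
qed

lemma nu_invertible:
  assumes [simp]: "a \<in> Obj C" "b \<in> Obj C"
  obtains m where "mutually_inverse C (Cj C b \<otimes>\<^sub>o Cj C a) (Cj C (a \<otimes>\<^sub>o b)) (nu C b a) m"
proof -
  let ?A = "Cj C a" and ?B = "Cj C b" and ?y = "a \<otimes>\<^sub>o b" and ?n = "nu C b a"
  let ?x = "?B \<otimes>\<^sub>o ?A"
  let ?g = "(Asc C a b ?x)\<dagger> \<cdot> unbend a (eta b ?A)"
  define m where "m = bend ?y ?x ?g"
  have m [simp]: "arr C m" "src C m = Cj C ?y" "tgt C m = ?x" by (simp_all add: m_def)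
  have "bend a (b \<otimes>\<^sub>o ?x) (unbend a (eta b ?A)) = eta b ?A"
    using bend_unbend[of a "eta b ?A"] by simp
  then have left: "m \<cdot> ?n = Idn C ?x"
    unfolding m_def by (subst bend_nu) (simp_all add: zigzag_functor2)
  \<comment> \<open>\<open>h\<close> is determined by \<open>h \<cdot> nu\<close>, so the one-sided inverse is two-sided\<close>
  have recover: "h = bend ?y (tgt C h) ((Asc C a b (tgt C h))\<dagger> \<cdot> unbend a ((Idn C b \<otimes>\<^sub>a (h \<cdot> ?n)) \<cdot> eta b ?A))"
    if [simp]: "arr C h" "src C h = Cj C ?y" for h
  proof -
    let ?z = "tgt C h"
    define k where "k = bend a (b \<otimes>\<^sub>o ?z) (Asc C a b ?z \<cdot> unbend ?y h)"
    have [simp]: "arr C k" "src C k = ?A" "tgt C k = b \<otimes>\<^sub>o ?z" by (simp_all add: k_def)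
    have "h \<cdot> ?n = eps b ?z \<cdot> (Idn C ?B \<otimes>\<^sub>a k)"
      using bend_nu[of a b ?z "unbend ?y h"] bend_unbend[of ?y h] by (simp add: k_def)
    then have "(Idn C b \<otimes>\<^sub>a (h \<cdot> ?n)) \<cdot> eta b ?A
        = (Idn C b \<otimes>\<^sub>a eps b ?z) \<cdot> ((Idn C b \<otimes>\<^sub>a (Idn C ?B \<otimes>\<^sub>a k)) \<cdot> eta b ?A)"
      by (simp add: whisker_left)
    also have "\<dots> = k"
      using eta_nat[of b k] rewrite_head[OF zigzag_functor1[of b ?z], of k] by simp
    finally have "unbend a ((Idn C b \<otimes>\<^sub>a (h \<cdot> ?n)) \<cdot> eta b ?A) = Asc C a b ?z \<cdot> unbend ?y h"
      by (simp add: k_def unbend_bend)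
    then show ?thesis using bend_unbend[of ?y h] by simp
  qed
  have "(?n \<cdot> m) \<cdot> ?n = Idn C (Cj C ?y) \<cdot> ?n" by (simp add: left)
  then have "?n \<cdot> m = Idn C (Cj C ?y)"
    using recover[of "?n \<cdot> m"] recover[of "Idn C (Cj C ?y)"] by simp
  with left show ?thesis by (intro that[of m]) (simp add: mutually_inverse_iff)
qed

end

section \<open>Complex vector spaces\<close>

lemma cring_complex_field: "cring complex_field"
proof -
  have neg: "\<exists>y. y + x = 0" "\<exists>y. x + y = 0" for x :: complex
    by (rule exI[of _ "- x"]; simp)+
  have "abelian_group complex_field"
    by (rule abelian_groupI) (auto simp: complex_field_def algebra_simps neg)
  moreover have "comm_monoid complex_field"
    by (rule comm_monoidI) (auto simp: complex_field_def algebra_simps)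
  ultimately show ?thesis
    by (rule cringI) (auto simp: complex_field_def algebra_simps)
qed

lemma cvector_spaceI:
  assumes zero: "\<zero>\<^bsub>V\<^esub> \<in> carrier V"
    and add: "\<And>x y. \<lbrakk>x \<in> carrier V; y \<in> carrier V\<rbrakk> \<Longrightarrow> x \<oplus>\<^bsub>V\<^esub> y \<in> carrier V"
    and smult: "\<And>c x. x \<in> carrier V \<Longrightarrow> c \<odot>\<^bsub>V\<^esub> x \<in> carrier V"
    and assoc: "\<And>x y z. \<lbrakk>x \<in> carrier V; y \<in> carrier V; z \<in> carrier V\<rbrakk>
      \<Longrightarrow> (x \<oplus>\<^bsub>V\<^esub> y) \<oplus>\<^bsub>V\<^esub> z = x \<oplus>\<^bsub>V\<^esub> (y \<oplus>\<^bsub>V\<^esub> z)"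
    and comm: "\<And>x y. \<lbrakk>x \<in> carrier V; y \<in> carrier V\<rbrakk> \<Longrightarrow> x \<oplus>\<^bsub>V\<^esub> y = y \<oplus>\<^bsub>V\<^esub> x"
    and l_zero: "\<And>x. x \<in> carrier V \<Longrightarrow> \<zero>\<^bsub>V\<^esub> \<oplus>\<^bsub>V\<^esub> x = x"
    and smult_zero: "\<And>x. x \<in> carrier V \<Longrightarrow> 0 \<odot>\<^bsub>V\<^esub> x = \<zero>\<^bsub>V\<^esub>"
    and l_distr: "\<And>c d x. x \<in> carrier V \<Longrightarrow> (c + d) \<odot>\<^bsub>V\<^esub> x = c \<odot>\<^bsub>V\<^esub> x \<oplus>\<^bsub>V\<^esub> d \<odot>\<^bsub>V\<^esub> x"
    and r_distr: "\<And>c x y. \<lbrakk>x \<in> carrier V; y \<in> carrier V\<rbrakk>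
      \<Longrightarrow> c \<odot>\<^bsub>V\<^esub> (x \<oplus>\<^bsub>V\<^esub> y) = c \<odot>\<^bsub>V\<^esub> x \<oplus>\<^bsub>V\<^esub> c \<odot>\<^bsub>V\<^esub> y"
    and smult_assoc: "\<And>c d x. x \<in> carrier V \<Longrightarrow> (c * d) \<odot>\<^bsub>V\<^esub> x = c \<odot>\<^bsub>V\<^esub> (d \<odot>\<^bsub>V\<^esub> x)"
    and one: "\<And>x. x \<in> carrier V \<Longrightarrow> 1 \<odot>\<^bsub>V\<^esub> x = x"
  shows "cvector_space V"
proof -
  have "abelian_group V"
  proof (rule abelian_groupI)
    fix x assume x: "x \<in> carrier V"
    have "(-1) \<odot>\<^bsub>V\<^esub> x \<oplus>\<^bsub>V\<^esub> x = \<zero>\<^bsub>V\<^esub>"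
      using l_distr[OF x, of "-1" 1] by (simp add: one smult_zero x)
    then show "\<exists>y\<in>carrier V. y \<oplus>\<^bsub>V\<^esub> x = \<zero>\<^bsub>V\<^esub>" using smult[OF x] by blast
  qed (use assms in auto)
  with cring_complex_field show ?thesis
    by (rule moduleI) (use assms in \<open>auto simp: complex_field_def\<close>)
qed

lemma cvector_spaceD:
  assumes "cvector_space V"
  shows "\<zero>\<^bsub>V\<^esub> \<in> carrier V"
    and "\<lbrakk>x \<in> carrier V; y \<in> carrier V\<rbrakk> \<Longrightarrow> x \<oplus>\<^bsub>V\<^esub> y \<in> carrier V"
    and "x \<in> carrier V \<Longrightarrow> c \<odot>\<^bsub>V\<^esub> x \<in> carrier V"
    and "\<lbrakk>x \<in> carrier V; y \<in> carrier V; z \<in> carrier V\<rbrakk>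
      \<Longrightarrow> (x \<oplus>\<^bsub>V\<^esub> y) \<oplus>\<^bsub>V\<^esub> z = x \<oplus>\<^bsub>V\<^esub> (y \<oplus>\<^bsub>V\<^esub> z)"
    and "\<lbrakk>x \<in> carrier V; y \<in> carrier V\<rbrakk> \<Longrightarrow> x \<oplus>\<^bsub>V\<^esub> y = y \<oplus>\<^bsub>V\<^esub> x"
    and "x \<in> carrier V \<Longrightarrow> \<zero>\<^bsub>V\<^esub> \<oplus>\<^bsub>V\<^esub> x = x"
    and "x \<in> carrier V \<Longrightarrow> 0 \<odot>\<^bsub>V\<^esub> x = \<zero>\<^bsub>V\<^esub>"
    and "x \<in> carrier V \<Longrightarrow> (c + d) \<odot>\<^bsub>V\<^esub> x = c \<odot>\<^bsub>V\<^esub> x \<oplus>\<^bsub>V\<^esub> d \<odot>\<^bsub>V\<^esub> x"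
    and "\<lbrakk>x \<in> carrier V; y \<in> carrier V\<rbrakk> \<Longrightarrow> c \<odot>\<^bsub>V\<^esub> (x \<oplus>\<^bsub>V\<^esub> y) = c \<odot>\<^bsub>V\<^esub> x \<oplus>\<^bsub>V\<^esub> c \<odot>\<^bsub>V\<^esub> y"
    and "x \<in> carrier V \<Longrightarrow> (c * d) \<odot>\<^bsub>V\<^esub> x = c \<odot>\<^bsub>V\<^esub> (d \<odot>\<^bsub>V\<^esub> x)"
    and "x \<in> carrier V \<Longrightarrow> 1 \<odot>\<^bsub>V\<^esub> x = x"
proof -
  interpret module complex_field V by (rule assms)
  show "\<zero>\<^bsub>V\<^esub> \<in> carrier V" by simp
  show "x \<oplus>\<^bsub>V\<^esub> y \<in> carrier V" if "x \<in> carrier V" "y \<in> carrier V" for x y using that by simp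
  show "c \<odot>\<^bsub>V\<^esub> x \<in> carrier V" if "x \<in> carrier V" using smult_closed[of c x] that by (simp add: complex_field_def)
  show "(x \<oplus>\<^bsub>V\<^esub> y) \<oplus>\<^bsub>V\<^esub> z = x \<oplus>\<^bsub>V\<^esub> (y \<oplus>\<^bsub>V\<^esub> z)" if "x \<in> carrier V" "y \<in> carrier V" "z \<in> carrier V"
    using that by (simp add: M.a_assoc)
  show "x \<oplus>\<^bsub>V\<^esub> y = y \<oplus>\<^bsub>V\<^esub> x" if "x \<in> carrier V" "y \<in> carrier V" using that by (simp add: M.a_comm)
  show "\<zero>\<^bsub>V\<^esub> \<oplus>\<^bsub>V\<^esub> x = x" if "x \<in> carrier V" using that by simp
  show "0 \<odot>\<^bsub>V\<^esub> x = \<zero>\<^bsub>V\<^esub>" if "x \<in> carrier V" using smult_l_null[OF that] by (simp add: complex_field_def)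
  show "(c + d) \<odot>\<^bsub>V\<^esub> x = c \<odot>\<^bsub>V\<^esub> x \<oplus>\<^bsub>V\<^esub> d \<odot>\<^bsub>V\<^esub> x" if "x \<in> carrier V"
    using smult_l_distr[of c d x] that by (simp add: complex_field_def)
  show "c \<odot>\<^bsub>V\<^esub> (x \<oplus>\<^bsub>V\<^esub> y) = c \<odot>\<^bsub>V\<^esub> x \<oplus>\<^bsub>V\<^esub> c \<odot>\<^bsub>V\<^esub> y" if "x \<in> carrier V" "y \<in> carrier V"
    using smult_r_distr[of c x y] that by (simp add: complex_field_def)
  show "(c * d) \<odot>\<^bsub>V\<^esub> x = c \<odot>\<^bsub>V\<^esub> (d \<odot>\<^bsub>V\<^esub> x)" if "x \<in> carrier V"
    using smult_assoc1[of c d x] that by (simp add: complex_field_def)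
  show "1 \<odot>\<^bsub>V\<^esub> x = x" if "x \<in> carrier V" using smult_one[OF that] by (simp add: complex_field_def)
qed

lemma semilinear_map_comp:
  "\<lbrakk>semilinear_map \<sigma> U V f; semilinear_map \<tau> V W g\<rbrakk> \<Longrightarrow> semilinear_map (\<lambda>z. \<tau> (\<sigma> z)) U W (\<lambda>x. g (f x))"
  by (simp add: semilinear_map_def Pi_iff)

lemma linear_map_comp: "\<lbrakk>linear_map U V f; linear_map V W g\<rbrakk> \<Longrightarrow> linear_map U W (\<lambda>x. g (f x))"
  using semilinear_map_comp[of id U V f id W g] by (simp add: id_def)

lemma conj_linear_map_comp:
  "\<lbrakk>linear_map U V f; conj_linear_map V W g\<rbrakk> \<Longrightarrow> conj_linear_map U W (\<lambda>x. g (f x))"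
  "\<lbrakk>conj_linear_map U V f; linear_map V W g\<rbrakk> \<Longrightarrow> conj_linear_map U W (\<lambda>x. g (f x))"
  using semilinear_map_comp[of id U V f cnj W g] semilinear_map_comp[of cnj U V f id W g]
  by (simp_all add: id_def)

lemma semilinear_map_cong:
  "\<lbrakk>semilinear_map \<sigma> V W f; cvector_space V; \<And>x. x \<in> carrier V \<Longrightarrow> f x = g x\<rbrakk> \<Longrightarrow> semilinear_map \<sigma> V W g"
  using cvector_spaceD(2,3)[of V] by (simp add: semilinear_map_def Pi_iff)

lemma smult_zero_vector: "cvector_space V \<Longrightarrow> z \<odot>\<^bsub>V\<^esub> \<zero>\<^bsub>V\<^esub> = \<zero>\<^bsub>V\<^esub>"
  using cvector_spaceD(10)[of V "\<zero>\<^bsub>V\<^esub>" z 0] cvector_spaceD(1)[of V] cvector_spaceD(7)[of V "\<zero>\<^bsub>V\<^esub>"] by simp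

lemma linear_zero: "cvector_space W \<Longrightarrow> linear_map V W (\<lambda>x. \<zero>\<^bsub>W\<^esub>)"
  using cvector_spaceD(1,6)[of W] smult_zero_vector[of W] by (auto simp: semilinear_map_def)

lemma linear_mapD:
  "linear_map V W f \<Longrightarrow> x \<in> carrier V \<Longrightarrow> f x \<in> carrier W"
  "linear_map V W f \<Longrightarrow> x \<in> carrier V \<Longrightarrow> y \<in> carrier V \<Longrightarrow> f (x \<oplus>\<^bsub>V\<^esub> y) = f x \<oplus>\<^bsub>W\<^esub> f y"
  "linear_map V W f \<Longrightarrow> x \<in> carrier V \<Longrightarrow> f (z \<odot>\<^bsub>V\<^esub> x) = z \<odot>\<^bsub>W\<^esub> f x"
  by (auto simp: semilinear_map_def)

lemma linear_preserves_zero: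
  assumes "linear_map V W f" "cvector_space V" "cvector_space W"
  shows "f \<zero>\<^bsub>V\<^esub> = \<zero>\<^bsub>W\<^esub>"
proof -
  have "f \<zero>\<^bsub>V\<^esub> = f (0 \<odot>\<^bsub>V\<^esub> \<zero>\<^bsub>V\<^esub>)" using smult_zero_vector[OF assms(2)] by simp
  also have "\<dots> = 0 \<odot>\<^bsub>W\<^esub> f \<zero>\<^bsub>V\<^esub>" by (rule linear_mapD(3)[OF assms(1) cvector_spaceD(1)[OF assms(2)]])
  also have "\<dots> = \<zero>\<^bsub>W\<^esub>"
    by (rule cvector_spaceD(7)[OF assms(3) linear_mapD(1)[OF assms(1) cvector_spaceD(1)[OF assms(2)]]])
  finally show ?thesis .
qed

lemma linear_add:
  assumes f: "linear_map V W f" and g: "linear_map V W g" and W: "cvector_space W"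
  shows "linear_map V W (\<lambda>x. f x \<oplus>\<^bsub>W\<^esub> g x)"
proof -
  interpret W: module complex_field W by (rule W)
  show ?thesis
    using f g cvector_spaceD(2,3,9)[OF W]
    by (auto simp: semilinear_map_def Pi_iff W.M.a_ac)
qed

lemma linear_scale:
  assumes f: "linear_map V W f" and W: "cvector_space W"
  shows "linear_map V W (\<lambda>x. z \<odot>\<^bsub>W\<^esub> f x)"
  using f cvector_spaceD(2,3,9)[OF W] cvector_spaceD(10)[OF W, symmetric]
  by (auto simp: semilinear_map_def Pi_iff mult.commute)

lemma semilinear_on_image:
  assumes bij: "bij_betw p (carrier U) (carrier V)" and lin: "linear_map U V p" and U: "cvector_space U"
    and G: "semilinear_map \<sigma> U W (\<lambda>u. g (p u))"
  shows "semilinear_map \<sigma> V W g"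
  unfolding semilinear_map_def
proof (intro conjI ballI allI)
  have im: "carrier V = p ` carrier U" using bij by (simp add: bij_betw_def)
  show "g \<in> carrier V \<rightarrow> carrier W" using G im by (auto simp: semilinear_map_def)
  fix x assume "x \<in> carrier V"
  then obtain u where u: "u \<in> carrier U" "x = p u" using im by auto
  show "g (z \<odot>\<^bsub>V\<^esub> x) = \<sigma> z \<odot>\<^bsub>W\<^esub> g x" for z
    using G u by (simp add: semilinear_map_def flip: linear_mapD(3)[OF lin u(1)])
  fix y assume "y \<in> carrier V"
  then obtain v where v: "v \<in> carrier U" "y = p v" using im by auto
  show "g (x \<oplus>\<^bsub>V\<^esub> y) = g x \<oplus>\<^bsub>W\<^esub> g y"
    using G u v by (simp add: semilinear_map_def flip: linear_mapD(2)[OF lin u(1) v(1)])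
qed

lemma cvector_space_image:
  assumes U: "cvector_space U" and bij: "bij_betw p (carrier U) (carrier V)" and lin: "linear_map U V p"
    and zero: "\<zero>\<^bsub>V\<^esub> = p \<zero>\<^bsub>U\<^esub>"
  shows "cvector_space V"
proof -
  note vs = cvector_spaceD[OF U] and add = linear_mapD(2)[OF lin, symmetric] and scale = linear_mapD(3)[OF lin, symmetric]
  have im: "carrier V = p ` carrier U" using bij by (simp add: bij_betw_def)
  show ?thesis
  proof (rule cvector_spaceI)
    show "\<zero>\<^bsub>V\<^esub> \<in> carrier V" using vs(1) by (simp add: zero im)
    fix x assume "x \<in> carrier V"
    then obtain u where u: "u \<in> carrier U" and x: "x = p u" using im by auto
    show "z \<odot>\<^bsub>V\<^esub> x \<in> carrier V" for z using u vs(3) by (simp add: x scale im)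
    show "\<zero>\<^bsub>V\<^esub> \<oplus>\<^bsub>V\<^esub> x = x" using u vs(1,6) by (simp add: x zero add)
    show "0 \<odot>\<^bsub>V\<^esub> x = \<zero>\<^bsub>V\<^esub>" using u vs(7) by (simp add: x zero scale)
    show "(c + d) \<odot>\<^bsub>V\<^esub> x = c \<odot>\<^bsub>V\<^esub> x \<oplus>\<^bsub>V\<^esub> d \<odot>\<^bsub>V\<^esub> x" for c d using u vs(3,8) by (simp add: x scale add)
    show "(c * d) \<odot>\<^bsub>V\<^esub> x = c \<odot>\<^bsub>V\<^esub> (d \<odot>\<^bsub>V\<^esub> x)" for c d using u vs(3,10) by (simp add: x scale)
    show "1 \<odot>\<^bsub>V\<^esub> x = x" using u vs(11) by (simp add: x scale)
    fix y assume "y \<in> carrier V"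
    then obtain v where v: "v \<in> carrier U" and y: "y = p v" using im by auto
    show "x \<oplus>\<^bsub>V\<^esub> y \<in> carrier V" using u v vs(2) by (simp add: x y add im)
    show "x \<oplus>\<^bsub>V\<^esub> y = y \<oplus>\<^bsub>V\<^esub> x" using vs(5)[OF u v] u v by (simp add: x y add)
    show "c \<odot>\<^bsub>V\<^esub> (x \<oplus>\<^bsub>V\<^esub> y) = c \<odot>\<^bsub>V\<^esub> x \<oplus>\<^bsub>V\<^esub> c \<odot>\<^bsub>V\<^esub> y" for c
      using u v vs(2,3,9) by (simp add: x y add scale)
    fix w assume "w \<in> carrier V"
    then obtain t where t: "t \<in> carrier U" and w: "w = p t" using im by auto
    show "(x \<oplus>\<^bsub>V\<^esub> y) \<oplus>\<^bsub>V\<^esub> w = x \<oplus>\<^bsub>V\<^esub> (y \<oplus>\<^bsub>V\<^esub> w)" using u v t vs(2,4) by (simp add: x y w add)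
  qed
qed

lemma (in linear_category) comp_left_linear:
  "\<lbrakk>arr C g; a \<in> Obj C\<rbrakk> \<Longrightarrow> linear_map (hom_space C a (src C g)) (hom_space C a (tgt C g)) (\<lambda>f. g \<cdot> f)"
  using Cmp_bilinear[of a "src C g" "tgt C g"] arr_in_Hom[of g]
  by (simp add: bilinear_map_def hom_space_def)

lemma (in linear_category) comp_right_linear:
  "\<lbrakk>arr C f; c \<in> Obj C\<rbrakk> \<Longrightarrow> linear_map (hom_space C (tgt C f) c) (hom_space C (src C f) c) (\<lambda>g. g \<cdot> f)"
  using Cmp_bilinear[of "src C f" "tgt C f" c] arr_in_Hom[of f]
  by (simp add: bilinear_map_def hom_space_def)

lemma linear_map_Hom:
  "\<lbrakk>semilinear_map \<sigma> (hom_space K a b) (hom_space L c d) F; f \<in> Hom K a b\<rbrakk> \<Longrightarrow> F f \<in> Hom L c d"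
  by (auto simp: semilinear_map_def hom_space_def)

section \<open>Orbit categories\<close>

text \<open>
  A cyclic module category is determined, up to the names of its objects, by the arrows between
  the objects \<open>c \<triangleright> m\<close> of the orbit of the basepoint \<open>m\<close>. They form a category \<open>K\<close> with the objects of
  \<open>C\<close>; an arrow \<open>f\<close> of \<open>C\<close> gives the arrow \<open>J f = f \<triangleright> m\<close>, and \<open>act c\<close> tensors with \<open>c\<close> and
  corrects by the associators. The associators of \<open>K\<close> are the images under \<open>J\<close> of those of \<open>C\<close>,
  so that coherence in \<open>K\<close> reduces to coherence in \<open>C\<close>.
\<close>

locale orbit_category = rigid_cstar_tensor_category C + K: linear_category K
  for C :: "('o, 'a, 'z) rigid_cat_scheme" (structure)
    and K :: "('o, 'y, 'w) lin_cat_scheme"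
    and J :: "'a \<Rightarrow> 'y" and act :: "'o \<Rightarrow> 'y \<Rightarrow> 'y" +
  assumes Obj_K: "Obj K = Obj C"
    and J_linear: "\<lbrakk>a \<in> Obj C; b \<in> Obj C\<rbrakk> \<Longrightarrow> linear_map (hom_space C a b) (hom_space K a b) J"
    and J_Idn: "a \<in> Obj C \<Longrightarrow> J (Idn C a) = Idn K a"
    and J_Cmp: "\<lbrakk>arr C f; arr C g; tgt C f = src C g\<rbrakk> \<Longrightarrow> J (g \<cdot> f) = J g \<cdot>\<^bsub>K\<^esub> J f"
    and act_linear: "\<lbrakk>a \<in> Obj C; b \<in> Obj C; c \<in> Obj C\<rbrakk> \<Longrightarrow>
      linear_map (hom_space K a b) (hom_space K (c \<otimes>\<^sub>o a) (c \<otimes>\<^sub>o b)) (act c)"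
    and act_Cmp: "\<lbrakk>c \<in> Obj C; arr K T; arr K S; tgt K T = src K S\<rbrakk>
      \<Longrightarrow> act c (S \<cdot>\<^bsub>K\<^esub> T) = act c S \<cdot>\<^bsub>K\<^esub> act c T"
    and act_J: "\<lbrakk>c \<in> Obj C; arr C f\<rbrakk> \<Longrightarrow> act c (J f) = J (Idn C c \<otimes>\<^sub>a f)"
    and J_act: "\<lbrakk>arr C f; arr K T\<rbrakk> \<Longrightarrow> J (f \<otimes>\<^sub>a Idn C (tgt K T)) \<cdot>\<^bsub>K\<^esub> act (src C f) T
      = act (tgt C f) T \<cdot>\<^bsub>K\<^esub> J (f \<otimes>\<^sub>a Idn C (src K T))"
    and act_TOb: "\<lbrakk>c \<in> Obj C; d \<in> Obj C; arr K T\<rbrakk> \<Longrightarrow> J (Asc C c d (tgt K T)) \<cdot>\<^bsub>K\<^esub> act (c \<otimes>\<^sub>o d) T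
      = act c (act d T) \<cdot>\<^bsub>K\<^esub> J (Asc C c d (src K T))"
    and act_Unt: "arr K T \<Longrightarrow> J (LUn C (tgt K T)) \<cdot>\<^bsub>K\<^esub> act (Unt C) T = T \<cdot>\<^bsub>K\<^esub> J (LUn C (src K T))"
begin

abbreviation Kcomp :: "'y \<Rightarrow> 'y \<Rightarrow> 'y"  (infixr \<open>\<star>\<close> 70) where
  "S \<star> T \<equiv> S \<cdot>\<^bsub>K\<^esub> T"

declare Obj_K [simp]

lemma src_tgt_K [simp]: "arr K T \<Longrightarrow> src K T \<in> Obj C" "arr K T \<Longrightarrow> tgt K T \<in> Obj C"
  using K.src_Obj K.tgt_Obj by auto

lemma Hom_K_iff: "\<lbrakk>a \<in> Obj C; b \<in> Obj C\<rbrakk> \<Longrightarrow> T \<in> Hom K a b \<longleftrightarrow> arr K T \<and> src K T = a \<and> tgt K T = b"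
  using K.Hom_iff[of a b T] by simp

lemma typed_J [simp]:
  assumes "arr C f"
  shows "arr K (J f)" "src K (J f) = src C f" "tgt K (J f) = tgt C f"
  using linear_map_Hom[OF J_linear[of "src C f" "tgt C f"], of f] arr_in_Hom[OF assms] by (simp_all add: Hom_K_iff)

lemma typed_act [simp]:
  assumes "arr K T" "c \<in> Obj C"
  shows "arr K (act c T)" "src K (act c T) = c \<otimes>\<^sub>o src K T" "tgt K (act c T) = c \<otimes>\<^sub>o tgt K T"
  using linear_map_Hom[OF act_linear[of "src K T" "tgt K T" c], of T] assms by (simp_all add: Hom_K_iff)

lemma J_comp: "\<lbrakk>arr C f; arr C g; tgt C f = src C g\<rbrakk> \<Longrightarrow> J g \<star> J f = J (g \<cdot> f)"
  by (simp add: J_Cmp)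

lemma J_comp_head:
  "\<lbrakk>arr C f; arr C g; tgt C f = src C g; arr K T; tgt K T = src C f\<rbrakk> \<Longrightarrow> J g \<star> (J f \<star> T) = J (g \<cdot> f) \<star> T"
  by (rule K.rewrite_head[OF J_comp]) auto

lemmas J_merge = J_comp J_comp_head

lemma act_Idn [simp]: "\<lbrakk>c \<in> Obj C; a \<in> Obj C\<rbrakk> \<Longrightarrow> act c (Idn K a) = Idn K (c \<otimes>\<^sub>o a)"
  using act_J[of c "Idn C a"] by (simp add: J_Idn)

lemma J_epi:
  assumes "S \<star> J f = T \<star> J f" "f \<cdot> f\<dagger> = Idn C (tgt C f)" "arr C f" "arr K S" "arr K T"
    "src K S = tgt C f" "src K T = tgt C f"
  shows "S = T"
  by (rule K.epi_cancel[OF assms(1), of "J (f\<dagger>)"]) (use assms(2-) in \<open>auto simp: J_comp J_Idn\<close>)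

lemma act_act:
  assumes [simp]: "c \<in> Obj C" "d \<in> Obj C" "arr K T"
  shows "act c (act d T) = J (Asc C c d (tgt K T)) \<star> act (c \<otimes>\<^sub>o d) T \<star> J ((Asc C c d (src K T))\<dagger>)"
proof -
  have "J (Asc C c d (tgt K T)) \<star> act (c \<otimes>\<^sub>o d) T \<star> J ((Asc C c d (src K T))\<dagger>)
      = (J (Asc C c d (tgt K T)) \<star> act (c \<otimes>\<^sub>o d) T) \<star> J ((Asc C c d (src K T))\<dagger>)" by simp
  then show ?thesis by (simp add: act_TOb J_comp J_Idn)
qed

lemma act_act_dag:
  assumes [simp]: "c \<in> Obj C" "d \<in> Obj C" "arr K T"
  shows "J ((Asc C c d (tgt K T))\<dagger>) \<star> act c (act d T) = act (c \<otimes>\<^sub>o d) T \<star> J ((Asc C c d (src K T))\<dagger>)"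
  by (simp add: act_act J_merge J_Idn)

lemma act_Unt_eq:
  assumes [simp]: "arr K T"
  shows "act (Unt C) T = J ((LUn C (tgt K T))\<dagger>) \<star> T \<star> J (LUn C (src K T))"
proof -
  have "J ((LUn C (tgt K T))\<dagger>) \<star> (J (LUn C (tgt K T)) \<star> act (Unt C) T) = act (Unt C) T"
    by (simp add: J_comp_head J_Idn)
  then show ?thesis by (simp add: act_Unt)
qed

text \<open>
  The unit and counit of the adjunction between tensoring with \<open>c\<close> and with \<open>Cj C c\<close> are natural with respect
  to all arrows of \<open>K\<close>, since their factors \<open>Coev C c\<close> and \<open>Ev C c\<close> act on the other side than \<open>T\<close>.
\<close>

lemma eps_act:
  assumes [simp]: "c \<in> Obj C" "arr K T"
  shows "J (eps c (tgt K T)) \<star> act (Cj C c) (act c T) = T \<star> J (eps c (src K T))"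
proof -
  let ?c = "Cj C c" and ?x = "src K T" and ?y = "tgt K T"
  have "J (eps c ?y) \<star> act ?c (act c T)
      = J (LUn C ?y) \<star> J (Ev C c \<otimes>\<^sub>a Idn C ?y) \<star> J ((Asc C ?c c ?y)\<dagger>) \<star> act ?c (act c T)"
    by (simp add: eps_def J_Cmp)
  also have "\<dots> = J (LUn C ?y) \<star> (J (Ev C c \<otimes>\<^sub>a Idn C ?y) \<star> act (?c \<otimes>\<^sub>o c) T) \<star> J ((Asc C ?c c ?x)\<dagger>)"
    by (simp add: act_act_dag)
  also have "\<dots> = (J (LUn C ?y) \<star> act (Unt C) T) \<star> J (Ev C c \<otimes>\<^sub>a Idn C ?x) \<star> J ((Asc C ?c c ?x)\<dagger>)"
    using J_act[of "Ev C c" T] by simp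
  also have "\<dots> = T \<star> J (eps c ?x)"
    unfolding act_Unt[OF assms(2)] by (simp add: eps_def J_Cmp)
  finally show ?thesis .
qed

lemma eta_act:
  assumes [simp]: "c \<in> Obj C" "arr K T"
  shows "act c (act (Cj C c) T) \<star> J (eta c (src K T)) = J (eta c (tgt K T)) \<star> T"
proof -
  let ?c = "Cj C c" and ?x = "src K T" and ?y = "tgt K T"
  have "act c (act ?c T) \<star> J (eta c ?x)
      = (act c (act ?c T) \<star> J (Asc C c ?c ?x)) \<star> J (Coev C c \<otimes>\<^sub>a Idn C ?x) \<star> J ((LUn C ?x)\<dagger>)"
    by (simp add: eta_def J_Cmp)
  also have "\<dots> = J (Asc C c ?c ?y) \<star> (act (c \<otimes>\<^sub>o ?c) T \<star> J (Coev C c \<otimes>\<^sub>a Idn C ?x)) \<star> J ((LUn C ?x)\<dagger>)"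
    by (simp flip: act_TOb)
  also have "act (c \<otimes>\<^sub>o ?c) T \<star> J (Coev C c \<otimes>\<^sub>a Idn C ?x) = J (Coev C c \<otimes>\<^sub>a Idn C ?y) \<star> act (Unt C) T"
    using J_act[of "Coev C c" T] by simp
  also have "J (Asc C c ?c ?y) \<star> (J (Coev C c \<otimes>\<^sub>a Idn C ?y) \<star> act (Unt C) T) \<star> J ((LUn C ?x)\<dagger>)
      = J (Asc C c ?c ?y) \<star> J (Coev C c \<otimes>\<^sub>a Idn C ?y) \<star> (act (Unt C) T \<star> J ((LUn C ?x)\<dagger>))"
    by simp
  also have "act (Unt C) T \<star> J ((LUn C ?x)\<dagger>) = J ((LUn C ?y)\<dagger>) \<star> T"
    by (simp add: act_Unt_eq J_merge J_Idn)
  finally show ?thesis by (simp add: eta_def J_Cmp)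
qed

text \<open>
  Bending the target: \<open>hat T : Cj C b \<otimes> a \<rightarrow> 1\<close> for \<open>T : a \<rightarrow> b\<close>, and the way back. The product
  of two elements of the algebra object \<open>K(_, 1)\<close> is \<open>mul\<close>.
\<close>

definition hat :: "'y \<Rightarrow> 'y" where
  "hat T = J (Ev C (tgt K T)) \<star> act (Cj C (tgt K T)) T"

definition unhat :: "'o \<Rightarrow> 'o \<Rightarrow> 'y \<Rightarrow> 'y" where
  "unhat a b F = J (RUn C b) \<star> act b F \<star> J (eta b a)"

definition mul :: "'y \<Rightarrow> 'y \<Rightarrow> 'y" where
  "mul f g = f \<star> J (RUn C (src K f)) \<star> act (src K f) g"

lemma typed_hat [simp]:
  assumes "arr K T"
  shows "arr K (hat T)" "src K (hat T) = Cj C (tgt K T) \<otimes>\<^sub>o src K T" "tgt K (hat T) = Unt C"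
  using assms by (simp_all add: hat_def)

lemma typed_unhat [simp]:
  assumes "a \<in> Obj C" "b \<in> Obj C" "arr K F" "src K F = Cj C b \<otimes>\<^sub>o a" "tgt K F = Unt C"
  shows "arr K (unhat a b F)" "src K (unhat a b F) = a" "tgt K (unhat a b F) = b"
  using assms by (simp_all add: unhat_def)

lemma typed_mul [simp]:
  assumes "arr K f" "arr K g" "tgt K g = Unt C"
  shows "arr K (mul f g)" "src K (mul f g) = src K f \<otimes>\<^sub>o src K g" "tgt K (mul f g) = tgt K f"
  using assms by (simp_all add: mul_def)

lemma unhat_hat:
  assumes [simp]: "arr K T"
  shows "unhat (src K T) (tgt K T) (hat T) = T"
proof -
  let ?a = "src K T" and ?b = "tgt K T"
  have "unhat ?a ?b (hat T) = J (RUn C ?b) \<star> J (Idn C ?b \<otimes>\<^sub>a Ev C ?b) \<star> (act ?b (act (Cj C ?b) T) \<star> J (eta ?b ?a))"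
    by (simp add: unhat_def hat_def act_Cmp act_J)
  also have "\<dots> = J (RUn C ?b \<cdot> (Idn C ?b \<otimes>\<^sub>a Ev C ?b) \<cdot> eta ?b ?b) \<star> T"
    unfolding eta_act[OF src_tgt_K(2)[OF assms] assms] by (simp add: J_merge)
  finally show ?thesis by (simp add: zigzag_eta J_Idn)
qed

lemma hat_inj:
  assumes "hat S = hat T" "arr K S" "arr K T" "src K S = src K T" "tgt K S = tgt K T"
  shows "S = T"
proof -
  have "S = unhat (src K S) (tgt K S) (hat S)" using assms(2) by (simp add: unhat_hat)
  also have "\<dots> = unhat (src K T) (tgt K T) (hat T)" by (simp only: assms(1,4,5))
  also have "\<dots> = T" using assms(3) by (simp add: unhat_hat)
  finally show ?thesis .
qed

text \<open>
  Precomposition with \<open>act x T\<close> is multiplication by the bent arrow, up to an arrow of \<open>C\<close>. Therefore a map that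
  respects products and arrows of \<open>C\<close> respects all compositions.
\<close>

lemma comp_act_unhat:
  assumes [simp]: "a \<in> Obj C" "b \<in> Obj C" "arr K F" "src K F = Cj C b \<otimes>\<^sub>o a" "tgt K F = Unt C"
    and [simp]: "x \<in> Obj C" "arr K f" "src K f = x \<otimes>\<^sub>o b"
  shows "f \<star> act x (unhat a b F) = mul f F \<star> J ((Asc C x b (Cj C b \<otimes>\<^sub>o a))\<dagger> \<cdot> (Idn C x \<otimes>\<^sub>a eta b a))"
proof -
  have "f \<star> act x (unhat a b F) = f \<star> J (Idn C x \<otimes>\<^sub>a RUn C b) \<star> act x (act b F) \<star> J (Idn C x \<otimes>\<^sub>a eta b a)"
    by (simp add: unhat_def act_Cmp act_J)
  also have "\<dots> = f \<star> J ((Idn C x \<otimes>\<^sub>a RUn C b) \<cdot> Asc C x b (Unt C)) \<star> act (x \<otimes>\<^sub>o b) F \<star>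
      J ((Asc C x b (Cj C b \<otimes>\<^sub>o a))\<dagger> \<cdot> (Idn C x \<otimes>\<^sub>a eta b a))"
    by (simp add: act_act J_Cmp)
  finally show ?thesis by (simp add: RUn_TOb mul_def)
qed

lemma mul_hat:
  assumes [simp]: "arr K T" "x \<in> Obj C" "arr K f" "src K f = x \<otimes>\<^sub>o tgt K T"
  shows "f \<star> act x T = mul f (hat T) \<star> J ((Asc C x (tgt K T) (Cj C (tgt K T) \<otimes>\<^sub>o src K T))\<dagger> \<cdot> (Idn C x \<otimes>\<^sub>a eta (tgt K T) (src K T)))"
  using comp_act_unhat[of "src K T" "tgt K T" "hat T" x f] by (simp add: unhat_hat)

lemma hat_linear:
  assumes "a \<in> Obj C" "b \<in> Obj C"
  shows "linear_map (hom_space K a b) (hom_space K (Cj C b \<otimes>\<^sub>o a) (Unt C)) hat"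
proof (rule semilinear_map_cong)
  show "linear_map (hom_space K a b) (hom_space K (Cj C b \<otimes>\<^sub>o a) (Unt C)) (\<lambda>T. J (Ev C b) \<star> act (Cj C b) T)"
    using linear_map_comp[OF act_linear[of a b "Cj C b"]] K.comp_left_linear[of "J (Ev C b)" "Cj C b \<otimes>\<^sub>o a"] assms
    by simp
  show "cvector_space (hom_space K a b)" using K.hom_vector_space assms by simp
  show "J (Ev C b) \<star> act (Cj C b) T = hat T" if "T \<in> carrier (hom_space K a b)" for T
    using that assms by (simp add: hom_space_def Hom_K_iff hat_def)
qed

lemma unhat_linear:
  assumes "a \<in> Obj C" "b \<in> Obj C"
  shows "linear_map (hom_space K (Cj C b \<otimes>\<^sub>o a) (Unt C)) (hom_space K a b) (unhat a b)"
proof -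
  have 1: "linear_map (hom_space K (Cj C b \<otimes>\<^sub>o a) (Unt C)) (hom_space K (b \<otimes>\<^sub>o (Cj C b \<otimes>\<^sub>o a)) (b \<otimes>\<^sub>o Unt C)) (act b)"
    using assms by (intro act_linear) simp_all
  have 2: "linear_map (hom_space K (b \<otimes>\<^sub>o (Cj C b \<otimes>\<^sub>o a)) (b \<otimes>\<^sub>o Unt C)) (hom_space K a (b \<otimes>\<^sub>o Unt C)) (\<lambda>g. g \<star> J (eta b a))"
    using K.comp_right_linear[of "J (eta b a)" "b \<otimes>\<^sub>o Unt C"] assms by simp
  have 3: "linear_map (hom_space K a (b \<otimes>\<^sub>o Unt C)) (hom_space K a b) (\<lambda>f. J (RUn C b) \<star> f)"
    using K.comp_left_linear[of "J (RUn C b)" a] assms by simp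
  show ?thesis using linear_map_comp[OF linear_map_comp[OF 1 2] 3] by (simp add: unhat_def[abs_def])
qed

end

locale orbit_pair = K: orbit_category C K J act + L: orbit_category C L J' act'
  for C :: "('o, 'a, 'z) rigid_cat_scheme" (structure)
    and K :: "('o, 'y, 'w) lin_cat_scheme" and J and act
    and L :: "('o, 'x, 'v) lin_cat_scheme" and J' and act'

text \<open>
  A cyclic module dagger functor gives such a map after conjugation with the isomorphisms between \<open>c \<triangleright> Base N\<close> and
  the image of \<open>c \<triangleright> Base M\<close>.
\<close>

locale orbit_functor = orbit_pair +
  fixes \<Theta> :: "'d \<Rightarrow> 'f"
  assumes Theta_linear: "\<lbrakk>a \<in> Obj C; b \<in> Obj C\<rbrakk> \<Longrightarrow> linear_map (hom_space K a b) (hom_space L a b) \<Theta>"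
    and Theta_comp: "\<lbrakk>arr K T; arr K S; tgt K T = src K S\<rbrakk> \<Longrightarrow> \<Theta> (S \<cdot>\<^bsub>K\<^esub> T) = \<Theta> S \<cdot>\<^bsub>L\<^esub> \<Theta> T"
    and Theta_J: "arr C f \<Longrightarrow> \<Theta> (J f) = J' f"
    and Theta_act: "\<lbrakk>c \<in> Obj C; arr K T\<rbrakk> \<Longrightarrow> \<Theta> (act c T) = act' c (\<Theta> T)"
begin

lemma typed_Theta [simp]:
  assumes "arr K T"
  shows "arr L (\<Theta> T)" "src L (\<Theta> T) = src K T" "tgt L (\<Theta> T) = tgt K T"
  using linear_map_Hom[OF Theta_linear[of "src K T" "tgt K T"], of T] assms
  by (simp_all add: K.Hom_K_iff L.Hom_K_iff)

end

text \<open>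
  The algebra object of an orbit category \<open>K\<close> is \<open>K(_, 1)\<close>, on which \<open>C\<close> acts by precomposition with \<open>J\<close>.
  The extension of a map of algebra objects is forced, since an orbit functor commutes with bending.
\<close>

locale orbit_algebra_map = orbit_pair +
  fixes \<theta> :: "'d \<Rightarrow> 'f"
  assumes theta_linear: "c \<in> Obj C \<Longrightarrow> linear_map (hom_space K c (Unt C)) (hom_space L c (Unt C)) \<theta>"
    and theta_J: "\<lbrakk>arr K f; tgt K f = Unt C; arr C h; tgt C h = src K f\<rbrakk> \<Longrightarrow> \<theta> (f \<cdot>\<^bsub>K\<^esub> J h) = \<theta> f \<cdot>\<^bsub>L\<^esub> J' h"
    and theta_mul: "\<lbrakk>arr K f; tgt K f = Unt C; arr K g; tgt K g = Unt C\<rbrakk> \<Longrightarrow> \<theta> (K.mul f g) = L.mul (\<theta> f) (\<theta> g)"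
    and theta_unit: "\<theta> (Idn K (Unt C)) = Idn L (Unt C)"
begin

lemma typed_theta [simp]:
  assumes "arr K f" "tgt K f = Unt C"
  shows "arr L (\<theta> f)" "src L (\<theta> f) = src K f" "tgt L (\<theta> f) = Unt C"
  using linear_map_Hom[OF theta_linear[of "src K f"], of f] assms
  by (simp_all add: K.Hom_K_iff L.Hom_K_iff)

definition extension :: "'d \<Rightarrow> 'f" where
  "extension T = L.unhat (src K T) (tgt K T) (\<theta> (K.hat T))"

lemma typed_extension [simp]:
  assumes "arr K T"
  shows "arr L (extension T)" "src L (extension T) = src K T" "tgt L (extension T) = tgt K T"
  using assms by (simp_all add: extension_def)

lemma theta_comp_act:
  assumes [simp]: "arr K T" "x \<in> Obj C" "arr K f" "src K f = x \<otimes>\<^sub>o tgt K T" "tgt K f = Unt C"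
  shows "\<theta> (f \<cdot>\<^bsub>K\<^esub> act x T) = \<theta> f \<cdot>\<^bsub>L\<^esub> act' x (extension T)"
  unfolding extension_def
  by (subst L.comp_act_unhat) (simp_all add: K.mul_hat theta_J theta_mul)

lemma theta_J_unit: "\<lbrakk>arr C h; tgt C h = Unt C\<rbrakk> \<Longrightarrow> \<theta> (J h) = J' h"
  using theta_J[of "Idn K (Unt C)" h] by (simp add: theta_unit)

lemma theta_hat:
  assumes [simp]: "arr K T"
  shows "\<theta> (K.hat T) = L.hat (extension T)"
  using theta_comp_act[of T "Cj C (tgt K T)" "J (Ev C (tgt K T))"]
  by (simp add: K.hat_def L.hat_def theta_J_unit)

lemma extension_unique:
  assumes "\<theta> (K.hat T) = L.hat S" "arr K T" "arr L S" "src L S = src K T" "tgt L S = tgt K T"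
  shows "extension T = S"
  by (rule L.hat_inj) (use assms in \<open>auto simp flip: theta_hat\<close>)

lemma extension_J:
  assumes [simp]: "arr C f"
  shows "extension (J f) = J' f"
proof (rule extension_unique)
  show "\<theta> (K.hat (J f)) = L.hat (J' f)"
    by (simp add: K.hat_def L.hat_def K.act_J L.act_J K.J_comp L.J_comp theta_J_unit)
qed simp_all

lemma extension_comp:
  assumes [simp]: "arr K T" "arr K S" "tgt K T = src K S"
  shows "extension (S \<cdot>\<^bsub>K\<^esub> T) = extension S \<cdot>\<^bsub>L\<^esub> extension T"
proof (rule extension_unique)
  let ?c = "tgt K S"
  have "K.hat (S \<cdot>\<^bsub>K\<^esub> T) = K.hat S \<cdot>\<^bsub>K\<^esub> act (Cj C ?c) T"
    by (simp add: K.hat_def K.act_Cmp)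
  then show "\<theta> (K.hat (S \<cdot>\<^bsub>K\<^esub> T)) = L.hat (extension S \<cdot>\<^bsub>L\<^esub> extension T)"
    using theta_comp_act[of T "Cj C ?c" "K.hat S"] by (simp add: theta_hat L.hat_def L.act_Cmp)
qed simp_all

lemma extension_act:
  assumes [simp]: "c \<in> Obj C" "arr K T"
  shows "extension (act c T) = act' c (extension T)"
proof (rule extension_unique)
  let ?a = "src K T" and ?b = "tgt K T"
  let ?y = "Cj C (c \<otimes>\<^sub>o ?b)"
  let ?u = "Asc C ?y c ?b" and ?v = "Asc C ?y c ?a"
  have "\<theta> (K.hat (act c T)) = \<theta> ((J (Ev C (c \<otimes>\<^sub>o ?b) \<cdot> ?u) \<cdot>\<^bsub>K\<^esub> act (?y \<otimes>\<^sub>o c) T) \<cdot>\<^bsub>K\<^esub> J (?v\<dagger>))"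
    by (simp add: K.hat_def K.act_act K.J_Cmp)
  also have "\<dots> = (J' (Ev C (c \<otimes>\<^sub>o ?b) \<cdot> ?u) \<cdot>\<^bsub>L\<^esub> act' (?y \<otimes>\<^sub>o c) (extension T)) \<cdot>\<^bsub>L\<^esub> J' (?v\<dagger>)"
    using theta_comp_act[of T "?y \<otimes>\<^sub>o c" "J (Ev C (c \<otimes>\<^sub>o ?b) \<cdot> ?u)"]
    by (simp add: theta_J theta_J_unit del: K.K.comp_assoc L.K.comp_assoc)
  also have "\<dots> = L.hat (act' c (extension T))"
    by (simp add: L.hat_def L.act_act L.J_Cmp)
  finally show "\<theta> (K.hat (act c T)) = L.hat (act' c (extension T))" .
qed simp_all

lemma extension_restricts:
  assumes [simp]: "arr K f" "tgt K f = Unt C"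
  shows "extension f = \<theta> f"
proof (rule L.J_epi)
  let ?I = "Unt C" and ?a = "src K f"
  have "\<theta> (J (LUn C ?I) \<cdot>\<^bsub>K\<^esub> act ?I f) = J' (LUn C ?I) \<cdot>\<^bsub>L\<^esub> act' ?I (extension f)"
    using theta_comp_act[of f ?I "J (LUn C ?I)"] by (simp add: theta_J_unit)
  moreover have "J (LUn C ?I) \<cdot>\<^bsub>K\<^esub> act ?I f = f \<cdot>\<^bsub>K\<^esub> J (LUn C ?a)"
    using K.act_Unt[of f] by simp
  moreover have "J' (LUn C ?I) \<cdot>\<^bsub>L\<^esub> act' ?I (extension f) = extension f \<cdot>\<^bsub>L\<^esub> J' (LUn C ?a)"
    using L.act_Unt[of "extension f"] by simp
  ultimately show "extension f \<cdot>\<^bsub>L\<^esub> J' (LUn C ?a) = \<theta> f \<cdot>\<^bsub>L\<^esub> J' (LUn C ?a)"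
    by (simp add: theta_J)
qed simp_all

lemma extension_linear:
  assumes [simp]: "a \<in> Obj C" "b \<in> Obj C"
  shows "linear_map (hom_space K a b) (hom_space L a b) extension"
proof (rule semilinear_map_cong)
  show "linear_map (hom_space K a b) (hom_space L a b) (\<lambda>T. L.unhat a b (\<theta> (K.hat T)))"
    using linear_map_comp[OF linear_map_comp[OF K.hat_linear theta_linear] L.unhat_linear, of a b] by simp
  show "cvector_space (hom_space K a b)" using K.K.hom_vector_space by simp
  show "L.unhat a b (\<theta> (K.hat T)) = extension T" if "T \<in> carrier (hom_space K a b)" for T
    using that by (simp add: hom_space_def K.Hom_K_iff extension_def)
qed

text \<open>
  The extension is compared with an orbit functor by bending: by \<open>extension_unique\<close> each axiom becomes an
  equation in the algebra objects, where \<open>theta_comp_act\<close> applies.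
\<close>

lemma orbit_functor_extension: "orbit_functor C K J act L J' act' extension"
  by unfold_locales (simp_all add: extension_linear extension_comp extension_J extension_act)

end

lemma (in orbit_functor) orbit_functor_eqI:
  assumes "orbit_functor C K J act L J' act' \<Theta>'"
    and eq: "\<And>f. \<lbrakk>arr K f; tgt K f = Unt C\<rbrakk> \<Longrightarrow> \<Theta> f = \<Theta>' f"
    and [simp]: "arr K T"
  shows "\<Theta> T = \<Theta>' T"
proof (rule L.hat_inj)
  interpret other: orbit_functor C K J act L J' act' \<Theta>' by fact
  have "L.hat (\<Theta> T) = \<Theta> (K.hat T)" by (simp add: K.hat_def L.hat_def Theta_comp Theta_J Theta_act)
  moreover have "L.hat (\<Theta>' T) = \<Theta>' (K.hat T)"
    by (simp add: K.hat_def L.hat_def other.Theta_comp other.Theta_J other.Theta_act)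
  ultimately show "L.hat (\<Theta> T) = L.hat (\<Theta>' T)" by (simp add: eq)
qed (use assms orbit_functor.typed_Theta[OF assms(1)] in auto)

section \<open>Stars and daggers\<close>

lemma (in rigid_cstar_tensor_category) Ev_RUn:
  assumes [simp]: "c \<in> Obj C"
  shows "Ev C c \<cdot> (Idn C (Cj C c) \<otimes>\<^sub>a RUn C c) = eps c (Unt C)"
proof -
  let ?A = "Cj C c" and ?I = "Unt C"
  have "Ev C c \<cdot> (Idn C ?A \<otimes>\<^sub>a RUn C c)
      = Ev C c \<cdot> ((Idn C ?A \<otimes>\<^sub>a RUn C c) \<cdot> Asc C ?A c ?I) \<cdot> (Asc C ?A c ?I)\<dagger>" by simp
  also have "\<dots> = (Ev C c \<cdot> RUn C (?A \<otimes>\<^sub>o c)) \<cdot> (Asc C ?A c ?I)\<dagger>"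
    by (simp add: RUn_TOb)
  also have "Ev C c \<cdot> RUn C (?A \<otimes>\<^sub>o c) = RUn C ?I \<cdot> (Ev C c \<otimes>\<^sub>a Idn C ?I)"
    using RUn_nat[of "Ev C c" "?A \<otimes>\<^sub>o c" ?I] by simp
  finally show ?thesis by (simp add: eps_def LUn_Unt)
qed

lemma (in rigid_cstar_tensor_category) eps_RUn_dag:
  assumes [simp]: "c \<in> Obj C"
  shows "eps c (Unt C) \<cdot> (Idn C (Cj C c) \<otimes>\<^sub>a (RUn C c)\<dagger>) = Ev C c"
  by (simp add: interchange flip: Ev_RUn)

lemma (in rigid_cstar_tensor_category) RUn_dag_TOb:
  assumes [simp]: "a \<in> Obj C" "b \<in> Obj C"
  shows "Asc C a b (Unt C) \<cdot> (RUn C (a \<otimes>\<^sub>o b))\<dagger> = Idn C a \<otimes>\<^sub>a (RUn C b)\<dagger>"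
proof -
  have "(RUn C (a \<otimes>\<^sub>o b))\<dagger> = ((Idn C a \<otimes>\<^sub>a RUn C b) \<cdot> Asc C a b (Unt C))\<dagger>" by (simp only: RUn_TOb assms)
  then show ?thesis by simp
qed

context orbit_category
begin

text \<open>Bending an arrow out of the unit, and the way back.\<close>

definition flat :: "'y \<Rightarrow> 'y" where
  "flat h = J (Ev C (tgt K h)) \<star> act (Cj C (tgt K h)) h \<star> J ((RUn C (Cj C (tgt K h)))\<dagger>)"

definition sharp :: "'o \<Rightarrow> 'y \<Rightarrow> 'y" where
  "sharp c g = J (RUn C c) \<star> act c g \<star> J (Coev C c)"

lemma typed_flat [simp]:
  assumes "arr K h" "src K h = Unt C"
  shows "arr K (flat h)" "src K (flat h) = Cj C (tgt K h)" "tgt K (flat h) = Unt C"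
  using assms by (simp_all add: flat_def)

lemma typed_sharp [simp]:
  assumes "c \<in> Obj C" "arr K g" "src K g = Cj C c" "tgt K g = Unt C"
  shows "arr K (sharp c g)" "src K (sharp c g) = Unt C" "tgt K (sharp c g) = c"
  using assms by (simp_all add: sharp_def)

lemma sharp_flat:
  assumes [simp]: "arr K h" "src K h = Unt C"
  shows "sharp (tgt K h) (flat h) = h"
proof -
  let ?c = "tgt K h"
  have "sharp ?c (flat h) = J (RUn C ?c \<cdot> (Idn C ?c \<otimes>\<^sub>a Ev C ?c)) \<star> act ?c (act (Cj C ?c) h) \<star>
      J ((Idn C ?c \<otimes>\<^sub>a (RUn C (Cj C ?c))\<dagger>) \<cdot> Coev C ?c)"
    by (simp add: sharp_def flat_def act_Cmp act_J J_Cmp)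
  also have "\<dots> = J (RUn C ?c \<cdot> (Idn C ?c \<otimes>\<^sub>a Ev C ?c)) \<star> (J (eta ?c ?c) \<star> h)"
    using eta_act[of ?c h] by (simp add: Coev_RUn)
  also have "\<dots> = J (RUn C ?c \<cdot> (Idn C ?c \<otimes>\<^sub>a Ev C ?c) \<cdot> eta ?c ?c) \<star> h"
    by (simp add: J_merge)
  finally show ?thesis by (simp add: zigzag_eta J_Idn)
qed

lemma flat_sharp:
  assumes [simp]: "c \<in> Obj C" "arr K g" "src K g = Cj C c" "tgt K g = Unt C"
  shows "flat (sharp c g) = g"
proof -
  let ?A = "Cj C c"
  have "flat (sharp c g) = J (Ev C c \<cdot> (Idn C ?A \<otimes>\<^sub>a RUn C c)) \<star> act ?A (act c g) \<star>
      J ((Idn C ?A \<otimes>\<^sub>a Coev C c) \<cdot> (RUn C ?A)\<dagger>)"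
    by (simp add: flat_def) (simp add: sharp_def act_Cmp act_J J_Cmp)
  also have "\<dots> = (J (eps c (tgt K g)) \<star> act ?A (act c g)) \<star> J ((Idn C ?A \<otimes>\<^sub>a Coev C c) \<cdot> (RUn C ?A)\<dagger>)"
    by (simp add: Ev_RUn)
  also have "\<dots> = g \<star> J (eps c ?A \<cdot> (Idn C ?A \<otimes>\<^sub>a Coev C c) \<cdot> (RUn C ?A)\<dagger>)"
    by (subst eps_act) (simp_all add: J_Cmp)
  finally show ?thesis by (simp add: zigzag_eps J_Idn)
qed

lemma flat_inj:
  assumes "flat h = flat k" "arr K h" "src K h = Unt C" "arr K k" "src K k = Unt C" "tgt K h = tgt K k"
  shows "h = k"
proof -
  have "h = sharp (tgt K h) (flat h)" using assms(2,3) by (simp add: sharp_flat)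
  also have "\<dots> = sharp (tgt K k) (flat k)" by (simp only: assms(1,6))
  also have "\<dots> = k" using assms(4,5) by (simp add: sharp_flat)
  finally show ?thesis .
qed

lemma flat_J:
  assumes [simp]: "arr K h" "src K h = Unt C" "arr C g" "src C g = tgt K h"
  shows "flat (J g \<star> h) = flat h \<star> J (dual_arr C (src C g) (tgt C g) g)"
proof -
  let ?a = "tgt K h" and ?b = "tgt C g" and ?I = "Unt C"
  let ?d = "dual_arr C ?a ?b g"
  have "flat (J g \<star> h) = J (Ev C ?b \<cdot> (Idn C (Cj C ?b) \<otimes>\<^sub>a g)) \<star> act (Cj C ?b) h \<star> J ((RUn C (Cj C ?b))\<dagger>)"
    by (simp add: flat_def act_Cmp act_J J_Cmp)
  also have "\<dots> = J (Ev C ?a) \<star> (J (?d \<otimes>\<^sub>a Idn C ?a) \<star> act (Cj C ?b) h) \<star> J ((RUn C (Cj C ?b))\<dagger>)"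
    using Ev_dual_arr[of ?a ?b g] by (simp add: J_comp_head)
  also have "J (?d \<otimes>\<^sub>a Idn C ?a) \<star> act (Cj C ?b) h = act (Cj C ?a) h \<star> J (?d \<otimes>\<^sub>a Idn C ?I)"
    using J_act[of ?d h] by simp
  also have "J (Ev C ?a) \<star> (act (Cj C ?a) h \<star> J (?d \<otimes>\<^sub>a Idn C ?I)) \<star> J ((RUn C (Cj C ?b))\<dagger>)
      = J (Ev C ?a) \<star> act (Cj C ?a) h \<star> J ((?d \<otimes>\<^sub>a Idn C ?I) \<cdot> (RUn C (Cj C ?b))\<dagger>)"
    by (simp add: J_Cmp)
  also have "\<dots> = flat h \<star> J ?d"
    by (subst RUn_dag_nat[of ?d "Cj C ?b" "Cj C ?a"]) (simp_all add: flat_def J_Cmp)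
  finally show ?thesis by simp
qed

lemma flat_unit: "flat (Idn K (Unt C)) = J (Ev C (Unt C) \<cdot> (RUn C (Cj C (Unt C)))\<dagger>)"
  by (simp add: flat_def J_comp)

text \<open>
  The pairing of \<open>nu\<close> is the nested evaluation. So bending an arrow \<open>1 \<rightarrow> a \<otimes> b\<close> and composing with \<open>nu\<close>
  amounts to bending the two legs one after the other.
\<close>

lemma flat_mul:
  assumes [simp]: "arr K f" "src K f = Unt C" "arr K g" "src K g = Unt C"
  shows "flat (act (tgt K f) g \<star> J ((RUn C (tgt K f))\<dagger>) \<star> f) \<star> J (nu C (tgt K g) (tgt K f)) = mul (flat g) (flat f)"
proof -
  let ?a = "tgt K f" and ?b = "tgt K g" and ?I = "Unt C"
  let ?A = "Cj C ?a" and ?B = "Cj C ?b" and ?y = "?a \<otimes>\<^sub>o ?b" and ?n = "nu C ?b ?a"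
  let ?x = "?B \<otimes>\<^sub>o ?A"
  define X where "X = act ?a g \<star> J ((RUn C ?a)\<dagger>) \<star> f"
  have [simp]: "arr K X" "src K X = ?I" "tgt K X = ?y" by (simp_all add: X_def)
  have "J (eps ?a ?b) \<star> act ?A X = (J (eps ?a ?b) \<star> act ?A (act ?a g)) \<star> J (Idn C ?A \<otimes>\<^sub>a (RUn C ?a)\<dagger>) \<star> act ?A f"
    by (simp add: X_def act_Cmp act_J)
  also have "\<dots> = g \<star> J (eps ?a ?I \<cdot> (Idn C ?A \<otimes>\<^sub>a (RUn C ?a)\<dagger>)) \<star> act ?A f"
    by (subst eps_act) (simp_all add: J_Cmp)
  finally have inner: "J (eps ?a ?b) \<star> act ?A X \<star> J ((RUn C ?A)\<dagger>) = g \<star> flat f"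
    using K.rewrite_head[of "J (eps ?a ?b)" "act ?A X" "g \<star> J (Ev C ?a) \<star> act ?A f" "J ((RUn C ?A)\<dagger>)"]
    by (simp add: eps_RUn_dag flat_def)
  have "(RUn C (Cj C ?y))\<dagger> \<cdot> ?n = (?n \<otimes>\<^sub>a Idn C ?I) \<cdot> (RUn C ?x)\<dagger>"
    using RUn_dag_nat[of ?n ?x "Cj C ?y"] by simp
  then have "flat X \<star> J ?n = J (Ev C ?y) \<star> (act (Cj C ?y) X \<star> J (?n \<otimes>\<^sub>a Idn C ?I)) \<star> J ((RUn C ?x)\<dagger>)"
    by (simp add: flat_def J_comp)
  also have "act (Cj C ?y) X \<star> J (?n \<otimes>\<^sub>a Idn C ?I) = J (?n \<otimes>\<^sub>a Idn C ?y) \<star> act ?x X"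
    using J_act[of ?n X] by simp
  also have "J (Ev C ?y) \<star> (J (?n \<otimes>\<^sub>a Idn C ?y) \<star> act ?x X) \<star> J ((RUn C ?x)\<dagger>)
      = J (Ev C ?y \<cdot> (?n \<otimes>\<^sub>a Idn C ?y)) \<star> act ?x X \<star> J ((RUn C ?x)\<dagger>)"
    by (simp add: J_Cmp)
  also have "\<dots> = J (Ev C ?b) \<star> J (Idn C ?B \<otimes>\<^sub>a eps ?a ?b) \<star> (J (Asc C ?B ?A ?y) \<star> act ?x X) \<star> J ((RUn C ?x)\<dagger>)"
    by (simp add: Ev_nu) (simp add: nested_ev_def eps_def J_Cmp)
  also have "J (Asc C ?B ?A ?y) \<star> act ?x X = act ?B (act ?A X) \<star> J (Asc C ?B ?A ?I)"
    using act_TOb[of ?B ?A X] by simp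
  also have "J (Ev C ?b) \<star> J (Idn C ?B \<otimes>\<^sub>a eps ?a ?b) \<star> (act ?B (act ?A X) \<star> J (Asc C ?B ?A ?I)) \<star> J ((RUn C ?x)\<dagger>)
      = J (Ev C ?b) \<star> act ?B (J (eps ?a ?b) \<star> act ?A X \<star> J ((RUn C ?A)\<dagger>))"
    by (simp add: act_Cmp act_J J_comp RUn_dag_TOb)
  also have "\<dots> = J (Ev C ?b) \<star> act ?B g \<star> act ?B (flat f)"
    by (simp add: inner act_Cmp)
  also have "\<dots> = mul (flat g) (flat f)"
    by (simp add: mul_def) (simp add: flat_def J_comp_head J_Idn)
  finally show ?thesis by (simp add: X_def)
qed

text \<open>
  The pairing of \<open>phi C c\<close> is \<open>(Coev C c)\<dagger>\<close>; hence bending \<open>u\<close> back along \<open>phi\<close> uses the dagger of the same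
  arrow \<open>Coev C c\<close> that enters \<open>sharp\<close>. It links the involutivity
  of the star to that of the dagger.
\<close>

lemma flat_phi:
  assumes [simp]: "c \<in> Obj C" "arr K u" "src K u = Unt C" "tgt K u = Cj C c"
  shows "flat u \<star> J (phi C c) = J ((Coev C c)\<dagger>) \<star> act c u \<star> J ((RUn C c)\<dagger>)"
proof -
  let ?A = "Cj C c" and ?I = "Unt C"
  let ?D = "Cj C ?A"
  have "(RUn C ?D)\<dagger> \<cdot> phi C c = (phi C c \<otimes>\<^sub>a Idn C ?I) \<cdot> (RUn C c)\<dagger>"
    using RUn_dag_nat[of "phi C c" c ?D] by simp
  then have "flat u \<star> J (phi C c) = J (Ev C ?A) \<star> (act ?D u \<star> J (phi C c \<otimes>\<^sub>a Idn C ?I)) \<star> J ((RUn C c)\<dagger>)"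
    by (simp add: flat_def J_comp)
  also have "act ?D u \<star> J (phi C c \<otimes>\<^sub>a Idn C ?I) = J (phi C c \<otimes>\<^sub>a Idn C ?A) \<star> act c u"
    using J_act[of "phi C c" u] by simp
  also have "J (Ev C ?A) \<star> (J (phi C c \<otimes>\<^sub>a Idn C ?A) \<star> act c u) \<star> J ((RUn C c)\<dagger>)
      = J (Ev C ?A \<cdot> (phi C c \<otimes>\<^sub>a Idn C ?A)) \<star> act c u \<star> J ((RUn C c)\<dagger>)"
    by (simp add: J_Cmp)
  finally show ?thesis by (simp add: Ev_phi)
qed

lemma flat_linear:
  assumes [simp]: "c \<in> Obj C"
  shows "linear_map (hom_space K (Unt C) c) (hom_space K (Cj C c) (Unt C)) flat"
proof (rule semilinear_map_cong)
  let ?A = "Cj C c" and ?I = "Unt C"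
  have 1: "linear_map (hom_space K ?I c) (hom_space K (?A \<otimes>\<^sub>o ?I) (?A \<otimes>\<^sub>o c)) (act ?A)"
    by (intro act_linear) simp_all
  have 2: "linear_map (hom_space K (?A \<otimes>\<^sub>o ?I) (?A \<otimes>\<^sub>o c)) (hom_space K ?A (?A \<otimes>\<^sub>o c)) (\<lambda>g. g \<star> J ((RUn C ?A)\<dagger>))"
    using K.comp_right_linear[of "J ((RUn C ?A)\<dagger>)" "?A \<otimes>\<^sub>o c"] by simp
  have 3: "linear_map (hom_space K ?A (?A \<otimes>\<^sub>o c)) (hom_space K ?A ?I) (\<lambda>f. J (Ev C c) \<star> f)"
    using K.comp_left_linear[of "J (Ev C c)" ?A] by simp
  show "linear_map (hom_space K ?I c) (hom_space K ?A ?I) (\<lambda>h. J (Ev C c) \<star> (act ?A h \<star> J ((RUn C ?A)\<dagger>)))"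
    by (rule linear_map_comp[OF linear_map_comp[OF 1 2] 3])
  show "cvector_space (hom_space K ?I c)" using K.hom_vector_space by simp
  show "J (Ev C c) \<star> (act ?A h \<star> J ((RUn C ?A)\<dagger>)) = flat h" if "h \<in> carrier (hom_space K ?I c)" for h
    using that by (simp add: hom_space_def Hom_K_iff flat_def)
qed

lemma sharp_linear:
  assumes [simp]: "c \<in> Obj C"
  shows "linear_map (hom_space K (Cj C c) (Unt C)) (hom_space K (Unt C) c) (sharp c)"
proof -
  let ?A = "Cj C c" and ?I = "Unt C"
  have 1: "linear_map (hom_space K ?A ?I) (hom_space K (c \<otimes>\<^sub>o ?A) (c \<otimes>\<^sub>o ?I)) (act c)"
    by (intro act_linear) simp_all
  have 2: "linear_map (hom_space K (c \<otimes>\<^sub>o ?A) (c \<otimes>\<^sub>o ?I)) (hom_space K ?I (c \<otimes>\<^sub>o ?I)) (\<lambda>g. g \<star> J (Coev C c))"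
    using K.comp_right_linear[of "J (Coev C c)" "c \<otimes>\<^sub>o ?I"] by simp
  have 3: "linear_map (hom_space K ?I (c \<otimes>\<^sub>o ?I)) (hom_space K ?I c) (\<lambda>f. J (RUn C c) \<star> f)"
    using K.comp_left_linear[of "J (RUn C c)" ?I] by simp
  show ?thesis using linear_map_comp[OF linear_map_comp[OF 1 2] 3] by (simp add: sharp_def[abs_def])
qed

end

text \<open>
  The category \<open>K\<close> with arrows reversed and the conjugate linear structure. The dagger of \<open>C\<close> makes
  it an orbit category again, and a dagger on \<open>K\<close> is an orbit functor from \<open>K\<close> to it that squares to the
  identity.
\<close>

definition conj_op :: "('o, 'y, 'w) lin_cat_scheme \<Rightarrow> ('o, 'y) lin_cat" where
  "conj_op K = \<lparr>Obj = Obj K, Hom = (\<lambda>a b. Hom K b a), Idn = Idn K, Cmp = (\<lambda>g f. f \<cdot>\<^bsub>K\<^esub> g),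
     HZero = (\<lambda>a b. HZero K b a), HAdd = HAdd K, HScale = (\<lambda>z. HScale K (cnj z))\<rparr>"

lemma conj_op_simps [simp]:
  "Obj (conj_op K) = Obj K" "Hom (conj_op K) a b = Hom K b a" "Idn (conj_op K) = Idn K"
  "g \<cdot>\<^bsub>conj_op K\<^esub> f = f \<cdot>\<^bsub>K\<^esub> g" "arr (conj_op K) = arr K" "src (conj_op K) = tgt K" "tgt (conj_op K) = src K"
  by (auto simp: conj_op_def arr_def src_def tgt_def fun_eq_iff)

lemma all_cnj: "(\<forall>z. P (cnj z)) \<longleftrightarrow> (\<forall>z. P z)"
  by (metis complex_cnj_cnj)

lemma semilinear_conj_op:
  "linear_map V (hom_space (conj_op K) a b) f \<longleftrightarrow> conj_linear_map V (hom_space K b a) f"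
  "linear_map (hom_space (conj_op K) a b) W g \<longleftrightarrow> conj_linear_map (hom_space K b a) W g"
  "conj_linear_map (hom_space (conj_op K) a b) W g \<longleftrightarrow> linear_map (hom_space K b a) W g"
proof -
  show "linear_map V (hom_space (conj_op K) a b) f \<longleftrightarrow> conj_linear_map V (hom_space K b a) f"
    by (simp add: semilinear_map_def hom_space_def conj_op_def)
  have "(\<forall>z. \<forall>x\<in>Hom K b a. g (HScale K (cnj z) x) = z \<odot>\<^bsub>W\<^esub> g x) \<longleftrightarrow>
    (\<forall>z. \<forall>x\<in>Hom K b a. g (HScale K z x) = cnj z \<odot>\<^bsub>W\<^esub> g x)"
    using all_cnj[of "\<lambda>z. \<forall>x\<in>Hom K b a. g (HScale K z x) = cnj z \<odot>\<^bsub>W\<^esub> g x"] by simp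
  then show "linear_map (hom_space (conj_op K) a b) W g \<longleftrightarrow> conj_linear_map (hom_space K b a) W g"
    by (simp add: semilinear_map_def hom_space_def conj_op_def)
  have "(\<forall>z. \<forall>x\<in>Hom K b a. g (HScale K (cnj z) x) = cnj z \<odot>\<^bsub>W\<^esub> g x) \<longleftrightarrow>
    (\<forall>z. \<forall>x\<in>Hom K b a. g (HScale K z x) = z \<odot>\<^bsub>W\<^esub> g x)"
    using all_cnj[of "\<lambda>z. \<forall>x\<in>Hom K b a. g (HScale K z x) = z \<odot>\<^bsub>W\<^esub> g x"] by simp
  then show "conj_linear_map (hom_space (conj_op K) a b) W g \<longleftrightarrow> linear_map (hom_space K b a) W g"
    by (simp add: semilinear_map_def hom_space_def conj_op_def)
qed

lemma (in linear_category) linear_category_conj_op: "linear_category (conj_op C)"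
proof (intro linear_category.intro linear_category_axioms.intro category.intro)
  fix a b assume ab: "a \<in> Obj (conj_op C)" "b \<in> Obj (conj_op C)"
  show "cvector_space (hom_space (conj_op C) a b)"
  proof -
    have V: "cvector_space (hom_space C b a)" using ab hom_vector_space by simp
    show ?thesis
      by (rule cvector_spaceI) (use cvector_spaceD[OF V] in \<open>simp_all add: hom_space_def conj_op_def\<close>)
  qed
next
  fix a b c assume "a \<in> Obj (conj_op C)" "b \<in> Obj (conj_op C)" "c \<in> Obj (conj_op C)"
  then show "bilinear_map (hom_space (conj_op C) b c) (hom_space (conj_op C) a b) (hom_space (conj_op C) a c)
      (\<lambda>g f. g \<cdot>\<^bsub>conj_op C\<^esub> f)"
    using Cmp_bilinear[of c b a]
    by (simp add: bilinear_map_def semilinear_conj_op) (simp add: hom_space_def)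
qed (auto simp: Idn_in Cmp_in Cmp_Idn_left Cmp_Idn_right Cmp_assoc[symmetric] dest: Hom_disjoint)

lemma (in orbit_category) orbit_category_conj_op: "orbit_category C (conj_op K) (\<lambda>f. J (f\<dagger>)) act"
proof -
  interpret op: linear_category "conj_op K" by (rule K.linear_category_conj_op)
  show ?thesis
  proof unfold_locales
    fix a b assume ab: "a \<in> Obj C" "b \<in> Obj C"
    show "linear_map (hom_space C a b) (hom_space (conj_op K) a b) (\<lambda>f. J (f\<dagger>))"
      unfolding semilinear_conj_op using conj_linear_map_comp(2)[OF Dag_conj_linear J_linear] ab by blast
  next
    fix a b c assume ab: "a \<in> Obj C" "b \<in> Obj C" "c \<in> Obj C"
    show "linear_map (hom_space (conj_op K) a b) (hom_space (conj_op K) (c \<otimes>\<^sub>o a) (c \<otimes>\<^sub>o b)) (act c)"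
      unfolding semilinear_conj_op using act_linear[of b a c] ab by simp
  next
    fix f T assume "arr C f" "arr (conj_op K) T"
    then show "J ((f \<otimes>\<^sub>a Idn C (tgt (conj_op K) T))\<dagger>) \<cdot>\<^bsub>conj_op K\<^esub> act (src C f) T
      = act (tgt C f) T \<cdot>\<^bsub>conj_op K\<^esub> J ((f \<otimes>\<^sub>a Idn C (src (conj_op K) T))\<dagger>)"
      using J_act[of "f\<dagger>" T] by simp
  next
    fix c d T assume "c \<in> Obj C" "d \<in> Obj C" "arr (conj_op K) T"
    then show "J ((Asc C c d (tgt (conj_op K) T))\<dagger>) \<cdot>\<^bsub>conj_op K\<^esub> act (c \<otimes>\<^sub>o d) T
      = act c (act d T) \<cdot>\<^bsub>conj_op K\<^esub> J ((Asc C c d (src (conj_op K) T))\<dagger>)"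
      by (simp add: act_act_dag)
  next
    fix T assume "arr (conj_op K) T"
    then show "J ((LUn C (tgt (conj_op K) T))\<dagger>) \<cdot>\<^bsub>conj_op K\<^esub> act (Unt C) T
      = T \<cdot>\<^bsub>conj_op K\<^esub> J ((LUn C (src (conj_op K) T))\<dagger>)"
      by (simp add: act_Unt_eq J_merge J_Idn)
  qed (simp_all add: J_Idn J_Cmp act_Cmp act_J)
qed

text \<open>
  What remains of the dagger of a module category on its orbit category. Compatibility with \<open>act\<close>
  expresses that the associators, by which \<open>act\<close> is conjugated, are unitary.
\<close>

locale orbit_dagger = orbit_category +
  fixes dag :: "'d \<Rightarrow> 'd"
  assumes dag_conj_linear: "\<lbrakk>a \<in> Obj C; b \<in> Obj C\<rbrakk> \<Longrightarrow> conj_linear_map (hom_space K a b) (hom_space K b a) dag"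
    and dag_dag': "arr K T \<Longrightarrow> dag (dag T) = T"
    and dag_comp': "\<lbrakk>arr K T; arr K S; tgt K T = src K S\<rbrakk> \<Longrightarrow> dag (S \<star> T) = dag T \<star> dag S"
    and dag_J: "arr C f \<Longrightarrow> dag (J f) = J (f\<dagger>)"
    and dag_act: "\<lbrakk>c \<in> Obj C; arr K T\<rbrakk> \<Longrightarrow> dag (act c T) = act c (dag T)"

text \<open>
  The *-structures on the algebra object \<open>K(_, 1)\<close>. The inverse of \<open>unit_conj\<close> is written out, and
  \<open>nu\<close> appears on the left instead of its inverse on the right.
\<close>

locale orbit_star = orbit_category +
  fixes j :: "'d \<Rightarrow> 'd"
  assumes j_conj_linear: "c \<in> Obj C \<Longrightarrow> conj_linear_map (hom_space K c (Unt C)) (hom_space K (Cj C c) (Unt C)) j"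
    and j_J: "\<lbrakk>arr K f; tgt K f = Unt C; arr C h; tgt C h = src K f\<rbrakk>
      \<Longrightarrow> j (f \<star> J h) = j f \<star> J (conj_arr C (src C h) (tgt C h) h)"
    and j_j: "\<lbrakk>arr K f; tgt K f = Unt C\<rbrakk> \<Longrightarrow> j (j f) \<star> J (phi C (src K f)) = f"
    and j_unit: "j (Idn K (Unt C)) = J (Ev C (Unt C) \<cdot> (RUn C (Cj C (Unt C)))\<dagger>)"
    and j_mul: "\<lbrakk>arr K f; tgt K f = Unt C; arr K g; tgt K g = Unt C\<rbrakk>
      \<Longrightarrow> j (mul f g) \<star> J (nu C (src K g) (src K f)) = mul (j g) (j f)"

context orbit_dagger
begin

lemma typed_dag [simp]:
  assumes "arr K T"
  shows "arr K (dag T)" "src K (dag T) = tgt K T" "tgt K (dag T) = src K T"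
  using linear_map_Hom[OF dag_conj_linear[of "src K T" "tgt K T"], of T] assms by (simp_all add: Hom_K_iff)

lemma orbit_star_flat_dag: "orbit_star C K J act (\<lambda>f. flat (dag f))"
proof unfold_locales
  fix c assume "c \<in> Obj C"
  then show "conj_linear_map (hom_space K c (Unt C)) (hom_space K (Cj C c) (Unt C)) (\<lambda>f. flat (dag f))"
    by (intro conj_linear_map_comp(2)[OF dag_conj_linear flat_linear]) simp_all
next
  fix f h assume "arr K f" "tgt K f = Unt C" "arr C h" "tgt C h = src K f"
  then show "flat (dag (f \<star> J h)) = flat (dag f) \<star> J (conj_arr C (src C h) (tgt C h) h)"
    by (simp add: dag_comp' dag_J flat_J conj_arr_def)
next
  fix f assume [simp]: "arr K f" "tgt K f = Unt C"
  let ?c = "src K f"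
  let ?u = "dag (flat (dag f))"
  have "flat ?u \<star> J (phi C ?c) = dag (dag (J ((Coev C ?c)\<dagger>) \<star> act ?c ?u \<star> J ((RUn C ?c)\<dagger>)))"
    by (simp add: flat_phi dag_dag')
  also have "dag (J ((Coev C ?c)\<dagger>) \<star> act ?c ?u \<star> J ((RUn C ?c)\<dagger>)) = sharp ?c (flat (dag f))"
    by (simp add: dag_comp' dag_J dag_act dag_dag' sharp_def)
  also have "\<dots> = dag f"
    using sharp_flat[of "dag f"] by simp
  finally show "flat ?u \<star> J (phi C ?c) = f" by (simp add: dag_dag')
next
  have "dag (Idn K (Unt C)) = Idn K (Unt C)"
    using dag_J[of "Idn C (Unt C)"] by (simp add: J_Idn)
  then show "flat (dag (Idn K (Unt C))) = J (Ev C (Unt C) \<cdot> (RUn C (Cj C (Unt C)))\<dagger>)"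
    by (simp add: flat_unit)
next
  fix f g assume [simp]: "arr K f" "tgt K f = Unt C" "arr K g" "tgt K g = Unt C"
  show "flat (dag (mul f g)) \<star> J (nu C (src K g) (src K f)) = mul (flat (dag g)) (flat (dag f))"
    using flat_mul[of "dag f" "dag g"] by (simp add: mul_def[of f g] dag_comp' dag_J dag_act)
qed

lemma dag_eq_sharp: "\<lbrakk>arr K f; tgt K f = Unt C\<rbrakk> \<Longrightarrow> dag f = sharp (src K f) (flat (dag f))"
  using sharp_flat[of "dag f"] by simp

lemma dag_unhat:
  assumes "a \<in> Obj C" "b \<in> Obj C" "arr K F" "src K F = Cj C b \<otimes>\<^sub>o a" "tgt K F = Unt C"
  shows "dag (unhat a b F) = J ((eta b a)\<dagger>) \<star> act b (dag F) \<star> J ((RUn C b)\<dagger>)"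
  using assms by (simp add: unhat_def dag_comp' dag_J dag_act)

end

context orbit_star
begin

lemma typed_j [simp]:
  assumes "arr K f" "tgt K f = Unt C"
  shows "arr K (j f)" "src K (j f) = Cj C (src K f)" "tgt K (j f) = Unt C"
  using linear_map_Hom[OF j_conj_linear[of "src K f"], of f] assms by (simp_all add: Hom_K_iff)

interpretation op: orbit_category C "conj_op K" "\<lambda>f. J (f\<dagger>)" act
  by (rule orbit_category_conj_op)

text \<open>
  The axioms of a star other than \<open>j_j\<close> say that \<open>f \<mapsto> sharp (j f)\<close> is a map of algebra objects from \<open>K(_, 1)\<close> to that of
  \<open>conj_op K\<close>; the corresponding orbit functor is the dagger. Since \<open>flat\<close> is injective, the axioms
  are compared after bending.
\<close>

lemma orbit_algebra_map_sharp_j: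
  "orbit_algebra_map C K J act (conj_op K) (\<lambda>f. J (f\<dagger>)) act (\<lambda>f. sharp (src K f) (j f))"
proof unfold_locales
  fix c assume c: "c \<in> Obj C"
  have "conj_linear_map (hom_space K c (Unt C)) (hom_space K (Unt C) c) (\<lambda>f. sharp c (j f))"
    using conj_linear_map_comp(2)[OF j_conj_linear sharp_linear] c by blast
  then have "conj_linear_map (hom_space K c (Unt C)) (hom_space K (Unt C) c) (\<lambda>f. sharp (src K f) (j f))"
    by (rule semilinear_map_cong) (use c K.hom_vector_space in \<open>auto simp: hom_space_def Hom_K_iff\<close>)
  then show "linear_map (hom_space K c (Unt C)) (hom_space (conj_op K) c (Unt C)) (\<lambda>f. sharp (src K f) (j f))"
    by (simp add: semilinear_conj_op)
next
  fix f h assume [simp]: "arr K f" "tgt K f = Unt C" "arr C h" "tgt C h = src K f"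
  show "sharp (src K (f \<star> J h)) (j (f \<star> J h)) = sharp (src K f) (j f) \<cdot>\<^bsub>conj_op K\<^esub> J (h\<dagger>)"
    by (rule flat_inj) (simp_all add: flat_sharp flat_J j_J conj_arr_def)
next
  fix f g assume [simp]: "arr K f" "tgt K f = Unt C" "arr K g" "tgt K g = Unt C"
  let ?a = "src K f" and ?b = "src K g"
  obtain m where m: "mutually_inverse C (Cj C ?b \<otimes>\<^sub>o Cj C ?a) (Cj C (?a \<otimes>\<^sub>o ?b)) (nu C ?b ?a) m"
    using nu_invertible[of ?a ?b] by auto
  have "sharp (src K (mul f g)) (j (mul f g)) = act ?a (sharp ?b (j g)) \<star> J ((RUn C ?a)\<dagger>) \<star> sharp ?a (j f)"
    (is "?l = ?r")
  proof (rule flat_inj)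
    show "flat ?l = flat ?r"
    proof (rule K.epi_cancel[of _ "J (nu C ?b ?a)" _ "J m"])
      show "flat ?l \<star> J (nu C ?b ?a) = flat ?r \<star> J (nu C ?b ?a)"
        using flat_mul[of "sharp ?a (j f)" "sharp ?b (j g)"] by (simp add: flat_sharp j_mul)
    qed (use m in \<open>simp_all add: mutually_inverse_iff J_comp J_Idn\<close>)
  qed simp_all
  then show "sharp (src K (mul f g)) (j (mul f g)) = op.mul (sharp ?a (j f)) (sharp ?b (j g))"
    by (simp add: op.mul_def)
next
  have "sharp (Unt C) (j (Idn K (Unt C))) = Idn K (Unt C)"
  proof (rule flat_inj)
    show "flat (sharp (Unt C) (j (Idn K (Unt C)))) = flat (Idn K (Unt C))"
      by (simp add: flat_sharp j_unit flat_unit)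
  qed simp_all
  then show "sharp (src K (Idn K (Unt C))) (j (Idn K (Unt C))) = Idn (conj_op K) (Unt C)" by simp
qed

interpretation sj: orbit_algebra_map C K J act "conj_op K" "\<lambda>f. J (f\<dagger>)" act "\<lambda>f. sharp (src K f) (j f)"
  by (rule orbit_algebra_map_sharp_j)

definition dagger :: "'d \<Rightarrow> 'd" where
  "dagger = sj.extension"

lemma dagger_restricts: "\<lbrakk>arr K f; tgt K f = Unt C\<rbrakk> \<Longrightarrow> dagger f = sharp (src K f) (j f)"
  unfolding dagger_def by (rule sj.extension_restricts)

lemma dagger_rules:
  "arr K T \<Longrightarrow> arr K (dagger T)" "arr K T \<Longrightarrow> src K (dagger T) = tgt K T" "arr K T \<Longrightarrow> tgt K (dagger T) = src K T"
  "\<lbrakk>arr K T; arr K S; tgt K T = src K S\<rbrakk> \<Longrightarrow> dagger (S \<star> T) = dagger T \<star> dagger S"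
  "arr C f \<Longrightarrow> dagger (J f) = J (f\<dagger>)"
  "\<lbrakk>c \<in> Obj C; arr K T\<rbrakk> \<Longrightarrow> dagger (act c T) = act c (dagger T)"
  using sj.typed_extension[of T] sj.extension_comp[of T S] sj.extension_J[of f] sj.extension_act[of c T]
  by (simp_all add: dagger_def)

lemma dagger_dagger_unit:
  assumes [simp]: "arr K f" "tgt K f = Unt C"
  shows "dagger (dagger f) = f"
proof -
  let ?c = "src K f"
  have "dagger (dagger f) = J ((Coev C ?c)\<dagger>) \<star> act ?c (dagger (j f)) \<star> J ((RUn C ?c)\<dagger>)"
    by (simp add: dagger_restricts[of f] sharp_def dagger_rules)
  also have "\<dots> = flat (sharp (Cj C ?c) (j (j f))) \<star> J (phi C ?c)"
    by (simp add: flat_phi dagger_restricts)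
  also have "\<dots> = f" by (simp add: flat_sharp j_j)
  finally show ?thesis .
qed

lemma orbit_dagger_dagger: "orbit_dagger C K J act dagger"
proof unfold_locales
  fix a b assume "a \<in> Obj C" "b \<in> Obj C"
  then show "conj_linear_map (hom_space K a b) (hom_space K b a) dagger"
    using sj.extension_linear[of a b] by (simp add: semilinear_conj_op dagger_def)
next
  fix T assume [simp]: "arr K T"
  let ?a = "src K T" and ?b = "tgt K T"
  have "dagger (dagger T) = dagger (dagger (unhat ?a ?b (hat T)))" by (simp add: unhat_hat)
  also have "\<dots> = unhat ?a ?b (dagger (dagger (hat T)))"
    by (simp add: unhat_def dagger_rules)
  also have "\<dots> = T" by (simp add: dagger_dagger_unit unhat_hat)
  finally show "dagger (dagger T) = T" .
qed (simp_all add: dagger_rules)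

lemma flat_dagger: "\<lbrakk>arr K f; tgt K f = Unt C\<rbrakk> \<Longrightarrow> flat (dagger f) = j f"
  by (simp add: dagger_restricts flat_sharp)

end

text \<open>
  On an arrow \<open>f\<close> to the unit the dagger is recovered from the star as \<open>sharp (flat (dag f))\<close>, and every
  arrow is an unbent arrow to the unit. Orbit functors commute with all of these constructions.
\<close>

lemma (in orbit_functor) Theta_dag:
  assumes "orbit_dagger C K J act dag" "orbit_dagger C L J' act' dag'"
    and star: "\<And>f. \<lbrakk>arr K f; tgt K f = Unt C\<rbrakk> \<Longrightarrow> \<Theta> (K.flat (dag f)) = L.flat (dag' (\<Theta> f))"
    and [simp]: "arr K T"
  shows "\<Theta> (dag T) = dag' (\<Theta> T)"
proof -
  interpret D: orbit_dagger C K J act dag by fact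
  interpret D': orbit_dagger C L J' act' dag' by fact
  have unit: "\<Theta> (dag f) = dag' (\<Theta> f)" if [simp]: "arr K f" "tgt K f = Unt C" for f
  proof -
    let ?c = "src K f"
    have "\<Theta> (dag f) = \<Theta> (K.sharp ?c (K.flat (dag f)))" using D.dag_eq_sharp[of f] by simp
    also have "\<dots> = L.sharp ?c (L.flat (dag' (\<Theta> f)))"
      unfolding star[OF that, symmetric] by (simp add: K.sharp_def L.sharp_def Theta_comp Theta_J Theta_act)
    also have "\<dots> = dag' (\<Theta> f)" using D'.dag_eq_sharp[of "\<Theta> f"] by simp
    finally show ?thesis .
  qed
  let ?a = "src K T" and ?b = "tgt K T"
  have "\<Theta> (dag T) = \<Theta> (dag (K.unhat ?a ?b (K.hat T)))" by (simp add: K.unhat_hat)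
  also have "\<dots> = J' ((K.eta ?b ?a)\<dagger>) \<cdot>\<^bsub>L\<^esub> act' ?b (dag' (\<Theta> (K.hat T))) \<cdot>\<^bsub>L\<^esub> J' ((RUn C ?b)\<dagger>)"
    by (simp add: D.dag_unhat Theta_comp Theta_J Theta_act unit)
  also have "\<Theta> (K.hat T) = L.hat (\<Theta> T)"
    by (simp add: K.hat_def L.hat_def Theta_comp Theta_J Theta_act)
  also have "J' ((K.eta ?b ?a)\<dagger>) \<cdot>\<^bsub>L\<^esub> act' ?b (dag' (L.hat (\<Theta> T))) \<cdot>\<^bsub>L\<^esub> J' ((RUn C ?b)\<dagger>)
      = dag' (L.unhat ?a ?b (L.hat (\<Theta> T)))"
    by (simp add: D'.dag_unhat)
  also have "\<dots> = dag' (\<Theta> T)" using L.unhat_hat[of "\<Theta> T"] by simp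
  finally show ?thesis .
qed

section \<open>The orbit category of an algebra object\<close>

locale rigid_algebra = rigid_cstar_tensor_category C + algebra_object C A
  for C :: "('o, 'a, 'z) rigid_cat_scheme" (structure)
    and A :: "('o, 'a, 'v, 'w) alg_object_scheme"
begin

lemma VAr_closed [simp]:
  assumes "arr C h" "src C h = a" "x \<in> carrier (VOb A (tgt C h))"
  shows "VAr A h x \<in> carrier (VOb A a)"
  using VAr_bilinear[of "src C h" "tgt C h"] arr_in_Hom[of h] assms
  by (auto simp: bilinear_map_def semilinear_map_def hom_space_def)

lemma VAr_VAr [simp]:
  "\<lbrakk>arr C f; arr C g; tgt C f = src C g; x \<in> carrier (VOb A (tgt C g))\<rbrakk>
    \<Longrightarrow> VAr A f (VAr A g x) = VAr A (g \<cdot> f) x"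
  using VAr_Cmp[of "src C f" "src C g" "tgt C g" f g x] arr_in_Hom[of f] arr_in_Hom[of g] by simp

lemma VAr_Id [simp]: "\<lbrakk>a \<in> Obj C; x \<in> carrier (VOb A a)\<rbrakk> \<Longrightarrow> VAr A (Idn C a) x = x"
  by (rule VAr_Idn)

lemma AMul_closed [simp]:
  "\<lbrakk>a \<in> Obj C; b \<in> Obj C; x \<in> carrier (VOb A a); y \<in> carrier (VOb A b)\<rbrakk>
    \<Longrightarrow> AMul A a b x y \<in> carrier (VOb A (a \<otimes>\<^sub>o b))"
  using AMul_bilinear[of a b] by (auto simp: bilinear_map_def semilinear_map_def)

lemma AUnit_closed [simp]: "AUnit A \<in> carrier (VOb A (Unt C))"
  by (rule AUnit_in)

lemma VAr_linear: "arr C h \<Longrightarrow> linear_map (VOb A (tgt C h)) (VOb A (src C h)) (VAr A h)"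
  using VAr_bilinear[of "src C h" "tgt C h"] arr_in_Hom[of h]
  by (auto simp: bilinear_map_def hom_space_def)

lemma AMul_VAr_left:
  "\<lbrakk>arr C f; b \<in> Obj C; x \<in> carrier (VOb A (tgt C f)); y \<in> carrier (VOb A b); src C f = a\<rbrakk>
    \<Longrightarrow> AMul A a b (VAr A f x) y = VAr A (f \<otimes>\<^sub>a Idn C b) (AMul A (tgt C f) b x y)"
  using AMul_natural[of "tgt C f" b "src C f" b f "Idn C b" x y] arr_in_Hom[of f] Idn_in[of b] by simp

lemma AMul_VAr_right:
  "\<lbrakk>arr C f; a \<in> Obj C; x \<in> carrier (VOb A a); y \<in> carrier (VOb A (tgt C f)); src C f = b\<rbrakk>
    \<Longrightarrow> AMul A a b x (VAr A f y) = VAr A (Idn C a \<otimes>\<^sub>a f) (AMul A a (tgt C f) x y)"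
  using AMul_natural[of a "tgt C f" a "src C f" "Idn C a" f x y] arr_in_Hom[of f] Idn_in[of a] by simp

lemma VOb_space: "a \<in> Obj C \<Longrightarrow> cvector_space (VOb A a)"
  by (rule VOb_vector_space)

text \<open>
  The arrows \<open>a \<rightarrow> b\<close> of the free module category on \<open>A\<close> are the \<open>A\<close>-linear maps between the free
  \<open>A\<close>-modules on \<open>b\<close> and \<open>a\<close>, that is, the families \<open>A(x \<otimes> b) \<rightarrow> A(x \<otimes> a)\<close> natural in \<open>x\<close> that commute
  with multiplication from the left. They compose as functions, which makes the category axioms immediate.
\<close>

definition operator :: "'o \<Rightarrow> 'o \<Rightarrow> ('o \<Rightarrow> 'v \<Rightarrow> 'v) \<Rightarrow> bool" where
  "operator a b F \<longleftrightarrow> (\<forall>x\<in>Obj C. linear_map (VOb A (x \<otimes>\<^sub>o b)) (VOb A (x \<otimes>\<^sub>o a)) (F x)) \<and>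
    (\<forall>h w. arr C h \<longrightarrow> w \<in> carrier (VOb A (tgt C h \<otimes>\<^sub>o b)) \<longrightarrow>
       F (src C h) (VAr A (h \<otimes>\<^sub>a Idn C b) w) = VAr A (h \<otimes>\<^sub>a Idn C a) (F (tgt C h) w)) \<and>
    (\<forall>x\<in>Obj C. \<forall>y\<in>Obj C. \<forall>u\<in>carrier (VOb A y). \<forall>w\<in>carrier (VOb A (x \<otimes>\<^sub>o b)).
       F (y \<otimes>\<^sub>o x) (VAr A (Asc C y x b) (AMul A y (x \<otimes>\<^sub>o b) u w)) = VAr A (Asc C y x a) (AMul A y (x \<otimes>\<^sub>o a) u (F x w)))"

definition mk_operator :: "'o \<Rightarrow> 'o \<Rightarrow> ('o \<Rightarrow> 'v \<Rightarrow> 'v) \<Rightarrow> 'o \<times> 'o \<times> ('o \<Rightarrow> 'v \<Rightarrow> 'v)" where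
  "mk_operator a b F = (a, b, \<lambda>x\<in>Obj C. \<lambda>w\<in>carrier (VOb A (x \<otimes>\<^sub>o b)). F x w)"

abbreviation app :: "'o \<times> 'o \<times> ('o \<Rightarrow> 'v \<Rightarrow> 'v) \<Rightarrow> 'o \<Rightarrow> 'v \<Rightarrow> 'v" where
  "app T \<equiv> snd (snd T)"

definition op_cat :: "('o, 'o \<times> 'o \<times> ('o \<Rightarrow> 'v \<Rightarrow> 'v)) lin_cat" where
  "op_cat = \<lparr>Obj = Obj C, Hom = (\<lambda>a b. {mk_operator a b F |F. operator a b F}),
     Idn = (\<lambda>a. mk_operator a a (\<lambda>x w. w)),
     Cmp = (\<lambda>S T. mk_operator (fst T) (fst (snd S)) (\<lambda>x w. app T x (app S x w))),
     HZero = (\<lambda>a b. mk_operator a b (\<lambda>x w. \<zero>\<^bsub>VOb A (x \<otimes>\<^sub>o a)\<^esub>)),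
     HAdd = (\<lambda>S T. mk_operator (fst S) (fst (snd S)) (\<lambda>x w. app S x w \<oplus>\<^bsub>VOb A (x \<otimes>\<^sub>o fst S)\<^esub> app T x w)),
     HScale = (\<lambda>z T. mk_operator (fst T) (fst (snd T)) (\<lambda>x w. z \<odot>\<^bsub>VOb A (x \<otimes>\<^sub>o fst T)\<^esub> app T x w))\<rparr>"

definition op_J :: "'a \<Rightarrow> 'o \<times> 'o \<times> ('o \<Rightarrow> 'v \<Rightarrow> 'v)" where
  "op_J f = mk_operator (src C f) (tgt C f) (\<lambda>x. VAr A (Idn C x \<otimes>\<^sub>a f))"

definition op_act :: "'o \<Rightarrow> 'o \<times> 'o \<times> ('o \<Rightarrow> 'v \<Rightarrow> 'v) \<Rightarrow> 'o \<times> 'o \<times> ('o \<Rightarrow> 'v \<Rightarrow> 'v)" where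
  "op_act c T = mk_operator (c \<otimes>\<^sub>o fst T) (c \<otimes>\<^sub>o fst (snd T))
     (\<lambda>x w. VAr A ((Asc C x c (fst T))\<dagger>) (app T (x \<otimes>\<^sub>o c) (VAr A (Asc C x c (fst (snd T))) w)))"

lemma mk_operator_simps [simp]:
  "fst (mk_operator a b F) = a" "fst (snd (mk_operator a b F)) = b"
  "\<lbrakk>x \<in> Obj C; w \<in> carrier (VOb A (x \<otimes>\<^sub>o b))\<rbrakk> \<Longrightarrow> app (mk_operator a b F) x w = F x w"
  by (simp_all add: mk_operator_def)

lemma mk_operator_cong:
  "\<lbrakk>a = a'; b = b'; \<And>x w. \<lbrakk>x \<in> Obj C; w \<in> carrier (VOb A (x \<otimes>\<^sub>o b'))\<rbrakk> \<Longrightarrow> F x w = G x w\<rbrakk>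
    \<Longrightarrow> mk_operator a b F = mk_operator a' b' G"
  by (auto simp: mk_operator_def restrict_def fun_eq_iff)

lemma op_cat_simps [simp]:
  "Obj op_cat = Obj C" "Hom op_cat a b = {mk_operator a b F |F. operator a b F}"
  "Idn op_cat a = mk_operator a a (\<lambda>x w. w)"
  "S \<cdot>\<^bsub>op_cat\<^esub> T = mk_operator (fst T) (fst (snd S)) (\<lambda>x w. app T x (app S x w))"
  by (simp_all add: op_cat_def)

lemma operatorD:
  assumes "operator a b F"
  shows "x \<in> Obj C \<Longrightarrow> linear_map (VOb A (x \<otimes>\<^sub>o b)) (VOb A (x \<otimes>\<^sub>o a)) (F x)"
    and "\<lbrakk>x \<in> Obj C; w \<in> carrier (VOb A (x \<otimes>\<^sub>o b))\<rbrakk> \<Longrightarrow> F x w \<in> carrier (VOb A (x \<otimes>\<^sub>o a))"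
    and "\<lbrakk>arr C h; w \<in> carrier (VOb A (tgt C h \<otimes>\<^sub>o b))\<rbrakk> \<Longrightarrow>
      F (src C h) (VAr A (h \<otimes>\<^sub>a Idn C b) w) = VAr A (h \<otimes>\<^sub>a Idn C a) (F (tgt C h) w)"
    and "\<lbrakk>x \<in> Obj C; y \<in> Obj C; u \<in> carrier (VOb A y); w \<in> carrier (VOb A (x \<otimes>\<^sub>o b))\<rbrakk> \<Longrightarrow>
      F (y \<otimes>\<^sub>o x) (VAr A (Asc C y x b) (AMul A y (x \<otimes>\<^sub>o b) u w)) = VAr A (Asc C y x a) (AMul A y (x \<otimes>\<^sub>o a) u (F x w))"
  using assms by (auto simp: operator_def semilinear_map_def)

lemma operator_id: "a \<in> Obj C \<Longrightarrow> operator a a (\<lambda>x w. w)"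
  by (simp add: operator_def semilinear_map_def)

lemma operator_comp:
  assumes F: "operator a b F" and G: "operator b c G" and "a \<in> Obj C" "b \<in> Obj C" "c \<in> Obj C"
  shows "operator a c (\<lambda>x w. F x (G x w))"
  unfolding operator_def
proof (intro conjI ballI allI impI)
  fix x assume "x \<in> Obj C"
  then show "linear_map (VOb A (x \<otimes>\<^sub>o c)) (VOb A (x \<otimes>\<^sub>o a)) (\<lambda>w. F x (G x w))"
    by (intro linear_map_comp[OF operatorD(1)[OF G] operatorD(1)[OF F]])
qed (use assms(3-) in \<open>simp_all add: operatorD(2-)[OF F] operatorD(2-)[OF G]\<close>)

lemma AMul_linear_right: "\<lbrakk>a \<in> Obj C; b \<in> Obj C; u \<in> carrier (VOb A a)\<rbrakk> \<Longrightarrow> linear_map (VOb A b) (VOb A (a \<otimes>\<^sub>o b)) (AMul A a b u)"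
  using AMul_bilinear[of a b] by (simp add: bilinear_map_def)

lemma AMul_linear_left: "\<lbrakk>a \<in> Obj C; b \<in> Obj C; u \<in> carrier (VOb A b)\<rbrakk> \<Longrightarrow> linear_map (VOb A a) (VOb A (a \<otimes>\<^sub>o b)) (\<lambda>w. AMul A a b w u)"
  using AMul_bilinear[of a b] by (simp add: bilinear_map_def)

lemma operator_zero:
  assumes [simp]: "a \<in> Obj C" "b \<in> Obj C"
  shows "operator a b (\<lambda>x w. \<zero>\<^bsub>VOb A (x \<otimes>\<^sub>o a)\<^esub>)"
  unfolding operator_def
proof (intro conjI ballI allI impI)
  fix h w assume "arr C h"
  then show "\<zero>\<^bsub>VOb A (src C h \<otimes>\<^sub>o a)\<^esub> = VAr A (h \<otimes>\<^sub>a Idn C a) \<zero>\<^bsub>VOb A (tgt C h \<otimes>\<^sub>o a)\<^esub>"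
    using linear_preserves_zero[OF VAr_linear[of "h \<otimes>\<^sub>a Idn C a"]] VOb_space by simp
next
  fix x y u assume "x \<in> Obj C" "y \<in> Obj C" "u \<in> carrier (VOb A y)"
  then show "\<zero>\<^bsub>VOb A ((y \<otimes>\<^sub>o x) \<otimes>\<^sub>o a)\<^esub> = VAr A (Asc C y x a) (AMul A y (x \<otimes>\<^sub>o a) u \<zero>\<^bsub>VOb A (x \<otimes>\<^sub>o a)\<^esub>)"
    using linear_preserves_zero[OF VAr_linear[of "Asc C y x a"]]
      linear_preserves_zero[OF AMul_linear_right[of y "x \<otimes>\<^sub>o a" u]] VOb_space by simp
qed (simp_all add: linear_zero VOb_space)

lemma operator_add:
  assumes F: "operator a b F" and G: "operator a b G" and [simp]: "a \<in> Obj C" "b \<in> Obj C"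
  shows "operator a b (\<lambda>x w. F x w \<oplus>\<^bsub>VOb A (x \<otimes>\<^sub>o a)\<^esub> G x w)"
  unfolding operator_def
proof (intro conjI ballI allI impI)
  fix x assume "x \<in> Obj C"
  then show "linear_map (VOb A (x \<otimes>\<^sub>o b)) (VOb A (x \<otimes>\<^sub>o a)) (\<lambda>w. F x w \<oplus>\<^bsub>VOb A (x \<otimes>\<^sub>o a)\<^esub> G x w)"
    using linear_add[OF operatorD(1)[OF F] operatorD(1)[OF G] VOb_space] by simp
next
  fix h w assume "arr C h" "w \<in> carrier (VOb A (tgt C h \<otimes>\<^sub>o b))"
  then show "F (src C h) (VAr A (h \<otimes>\<^sub>a Idn C b) w) \<oplus>\<^bsub>VOb A (src C h \<otimes>\<^sub>o a)\<^esub> G (src C h) (VAr A (h \<otimes>\<^sub>a Idn C b) w)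
      = VAr A (h \<otimes>\<^sub>a Idn C a) (F (tgt C h) w \<oplus>\<^bsub>VOb A (tgt C h \<otimes>\<^sub>o a)\<^esub> G (tgt C h) w)"
    using operatorD(2,3)[OF F] operatorD(2,3)[OF G] linear_mapD(2)[OF VAr_linear[of "h \<otimes>\<^sub>a Idn C a"]] by simp
next
  fix x y u w assume "x \<in> Obj C" "y \<in> Obj C" "u \<in> carrier (VOb A y)" "w \<in> carrier (VOb A (x \<otimes>\<^sub>o b))"
  then show "F (y \<otimes>\<^sub>o x) (VAr A (Asc C y x b) (AMul A y (x \<otimes>\<^sub>o b) u w)) \<oplus>\<^bsub>VOb A ((y \<otimes>\<^sub>o x) \<otimes>\<^sub>o a)\<^esub>
        G (y \<otimes>\<^sub>o x) (VAr A (Asc C y x b) (AMul A y (x \<otimes>\<^sub>o b) u w))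
      = VAr A (Asc C y x a) (AMul A y (x \<otimes>\<^sub>o a) u (F x w \<oplus>\<^bsub>VOb A (x \<otimes>\<^sub>o a)\<^esub> G x w))"
    using operatorD(2,4)[OF F] operatorD(2,4)[OF G] linear_mapD(2)[OF VAr_linear[of "Asc C y x a"]]
      linear_mapD(2)[OF AMul_linear_right[of y "x \<otimes>\<^sub>o a" u]] by simp
qed

lemma operator_scale:
  assumes F: "operator a b F" and [simp]: "a \<in> Obj C" "b \<in> Obj C"
  shows "operator a b (\<lambda>x w. z \<odot>\<^bsub>VOb A (x \<otimes>\<^sub>o a)\<^esub> F x w)"
  unfolding operator_def
proof (intro conjI ballI allI impI)
  fix x assume "x \<in> Obj C"
  then show "linear_map (VOb A (x \<otimes>\<^sub>o b)) (VOb A (x \<otimes>\<^sub>o a)) (\<lambda>w. z \<odot>\<^bsub>VOb A (x \<otimes>\<^sub>o a)\<^esub> F x w)"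
    using linear_scale[OF operatorD(1)[OF F] VOb_space] by simp
next
  fix h w assume "arr C h" "w \<in> carrier (VOb A (tgt C h \<otimes>\<^sub>o b))"
  then show "z \<odot>\<^bsub>VOb A (src C h \<otimes>\<^sub>o a)\<^esub> F (src C h) (VAr A (h \<otimes>\<^sub>a Idn C b) w)
      = VAr A (h \<otimes>\<^sub>a Idn C a) (z \<odot>\<^bsub>VOb A (tgt C h \<otimes>\<^sub>o a)\<^esub> F (tgt C h) w)"
    using operatorD(2,3)[OF F] linear_mapD(3)[OF VAr_linear[of "h \<otimes>\<^sub>a Idn C a"]] by simp
next
  fix x y u w assume "x \<in> Obj C" "y \<in> Obj C" "u \<in> carrier (VOb A y)" "w \<in> carrier (VOb A (x \<otimes>\<^sub>o b))"
  then show "z \<odot>\<^bsub>VOb A ((y \<otimes>\<^sub>o x) \<otimes>\<^sub>o a)\<^esub> F (y \<otimes>\<^sub>o x) (VAr A (Asc C y x b) (AMul A y (x \<otimes>\<^sub>o b) u w))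
      = VAr A (Asc C y x a) (AMul A y (x \<otimes>\<^sub>o a) u (z \<odot>\<^bsub>VOb A (x \<otimes>\<^sub>o a)\<^esub> F x w))"
    using operatorD(2,4)[OF F] linear_mapD(3)[OF VAr_linear[of "Asc C y x a"]]
      linear_mapD(3)[OF AMul_linear_right[of y "x \<otimes>\<^sub>o a" u]] by simp
qed

lemma operator_J:
  assumes [simp]: "arr C f"
  shows "operator (src C f) (tgt C f) (\<lambda>x. VAr A (Idn C x \<otimes>\<^sub>a f))"
  unfolding operator_def
proof (intro conjI ballI allI impI)
  fix x assume "x \<in> Obj C"
  then show "linear_map (VOb A (x \<otimes>\<^sub>o tgt C f)) (VOb A (x \<otimes>\<^sub>o src C f)) (VAr A (Idn C x \<otimes>\<^sub>a f))"
    using VAr_linear[of "Idn C x \<otimes>\<^sub>a f"] by simp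
next
  fix x y u w assume "x \<in> Obj C" "y \<in> Obj C" "u \<in> carrier (VOb A y)" "w \<in> carrier (VOb A (x \<otimes>\<^sub>o tgt C f))"
  then show "VAr A (Idn C (y \<otimes>\<^sub>o x) \<otimes>\<^sub>a f) (VAr A (Asc C y x (tgt C f)) (AMul A y (x \<otimes>\<^sub>o tgt C f) u w))
      = VAr A (Asc C y x (src C f)) (AMul A y (x \<otimes>\<^sub>o src C f) u (VAr A (Idn C x \<otimes>\<^sub>a f) w))"
    using Asc_nat[of "Idn C y" "Idn C x" f] by (simp add: AMul_VAr_right)
qed (simp add: interchange)

lemma pentagon_dag2:
  assumes [simp]: "a \<in> Obj C" "b \<in> Obj C" "c \<in> Obj C" "d \<in> Obj C"
  shows "(Idn C a \<otimes>\<^sub>a (Asc C b c d)\<dagger>) \<cdot> Asc C a b (c \<otimes>\<^sub>o d)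
    = Asc C a (b \<otimes>\<^sub>o c) d \<cdot> (Asc C a b c \<otimes>\<^sub>a Idn C d) \<cdot> (Asc C (a \<otimes>\<^sub>o b) c d)\<dagger>"
proof -
  have "(Idn C a \<otimes>\<^sub>a (Asc C b c d)\<dagger>) \<cdot> Asc C a b (c \<otimes>\<^sub>o d)
      = (Idn C a \<otimes>\<^sub>a (Asc C b c d)\<dagger>) \<cdot> (Asc C a b (c \<otimes>\<^sub>o d) \<cdot> Asc C (a \<otimes>\<^sub>o b) c d) \<cdot> (Asc C (a \<otimes>\<^sub>o b) c d)\<dagger>"
    by simp
  also have "\<dots> = Asc C a (b \<otimes>\<^sub>o c) d \<cdot> (Asc C a b c \<otimes>\<^sub>a Idn C d) \<cdot> (Asc C (a \<otimes>\<^sub>o b) c d)\<dagger>"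
    by (subst pentagon[symmetric]) (simp_all add: interchange_head)
  finally show ?thesis .
qed

lemma operator_act:
  assumes F: "operator a b F" and [simp]: "a \<in> Obj C" "b \<in> Obj C" "c \<in> Obj C"
  shows "operator (c \<otimes>\<^sub>o a) (c \<otimes>\<^sub>o b) (\<lambda>x w. VAr A ((Asc C x c a)\<dagger>) (F (x \<otimes>\<^sub>o c) (VAr A (Asc C x c b) w)))"
  unfolding operator_def
proof (intro conjI ballI allI impI)
  note [simp] = operatorD(2)[OF F]
  fix x assume [simp]: "x \<in> Obj C"
  show "linear_map (VOb A (x \<otimes>\<^sub>o c \<otimes>\<^sub>o b)) (VOb A (x \<otimes>\<^sub>o c \<otimes>\<^sub>o a)) (\<lambda>w. VAr A ((Asc C x c a)\<dagger>) (F (x \<otimes>\<^sub>o c) (VAr A (Asc C x c b) w)))"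
    using linear_map_comp[OF linear_map_comp[OF VAr_linear[of "Asc C x c b"]] VAr_linear[of "(Asc C x c a)\<dagger>"], of "F (x \<otimes>\<^sub>o c)"]
      operatorD(1)[OF F, of "x \<otimes>\<^sub>o c"] by simp
next
  note [simp] = operatorD(2)[OF F]
  fix h w assume [simp]: "arr C h" "w \<in> carrier (VOb A (tgt C h \<otimes>\<^sub>o c \<otimes>\<^sub>o b))"
  let ?x = "src C h" and ?y = "tgt C h"
  have 1: "(h \<otimes>\<^sub>a Idn C (c \<otimes>\<^sub>o b)) \<cdot> Asc C ?x c b = Asc C ?y c b \<cdot> ((h \<otimes>\<^sub>a Idn C c) \<otimes>\<^sub>a Idn C b)"
    using Asc_nat[of h "Idn C c" "Idn C b"] by simp
  have 2: "((h \<otimes>\<^sub>a Idn C c) \<otimes>\<^sub>a Idn C a) \<cdot> (Asc C ?x c a)\<dagger> = (Asc C ?y c a)\<dagger> \<cdot> (h \<otimes>\<^sub>a Idn C (c \<otimes>\<^sub>o a))"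
    using Asc_dag_nat[of h "Idn C c" "Idn C a"] by simp
  show "VAr A ((Asc C ?x c a)\<dagger>) (F (?x \<otimes>\<^sub>o c) (VAr A (Asc C ?x c b) (VAr A (h \<otimes>\<^sub>a Idn C (c \<otimes>\<^sub>o b)) w)))
    = VAr A (h \<otimes>\<^sub>a Idn C (c \<otimes>\<^sub>o a)) (VAr A ((Asc C ?y c a)\<dagger>) (F (?y \<otimes>\<^sub>o c) (VAr A (Asc C ?y c b) w)))"
    using operatorD(3)[OF F, of "h \<otimes>\<^sub>a Idn C c" "VAr A (Asc C ?y c b) w"] by (simp add: 1 2)
next
  note [simp] = operatorD(2)[OF F]
  fix x y u w assume [simp]: "x \<in> Obj C" "y \<in> Obj C" "u \<in> carrier (VOb A y)" "w \<in> carrier (VOb A (x \<otimes>\<^sub>o c \<otimes>\<^sub>o b))"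
  let ?w = "VAr A (Asc C x c b) w"
  have "F ((y \<otimes>\<^sub>o x) \<otimes>\<^sub>o c) (VAr A (Asc C y x (c \<otimes>\<^sub>o b) \<cdot> Asc C (y \<otimes>\<^sub>o x) c b) (AMul A y (x \<otimes>\<^sub>o c \<otimes>\<^sub>o b) u w))
      = F ((y \<otimes>\<^sub>o x) \<otimes>\<^sub>o c) (VAr A (Asc C y x c \<otimes>\<^sub>a Idn C b) (VAr A (Asc C y (x \<otimes>\<^sub>o c) b) (AMul A y ((x \<otimes>\<^sub>o c) \<otimes>\<^sub>o b) u ?w)))"
    by (simp add: AMul_VAr_right flip: pentagon)
  also have "\<dots> = VAr A (Asc C y x c \<otimes>\<^sub>a Idn C a) (VAr A (Asc C y (x \<otimes>\<^sub>o c) a) (AMul A y ((x \<otimes>\<^sub>o c) \<otimes>\<^sub>o a) u (F (x \<otimes>\<^sub>o c) ?w)))"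
    using operatorD(3)[OF F, of "Asc C y x c" "VAr A (Asc C y (x \<otimes>\<^sub>o c) b) (AMul A y ((x \<otimes>\<^sub>o c) \<otimes>\<^sub>o b) u ?w)"]
      operatorD(4)[OF F, of "x \<otimes>\<^sub>o c" y u ?w] by simp
  finally show "VAr A ((Asc C (y \<otimes>\<^sub>o x) c a)\<dagger>) (F ((y \<otimes>\<^sub>o x) \<otimes>\<^sub>o c) (VAr A (Asc C (y \<otimes>\<^sub>o x) c b)
       (VAr A (Asc C y x (c \<otimes>\<^sub>o b)) (AMul A y (x \<otimes>\<^sub>o c \<otimes>\<^sub>o b) u w))))
    = VAr A (Asc C y x (c \<otimes>\<^sub>o a)) (AMul A y (x \<otimes>\<^sub>o c \<otimes>\<^sub>o a) u (VAr A ((Asc C x c a)\<dagger>) (F (x \<otimes>\<^sub>o c) ?w)))"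
    by (simp add: AMul_VAr_right pentagon_dag2)
qed

lemma HomE:
  assumes "T \<in> Hom op_cat a b"
  obtains F where "operator a b F" "T = mk_operator a b F"
  using assms by auto

lemma hom_space_op_cat:
  assumes [simp]: "a \<in> Obj C" "b \<in> Obj C"
  shows "cvector_space (hom_space op_cat a b)"
proof (rule cvector_spaceI)
  let ?V = "hom_space op_cat a b"
  note vs = cvector_spaceD[OF VOb_space]
  have carrier: "carrier ?V = {mk_operator a b F |F. operator a b F}" by (simp add: hom_space_def)
  have add: "mk_operator a b F \<oplus>\<^bsub>?V\<^esub> mk_operator a b G = mk_operator a b (\<lambda>x w. F x w \<oplus>\<^bsub>VOb A (x \<otimes>\<^sub>o a)\<^esub> G x w)" for F G
    by (auto simp: hom_space_def op_cat_def intro!: mk_operator_cong)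
  have smult: "z \<odot>\<^bsub>?V\<^esub> mk_operator a b F = mk_operator a b (\<lambda>x w. z \<odot>\<^bsub>VOb A (x \<otimes>\<^sub>o a)\<^esub> F x w)" for z F
    by (auto simp: hom_space_def op_cat_def intro!: mk_operator_cong)
  have zero: "\<zero>\<^bsub>?V\<^esub> = mk_operator a b (\<lambda>x w. \<zero>\<^bsub>VOb A (x \<otimes>\<^sub>o a)\<^esub>)"
    by (simp add: hom_space_def op_cat_def)
  show "\<zero>\<^bsub>?V\<^esub> \<in> carrier ?V" by (auto simp: zero carrier intro!: exI operator_zero)
  fix S assume "S \<in> carrier ?V"
  then obtain F where F: "operator a b F" and S: "S = mk_operator a b F" by (auto simp: carrier)
  note [simp] = operatorD(2)[OF F]
  show "z \<odot>\<^bsub>?V\<^esub> S \<in> carrier ?V" for z unfolding S smult carrier using operator_scale[OF F] by auto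
  show "\<zero>\<^bsub>?V\<^esub> \<oplus>\<^bsub>?V\<^esub> S = S" unfolding S zero add by (rule mk_operator_cong) (simp_all add: vs(6))
  show "0 \<odot>\<^bsub>?V\<^esub> S = \<zero>\<^bsub>?V\<^esub>" unfolding S zero smult by (rule mk_operator_cong) (simp_all add: vs)
  show "1 \<odot>\<^bsub>?V\<^esub> S = S" unfolding S smult by (rule mk_operator_cong) (simp_all add: vs)
  show "(z + z') \<odot>\<^bsub>?V\<^esub> S = z \<odot>\<^bsub>?V\<^esub> S \<oplus>\<^bsub>?V\<^esub> z' \<odot>\<^bsub>?V\<^esub> S" for z z'
    unfolding S smult add by (rule mk_operator_cong) (simp_all add: vs)
  show "(z * z') \<odot>\<^bsub>?V\<^esub> S = z \<odot>\<^bsub>?V\<^esub> (z' \<odot>\<^bsub>?V\<^esub> S)" for z z'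
    unfolding S smult by (rule mk_operator_cong) (simp_all add: vs)
  fix T assume "T \<in> carrier ?V"
  then obtain G where G: "operator a b G" and T: "T = mk_operator a b G" by (auto simp: carrier)
  note [simp] = operatorD(2)[OF G]
  show "S \<oplus>\<^bsub>?V\<^esub> T \<in> carrier ?V" unfolding S T add carrier using operator_add[OF F G] by auto
  show "S \<oplus>\<^bsub>?V\<^esub> T = T \<oplus>\<^bsub>?V\<^esub> S" unfolding S T add by (rule mk_operator_cong) (simp_all add: vs(5))
  show "z \<odot>\<^bsub>?V\<^esub> (S \<oplus>\<^bsub>?V\<^esub> T) = z \<odot>\<^bsub>?V\<^esub> S \<oplus>\<^bsub>?V\<^esub> z \<odot>\<^bsub>?V\<^esub> T" for z
    unfolding S T add smult by (rule mk_operator_cong) (simp_all add: vs)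
  fix U assume "U \<in> carrier ?V"
  then obtain H where H: "operator a b H" and U: "U = mk_operator a b H" by (auto simp: carrier)
  note [simp] = operatorD(2)[OF H]
  show "(S \<oplus>\<^bsub>?V\<^esub> T) \<oplus>\<^bsub>?V\<^esub> U = S \<oplus>\<^bsub>?V\<^esub> (T \<oplus>\<^bsub>?V\<^esub> U)" unfolding S T U add
    by (rule mk_operator_cong) (simp_all add: vs(4))
qed

lemma HAdd_op [simp]: "HAdd op_cat (mk_operator a b F) (mk_operator a b G) = mk_operator a b (\<lambda>x w. F x w \<oplus>\<^bsub>VOb A (x \<otimes>\<^sub>o a)\<^esub> G x w)"
  by (auto simp: op_cat_def intro!: mk_operator_cong)

lemma HScale_op [simp]: "HScale op_cat z (mk_operator a b F) = mk_operator a b (\<lambda>x w. z \<odot>\<^bsub>VOb A (x \<otimes>\<^sub>o a)\<^esub> F x w)"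
  by (auto simp: op_cat_def intro!: mk_operator_cong)

lemma Cmp_op:
  assumes "operator b c G"
  shows "mk_operator b c G \<cdot>\<^bsub>op_cat\<^esub> mk_operator a b F = mk_operator a c (\<lambda>x w. F x (G x w))"
  using assms by (auto intro!: mk_operator_cong simp: operatorD(2))

lemma category_op_cat: "category op_cat"
proof (rule category.intro)
  fix a b c f g assume obj: "a \<in> Obj op_cat" "b \<in> Obj op_cat" "c \<in> Obj op_cat" and "f \<in> Hom op_cat a b" "g \<in> Hom op_cat b c"
  then obtain F G where F: "operator a b F" "f = mk_operator a b F" and G: "operator b c G" "g = mk_operator b c G"
    by auto
  show "g \<cdot>\<^bsub>op_cat\<^esub> f \<in> Hom op_cat a c"
    unfolding F(2) G(2) Cmp_op[OF G(1)] using operator_comp[OF F(1) G(1)] obj by auto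
next
  fix a b c d f g h assume obj: "a \<in> Obj op_cat" "b \<in> Obj op_cat" "c \<in> Obj op_cat" "d \<in> Obj op_cat"
    and "f \<in> Hom op_cat a b" "g \<in> Hom op_cat b c" "h \<in> Hom op_cat c d"
  then obtain F G H where F: "operator a b F" "f = mk_operator a b F" and G: "operator b c G" "g = mk_operator b c G"
    and H: "operator c d H" "h = mk_operator c d H" by auto
  show "(h \<cdot>\<^bsub>op_cat\<^esub> g) \<cdot>\<^bsub>op_cat\<^esub> f = h \<cdot>\<^bsub>op_cat\<^esub> (g \<cdot>\<^bsub>op_cat\<^esub> f)"
    unfolding F(2) G(2) H(2) using obj F G H
    by (simp add: Cmp_op operator_comp[OF G(1) H(1)] del: op_cat_simps(4))
next
  fix a assume "a \<in> Obj op_cat"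
  then show "Idn op_cat a \<in> Hom op_cat a a" using operator_id[of a] by auto
next
  fix a b f assume "a \<in> Obj op_cat" "b \<in> Obj op_cat" "f \<in> Hom op_cat a b"
  then obtain F where F: "operator a b F" "f = mk_operator a b F" and "a \<in> Obj C" "b \<in> Obj C" by auto
  then show "Idn op_cat b \<cdot>\<^bsub>op_cat\<^esub> f = f" "f \<cdot>\<^bsub>op_cat\<^esub> Idn op_cat a = f"
    by (auto intro!: mk_operator_cong simp: operatorD(2))
next
  fix a b a' b' f assume "f \<in> Hom op_cat a b" "f \<in> Hom op_cat a' b'"
  then show "a = a' \<and> b = b'" by (auto simp: mk_operator_def)
qed

lemma linear_category_op_cat: "linear_category op_cat"
proof (intro linear_category.intro linear_category_axioms.intro category_op_cat)
  fix a b assume "a \<in> Obj op_cat" "b \<in> Obj op_cat"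
  then show "cvector_space (hom_space op_cat a b)" by (simp add: hom_space_op_cat)
next
  fix a b c assume obj: "a \<in> Obj op_cat" "b \<in> Obj op_cat" "c \<in> Obj op_cat"
  show "bilinear_map (hom_space op_cat b c) (hom_space op_cat a b) (hom_space op_cat a c) (\<lambda>g f. g \<cdot>\<^bsub>op_cat\<^esub> f)"
    unfolding bilinear_map_def
  proof (intro conjI ballI)
    fix g assume "g \<in> carrier (hom_space op_cat b c)"
    then obtain G where G: "operator b c G" and g: "g = mk_operator b c G" by (auto simp: hom_space_def)
    have gH: "g \<in> Hom op_cat b c" using G g by auto
    show "linear_map (hom_space op_cat a b) (hom_space op_cat a c) (\<lambda>f. g \<cdot>\<^bsub>op_cat\<^esub> f)"
      unfolding semilinear_map_def
    proof (intro conjI ballI allI)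
      show "(\<lambda>f. g \<cdot>\<^bsub>op_cat\<^esub> f) \<in> carrier (hom_space op_cat a b) \<rightarrow> carrier (hom_space op_cat a c)"
        using category.Cmp_in[OF category_op_cat obj _ gH] by (simp add: hom_space_def Pi_iff del: op_cat_simps)
    next
      fix S T assume "S \<in> carrier (hom_space op_cat a b)" "T \<in> carrier (hom_space op_cat a b)"
      then obtain F H where F: "operator a b F" "S = mk_operator a b F" and H: "operator a b H" "T = mk_operator a b H"
        by (auto simp: hom_space_def)
      show "g \<cdot>\<^bsub>op_cat\<^esub> (S \<oplus>\<^bsub>hom_space op_cat a b\<^esub> T) = (g \<cdot>\<^bsub>op_cat\<^esub> S) \<oplus>\<^bsub>hom_space op_cat a c\<^esub> (g \<cdot>\<^bsub>op_cat\<^esub> T)"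
        unfolding F(2) H(2) g by (simp add: hom_space_def Cmp_op[OF G] del: op_cat_simps(4))
    next
      fix z S assume "S \<in> carrier (hom_space op_cat a b)"
      then obtain F where F: "operator a b F" "S = mk_operator a b F" by (auto simp: hom_space_def)
      show "g \<cdot>\<^bsub>op_cat\<^esub> (z \<odot>\<^bsub>hom_space op_cat a b\<^esub> S) = id z \<odot>\<^bsub>hom_space op_cat a c\<^esub> (g \<cdot>\<^bsub>op_cat\<^esub> S)"
        unfolding F(2) g by (simp add: hom_space_def Cmp_op[OF G] del: op_cat_simps(4))
    qed
  next
    fix f assume "f \<in> carrier (hom_space op_cat a b)"
    then obtain F where F: "operator a b F" and f: "f = mk_operator a b F" by (auto simp: hom_space_def)
    have fH: "f \<in> Hom op_cat a b" using F f by auto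
    have obj': "a \<in> Obj C" "b \<in> Obj C" "c \<in> Obj C" using obj by auto
    show "linear_map (hom_space op_cat b c) (hom_space op_cat a c) (\<lambda>g. g \<cdot>\<^bsub>op_cat\<^esub> f)"
      unfolding semilinear_map_def
    proof (intro conjI ballI allI)
      show "(\<lambda>g. g \<cdot>\<^bsub>op_cat\<^esub> f) \<in> carrier (hom_space op_cat b c) \<rightarrow> carrier (hom_space op_cat a c)"
        using category.Cmp_in[OF category_op_cat obj fH] by (simp add: hom_space_def Pi_iff del: op_cat_simps)
    next
      fix S T assume "S \<in> carrier (hom_space op_cat b c)" "T \<in> carrier (hom_space op_cat b c)"
      then obtain G H where G: "operator b c G" "S = mk_operator b c G" and H: "operator b c H" "T = mk_operator b c H"
        by (auto simp: hom_space_def)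
      show "(S \<oplus>\<^bsub>hom_space op_cat b c\<^esub> T) \<cdot>\<^bsub>op_cat\<^esub> f = (S \<cdot>\<^bsub>op_cat\<^esub> f) \<oplus>\<^bsub>hom_space op_cat a c\<^esub> (T \<cdot>\<^bsub>op_cat\<^esub> f)"
        unfolding G(2) H(2) f using obj'
        by (auto simp: hom_space_def Cmp_op[OF G(1)] Cmp_op[OF H(1)] Cmp_op[OF operator_add[OF G(1) H(1)]]
            linear_mapD(2)[OF operatorD(1)[OF F]] operatorD(2)[OF G(1)] operatorD(2)[OF H(1)]
            simp del: op_cat_simps(4) intro!: mk_operator_cong)
    next
      fix z S assume "S \<in> carrier (hom_space op_cat b c)"
      then obtain G where G: "operator b c G" "S = mk_operator b c G" by (auto simp: hom_space_def)
      show "(z \<odot>\<^bsub>hom_space op_cat b c\<^esub> S) \<cdot>\<^bsub>op_cat\<^esub> f = id z \<odot>\<^bsub>hom_space op_cat a c\<^esub> (S \<cdot>\<^bsub>op_cat\<^esub> f)"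
        unfolding G(2) f using obj'
        by (auto simp: hom_space_def Cmp_op[OF G(1)] Cmp_op[OF operator_scale[OF G(1)]]
            linear_mapD(3)[OF operatorD(1)[OF F]] operatorD(2)[OF G(1)]
            simp del: op_cat_simps(4) intro!: mk_operator_cong)
    qed
  qed
qed

lemma op_J_eq: "\<lbrakk>arr C f; src C f = a; tgt C f = b\<rbrakk> \<Longrightarrow> op_J f = mk_operator a b (\<lambda>x. VAr A (Idn C x \<otimes>\<^sub>a f))"
  by (auto simp: op_J_def)

lemma op_act_eq:
  "\<lbrakk>a \<in> Obj C; b \<in> Obj C; c \<in> Obj C\<rbrakk> \<Longrightarrow> op_act c (mk_operator a b F)
    = mk_operator (c \<otimes>\<^sub>o a) (c \<otimes>\<^sub>o b) (\<lambda>x w. VAr A ((Asc C x c a)\<dagger>) (F (x \<otimes>\<^sub>o c) (VAr A (Asc C x c b) w)))"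
  unfolding op_act_def by (rule mk_operator_cong) simp_all

lemma Cmp_op_J:
  assumes "arr C f" "tgt C f = b" "operator b c G"
  shows "mk_operator b c G \<cdot>\<^bsub>op_cat\<^esub> op_J f = mk_operator (src C f) c (\<lambda>x w. VAr A (Idn C x \<otimes>\<^sub>a f) (G x w))"
  using Cmp_op[OF assms(3)] op_J_eq[of f "src C f" b] assms by simp

lemma Cmp_J_op:
  assumes "arr C f" "src C f = b"
  shows "op_J f \<cdot>\<^bsub>op_cat\<^esub> mk_operator a b F = mk_operator a (tgt C f) (\<lambda>x w. F x (VAr A (Idn C x \<otimes>\<^sub>a f) w))"
  using Cmp_op[OF operator_J[OF assms(1)], of a F] op_J_eq[of f b "tgt C f"] assms by simp

lemma triangle_dag:
  assumes [simp]: "a \<in> Obj C" "b \<in> Obj C"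
  shows "(RUn C a \<otimes>\<^sub>a Idn C b) \<cdot> (Asc C a (Unt C) b)\<dagger> = Idn C a \<otimes>\<^sub>a LUn C b"
  by (simp flip: triangle)

lemma pentagon2:
  assumes [simp]: "x \<in> Obj C" "c \<in> Obj C" "d \<in> Obj C" "b \<in> Obj C"
  shows "(Idn C x \<otimes>\<^sub>a Asc C c d b) \<cdot> Asc C x (c \<otimes>\<^sub>o d) b = Asc C x c (d \<otimes>\<^sub>o b) \<cdot> Asc C (x \<otimes>\<^sub>o c) d b \<cdot> ((Asc C x c d)\<dagger> \<otimes>\<^sub>a Idn C b)"
proof -
  have "(Idn C x \<otimes>\<^sub>a Asc C c d b) \<cdot> Asc C x (c \<otimes>\<^sub>o d) b
    = ((Idn C x \<otimes>\<^sub>a Asc C c d b) \<cdot> Asc C x (c \<otimes>\<^sub>o d) b \<cdot> (Asc C x c d \<otimes>\<^sub>a Idn C b)) \<cdot> ((Asc C x c d)\<dagger> \<otimes>\<^sub>a Idn C b)"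
    by (simp add: interchange)
  then show ?thesis by (simp only: pentagon assms) simp
qed

lemma app_op_J_linear:
  assumes [simp]: "a \<in> Obj C" "b \<in> Obj C" "x \<in> Obj C" "w \<in> carrier (VOb A (x \<otimes>\<^sub>o b))"
  shows "linear_map (hom_space C a b) (VOb A (x \<otimes>\<^sub>o a)) (\<lambda>f. VAr A (Idn C x \<otimes>\<^sub>a f) w)"
proof -
  have 1: "linear_map (hom_space C a b) (hom_space C (x \<otimes>\<^sub>o a) (x \<otimes>\<^sub>o b)) (\<lambda>f. Idn C x \<otimes>\<^sub>a f)"
    using TAr_bilinear[of x x a b] Idn_in[of x] by (simp add: bilinear_map_def hom_space_def)
  have 2: "linear_map (hom_space C (x \<otimes>\<^sub>o a) (x \<otimes>\<^sub>o b)) (VOb A (x \<otimes>\<^sub>o a)) (\<lambda>h. VAr A h w)"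
    using VAr_bilinear[of "x \<otimes>\<^sub>o a" "x \<otimes>\<^sub>o b"] by (simp add: bilinear_map_def)
  show ?thesis by (rule linear_map_comp[OF 1 2])
qed

lemma arr_op_catE:
  assumes "arr op_cat T"
  obtains a b F where "T = mk_operator a b F" "operator a b F" "a \<in> Obj C" "b \<in> Obj C"
    "src op_cat T = a" "tgt op_cat T = b"
proof -
  interpret K: linear_category op_cat by (rule linear_category_op_cat)
  obtain F where "operator (src op_cat T) (tgt op_cat T) F" "T = mk_operator (src op_cat T) (tgt op_cat T) F"
    using K.arr_in_Hom(3)[OF assms] by (rule HomE)
  then show ?thesis using that K.arr_in_Hom(1,2)[OF assms] by simp
qed

lemma typed_mk_operator:
  assumes "operator a b F" "a \<in> Obj C" "b \<in> Obj C"
  shows "arr op_cat (mk_operator a b F)" "src op_cat (mk_operator a b F) = a" "tgt op_cat (mk_operator a b F) = b"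
proof -
  interpret K: linear_category op_cat by (rule linear_category_op_cat)
  have "mk_operator a b F \<in> Hom op_cat a b" using assms by auto
  then show "arr op_cat (mk_operator a b F)" "src op_cat (mk_operator a b F) = a" "tgt op_cat (mk_operator a b F) = b"
    using K.typed_arrow[of a b] assms by simp_all
qed

lemma orbit_category_op_cat: "orbit_category C op_cat op_J op_act"
proof (intro orbit_category.intro orbit_category_axioms.intro rigid_cstar_tensor_category_axioms linear_category_op_cat)
  show "Obj op_cat = Obj C" by simp
  show "op_J (Idn C a) = Idn op_cat a" if "a \<in> Obj C" for a
    using that op_J_eq[of "Idn C a" a a] by (auto intro!: mk_operator_cong)
  show "linear_map (hom_space C a b) (hom_space op_cat a b) op_J" if ab [simp]: "a \<in> Obj C" "b \<in> Obj C" for a b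
  proof -
    have eq: "op_J f = mk_operator a b (\<lambda>x. VAr A (Idn C x \<otimes>\<^sub>a f))" if "f \<in> Hom C a b" for f
      using op_J_eq[of f a b] that by (simp add: Hom_iff)
    note V = cvector_spaceD(2,3)[OF hom_vector_space[OF ab]]
    show ?thesis
      unfolding semilinear_map_def
    proof (intro conjI ballI allI)
      have "op_J f \<in> Hom op_cat a b" if "f \<in> Hom C a b" for f
        using operator_J[of f] that by (auto simp: eq Hom_iff)
      then show "op_J \<in> carrier (hom_space C a b) \<rightarrow> carrier (hom_space op_cat a b)"
        by (simp add: hom_space_def Pi_iff del: op_cat_simps)
    next
      fix f g assume fg: "f \<in> carrier (hom_space C a b)" "g \<in> carrier (hom_space C a b)"
      show "op_J (f \<oplus>\<^bsub>hom_space C a b\<^esub> g) = op_J f \<oplus>\<^bsub>hom_space op_cat a b\<^esub> op_J g"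
        using fg V(1)[OF fg] linear_mapD(2)[OF app_op_J_linear[OF ab] fg]
        by (auto simp: hom_space_def eq intro!: mk_operator_cong)
    next
      fix z f assume f: "f \<in> carrier (hom_space C a b)"
      show "op_J (z \<odot>\<^bsub>hom_space C a b\<^esub> f) = id z \<odot>\<^bsub>hom_space op_cat a b\<^esub> op_J f"
        using f V(2)[OF f] linear_mapD(3)[OF app_op_J_linear[OF ab] f]
        by (auto simp: hom_space_def eq intro!: mk_operator_cong)
    qed
  qed
  show "op_J (g \<cdot> f) = op_J g \<cdot>\<^bsub>op_cat\<^esub> op_J f" if [simp]: "arr C f" "arr C g" "tgt C f = src C g" for f g
    using op_J_eq[of "g \<cdot> f" "src C f" "tgt C g"] op_J_eq[of f "src C f" "src C g"] Cmp_J_op[of g "src C g" "src C f"]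
    by (auto simp: interchange simp del: op_cat_simps(4) intro!: mk_operator_cong)
  show "linear_map (hom_space op_cat a b) (hom_space op_cat (c \<otimes>\<^sub>o a) (c \<otimes>\<^sub>o b)) (op_act c)"
    if [simp]: "a \<in> Obj C" "b \<in> Obj C" "c \<in> Obj C" for a b c
    unfolding semilinear_map_def
  proof (intro conjI ballI allI)
    have "op_act c (mk_operator a b F) \<in> Hom op_cat (c \<otimes>\<^sub>o a) (c \<otimes>\<^sub>o b)" if "operator a b F" for F
      using operator_act[OF that, of c] op_act_eq[of a b c F] by auto
    then show "op_act c \<in> carrier (hom_space op_cat a b) \<rightarrow> carrier (hom_space op_cat (c \<otimes>\<^sub>o a) (c \<otimes>\<^sub>o b))"
      by (auto simp: hom_space_def simp del: op_cat_simps(2) elim!: HomE)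
  next
    fix S T assume "S \<in> carrier (hom_space op_cat a b)" "T \<in> carrier (hom_space op_cat a b)"
    then obtain F G where F: "operator a b F" "S = mk_operator a b F" and G: "operator a b G" "T = mk_operator a b G"
      by (auto simp: hom_space_def)
    note [simp] = operatorD(2)[OF F(1)] operatorD(2)[OF G(1)]
    have "VAr A ((Asc C x c a)\<dagger>) (F (x \<otimes>\<^sub>o c) w \<oplus>\<^bsub>VOb A ((x \<otimes>\<^sub>o c) \<otimes>\<^sub>o a)\<^esub> G (x \<otimes>\<^sub>o c) w)
       = VAr A ((Asc C x c a)\<dagger>) (F (x \<otimes>\<^sub>o c) w) \<oplus>\<^bsub>VOb A (x \<otimes>\<^sub>o c \<otimes>\<^sub>o a)\<^esub> VAr A ((Asc C x c a)\<dagger>) (G (x \<otimes>\<^sub>o c) w)"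
      if "x \<in> Obj C" "w \<in> carrier (VOb A ((x \<otimes>\<^sub>o c) \<otimes>\<^sub>o b))" for x w
      using that linear_mapD(2)[OF VAr_linear[of "(Asc C x c a)\<dagger>"]] by simp
    then show "op_act c (S \<oplus>\<^bsub>hom_space op_cat a b\<^esub> T) = op_act c S \<oplus>\<^bsub>hom_space op_cat (c \<otimes>\<^sub>o a) (c \<otimes>\<^sub>o b)\<^esub> op_act c T"
      unfolding F(2) G(2) by (auto simp: hom_space_def op_act_eq intro!: mk_operator_cong)
  next
    fix z S assume "S \<in> carrier (hom_space op_cat a b)"
    then obtain F where F: "operator a b F" "S = mk_operator a b F"
      by (auto simp: hom_space_def)
    note [simp] = operatorD(2)[OF F(1)]
    have "VAr A ((Asc C x c a)\<dagger>) (z \<odot>\<^bsub>VOb A ((x \<otimes>\<^sub>o c) \<otimes>\<^sub>o a)\<^esub> F (x \<otimes>\<^sub>o c) w)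
       = z \<odot>\<^bsub>VOb A (x \<otimes>\<^sub>o c \<otimes>\<^sub>o a)\<^esub> VAr A ((Asc C x c a)\<dagger>) (F (x \<otimes>\<^sub>o c) w)"
      if "x \<in> Obj C" "w \<in> carrier (VOb A ((x \<otimes>\<^sub>o c) \<otimes>\<^sub>o b))" for x w
      using that linear_mapD(3)[OF VAr_linear[of "(Asc C x c a)\<dagger>"]] by simp
    then show "op_act c (z \<odot>\<^bsub>hom_space op_cat a b\<^esub> S) = id z \<odot>\<^bsub>hom_space op_cat (c \<otimes>\<^sub>o a) (c \<otimes>\<^sub>o b)\<^esub> op_act c S"
      unfolding F(2) by (auto simp: hom_space_def op_act_eq intro!: mk_operator_cong)
  qed
  show "op_act c (S \<cdot>\<^bsub>op_cat\<^esub> T) = op_act c S \<cdot>\<^bsub>op_cat\<^esub> op_act c T"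
    if c [simp]: "c \<in> Obj C" and S: "arr op_cat S" and T: "arr op_cat T" and st: "tgt op_cat T = src op_cat S" for c S T
  proof -
    obtain a b F where F: "T = mk_operator a b F" "operator a b F" and [simp]: "a \<in> Obj C" "b \<in> Obj C" and "tgt op_cat T = b"
      by (rule arr_op_catE[OF T])
    moreover obtain b' d G where G: "S = mk_operator b' d G" "operator b' d G" and [simp]: "d \<in> Obj C" and "src op_cat S = b'"
      by (rule arr_op_catE[OF S])
    ultimately have b': "b' = b" using st by simp
    show ?thesis
      using G operatorD(2)[OF F(2)] operatorD(2)[OF G(2)] unfolding F(1) G(1) b'
      by (auto simp: op_act_eq Cmp_op[OF operator_act] Cmp_op simp del: op_cat_simps(4) intro!: mk_operator_cong)
  qed
  show "op_act c (op_J f) = op_J (Idn C c \<otimes>\<^sub>a f)" if [simp]: "c \<in> Obj C" "arr C f" for c f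
  proof -
    have 1: "Asc C x c (tgt C f) \<cdot> (Idn C (x \<otimes>\<^sub>o c) \<otimes>\<^sub>a f) \<cdot> (Asc C x c (src C f))\<dagger> = Idn C x \<otimes>\<^sub>a (Idn C c \<otimes>\<^sub>a f)"
      if "x \<in> Obj C" for x
      using rewrite_head2[OF Asc_nat[of "Idn C x" "Idn C c" f x c "src C f" x c "tgt C f"], of "(Asc C x c (src C f))\<dagger>"] that
      by simp
    show ?thesis
      using op_J_eq[of f "src C f" "tgt C f"] op_J_eq[of "Idn C c \<otimes>\<^sub>a f" "c \<otimes>\<^sub>o src C f" "c \<otimes>\<^sub>o tgt C f"]
      by (auto simp: op_act_eq 1 intro!: mk_operator_cong)
  qed
  fix T assume T: "arr op_cat T"
  then obtain a b F where F: "T = mk_operator a b F" "operator a b F" and [simp]: "a \<in> Obj C" "b \<in> Obj C"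
    and st [simp]: "src op_cat T = a" "tgt op_cat T = b" by (rule arr_op_catE)
  note [simp] = operatorD(2)[OF F(2)] and nat = operatorD(3)[OF F(2)]
  show "op_J (f \<otimes>\<^sub>a Idn C (tgt op_cat T)) \<cdot>\<^bsub>op_cat\<^esub> op_act (src C f) T
      = op_act (tgt C f) T \<cdot>\<^bsub>op_cat\<^esub> op_J (f \<otimes>\<^sub>a Idn C (src op_cat T))" if [simp]: "arr C f" for f
  proof -
    let ?c = "src C f" and ?d = "tgt C f"
    have eq: "VAr A ((Asc C x ?c a)\<dagger>) (F (x \<otimes>\<^sub>o ?c) (VAr A ((Idn C x \<otimes>\<^sub>a (f \<otimes>\<^sub>a Idn C b)) \<cdot> Asc C x ?c b) w))
        = VAr A ((Asc C x ?d a)\<dagger> \<cdot> (Idn C x \<otimes>\<^sub>a (f \<otimes>\<^sub>a Idn C a))) (F (x \<otimes>\<^sub>o ?d) (VAr A (Asc C x ?d b) w))"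
      if [simp]: "x \<in> Obj C" "w \<in> carrier (VOb A (x \<otimes>\<^sub>o ?d \<otimes>\<^sub>o b))" for x w
    proof -
      have "(Idn C x \<otimes>\<^sub>a (f \<otimes>\<^sub>a Idn C b)) \<cdot> Asc C x ?c b = Asc C x ?d b \<cdot> ((Idn C x \<otimes>\<^sub>a f) \<otimes>\<^sub>a Idn C b)"
        using Asc_nat[of "Idn C x" f "Idn C b"] by simp
      moreover have "((Idn C x \<otimes>\<^sub>a f) \<otimes>\<^sub>a Idn C a) \<cdot> (Asc C x ?c a)\<dagger> = (Asc C x ?d a)\<dagger> \<cdot> (Idn C x \<otimes>\<^sub>a (f \<otimes>\<^sub>a Idn C a))"
        using Asc_dag_nat[of "Idn C x" f "Idn C a"] by simp
      ultimately show ?thesis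
        using nat[of "Idn C x \<otimes>\<^sub>a f" "VAr A (Asc C x ?d b) w"] by simp
    qed
    show ?thesis
      unfolding st unfolding F(1)
      using eq by (auto simp: op_act_eq Cmp_J_op[of _ "?c \<otimes>\<^sub>o b"] Cmp_op_J[OF _ _ operator_act[OF F(2)]]
          simp del: op_cat_simps(4) intro!: mk_operator_cong)
  qed
  show "op_J (Asc C c d (tgt op_cat T)) \<cdot>\<^bsub>op_cat\<^esub> op_act (c \<otimes>\<^sub>o d) T
      = op_act c (op_act d T) \<cdot>\<^bsub>op_cat\<^esub> op_J (Asc C c d (src op_cat T))" if [simp]: "c \<in> Obj C" "d \<in> Obj C" for c d
  proof -
    have eq: "VAr A ((Asc C x (c \<otimes>\<^sub>o d) a)\<dagger>) (F (x \<otimes>\<^sub>o c \<otimes>\<^sub>o d) (VAr A ((Idn C x \<otimes>\<^sub>a Asc C c d b) \<cdot> Asc C x (c \<otimes>\<^sub>o d) b) w))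
        = VAr A ((Asc C (x \<otimes>\<^sub>o c) d a)\<dagger> \<cdot> (Asc C x c (d \<otimes>\<^sub>o a))\<dagger> \<cdot> (Idn C x \<otimes>\<^sub>a Asc C c d a))
           (F ((x \<otimes>\<^sub>o c) \<otimes>\<^sub>o d) (VAr A (Asc C x c (d \<otimes>\<^sub>o b) \<cdot> Asc C (x \<otimes>\<^sub>o c) d b) w))"
      if [simp]: "x \<in> Obj C" "w \<in> carrier (VOb A (x \<otimes>\<^sub>o c \<otimes>\<^sub>o d \<otimes>\<^sub>o b))" for x w
    proof -
      have 1: "(Idn C x \<otimes>\<^sub>a Asc C c d b) \<cdot> Asc C x (c \<otimes>\<^sub>o d) b
          = (Asc C x c (d \<otimes>\<^sub>o b) \<cdot> Asc C (x \<otimes>\<^sub>o c) d b) \<cdot> ((Asc C x c d)\<dagger> \<otimes>\<^sub>a Idn C b)"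
        by (simp add: pentagon2)
      have 2: "((Asc C x c d)\<dagger> \<otimes>\<^sub>a Idn C a) \<cdot> (Asc C x (c \<otimes>\<^sub>o d) a)\<dagger>
          = (Asc C (x \<otimes>\<^sub>o c) d a)\<dagger> \<cdot> (Asc C x c (d \<otimes>\<^sub>o a))\<dagger> \<cdot> (Idn C x \<otimes>\<^sub>a Asc C c d a)"
        by (simp add: pentagon_dag)
      show ?thesis
        using nat[of "(Asc C x c d)\<dagger>" "VAr A (Asc C x c (d \<otimes>\<^sub>o b) \<cdot> Asc C (x \<otimes>\<^sub>o c) d b) w"]
        by (simp add: 1 2)
    qed
    show ?thesis
      unfolding st unfolding F(1)
      using eq by (auto simp: op_act_eq Cmp_J_op[of _ "(c \<otimes>\<^sub>o d) \<otimes>\<^sub>o b"] Cmp_op_J[OF _ _ operator_act[OF operator_act[OF F(2)]]]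
          simp del: op_cat_simps(4) intro!: mk_operator_cong)
  qed
  show "op_J (LUn C (tgt op_cat T)) \<cdot>\<^bsub>op_cat\<^esub> op_act (Unt C) T = T \<cdot>\<^bsub>op_cat\<^esub> op_J (LUn C (src op_cat T))"
  proof -
    have eq: "VAr A ((Asc C x (Unt C) a)\<dagger>) (F (x \<otimes>\<^sub>o Unt C) (VAr A ((Idn C x \<otimes>\<^sub>a LUn C b) \<cdot> Asc C x (Unt C) b) w))
        = VAr A (Idn C x \<otimes>\<^sub>a LUn C a) (F x w)"
      if [simp]: "x \<in> Obj C" "w \<in> carrier (VOb A (x \<otimes>\<^sub>o b))" for x w
      using nat[of "RUn C x" w] by (simp add: triangle triangle_dag)
    show ?thesis
      unfolding st unfolding F(1)
      using eq by (auto simp: op_act_eq Cmp_J_op[of _ "Unt C \<otimes>\<^sub>o b"] Cmp_op_J[OF _ _ F(2)]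
          simp del: op_cat_simps(4) intro!: mk_operator_cong)
  qed
qed

end

section \<open>Algebra objects presented by orbit categories\<close>

text \<open>
  An algebra object is presented by an orbit category \<open>K\<close> if \<open>\<pi>\<close> identifies it with \<open>K(_, 1)\<close>. The elements
  of \<open>A(c)\<close> then are arrows \<open>c \<rightarrow> 1\<close>, which \<open>lift\<close> recovers.
\<close>

locale orbit_presentation = orbit_category C K J act + A: rigid_algebra C A
  for C :: "('o, 'a, 'z) rigid_cat_scheme" (structure)
    and K :: "('o, 'y, 'k) lin_cat_scheme" and J and act
    and A :: "('o, 'a, 'v, 'w) alg_object_scheme" +
  fixes \<pi> :: "'y \<Rightarrow> 'v"
  assumes pi_bij: "c \<in> Obj C \<Longrightarrow> bij_betw \<pi> (Hom K c (Unt C)) (carrier (VOb A c))"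
    and pi_linear: "c \<in> Obj C \<Longrightarrow> linear_map (hom_space K c (Unt C)) (VOb A c) \<pi>"
    and pi_J: "\<lbrakk>arr K f; tgt K f = Unt C; arr C h; tgt C h = src K f\<rbrakk> \<Longrightarrow> \<pi> (f \<star> J h) = VAr A h (\<pi> f)"
    and pi_mul: "\<lbrakk>arr K f; tgt K f = Unt C; arr K g; tgt K g = Unt C\<rbrakk>
      \<Longrightarrow> \<pi> (mul f g) = AMul A (src K f) (src K g) (\<pi> f) (\<pi> g)"
    and pi_unit: "\<pi> (Idn K (Unt C)) = AUnit A"
begin

definition lift :: "'o \<Rightarrow> 'v \<Rightarrow> 'y" where
  "lift c = inv_into (Hom K c (Unt C)) \<pi>"

lemma pi_closed [simp]: "\<lbrakk>arr K f; tgt K f = Unt C; src K f = c\<rbrakk> \<Longrightarrow> \<pi> f \<in> carrier (VOb A c)"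
  using bij_betw_apply[OF pi_bij[of c], of f] Hom_K_iff[of c "Unt C" f] src_tgt_K(1)[of f] by simp

lemma typed_lift [simp]:
  assumes "c \<in> Obj C" "x \<in> carrier (VOb A c)"
  shows "arr K (lift c x)" "src K (lift c x) = c" "tgt K (lift c x) = Unt C"
  using bij_betw_imp_surj_on[OF pi_bij[OF assms(1)]] inv_into_into[of x \<pi> "Hom K c (Unt C)"] assms
  by (simp_all add: lift_def Hom_K_iff)

lemma pi_lift [simp]: "\<lbrakk>c \<in> Obj C; x \<in> carrier (VOb A c)\<rbrakk> \<Longrightarrow> \<pi> (lift c x) = x"
  using pi_bij[of c] by (simp add: lift_def bij_betw_def f_inv_into_f)

lemma lift_pi [simp]:
  assumes "arr K f" "tgt K f = Unt C" "src K f = c"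
  shows "lift c (\<pi> f) = f"
proof -
  have c: "c \<in> Obj C" using src_tgt_K(1)[OF assms(1)] assms(3) by simp
  then have "f \<in> Hom K c (Unt C)" using assms by (simp add: Hom_K_iff)
  then show ?thesis unfolding lift_def by (rule bij_betw_inv_into_left[OF pi_bij[OF c]])
qed

lemma pi_inj:
  assumes eq: "\<pi> f = \<pi> g" and "arr K f" "tgt K f = Unt C" "arr K g" "tgt K g = Unt C" "src K f = src K g"
  shows "f = g"
proof -
  have "f = lift (src K g) (\<pi> f)" by (rule lift_pi[symmetric]) fact+
  also have "\<dots> = g" unfolding eq by (rule lift_pi) (fact | rule refl)+
  finally show ?thesis .
qed

lemma lift_linear:
  assumes c: "c \<in> Obj C"
  shows "linear_map (VOb A c) (hom_space K c (Unt C)) (lift c)"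
  unfolding semilinear_map_def
proof (intro conjI ballI allI)
  have V: "cvector_space (hom_space K c (Unt C))" using K.hom_vector_space c by simp
  have carrier: "f \<in> carrier (hom_space K c (Unt C)) \<longleftrightarrow> arr K f \<and> src K f = c \<and> tgt K f = Unt C" for f
    using c by (simp add: hom_space_def Hom_K_iff)
  show "lift c \<in> carrier (VOb A c) \<rightarrow> carrier (hom_space K c (Unt C))"
    using c by (simp add: carrier)
  fix x assume x: "x \<in> carrier (VOb A c)"
  have lx: "lift c x \<in> carrier (hom_space K c (Unt C))" using c x by (simp add: carrier)
  show "lift c (z \<odot>\<^bsub>VOb A c\<^esub> x) = id z \<odot>\<^bsub>hom_space K c (Unt C)\<^esub> lift c x" for z
  proof -
    have "lift c (\<pi> (z \<odot>\<^bsub>hom_space K c (Unt C)\<^esub> lift c x)) = z \<odot>\<^bsub>hom_space K c (Unt C)\<^esub> lift c x"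
      by (rule lift_pi) (use cvector_spaceD(3)[OF V lx] carrier in auto)
    then show ?thesis using linear_mapD(3)[OF pi_linear[OF c] lx] c x by simp
  qed
  fix y assume y: "y \<in> carrier (VOb A c)"
  have ly: "lift c y \<in> carrier (hom_space K c (Unt C))" using c y by (simp add: carrier)
  have "lift c (\<pi> (lift c x \<oplus>\<^bsub>hom_space K c (Unt C)\<^esub> lift c y)) = lift c x \<oplus>\<^bsub>hom_space K c (Unt C)\<^esub> lift c y"
    by (rule lift_pi) (use cvector_spaceD(2)[OF V lx ly] carrier in auto)
  then show "lift c (x \<oplus>\<^bsub>VOb A c\<^esub> y) = lift c x \<oplus>\<^bsub>hom_space K c (Unt C)\<^esub> lift c y"
    using linear_mapD(2)[OF pi_linear[OF c] lx ly] c x y by simp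
qed

lemma pi_J_unit: "\<lbrakk>arr C h; tgt C h = Unt C\<rbrakk> \<Longrightarrow> \<pi> (J h) = VAr A h (AUnit A)"
  using pi_J[of "Idn K (Unt C)" h] by (simp add: pi_unit)

end

context rigid_cstar_tensor_category
begin

lemma typed_conj_arr [simp]:
  assumes "arr C f" "src C f = a" "tgt C f = b"
  shows "arr C (conj_arr C a b f)" "src C (conj_arr C a b f) = Cj C a" "tgt C (conj_arr C a b f) = Cj C b"
  using assms by (auto simp: conj_arr_def)

lemma inv_arr_unit_conj: "inv_arr C (Unt C) (Cj C (Unt C)) (unit_conj C) = Ev C (Unt C) \<cdot> (RUn C (Cj C (Unt C)))\<dagger>"
  by (rule inv_arr_eq[OF _ _ inverse_unit_conj]) simp_all

lemma inverse_nu: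
  assumes [simp]: "a \<in> Obj C" "b \<in> Obj C"
  defines "m \<equiv> inv_arr C (Cj C b \<otimes>\<^sub>o Cj C a) (Cj C (a \<otimes>\<^sub>o b)) (nu C b a)"
  shows "arr C m" "src C m = Cj C (a \<otimes>\<^sub>o b)" "tgt C m = Cj C b \<otimes>\<^sub>o Cj C a"
    "m \<cdot> nu C b a = Idn C (Cj C b \<otimes>\<^sub>o Cj C a)" "nu C b a \<cdot> m = Idn C (Cj C (a \<otimes>\<^sub>o b))"
proof -
  obtain m' where m': "mutually_inverse C (Cj C b \<otimes>\<^sub>o Cj C a) (Cj C (a \<otimes>\<^sub>o b)) (nu C b a) m'"
    using nu_invertible[of a b] by auto
  then have "m = m'" unfolding m_def by (intro inv_arr_eq) simp_all
  with m' show "arr C m" "src C m = Cj C (a \<otimes>\<^sub>o b)" "tgt C m = Cj C b \<otimes>\<^sub>o Cj C a"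
    "m \<cdot> nu C b a = Idn C (Cj C b \<otimes>\<^sub>o Cj C a)" "nu C b a \<cdot> m = Idn C (Cj C (a \<otimes>\<^sub>o b))"
    by (simp_all add: mutually_inverse_iff)
qed

end

locale star_presentation = orbit_presentation C K J act A \<pi> + star_algebra_object C A
  for C :: "('o, 'a, 'z) rigid_cat_scheme" (structure)
    and K :: "('o, 'y, 'k) lin_cat_scheme" and J and act
    and A :: "('o, 'a, 'v, 'w) star_alg_object_scheme" and \<pi>
begin

definition star :: "'y \<Rightarrow> 'y" where
  "star f = lift (Cj C (src K f)) (AStar A (src K f) (\<pi> f))"

lemma AStar_closed [simp]: "\<lbrakk>a \<in> Obj C; x \<in> carrier (VOb A a)\<rbrakk> \<Longrightarrow> AStar A a x \<in> carrier (VOb A (Cj C a))"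
  using AStar_conj_linear[of a] by (auto simp: semilinear_map_def)

lemma typed_star [simp]:
  assumes "arr K f" "tgt K f = Unt C"
  shows "arr K (star f)" "src K (star f) = Cj C (src K f)" "tgt K (star f) = Unt C"
  using assms by (simp_all add: star_def)

lemma pi_star [simp]: "\<lbrakk>arr K f; tgt K f = Unt C\<rbrakk> \<Longrightarrow> \<pi> (star f) = AStar A (src K f) (\<pi> f)"
  by (simp add: star_def)

lemma orbit_star_star: "orbit_star C K J act star"
proof unfold_locales
  fix c assume [simp]: "c \<in> Obj C"
  have "conj_linear_map (hom_space K c (Unt C)) (hom_space K (Cj C c) (Unt C)) (\<lambda>f. lift (Cj C c) (AStar A c (\<pi> f)))"
    by (rule conj_linear_map_comp(2)[OF conj_linear_map_comp(1)[OF pi_linear AStar_conj_linear] lift_linear]) simp_all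
  then show "conj_linear_map (hom_space K c (Unt C)) (hom_space K (Cj C c) (Unt C)) star"
    by (rule semilinear_map_cong) (use K.hom_vector_space in \<open>auto simp: hom_space_def Hom_K_iff star_def\<close>)
next
  fix f h assume [simp]: "arr K f" "tgt K f = Unt C" "arr C h" "tgt C h = src K f"
  show "star (f \<star> J h) = star f \<star> J (conj_arr C (src C h) (tgt C h) h)"
  proof (rule pi_inj)
    show "\<pi> (star (f \<star> J h)) = \<pi> (star f \<star> J (conj_arr C (src C h) (tgt C h) h))"
      using AStar_natural[of "src K f" "src C h" h "\<pi> f"] arr_in_Hom[of h] by (simp add: pi_J)
  qed simp_all
next
  fix f assume [simp]: "arr K f" "tgt K f = Unt C"
  show "star (star f) \<star> J (phi C (src K f)) = f"
  proof (rule pi_inj)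
    show "\<pi> (star (star f) \<star> J (phi C (src K f))) = \<pi> f"
      using AStar_AStar[of "src K f" "\<pi> f"] by (simp add: pi_J)
  qed simp_all
next
  show "star (Idn K (Unt C)) = J (Ev C (Unt C) \<cdot> (RUn C (Cj C (Unt C)))\<dagger>)"
  proof (rule pi_inj)
    show "\<pi> (star (Idn K (Unt C))) = \<pi> (J (Ev C (Unt C) \<cdot> (RUn C (Cj C (Unt C)))\<dagger>))"
      using AStar_AUnit by (simp add: pi_J_unit pi_unit inv_arr_unit_conj)
  qed simp_all
next
  fix f g assume [simp]: "arr K f" "tgt K f = Unt C" "arr K g" "tgt K g = Unt C"
  let ?a = "src K f" and ?b = "src K g"
  note [simp] = inverse_nu[of ?a ?b]
  show "star (mul f g) \<star> J (nu C ?b ?a) = mul (star g) (star f)"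
  proof (rule pi_inj)
    show "\<pi> (star (mul f g) \<star> J (nu C ?b ?a)) = \<pi> (mul (star g) (star f))"
      using AStar_AMul[of ?a ?b "\<pi> f" "\<pi> g"] by (simp add: pi_J pi_mul)
  qed simp_all
qed

end

sublocale star_presentation \<subseteq> S: orbit_star C K J act star
  by (rule orbit_star_star)

text \<open>
  Conversely, an orbit category with a star gives a star algebra object on any type into which
  the arrows to the unit can be injected.
\<close>

definition (in orbit_category) orbit_algebra :: "('y \<Rightarrow> 'v) \<Rightarrow> ('y \<Rightarrow> 'y) \<Rightarrow> ('o, 'a, 'v) star_alg_object" where
  "orbit_algebra \<pi> j = (let lift = (\<lambda>c. inv_into (Hom K c (Unt C)) \<pi>) in
    \<lparr>VOb = (\<lambda>c. \<lparr>carrier = \<pi> ` Hom K c (Unt C), mult = undefined, one = undefined,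
        zero = \<pi> (HZero K c (Unt C)), add = (\<lambda>x y. \<pi> (HAdd K (lift c x) (lift c y))),
        smult = (\<lambda>z x. \<pi> (HScale K z (lift c x)))\<rparr>),
     VAr = (\<lambda>h x. \<pi> (lift (tgt C h) x \<star> J h)),
     AMul = (\<lambda>a b x y. \<pi> (mul (lift a x) (lift b y))),
     AUnit = \<pi> (Idn K (Unt C)),
     AStar = (\<lambda>c x. \<pi> (j (lift c x)))\<rparr>)"

context orbit_category
begin

lemma mul_J_J:
  assumes [simp]: "arr K f" "tgt K f = Unt C" "arr K g" "tgt K g = Unt C" "arr C h" "tgt C h = src K f"
    "arr C k" "tgt C k = src K g"
  shows "mul (f \<star> J h) (g \<star> J k) = mul f g \<star> J (h \<otimes>\<^sub>a k)"
proof -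
  let ?a = "src C h" and ?I = "Unt C"
  have 1: "J h \<star> J (RUn C ?a) = J (RUn C (src K f)) \<star> J (h \<otimes>\<^sub>a Idn C ?I)"
    using RUn_nat[of h ?a "src K f"] by (simp add: J_comp)
  have 2: "J (h \<otimes>\<^sub>a Idn C ?I) \<star> act ?a g = act (src K f) g \<star> J (h \<otimes>\<^sub>a Idn C (src K g))"
    using J_act[of h g] by simp
  have "mul (f \<star> J h) (g \<star> J k) = f \<star> (J h \<star> J (RUn C ?a)) \<star> act ?a g \<star> J (Idn C ?a \<otimes>\<^sub>a k)"
    by (simp add: mul_def act_Cmp act_J)
  also have "\<dots> = f \<star> J (RUn C (src K f)) \<star> (J (h \<otimes>\<^sub>a Idn C ?I) \<star> act ?a g) \<star> J (Idn C ?a \<otimes>\<^sub>a k)"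
    unfolding 1 by simp
  also have "\<dots> = mul f g \<star> J (h \<otimes>\<^sub>a k)"
    unfolding 2 by (simp add: mul_def J_comp interchange)
  finally show ?thesis .
qed

lemma mul_assoc:
  assumes [simp]: "arr K f" "tgt K f = Unt C" "arr K g" "tgt K g = Unt C" "arr K k" "tgt K k = Unt C"
  shows "mul (mul f g) k = mul f (mul g k) \<star> J (Asc C (src K f) (src K g) (src K k))"
proof -
  let ?a = "src K f" and ?b = "src K g" and ?c = "src K k" and ?I = "Unt C"
  have 1: "act ?a (act ?b k) \<star> J (Asc C ?a ?b ?c) = J (Asc C ?a ?b ?I) \<star> act (?a \<otimes>\<^sub>o ?b) k"
    using act_TOb[of ?a ?b k] by simp
  have "mul f (mul g k) \<star> J (Asc C ?a ?b ?c) = f \<star> J (RUn C ?a) \<star> act ?a g \<star> J (Idn C ?a \<otimes>\<^sub>a RUn C ?b) \<star>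
      (act ?a (act ?b k) \<star> J (Asc C ?a ?b ?c))"
    by (simp add: mul_def act_Cmp act_J)
  also have "\<dots> = mul (mul f g) k"
    unfolding 1 by (simp add: J_comp_head RUn_TOb) (simp add: mul_def)
  finally show ?thesis ..
qed

lemma mul_unit_left: "\<lbrakk>arr K f; tgt K f = Unt C\<rbrakk> \<Longrightarrow> mul (Idn K (Unt C)) f = f \<star> J (LUn C (src K f))"
  using act_Unt[of f] by (simp add: mul_def LUn_Unt)

lemma mul_unit_right: "\<lbrakk>arr K f; tgt K f = Unt C\<rbrakk> \<Longrightarrow> mul f (Idn K (Unt C)) = f \<star> J (RUn C (src K f))"
  by (simp add: mul_def)

lemma mul_linear_right:
  assumes [simp]: "arr K f" "tgt K f = Unt C" "b \<in> Obj C"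
  shows "linear_map (hom_space K b (Unt C)) (hom_space K (src K f \<otimes>\<^sub>o b) (Unt C)) (mul f)"
proof -
  have 1: "linear_map (hom_space K b (Unt C)) (hom_space K (src K f \<otimes>\<^sub>o b) (src K f \<otimes>\<^sub>o Unt C)) (act (src K f))"
    by (intro act_linear) simp_all
  have 2: "linear_map (hom_space K (src K f \<otimes>\<^sub>o b) (src K f \<otimes>\<^sub>o Unt C)) (hom_space K (src K f \<otimes>\<^sub>o b) (Unt C)) (\<lambda>g. (f \<star> J (RUn C (src K f))) \<star> g)"
    using K.comp_left_linear[of "f \<star> J (RUn C (src K f))" "src K f \<otimes>\<^sub>o b"] by simp
  have "linear_map (hom_space K b (Unt C)) (hom_space K (src K f \<otimes>\<^sub>o b) (Unt C)) (\<lambda>g. (f \<star> J (RUn C (src K f))) \<star> act (src K f) g)"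
    by (rule linear_map_comp[OF 1 2])
  then show ?thesis
    by (rule semilinear_map_cong) (use K.hom_vector_space in \<open>auto simp: hom_space_def Hom_K_iff mul_def\<close>)
qed

lemma mul_linear_left:
  assumes [simp]: "arr K g" "tgt K g = Unt C" "a \<in> Obj C"
  shows "linear_map (hom_space K a (Unt C)) (hom_space K (a \<otimes>\<^sub>o src K g) (Unt C)) (\<lambda>f. mul f g)"
proof -
  have "linear_map (hom_space K a (Unt C)) (hom_space K (a \<otimes>\<^sub>o src K g) (Unt C)) (\<lambda>f. f \<star> (J (RUn C a) \<star> act a g))"
    using K.comp_right_linear[of "J (RUn C a) \<star> act a g" "Unt C"] by simp
  then show ?thesis
    by (rule semilinear_map_cong) (use K.hom_vector_space in \<open>auto simp: hom_space_def Hom_K_iff mul_def\<close>)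
qed

end

context orbit_star
begin

context
  fixes \<pi> :: "'d \<Rightarrow> 'v"
  assumes inj: "\<And>c. c \<in> Obj C \<Longrightarrow> inj_on \<pi> (Hom K c (Unt C))"
begin

abbreviation "A \<equiv> orbit_algebra \<pi> j"

lemma inv_pi [simp]: "\<lbrakk>arr K f; tgt K f = Unt C; src K f = c\<rbrakk> \<Longrightarrow> inv_into (Hom K c (Unt C)) \<pi> (\<pi> f) = f"
  using inj[of c] Hom_K_iff[of c "Unt C" f] src_tgt_K(1)[of f] by simp

lemma orbit_algebra_simps [simp]:
  "carrier (VOb A c) = \<pi> ` Hom K c (Unt C)"
  "\<lbrakk>arr K f; tgt K f = Unt C; arr C h; tgt C h = src K f\<rbrakk> \<Longrightarrow> VAr A h (\<pi> f) = \<pi> (f \<star> J h)"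
  "\<lbrakk>arr K f; tgt K f = Unt C; arr K g; tgt K g = Unt C; src K f = a; src K g = b\<rbrakk> \<Longrightarrow> AMul A a b (\<pi> f) (\<pi> g) = \<pi> (mul f g)"
  "AUnit A = \<pi> (Idn K (Unt C))"
  "\<lbrakk>arr K f; tgt K f = Unt C; src K f = c\<rbrakk> \<Longrightarrow> AStar A c (\<pi> f) = \<pi> (j f)"
  by (simp_all add: orbit_algebra_def)

lemma pi_facts:
  assumes [simp]: "c \<in> Obj C"
  shows "bij_betw \<pi> (carrier (hom_space K c (Unt C))) (carrier (VOb A c))"
    "linear_map (hom_space K c (Unt C)) (VOb A c) \<pi>" "cvector_space (VOb A c)"
proof -
  have V: "cvector_space (hom_space K c (Unt C))" using K.hom_vector_space by simp
  show bij: "bij_betw \<pi> (carrier (hom_space K c (Unt C))) (carrier (VOb A c))"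
    using inj[of c] by (simp add: hom_space_def bij_betw_def)
  show lin: "linear_map (hom_space K c (Unt C)) (VOb A c) \<pi>"
    by (auto simp: semilinear_map_def orbit_algebra_def hom_space_def Hom_K_iff)
  show "cvector_space (VOb A c)"
    by (rule cvector_space_image[OF V bij lin]) (simp add: orbit_algebra_def hom_space_def)
qed

lemma pi_image:
  assumes "x \<in> carrier (VOb A c)" "c \<in> Obj C"
  obtains f where "arr K f" "src K f = c" "tgt K f = Unt C" "x = \<pi> f"
  using assms by (auto simp: Hom_K_iff)

lemma semilinear_orbit_algebra:
  assumes "c \<in> Obj C" "semilinear_map \<sigma> (hom_space K c (Unt C)) W (\<lambda>u. g (\<pi> u))"
  shows "semilinear_map \<sigma> (VOb A c) W g"
  by (rule semilinear_on_image[OF pi_facts(1,2)[OF assms(1)] _ assms(2)]) (use assms K.hom_vector_space in simp)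

lemma star_algebra_object_orbit_algebra: "star_algebra_object C A"
proof (intro star_algebra_object.intro algebra_object.intro vec_functor.intro algebra_object_axioms.intro star_algebra_object_axioms.intro)
  fix a assume [simp]: "a \<in> Obj C"
  show "cvector_space (VOb A a)" by (rule pi_facts) simp
next
  fix a b assume ab [simp]: "a \<in> Obj C" "b \<in> Obj C"
  show "bilinear_map (hom_space C a b) (VOb A b) (VOb A a) (VAr A)"
    unfolding bilinear_map_def
  proof (intro conjI ballI)
    fix h assume "h \<in> carrier (hom_space C a b)"
    then have [simp]: "arr C h" "src C h = a" "tgt C h = b" using Hom_iff[of a b h] by (simp_all add: hom_space_def)
    have "linear_map (hom_space K b (Unt C)) (VOb A a) (\<lambda>f. \<pi> (f \<star> J h))"
      using linear_map_comp[OF K.comp_right_linear[of "J h" "Unt C"] pi_facts(2)] by simp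
    then show "linear_map (VOb A b) (VOb A a) (VAr A h)"
      by (intro semilinear_orbit_algebra, simp, elim semilinear_map_cong)
        (use K.hom_vector_space in \<open>auto simp: hom_space_def Hom_K_iff\<close>)
  next
    fix y assume "y \<in> carrier (VOb A b)"
    then obtain f where [simp]: "arr K f" "src K f = b" "tgt K f = Unt C" "y = \<pi> f" by (rule pi_image) simp
    have "linear_map (hom_space C a b) (VOb A a) (\<lambda>h. \<pi> (f \<star> J h))"
      using linear_map_comp[OF linear_map_comp[OF J_linear[of a b]] pi_facts(2)[of a], of "\<lambda>g. f \<star> g"]
        K.comp_left_linear[of f a] by simp
    then show "linear_map (hom_space C a b) (VOb A a) (\<lambda>h. VAr A h y)"
      by (rule semilinear_map_cong) (use hom_vector_space Hom_iff[of a b] in \<open>auto simp: hom_space_def\<close>)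
  qed
next
  fix a x assume "a \<in> Obj C" "x \<in> carrier (VOb A a)"
  then show "VAr A (Idn C a) x = x" by (auto simp: Hom_K_iff J_Idn)
next
  fix a b c f g x assume "a \<in> Obj C" "b \<in> Obj C" "c \<in> Obj C" "f \<in> Hom C a b" "g \<in> Hom C b c" "x \<in> carrier (VOb A c)"
  then show "VAr A (g \<cdot> f) x = VAr A f (VAr A g x)" by (auto simp: Hom_iff J_Cmp Hom_K_iff)
next
  fix a b assume [simp]: "a \<in> Obj C" "b \<in> Obj C"
  show "bilinear_map (VOb A a) (VOb A b) (VOb A (a \<otimes>\<^sub>o b)) (AMul A a b)"
    unfolding bilinear_map_def
  proof (intro conjI ballI)
    fix x assume "x \<in> carrier (VOb A a)"
    then obtain f where [simp]: "arr K f" "src K f = a" "tgt K f = Unt C" "x = \<pi> f" by (rule pi_image) simp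
    have "linear_map (hom_space K b (Unt C)) (VOb A (a \<otimes>\<^sub>o b)) (\<lambda>g. \<pi> (mul f g))"
      using linear_map_comp[OF mul_linear_right[of f b] pi_facts(2)] by simp
    then show "linear_map (VOb A b) (VOb A (a \<otimes>\<^sub>o b)) (AMul A a b x)"
      by (intro semilinear_orbit_algebra, simp, elim semilinear_map_cong)
        (use K.hom_vector_space in \<open>auto simp: hom_space_def Hom_K_iff\<close>)
  next
    fix x assume "x \<in> carrier (VOb A b)"
    then obtain g where [simp]: "arr K g" "src K g = b" "tgt K g = Unt C" "x = \<pi> g" by (rule pi_image) simp
    have "linear_map (hom_space K a (Unt C)) (VOb A (a \<otimes>\<^sub>o b)) (\<lambda>f. \<pi> (mul f g))"
      using linear_map_comp[OF mul_linear_left[of g a] pi_facts(2)] by simp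
    then show "linear_map (VOb A a) (VOb A (a \<otimes>\<^sub>o b)) (\<lambda>y. AMul A a b y x)"
      by (intro semilinear_orbit_algebra, simp, elim semilinear_map_cong)
        (use K.hom_vector_space in \<open>auto simp: hom_space_def Hom_K_iff\<close>)
  qed
next
  fix a b a' b' f g x y
  assume "a \<in> Obj C" "b \<in> Obj C" "a' \<in> Obj C" "b' \<in> Obj C" "f \<in> Hom C a' a" "g \<in> Hom C b' b"
    "x \<in> carrier (VOb A a)" "y \<in> carrier (VOb A b)"
  then show "AMul A a' b' (VAr A f x) (VAr A g y) = VAr A (f \<otimes>\<^sub>a g) (AMul A a b x y)"
    by (auto simp: Hom_iff Hom_K_iff mul_J_J)
next
  fix a b c x y z
  assume "a \<in> Obj C" "b \<in> Obj C" "c \<in> Obj C" "x \<in> carrier (VOb A a)" "y \<in> carrier (VOb A b)" "z \<in> carrier (VOb A c)"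
  then show "AMul A (a \<otimes>\<^sub>o b) c (AMul A a b x y) z = VAr A (Asc C a b c) (AMul A a (b \<otimes>\<^sub>o c) x (AMul A b c y z))"
    by (auto simp: Hom_K_iff mul_assoc)
next
  show "AUnit A \<in> carrier (VOb A (Unt C))" by (auto simp: Hom_K_iff)
next
  fix a x assume "a \<in> Obj C" "x \<in> carrier (VOb A a)"
  then show "AMul A (Unt C) a (AUnit A) x = VAr A (LUn C a) x" "AMul A a (Unt C) x (AUnit A) = VAr A (RUn C a) x"
    by (auto simp: Hom_K_iff mul_unit_left mul_unit_right)
next
  fix a assume [simp]: "a \<in> Obj C"
  have "conj_linear_map (hom_space K a (Unt C)) (VOb A (Cj C a)) (\<lambda>f. \<pi> (j f))"
    using conj_linear_map_comp(2)[OF j_conj_linear pi_facts(2)] by simp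
  then show "conj_linear_map (VOb A a) (VOb A (Cj C a)) (AStar A a)"
    by (intro semilinear_orbit_algebra, simp, elim semilinear_map_cong)
      (use K.hom_vector_space in \<open>auto simp: hom_space_def Hom_K_iff\<close>)
next
  fix a b f x assume "a \<in> Obj C" "b \<in> Obj C" "f \<in> Hom C b a" "x \<in> carrier (VOb A a)"
  then show "AStar A b (VAr A f x) = VAr A (conj_arr C b a f) (AStar A a x)"
    by (auto simp: Hom_iff Hom_K_iff j_J)
next
  fix a x assume "a \<in> Obj C" "x \<in> carrier (VOb A a)"
  then show "VAr A (phi C a) (AStar A (Cj C a) (AStar A a x)) = x"
    by (auto simp: Hom_K_iff j_j)
next
  show "AStar A (Unt C) (AUnit A) = VAr A (inv_arr C (Unt C) (Cj C (Unt C)) (unit_conj C)) (AUnit A)"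
    by (simp add: inv_arr_unit_conj j_unit)
next
  fix a b x y assume ab: "a \<in> Obj C" "b \<in> Obj C" and xy: "x \<in> carrier (VOb A a)" "y \<in> carrier (VOb A b)"
  obtain f where f: "arr K f" "src K f = a" "tgt K f = Unt C" "x = \<pi> f" by (rule pi_image[OF xy(1) ab(1)])
  obtain g where g: "arr K g" "src K g = b" "tgt K g = Unt C" "y = \<pi> g" by (rule pi_image[OF xy(2) ab(2)])
  note [simp] = inverse_nu[OF ab]
  let ?m = "inv_arr C (Cj C b \<otimes>\<^sub>o Cj C a) (Cj C (a \<otimes>\<^sub>o b)) (nu C b a)"
  have "j (mul f g) = (j (mul f g) \<star> J (nu C b a)) \<star> J ?m"
    using f g ab by (simp add: J_comp J_Idn)
  also have "\<dots> = mul (j g) (j f) \<star> J ?m"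
    using j_mul[of f g] f g by simp
  finally show "AStar A (a \<otimes>\<^sub>o b) (AMul A a b x y) = VAr A ?m (AMul A (Cj C b) (Cj C a) (AStar A b y) (AStar A a x))"
    using f g ab by simp
qed

lemma star_presentation_orbit_algebra: "star_presentation C K J act A \<pi>"
proof (intro star_presentation.intro orbit_presentation.intro orbit_presentation_axioms.intro rigid_algebra.intro
    star_algebra_object_orbit_algebra orbit_category_axioms rigid_cstar_tensor_category_axioms)
  show "algebra_object C A"
    by (rule star_algebra_object.axioms(1)[OF star_algebra_object_orbit_algebra])
  show "bij_betw \<pi> (Hom K c (Unt C)) (carrier (VOb A c))" if "c \<in> Obj C" for c
    using pi_facts(1)[OF that] by (simp add: hom_space_def)
  show "linear_map (hom_space K c (Unt C)) (VOb A c) \<pi>" if "c \<in> Obj C" for c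
    by (rule pi_facts(2)[OF that])
qed simp_all

end

end

context rigid_algebra
begin

interpretation K: orbit_category C op_cat op_J op_act
  by (rule orbit_category_op_cat)

text \<open>
  An arrow into \<open>b\<close> is determined by one value, at \<open>Cj C b\<close> and the element of \<open>A(Cj C b \<otimes> b)\<close> given by the
  evaluation: every \<open>w\<close> is the product of \<open>w\<close> with this element, restricted along a zigzag. So the arrows
  between two objects inject into the type of the elements of \<open>A\<close>.
\<close>

definition op_code :: "'o \<times> 'o \<times> ('o \<Rightarrow> 'v \<Rightarrow> 'v) \<Rightarrow> 'v" where
  "op_code T = app T (Cj C (fst (snd T))) (VAr A (Ev C (fst (snd T))) (AUnit A))"

lemma operator_from_code:
  assumes F: "operator a b F" and [simp]: "a \<in> Obj C" "b \<in> Obj C" "x \<in> Obj C" "w \<in> carrier (VOb A (x \<otimes>\<^sub>o b))"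
  shows "F x w = VAr A (((Asc C x b (Cj C b))\<dagger> \<cdot> (Idn C x \<otimes>\<^sub>a Coev C b) \<cdot> (RUn C x)\<dagger>) \<otimes>\<^sub>a Idn C a)
    (VAr A (Asc C (x \<otimes>\<^sub>o b) (Cj C b) a) (AMul A (x \<otimes>\<^sub>o b) (Cj C b \<otimes>\<^sub>o a) w (F (Cj C b) (VAr A (Ev C b) (AUnit A)))))"
proof -
  let ?B = "Cj C b" and ?y = "x \<otimes>\<^sub>o b"
  let ?h = "(Asc C x b ?B)\<dagger> \<cdot> (Idn C x \<otimes>\<^sub>a Coev C b) \<cdot> (RUn C x)\<dagger>"
  let ?w = "VAr A (Asc C ?y ?B b) (AMul A ?y (?B \<otimes>\<^sub>o b) w (VAr A (Ev C b) (AUnit A)))"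
  have "VAr A (?h \<otimes>\<^sub>a Idn C b) ?w
      = VAr A (RUn C ?y \<cdot> (Idn C ?y \<otimes>\<^sub>a Ev C b) \<cdot> Asc C ?y ?B b \<cdot> (?h \<otimes>\<^sub>a Idn C b)) w"
    by (simp add: AMul_VAr_right AUnit_right)
  then have "VAr A (?h \<otimes>\<^sub>a Idn C b) ?w = w"
    by (simp only: zigzag_right assms) simp
  then have "F x w = F x (VAr A (?h \<otimes>\<^sub>a Idn C b) ?w)" by simp
  also have "\<dots> = VAr A (?h \<otimes>\<^sub>a Idn C a) (F (?y \<otimes>\<^sub>o ?B) ?w)"
    using operatorD(3)[OF F, of ?h ?w] by simp
  also have "F (?y \<otimes>\<^sub>o ?B) ?w = VAr A (Asc C ?y ?B a) (AMul A ?y (?B \<otimes>\<^sub>o a) w (F ?B (VAr A (Ev C b) (AUnit A))))"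
    using operatorD(4)[OF F, of ?B ?y w "VAr A (Ev C b) (AUnit A)"] by simp
  finally show ?thesis .
qed

lemma inj_on_op_code:
  assumes [simp]: "a \<in> Obj C" "b \<in> Obj C"
  shows "inj_on op_code (Hom op_cat a b)"
proof (rule inj_onI)
  fix S T assume "S \<in> Hom op_cat a b" "T \<in> Hom op_cat a b" and eq: "op_code S = op_code T"
  then obtain F G where F: "operator a b F" "S = mk_operator a b F" and G: "operator a b G" "T = mk_operator a b G"
    by auto
  have code: "F (Cj C b) (VAr A (Ev C b) (AUnit A)) = G (Cj C b) (VAr A (Ev C b) (AUnit A))"
    using eq by (simp add: op_code_def F(2) G(2))
  have "F x w = G x w" if "x \<in> Obj C" "w \<in> carrier (VOb A (x \<otimes>\<^sub>o b))" for x w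
    by (rule trans[OF operator_from_code[OF F(1) assms that] trans[OF _ operator_from_code[OF G(1) assms that, symmetric]]])
      (simp only: code)
  then show "S = T"
    unfolding F(2) G(2) by (intro mk_operator_cong) simp_all
qed

text \<open>The arrows from \<open>c\<close> to \<open>1\<close> are the right multiplications by elements of \<open>A(c)\<close>.\<close>

definition right_mult :: "'o \<Rightarrow> 'v \<Rightarrow> 'o \<Rightarrow> 'v \<Rightarrow> 'v" where
  "right_mult c f x w = AMul A x c (VAr A ((RUn C x)\<dagger>) w) f"

definition op_elem :: "'o \<times> 'o \<times> ('o \<Rightarrow> 'v \<Rightarrow> 'v) \<Rightarrow> 'v" where
  "op_elem T = VAr A ((LUn C (fst T))\<dagger>) (app T (Unt C) (VAr A (LUn C (Unt C)) (AUnit A)))"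

lemma operator_right_mult:
  assumes [simp]: "c \<in> Obj C" "f \<in> carrier (VOb A c)"
  shows "operator c (Unt C) (right_mult c f)"
  unfolding operator_def
proof (intro conjI ballI allI impI)
  fix x assume [simp]: "x \<in> Obj C"
  have "linear_map (VOb A (x \<otimes>\<^sub>o Unt C)) (VOb A x) (VAr A ((RUn C x)\<dagger>))"
    using VAr_linear[of "(RUn C x)\<dagger>"] by simp
  from linear_map_comp[OF this AMul_linear_left[of x c f]]
  show "linear_map (VOb A (x \<otimes>\<^sub>o Unt C)) (VOb A (x \<otimes>\<^sub>o c)) (right_mult c f x)"
    by (simp add: right_mult_def[abs_def])
next
  fix h w assume [simp]: "arr C h" "w \<in> carrier (VOb A (tgt C h \<otimes>\<^sub>o Unt C))"
  have "(h \<otimes>\<^sub>a Idn C (Unt C)) \<cdot> (RUn C (src C h))\<dagger> = (RUn C (tgt C h))\<dagger> \<cdot> h"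
    using RUn_dag_nat[of h] by simp
  moreover have "AMul A (src C h) c (VAr A h (VAr A ((RUn C (tgt C h))\<dagger>) w)) f
      = VAr A (h \<otimes>\<^sub>a Idn C c) (AMul A (tgt C h) c (VAr A ((RUn C (tgt C h))\<dagger>) w) f)"
    by (rule AMul_VAr_left) simp_all
  ultimately show "right_mult c f (src C h) (VAr A (h \<otimes>\<^sub>a Idn C (Unt C)) w) = VAr A (h \<otimes>\<^sub>a Idn C c) (right_mult c f (tgt C h) w)"
    by (simp add: right_mult_def)
next
  fix x y u w assume [simp]: "x \<in> Obj C" "y \<in> Obj C" "u \<in> carrier (VOb A y)" "w \<in> carrier (VOb A (x \<otimes>\<^sub>o Unt C))"
  have "VAr A ((RUn C (y \<otimes>\<^sub>o x))\<dagger>) (VAr A (Asc C y x (Unt C)) (AMul A y (x \<otimes>\<^sub>o Unt C) u w))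
      = AMul A y x u (VAr A ((RUn C x)\<dagger>) w)"
    by (simp add: RUn_dag_TOb AMul_VAr_right)
  then show "right_mult c f (y \<otimes>\<^sub>o x) (VAr A (Asc C y x (Unt C)) (AMul A y (x \<otimes>\<^sub>o Unt C) u w))
      = VAr A (Asc C y x c) (AMul A y (x \<otimes>\<^sub>o c) u (right_mult c f x w))"
    by (simp add: right_mult_def AMul_assoc del: VAr_VAr)
qed

lemma op_elem_right_mult:
  assumes [simp]: "c \<in> Obj C" "f \<in> carrier (VOb A c)"
  shows "op_elem (mk_operator c (Unt C) (right_mult c f)) = f"
  by (simp add: op_elem_def right_mult_def AUnit_left LUn_Unt)

lemma operator_from_elem:
  assumes F: "operator c (Unt C) F" and [simp]: "c \<in> Obj C" "x \<in> Obj C" "w \<in> carrier (VOb A (x \<otimes>\<^sub>o Unt C))"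
  shows "F x w = right_mult c (op_elem (mk_operator c (Unt C) F)) x w"
proof -
  let ?I = "Unt C"
  let ?i = "VAr A (LUn C ?I) (AUnit A)" and ?u = "VAr A ((RUn C x)\<dagger>) w"
  let ?w = "VAr A (Asc C x ?I ?I) (AMul A x (?I \<otimes>\<^sub>o ?I) ?u ?i)"
  note [simp] = operatorD(2)[OF F]
  have u: "RUn C x \<cdot> (Idn C x \<otimes>\<^sub>a LUn C ?I) \<cdot> Asc C x ?I ?I \<cdot> ((RUn C x)\<dagger> \<otimes>\<^sub>a Idn C ?I) = RUn C x"
    by (simp add: rewrite_head[OF triangle] interchange)
  have "VAr A ((RUn C x)\<dagger> \<otimes>\<^sub>a Idn C ?I) ?w
      = VAr A (RUn C x \<cdot> (Idn C x \<otimes>\<^sub>a LUn C ?I) \<cdot> Asc C x ?I ?I \<cdot> ((RUn C x)\<dagger> \<otimes>\<^sub>a Idn C ?I)) ?u"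
    by (simp add: AMul_VAr_right AUnit_right del: VAr_VAr) simp
  also have "\<dots> = w" unfolding u by simp
  finally have "F x w = F x (VAr A ((RUn C x)\<dagger> \<otimes>\<^sub>a Idn C ?I) ?w)" by simp
  also have "\<dots> = VAr A ((RUn C x)\<dagger> \<otimes>\<^sub>a Idn C c) (F (x \<otimes>\<^sub>o ?I) ?w)"
    using operatorD(3)[OF F, of "(RUn C x)\<dagger>" ?w] by simp
  also have "F (x \<otimes>\<^sub>o ?I) ?w = VAr A (Asc C x ?I c) (AMul A x (?I \<otimes>\<^sub>o c) ?u (F ?I ?i))"
    using operatorD(4)[OF F, of ?I x ?u ?i] by simp
  also have "VAr A ((RUn C x)\<dagger> \<otimes>\<^sub>a Idn C c) (VAr A (Asc C x ?I c) (AMul A x (?I \<otimes>\<^sub>o c) ?u (F ?I ?i)))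
      = VAr A (Idn C x \<otimes>\<^sub>a (LUn C c)\<dagger>) (AMul A x (?I \<otimes>\<^sub>o c) ?u (F ?I ?i))"
  proof -
    have "Asc C x ?I c \<cdot> ((RUn C x)\<dagger> \<otimes>\<^sub>a Idn C c) = Idn C x \<otimes>\<^sub>a (LUn C c)\<dagger>"
    proof -
      have "((RUn C x \<otimes>\<^sub>a Idn C c) \<cdot> (Asc C x ?I c)\<dagger>)\<dagger> = (Idn C x \<otimes>\<^sub>a LUn C c)\<dagger>"
        by (simp only: triangle_dag assms)
      then show ?thesis by simp
    qed
    then show ?thesis by simp
  qed
  also have "\<dots> = right_mult c (op_elem (mk_operator c ?I F)) x w"
    by (simp add: right_mult_def op_elem_def AMul_VAr_right)
  finally show ?thesis .
qed

lemma Hom_unit: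
  assumes "c \<in> Obj C"
  shows "T \<in> Hom op_cat c (Unt C) \<longleftrightarrow> (\<exists>f\<in>carrier (VOb A c). T = mk_operator c (Unt C) (right_mult c f))"
proof
  assume "T \<in> Hom op_cat c (Unt C)"
  then obtain F where F: "operator c (Unt C) F" "T = mk_operator c (Unt C) F" by auto
  have "op_elem T \<in> carrier (VOb A c)"
    using assms operatorD(2)[OF F(1)] by (simp add: op_elem_def F(2))
  moreover have "T = mk_operator c (Unt C) (right_mult c (op_elem T))"
    unfolding F(2) using operator_from_elem[OF F(1)] assms by (intro mk_operator_cong) simp_all
  ultimately show "\<exists>f\<in>carrier (VOb A c). T = mk_operator c (Unt C) (right_mult c f)" by blast
next
  assume "\<exists>f\<in>carrier (VOb A c). T = mk_operator c (Unt C) (right_mult c f)"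
  then show "T \<in> Hom op_cat c (Unt C)" using operator_right_mult[OF assms] by auto
qed

lemma orbit_presentation_op_cat: "orbit_presentation C op_cat op_J op_act A op_elem"
proof (intro orbit_presentation.intro orbit_presentation_axioms.intro orbit_category_op_cat rigid_algebra_axioms)
  fix c assume c [simp]: "c \<in> Obj C"
  show "bij_betw op_elem (Hom op_cat c (Unt C)) (carrier (VOb A c))"
  proof (rule bij_betw_byWitness[where f' = "\<lambda>f. mk_operator c (Unt C) (right_mult c f)"])
    show "\<forall>T\<in>Hom op_cat c (Unt C). mk_operator c (Unt C) (right_mult c (op_elem T)) = T"
      using Hom_unit[OF c] op_elem_right_mult[OF c] by auto
    show "\<forall>f\<in>carrier (VOb A c). op_elem (mk_operator c (Unt C) (right_mult c f)) = f"
      by (simp add: op_elem_right_mult)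
    show "op_elem ` Hom op_cat c (Unt C) \<subseteq> carrier (VOb A c)"
      using Hom_unit[OF c] op_elem_right_mult[OF c] by auto
    show "(\<lambda>f. mk_operator c (Unt C) (right_mult c f)) ` carrier (VOb A c) \<subseteq> Hom op_cat c (Unt C)"
      using operator_right_mult[OF c] by auto
  qed
  show "linear_map (hom_space op_cat c (Unt C)) (VOb A c) op_elem"
    unfolding semilinear_map_def
  proof (intro conjI ballI allI)
    note L = VAr_linear[of "(LUn C c)\<dagger>", simplified]
    show "op_elem \<in> carrier (hom_space op_cat c (Unt C)) \<rightarrow> carrier (VOb A c)"
      by (auto simp: hom_space_def op_elem_def operatorD(2))
    fix S assume "S \<in> carrier (hom_space op_cat c (Unt C))"
    then obtain F where F: "operator c (Unt C) F" "S = mk_operator c (Unt C) F" by (auto simp: hom_space_def)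
    show "op_elem (z \<odot>\<^bsub>hom_space op_cat c (Unt C)\<^esub> S) = id z \<odot>\<^bsub>VOb A c\<^esub> op_elem S" for z
      unfolding F(2) using linear_mapD(3)[OF L] operatorD(2)[OF F(1)] by (simp add: hom_space_def op_elem_def)
    fix T assume "T \<in> carrier (hom_space op_cat c (Unt C))"
    then obtain G where G: "operator c (Unt C) G" "T = mk_operator c (Unt C) G" by (auto simp: hom_space_def)
    show "op_elem (S \<oplus>\<^bsub>hom_space op_cat c (Unt C)\<^esub> T) = op_elem S \<oplus>\<^bsub>VOb A c\<^esub> op_elem T"
      unfolding F(2) G(2) using linear_mapD(2)[OF L] operatorD(2)[OF F(1)] operatorD(2)[OF G(1)]
      by (simp add: hom_space_def op_elem_def)
  qed
next
  fix f h assume f: "arr op_cat f" "tgt op_cat f = Unt C" and [simp]: "arr C h" and h: "tgt C h = src op_cat f"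
  obtain c F where F: "operator c (Unt C) F" "f = mk_operator c (Unt C) F" and [simp]: "c \<in> Obj C" "tgt C h = c"
    using f h by (elim arr_op_catE) auto
  have "Idn C (Unt C) \<otimes>\<^sub>a h = (LUn C c)\<dagger> \<cdot> h \<cdot> LUn C (src C h)"
    using LUn_nat[of h "src C h" c] by (simp flip: LUn_nat[of h "src C h" c])
  then show "op_elem (f \<cdot>\<^bsub>op_cat\<^esub> op_J h) = VAr A h (op_elem f)"
    unfolding F(2) Cmp_op_J[OF \<open>arr C h\<close> \<open>tgt C h = c\<close> F(1)]
    using operatorD(2)[OF F(1)] by (simp add: op_elem_def)
next
  fix f g assume f: "arr op_cat f" "tgt op_cat f = Unt C" and g: "arr op_cat g" "tgt op_cat g = Unt C"
  let ?I = "Unt C"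
  obtain a x where x: "x \<in> carrier (VOb A a)" "f = mk_operator a ?I (right_mult a x)" and [simp]: "a \<in> Obj C"
    using Hom_unit[of "src op_cat f" f] K.Hom_K_iff[of "src op_cat f" ?I f] K.src_tgt_K[OF f(1)] f by auto
  obtain b y where y: "y \<in> carrier (VOb A b)" "g = mk_operator b ?I (right_mult b y)" and [simp]: "b \<in> Obj C"
    using Hom_unit[of "src op_cat g" g] K.Hom_K_iff[of "src op_cat g" ?I g] K.src_tgt_K[OF g(1)] g by auto
  note F = operator_right_mult[of a x] and G = operator_right_mult[of b y]
  have src: "src op_cat f = a" "src op_cat g = b"
    using typed_mk_operator(2)[OF F] typed_mk_operator(2)[OF G] x y by auto
  have mul: "K.mul f g = mk_operator (a \<otimes>\<^sub>o b) ?I (\<lambda>z w. VAr A ((Asc C z a b)\<dagger>)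
      (right_mult b y (z \<otimes>\<^sub>o a) (VAr A (Asc C z a ?I) (VAr A (Idn C z \<otimes>\<^sub>a RUn C a) (right_mult a x z w)))))"
    unfolding K.mul_def src unfolding x(2) y(2) using x(1) y(1) F G
    by (auto simp: op_act_eq Cmp_J_op[of "RUn C a" "a \<otimes>\<^sub>o ?I"] Cmp_op right_mult_def simp del: op_cat_simps(4) intro!: mk_operator_cong)
  have 1: "right_mult a x ?I (VAr A (LUn C ?I) (AUnit A)) = VAr A (LUn C a) x"
    using x by (simp add: right_mult_def AUnit_left LUn_Unt)
  have 2: "LUn C a \<cdot> (Idn C ?I \<otimes>\<^sub>a RUn C a) \<cdot> Asc C ?I a ?I = LUn C a \<cdot> RUn C (?I \<otimes>\<^sub>o a)"
    by (simp add: RUn_TOb)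
  have 3: "right_mult b y (?I \<otimes>\<^sub>o a) (VAr A (LUn C a \<cdot> RUn C (?I \<otimes>\<^sub>o a)) x) = VAr A (LUn C a \<otimes>\<^sub>a Idn C b) (AMul A a b x y)"
    using x y by (simp add: right_mult_def AMul_VAr_left)
  have 4: "(LUn C a \<otimes>\<^sub>a Idn C b) \<cdot> (Asc C ?I a b)\<dagger> \<cdot> (LUn C (a \<otimes>\<^sub>o b))\<dagger> = Idn C (a \<otimes>\<^sub>o b)"
    by (simp flip: LUn_TOb)
  have "op_elem (K.mul f g) = VAr A ((LUn C a \<otimes>\<^sub>a Idn C b) \<cdot> (Asc C ?I a b)\<dagger> \<cdot> (LUn C (a \<otimes>\<^sub>o b))\<dagger>) (AMul A a b x y)"
    using x(1) y(1) by (simp add: mul op_elem_def 1 2 3)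
  also have "\<dots> = AMul A a b x y" unfolding 4 using x(1) y(1) by simp
  finally show "op_elem (K.mul f g) = AMul A (src op_cat f) (src op_cat g) (op_elem f) (op_elem g)"
    unfolding src unfolding x(2) y(2) using x(1) y(1) by (simp add: op_elem_right_mult)
next
  show "op_elem (Idn op_cat (Unt C)) = AUnit A"
    by (simp add: op_elem_def)
qed

end

section \<open>The orbit category of a cyclic module dagger category\<close>

locale rigid_module = rigid_cstar_tensor_category C + M: cyclic_module_dagger_category C M
  for C :: "('o, 'a, 'z) rigid_cat_scheme" (structure)
    and M :: "('m, 'y, 'o, 'a, 'w) mod_cat_scheme"
begin

abbreviation Mcomp :: "'y \<Rightarrow> 'y \<Rightarrow> 'y"  (infixr \<open>\<bullet>\<close> 70) where
  "g \<bullet> f \<equiv> g \<cdot>\<^bsub>M\<^esub> f"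

abbreviation actO :: "'o \<Rightarrow> 'm \<Rightarrow> 'm"  (infixr \<open>\<rhd>\<close> 75) where
  "c \<rhd> x \<equiv> c \<triangleright>\<^sub>o\<^bsub>M\<^esub> x"

abbreviation actA :: "'a \<Rightarrow> 'y \<Rightarrow> 'y"  (infixr \<open>\<unrhd>\<close> 75) where
  "f \<unrhd> g \<equiv> f \<triangleright>\<^sub>a\<^bsub>M\<^esub> g"

abbreviation "m \<equiv> Base M"

lemma Base_Obj [simp]: "m \<in> Obj M" by (rule M.Base_in)

lemma ActOb_Obj [simp]: "\<lbrakk>c \<in> Obj C; x \<in> Obj M\<rbrakk> \<Longrightarrow> c \<rhd> x \<in> Obj M" by (rule M.ActOb_in)

lemma typed_ActAr [simp]:
  assumes "arr C f" "arr M g"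
  shows "arr M (f \<unrhd> g)" "src M (f \<unrhd> g) = src C f \<rhd> src M g" "tgt M (f \<unrhd> g) = tgt C f \<rhd> tgt M g"
proof -
  have "f \<unrhd> g \<in> Hom M (src C f \<rhd> src M g) (tgt C f \<rhd> tgt M g)"
    using M.ActAr_bilinear[of "src C f" "tgt C f" "src M g" "tgt M g"] arr_in_Hom[of f] M.arr_in_Hom[of g] assms
    by (auto simp: bilinear_map_def semilinear_map_def hom_space_def)
  from M.typed_arrow[OF _ _ this] assms
  show "arr M (f \<unrhd> g)" "src M (f \<unrhd> g) = src C f \<rhd> src M g" "tgt M (f \<unrhd> g) = tgt C f \<rhd> tgt M g" by auto
qed

lemma act_interchange:
  "\<lbrakk>arr C f; arr C g; arr M f'; arr M g'; tgt C f = src C g; tgt M f' = src M g'\<rbrakk>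
    \<Longrightarrow> (g \<unrhd> g') \<bullet> (f \<unrhd> f') = (g \<cdot> f) \<unrhd> (g' \<bullet> f')"
  using M.ActAr_Cmp[of "src C f" "src C g" "tgt C g" "src M f'" "src M g'" "tgt M g'" f g f' g']
    arr_in_Hom[of f] arr_in_Hom[of g] M.arr_in_Hom[of f'] M.arr_in_Hom[of g'] by simp

lemma act_interchange_head:
  "\<lbrakk>arr C f; arr C g; arr M f'; arr M g'; tgt C f = src C g; tgt M f' = src M g';
    arr M k; tgt M k = src C f \<rhd> src M f'\<rbrakk>
    \<Longrightarrow> (g \<unrhd> g') \<bullet> ((f \<unrhd> f') \<bullet> k) = ((g \<cdot> f) \<unrhd> (g' \<bullet> f')) \<bullet> k"
  by (rule M.rewrite_head[OF act_interchange]) auto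

lemmas act_merge = act_interchange act_interchange_head

lemma ActAr_Idn_Idn [simp]: "\<lbrakk>c \<in> Obj C; x \<in> Obj M\<rbrakk> \<Longrightarrow> Idn C c \<unrhd> Idn M x = Idn M (c \<rhd> x)"
  by (rule M.ActAr_Idn)

lemma dag_ActAr [simp]: "\<lbrakk>arr C f; arr M g\<rbrakk> \<Longrightarrow> (f \<unrhd> g)\<dagger>\<^bsub>M\<^esub> = f\<dagger> \<unrhd> g\<dagger>\<^bsub>M\<^esub>"
  using M.ActAr_Dag[of "src C f" "tgt C f" "src M g" "tgt M g" f g] arr_in_Hom[of f] M.arr_in_Hom[of g] by simp

lemma typed_MAsc [simp]:
  assumes "a \<in> Obj C" "b \<in> Obj C" "x \<in> Obj M"
  shows "arr M (MAsc M a b x)" "src M (MAsc M a b x) = (a \<otimes>\<^sub>o b) \<rhd> x" "tgt M (MAsc M a b x) = a \<rhd> b \<rhd> x"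
  and MAsc_dag_MAsc [simp]: "(MAsc M a b x)\<dagger>\<^bsub>M\<^esub> \<bullet> MAsc M a b x = Idn M ((a \<otimes>\<^sub>o b) \<rhd> x)"
  and MAsc_MAsc_dag [simp]: "MAsc M a b x \<bullet> (MAsc M a b x)\<dagger>\<^bsub>M\<^esub> = Idn M (a \<rhd> b \<rhd> x)"
  using M.MAsc_unitary[OF assms] assms by (simp_all add: M.unitary_iff)

lemma typed_MUn [simp]:
  assumes "x \<in> Obj M"
  shows "arr M (MUn M x)" "src M (MUn M x) = Unt C \<rhd> x" "tgt M (MUn M x) = x"
  and MUn_dag_MUn [simp]: "(MUn M x)\<dagger>\<^bsub>M\<^esub> \<bullet> MUn M x = Idn M (Unt C \<rhd> x)"
  and MUn_MUn_dag [simp]: "MUn M x \<bullet> (MUn M x)\<dagger>\<^bsub>M\<^esub> = Idn M x"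
  using M.MUn_unitary[OF assms] assms by (simp_all add: M.unitary_iff)

lemma module_cancel [simp]:
  "\<lbrakk>a \<in> Obj C; b \<in> Obj C; x \<in> Obj M; arr M k; tgt M k = (a \<otimes>\<^sub>o b) \<rhd> x\<rbrakk>
    \<Longrightarrow> (MAsc M a b x)\<dagger>\<^bsub>M\<^esub> \<bullet> (MAsc M a b x \<bullet> k) = k"
  "\<lbrakk>a \<in> Obj C; b \<in> Obj C; x \<in> Obj M; arr M k; tgt M k = a \<rhd> b \<rhd> x\<rbrakk>
    \<Longrightarrow> MAsc M a b x \<bullet> ((MAsc M a b x)\<dagger>\<^bsub>M\<^esub> \<bullet> k) = k"
  "\<lbrakk>x \<in> Obj M; arr M k; tgt M k = Unt C \<rhd> x\<rbrakk> \<Longrightarrow> (MUn M x)\<dagger>\<^bsub>M\<^esub> \<bullet> (MUn M x \<bullet> k) = k"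
  "\<lbrakk>x \<in> Obj M; arr M k; tgt M k = x\<rbrakk> \<Longrightarrow> MUn M x \<bullet> ((MUn M x)\<dagger>\<^bsub>M\<^esub> \<bullet> k) = k"
  by (rule M.comp_inverse_cancel; simp)+

lemma MAsc_nat:
  "\<lbrakk>arr C f; arr C g; arr M h; a = src C f; b = src C g; x = src M h; a' = tgt C f; b' = tgt C g; x' = tgt M h\<rbrakk>
    \<Longrightarrow> MAsc M a' b' x' \<bullet> ((f \<otimes>\<^sub>a g) \<unrhd> h) = (f \<unrhd> (g \<unrhd> h)) \<bullet> MAsc M a b x"
  using M.MAsc_natural[of "src C f" "src C g" "src M h" "tgt C f" "tgt C g" "tgt M h" f g h]
    arr_in_Hom[of f] arr_in_Hom[of g] M.arr_in_Hom[of h] by simp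

lemma MAsc_nat_conj:
  assumes "arr C f" "arr C g" "arr M h" "a = src C f" "b = src C g" "x = src M h" "a' = tgt C f" "b' = tgt C g" "x' = tgt M h"
  shows "(MAsc M a' b' x')\<dagger>\<^bsub>M\<^esub> \<bullet> (f \<unrhd> (g \<unrhd> h)) \<bullet> MAsc M a b x = (f \<otimes>\<^sub>a g) \<unrhd> h"
  by (subst MAsc_nat[OF assms, symmetric]) (use assms in simp)

lemma MUn_nat: "\<lbrakk>arr M h; x = src M h; y = tgt M h\<rbrakk> \<Longrightarrow> MUn M y \<bullet> (Idn C (Unt C) \<unrhd> h) = h \<bullet> MUn M x"
  using M.MUn_natural[of "src M h" "tgt M h" h] M.arr_in_Hom[of h] by simp

lemma act_unit_inj:
  assumes "Idn C (Unt C) \<unrhd> f = Idn C (Unt C) \<unrhd> g" "arr M f" "arr M g" "src M f = src M g" "tgt M f = tgt M g"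
  shows "f = g"
proof -
  have "f \<bullet> MUn M (src M f) = g \<bullet> MUn M (src M f)"
    using assms MUn_nat[of f "src M f" "tgt M f"] MUn_nat[of g "src M g" "tgt M g"] by simp
  then show ?thesis by (rule M.epi_cancel[where g = "(MUn M (src M f))\<dagger>\<^bsub>M\<^esub>"]) (use assms in auto)
qed

text \<open>
  Kelly's argument again, now for the module category: acting with the unit is faithful, and after
  it the two sides are the two paths around the module pentagon.
\<close>

lemma MUn_act:
  assumes [simp]: "b \<in> Obj C" "x \<in> Obj M"
  shows "MUn M (b \<rhd> x) \<bullet> MAsc M (Unt C) b x = LUn C b \<unrhd> Idn M x"
proof (rule act_unit_inj)
  let ?I = "Unt C"
  let ?w = "MAsc M ?I (?I \<otimes>\<^sub>o b) x \<bullet> (Asc C ?I ?I b \<unrhd> Idn M x)"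
  have 1: "MAsc M ?I b x \<bullet> ((RUn C ?I \<otimes>\<^sub>a Idn C b) \<unrhd> Idn M x) = (RUn C ?I \<unrhd> (Idn C b \<unrhd> Idn M x)) \<bullet> MAsc M (?I \<otimes>\<^sub>o ?I) b x"
    by (rule MAsc_nat) simp_all
  have 2: "MAsc M ?I b x \<bullet> ((Idn C ?I \<otimes>\<^sub>a LUn C b) \<unrhd> Idn M x) = (Idn C ?I \<unrhd> (LUn C b \<unrhd> Idn M x)) \<bullet> MAsc M ?I (?I \<otimes>\<^sub>o b) x"
    by (rule MAsc_nat) simp_all
  have "(Idn C ?I \<unrhd> (MUn M (b \<rhd> x) \<bullet> MAsc M ?I b x)) \<bullet> ?w
      = (Idn C ?I \<unrhd> MUn M (b \<rhd> x)) \<bullet> ((Idn C ?I \<unrhd> MAsc M ?I b x) \<bullet> ?w)"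
    by (simp add: act_interchange_head)
  also have "\<dots> = ((Idn C ?I \<unrhd> MUn M (b \<rhd> x)) \<bullet> MAsc M ?I ?I (b \<rhd> x)) \<bullet> MAsc M (?I \<otimes>\<^sub>o ?I) b x"
    by (simp add: M.module_pentagon)
  also have "\<dots> = (RUn C ?I \<unrhd> (Idn C b \<unrhd> Idn M x)) \<bullet> MAsc M (?I \<otimes>\<^sub>o ?I) b x"
    by (simp add: M.module_triangle)
  also have "\<dots> = MAsc M ?I b x \<bullet> (((Idn C ?I \<otimes>\<^sub>a LUn C b) \<cdot> Asc C ?I ?I b) \<unrhd> Idn M x)"
    unfolding 1[symmetric] by (simp add: triangle)
  also have "\<dots> = (MAsc M ?I b x \<bullet> ((Idn C ?I \<otimes>\<^sub>a LUn C b) \<unrhd> Idn M x)) \<bullet> (Asc C ?I ?I b \<unrhd> Idn M x)"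
    by (simp add: act_interchange)
  also have "\<dots> = (Idn C ?I \<unrhd> (LUn C b \<unrhd> Idn M x)) \<bullet> ?w"
    unfolding 2 by simp
  finally show "Idn C ?I \<unrhd> (MUn M (b \<rhd> x) \<bullet> MAsc M ?I b x) = Idn C ?I \<unrhd> (LUn C b \<unrhd> Idn M x)"
    by (rule M.epi_cancel[where g = "((Asc C ?I ?I b)\<dagger> \<unrhd> Idn M x) \<bullet> (MAsc M ?I (?I \<otimes>\<^sub>o b) x)\<dagger>\<^bsub>M\<^esub>"])
      (simp_all add: act_interchange_head)
qed simp_all

text \<open>
  The arrows carry their source and target in \<open>C\<close>, since different objects of \<open>C\<close> can act on the
  basepoint in the same way.
\<close>

definition orb :: "('o, 'o \<times> 'o \<times> 'y) lin_cat" where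
  "orb = \<lparr>Obj = Obj C, Hom = (\<lambda>a b. {(a, b, f) |f. f \<in> Hom M (a \<rhd> m) (b \<rhd> m)}),
     Idn = (\<lambda>a. (a, a, Idn M (a \<rhd> m))),
     Cmp = (\<lambda>S T. (fst T, fst (snd S), snd (snd S) \<bullet> snd (snd T))),
     HZero = (\<lambda>a b. (a, b, HZero M (a \<rhd> m) (b \<rhd> m))),
     HAdd = (\<lambda>S T. (fst S, fst (snd S), HAdd M (snd (snd S)) (snd (snd T)))),
     HScale = (\<lambda>z T. (fst T, fst (snd T), HScale M z (snd (snd T))))\<rparr>"

definition orb_J :: "'a \<Rightarrow> 'o \<times> 'o \<times> 'y" where
  "orb_J f = (src C f, tgt C f, f \<unrhd> Idn M m)"

definition orb_act :: "'o \<Rightarrow> 'o \<times> 'o \<times> 'y \<Rightarrow> 'o \<times> 'o \<times> 'y" where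
  "orb_act c T = (c \<otimes>\<^sub>o fst T, c \<otimes>\<^sub>o fst (snd T),
     (MAsc M c (fst (snd T)) m)\<dagger>\<^bsub>M\<^esub> \<bullet> (Idn C c \<unrhd> snd (snd T)) \<bullet> MAsc M c (fst T) m)"

definition orb_dag :: "'o \<times> 'o \<times> 'y \<Rightarrow> 'o \<times> 'o \<times> 'y" where
  "orb_dag T = (fst (snd T), fst T, (snd (snd T))\<dagger>\<^bsub>M\<^esub>)"

lemma orb_simps [simp]:
  "Obj orb = Obj C" "Hom orb a b = {(a, b, f) |f. f \<in> Hom M (a \<rhd> m) (b \<rhd> m)}"
  "Idn orb a = (a, a, Idn M (a \<rhd> m))"
  "(b', c, g) \<cdot>\<^bsub>orb\<^esub> (a, b, f) = (a, c, g \<bullet> f)"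
  by (simp_all add: orb_def)

lemma hom_space_orb:
  "carrier (hom_space orb a b) = Pair a ` Pair b ` Hom M (a \<rhd> m) (b \<rhd> m)"
  "add (hom_space orb a b) (a, b, f) (a', b', g) = (a, b, add (hom_space M (a \<rhd> m) (b \<rhd> m)) f g)"
  "smult (hom_space orb a b) z (a, b, f) = (a, b, smult (hom_space M (a \<rhd> m) (b \<rhd> m)) z f)"
  "zero (hom_space orb a b) = (a, b, zero (hom_space M (a \<rhd> m) (b \<rhd> m)))"
  by (auto simp: hom_space_def orb_def)

lemma tag_linear:
  assumes "a \<in> Obj C" "b \<in> Obj C"
  shows "linear_map (hom_space M (a \<rhd> m) (b \<rhd> m)) (hom_space orb a b) (\<lambda>f. (a, b, f))"
    "linear_map (hom_space orb a b) (hom_space M (a \<rhd> m) (b \<rhd> m)) (\<lambda>T. snd (snd T))"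
  by (auto simp: semilinear_map_def hom_space_orb) (auto simp: hom_space_def)

lemma linear_category_orb: "linear_category orb"
proof (intro linear_category.intro linear_category_axioms.intro category.intro)
  fix a b assume "a \<in> Obj orb" "b \<in> Obj orb"
  then have ab: "a \<rhd> m \<in> Obj M" "b \<rhd> m \<in> Obj M" and [simp]: "a \<in> Obj C" "b \<in> Obj C" by auto
  show "cvector_space (hom_space orb a b)"
  proof (rule cvector_space_image[OF M.hom_vector_space[OF ab]])
    show "bij_betw (\<lambda>f. (a, b, f)) (carrier (hom_space M (a \<rhd> m) (b \<rhd> m))) (carrier (hom_space orb a b))"
      by (auto simp: bij_betw_def inj_on_def hom_space_orb hom_space_def)
  qed (simp_all add: tag_linear hom_space_orb)
next
  fix a b c assume "a \<in> Obj orb" "b \<in> Obj orb" "c \<in> Obj orb"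
  then have [simp]: "a \<in> Obj C" "b \<in> Obj C" "c \<in> Obj C" by auto
  show "bilinear_map (hom_space orb b c) (hom_space orb a b) (hom_space orb a c) (\<lambda>g f. g \<cdot>\<^bsub>orb\<^esub> f)"
    unfolding bilinear_map_def
  proof (intro conjI ballI)
    fix S assume "S \<in> carrier (hom_space orb b c)"
    then obtain g where g: "g \<in> Hom M (b \<rhd> m) (c \<rhd> m)" "S = (b, c, g)" by (auto simp: hom_space_def)
    then have [simp]: "arr M g" "src M g = b \<rhd> m" "tgt M g = c \<rhd> m" by (simp_all add: M.Hom_iff)
    have 1: "linear_map (hom_space M (a \<rhd> m) (b \<rhd> m)) (hom_space M (a \<rhd> m) (c \<rhd> m)) (\<lambda>f. g \<bullet> f)"
      using M.comp_left_linear[of g "a \<rhd> m"] by simp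
    have "linear_map (hom_space orb a b) (hom_space orb a c) (\<lambda>T. (a, c, g \<bullet> snd (snd T)))"
      by (rule linear_map_comp[OF linear_map_comp[OF tag_linear(2) 1] tag_linear(1)]) simp_all
    then show "linear_map (hom_space orb a b) (hom_space orb a c) (\<lambda>T. S \<cdot>\<^bsub>orb\<^esub> T)"
      unfolding g(2) orb_def by (auto simp: semilinear_map_def hom_space_def M.Hom_iff)
  next
    fix T assume "T \<in> carrier (hom_space orb a b)"
    then obtain f where f: "f \<in> Hom M (a \<rhd> m) (b \<rhd> m)" "T = (a, b, f)" by (auto simp: hom_space_def)
    then have [simp]: "arr M f" "src M f = a \<rhd> m" "tgt M f = b \<rhd> m" by (simp_all add: M.Hom_iff)
    have 1: "linear_map (hom_space M (b \<rhd> m) (c \<rhd> m)) (hom_space M (a \<rhd> m) (c \<rhd> m)) (\<lambda>g. g \<bullet> f)"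
      using M.comp_right_linear[of f "c \<rhd> m"] by simp
    have "linear_map (hom_space orb b c) (hom_space orb a c) (\<lambda>S. (a, c, snd (snd S) \<bullet> f))"
      by (rule linear_map_comp[OF linear_map_comp[OF tag_linear(2) 1] tag_linear(1)]) simp_all
    then show "linear_map (hom_space orb b c) (hom_space orb a c) (\<lambda>S. S \<cdot>\<^bsub>orb\<^esub> T)"
      unfolding f(2) orb_def by (auto simp: semilinear_map_def hom_space_def M.Hom_iff)
  qed
qed (auto simp: M.Hom_iff)

lemma typed_orb:
  assumes "a \<in> Obj C" "b \<in> Obj C" "f \<in> Hom M (a \<rhd> m) (b \<rhd> m)"
  shows "arr orb (a, b, f)" "src orb (a, b, f) = a" "tgt orb (a, b, f) = b"
proof -
  interpret O: linear_category orb by (rule linear_category_orb)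
  show "arr orb (a, b, f)" "src orb (a, b, f) = a" "tgt orb (a, b, f) = b"
    using O.typed_arrow[of a b "(a, b, f)"] assms by simp_all
qed

lemma arr_orbE:
  assumes "arr orb T"
  obtains a b f where "T = (a, b, f)" "a \<in> Obj C" "b \<in> Obj C" "arr M f" "src M f = a \<rhd> m" "tgt M f = b \<rhd> m"
    "src orb T = a" "tgt orb T = b"
proof -
  interpret O: linear_category orb by (rule linear_category_orb)
  show ?thesis using O.arr_in_Hom[OF assms] that by (auto simp: M.Hom_iff)
qed

lemma act_linear_M:
  assumes [simp]: "c \<in> Obj C" "x \<in> Obj M" "y \<in> Obj M"
  shows "linear_map (hom_space M x y) (hom_space M (c \<rhd> x) (c \<rhd> y)) (\<lambda>f. Idn C c \<unrhd> f)"
  using M.ActAr_bilinear[of c c x y] Idn_in[of c] by (simp add: bilinear_map_def hom_space_def)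

lemma orbit_category_orb: "orbit_category C orb orb_J orb_act"
proof (intro orbit_category.intro orbit_category_axioms.intro rigid_cstar_tensor_category_axioms linear_category_orb)
  show "Obj orb = Obj C" by simp
next
  fix a b assume ab [simp]: "a \<in> Obj C" "b \<in> Obj C"
  have 1: "linear_map (hom_space C a b) (hom_space M (a \<rhd> m) (b \<rhd> m)) (\<lambda>f. f \<unrhd> Idn M m)"
    using M.ActAr_bilinear[of a b m m] M.Idn_in[of m] by (simp add: bilinear_map_def hom_space_def)
  show "linear_map (hom_space C a b) (hom_space orb a b) orb_J"
    using linear_map_comp[OF 1 tag_linear(1)[OF ab]]
    by (rule semilinear_map_cong) (use hom_vector_space in \<open>auto simp: orb_J_def hom_space_def Hom_iff\<close>)
next
  fix a assume "a \<in> Obj C" then show "orb_J (Idn C a) = Idn orb a" by (simp add: orb_J_def)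
next
  fix f g assume "arr C f" "arr C g" "tgt C f = src C g"
  then show "orb_J (g \<cdot> f) = orb_J g \<cdot>\<^bsub>orb\<^esub> orb_J f" by (simp add: orb_J_def act_interchange)
next
  fix a b c assume [simp]: "a \<in> Obj C" "b \<in> Obj C" "c \<in> Obj C"
  have 1: "linear_map (hom_space M (c \<rhd> a \<rhd> m) (c \<rhd> b \<rhd> m)) (hom_space M ((c \<otimes>\<^sub>o a) \<rhd> m) (c \<rhd> b \<rhd> m)) (\<lambda>f. f \<bullet> MAsc M c a m)"
    using M.comp_right_linear[of "MAsc M c a m" "c \<rhd> b \<rhd> m"] by simp
  have 2: "linear_map (hom_space M ((c \<otimes>\<^sub>o a) \<rhd> m) (c \<rhd> b \<rhd> m)) (hom_space M ((c \<otimes>\<^sub>o a) \<rhd> m) ((c \<otimes>\<^sub>o b) \<rhd> m)) (\<lambda>f. (MAsc M c b m)\<dagger>\<^bsub>M\<^esub> \<bullet> f)"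
    using M.comp_left_linear[of "(MAsc M c b m)\<dagger>\<^bsub>M\<^esub>" "(c \<otimes>\<^sub>o a) \<rhd> m"] by simp
  have "linear_map (hom_space orb a b) (hom_space orb (c \<otimes>\<^sub>o a) (c \<otimes>\<^sub>o b))
     (\<lambda>T. (c \<otimes>\<^sub>o a, c \<otimes>\<^sub>o b, (MAsc M c b m)\<dagger>\<^bsub>M\<^esub> \<bullet> (Idn C c \<unrhd> snd (snd T)) \<bullet> MAsc M c a m))"
    using linear_map_comp[OF linear_map_comp[OF linear_map_comp[OF linear_map_comp[OF tag_linear(2) act_linear_M] 1] 2] tag_linear(1)]
    by simp
  then show "linear_map (hom_space orb a b) (hom_space orb (c \<otimes>\<^sub>o a) (c \<otimes>\<^sub>o b)) (orb_act c)"
    by (rule semilinear_map_cong)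
      (use linear_category.hom_vector_space[OF linear_category_orb] in \<open>auto simp: orb_act_def hom_space_def\<close>)
next
  fix c S T assume [simp]: "c \<in> Obj C" and "arr orb T" "arr orb S" "tgt orb T = src orb S"
  then show "orb_act c (S \<cdot>\<^bsub>orb\<^esub> T) = orb_act c S \<cdot>\<^bsub>orb\<^esub> orb_act c T"
    by (elim arr_orbE) (simp add: orb_act_def act_merge)
next
  fix c f assume "c \<in> Obj C" "arr C f"
  then show "orb_act c (orb_J f) = orb_J (Idn C c \<otimes>\<^sub>a f)"
    by (simp add: orb_act_def orb_J_def MAsc_nat_conj)
next
  fix f T assume [simp]: "arr C f" and "arr orb T"
  then obtain a b t where T: "T = (a, b, t)" "src orb T = a" "tgt orb T = b"
    and [simp]: "a \<in> Obj C" "b \<in> Obj C" "arr M t" "src M t = a \<rhd> m" "tgt M t = b \<rhd> m" by (elim arr_orbE)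
  let ?c = "src C f" and ?d = "tgt C f"
  have 1: "(MAsc M ?d b m)\<dagger>\<^bsub>M\<^esub> \<bullet> (f \<unrhd> Idn M (b \<rhd> m)) = ((f \<otimes>\<^sub>a Idn C b) \<unrhd> Idn M m) \<bullet> (MAsc M ?c b m)\<dagger>\<^bsub>M\<^esub>"
    using MAsc_nat_conj[of f "Idn C b" "Idn M m" ?c b m ?d b m, symmetric] by simp
  have 2: "MAsc M ?d a m \<bullet> ((f \<otimes>\<^sub>a Idn C a) \<unrhd> Idn M m) = (f \<unrhd> Idn M (a \<rhd> m)) \<bullet> MAsc M ?c a m"
    using MAsc_nat[of f "Idn C a" "Idn M m" ?c a m ?d a m] by simp
  have "((f \<otimes>\<^sub>a Idn C b) \<unrhd> Idn M m) \<bullet> (MAsc M ?c b m)\<dagger>\<^bsub>M\<^esub> \<bullet> (Idn C ?c \<unrhd> t) \<bullet> MAsc M ?c a m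
      = ((MAsc M ?d b m)\<dagger>\<^bsub>M\<^esub> \<bullet> (f \<unrhd> Idn M (b \<rhd> m))) \<bullet> (Idn C ?c \<unrhd> t) \<bullet> MAsc M ?c a m"
    unfolding 1 by simp
  also have "\<dots> = (MAsc M ?d b m)\<dagger>\<^bsub>M\<^esub> \<bullet> (Idn C ?d \<unrhd> t) \<bullet> ((f \<unrhd> Idn M (a \<rhd> m)) \<bullet> MAsc M ?c a m)"
    by (simp add: act_interchange_head)
  also have "\<dots> = ((MAsc M ?d b m)\<dagger>\<^bsub>M\<^esub> \<bullet> (Idn C ?d \<unrhd> t) \<bullet> MAsc M ?d a m) \<bullet> ((f \<otimes>\<^sub>a Idn C a) \<unrhd> Idn M m)"
    unfolding 2[symmetric] by simp
  finally show "orb_J (f \<otimes>\<^sub>a Idn C (tgt orb T)) \<cdot>\<^bsub>orb\<^esub> orb_act ?c T = orb_act ?d T \<cdot>\<^bsub>orb\<^esub> orb_J (f \<otimes>\<^sub>a Idn C (src orb T))"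
    unfolding T(2,3) by (simp add: T(1) orb_act_def orb_J_def)
next
  fix c d T assume [simp]: "c \<in> Obj C" "d \<in> Obj C" and "arr orb T"
  then obtain a b t where T: "T = (a, b, t)" "src orb T = a" "tgt orb T = b"
    and [simp]: "a \<in> Obj C" "b \<in> Obj C" "arr M t" "src M t = a \<rhd> m" "tgt M t = b \<rhd> m" by (elim arr_orbE)
  have p: "(Asc C c d b \<unrhd> Idn M m) \<bullet> (MAsc M (c \<otimes>\<^sub>o d) b m)\<dagger>\<^bsub>M\<^esub>
      = (MAsc M c (d \<otimes>\<^sub>o b) m)\<dagger>\<^bsub>M\<^esub> \<bullet> (Idn C c \<unrhd> (MAsc M d b m)\<dagger>\<^bsub>M\<^esub>) \<bullet> MAsc M c d (b \<rhd> m)"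
  proof -
    have "(Idn C c \<unrhd> (MAsc M d b m)\<dagger>\<^bsub>M\<^esub>) \<bullet> (MAsc M c d (b \<rhd> m) \<bullet> MAsc M (c \<otimes>\<^sub>o d) b m)
        = MAsc M c (d \<otimes>\<^sub>o b) m \<bullet> (Asc C c d b \<unrhd> Idn M m)"
      by (subst M.module_pentagon[symmetric]) (simp_all add: act_interchange_head)
    then have "(MAsc M c (d \<otimes>\<^sub>o b) m)\<dagger>\<^bsub>M\<^esub> \<bullet> ((Idn C c \<unrhd> (MAsc M d b m)\<dagger>\<^bsub>M\<^esub>) \<bullet> (MAsc M c d (b \<rhd> m) \<bullet> MAsc M (c \<otimes>\<^sub>o d) b m)) \<bullet> (MAsc M (c \<otimes>\<^sub>o d) b m)\<dagger>\<^bsub>M\<^esub>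
        = (Asc C c d b \<unrhd> Idn M m) \<bullet> (MAsc M (c \<otimes>\<^sub>o d) b m)\<dagger>\<^bsub>M\<^esub>" by simp
    then show ?thesis by simp
  qed
  have n: "MAsc M c d (b \<rhd> m) \<bullet> (Idn C (c \<otimes>\<^sub>o d) \<unrhd> t) = (Idn C c \<unrhd> (Idn C d \<unrhd> t)) \<bullet> MAsc M c d (a \<rhd> m)"
    using MAsc_nat[of "Idn C c" "Idn C d" t] by simp
  have "(Asc C c d b \<unrhd> Idn M m) \<bullet> (MAsc M (c \<otimes>\<^sub>o d) b m)\<dagger>\<^bsub>M\<^esub> \<bullet> (Idn C (c \<otimes>\<^sub>o d) \<unrhd> t) \<bullet> MAsc M (c \<otimes>\<^sub>o d) a m
      = ((Asc C c d b \<unrhd> Idn M m) \<bullet> (MAsc M (c \<otimes>\<^sub>o d) b m)\<dagger>\<^bsub>M\<^esub>) \<bullet> (Idn C (c \<otimes>\<^sub>o d) \<unrhd> t) \<bullet> MAsc M (c \<otimes>\<^sub>o d) a m"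
    by simp
  also have "\<dots> = (MAsc M c (d \<otimes>\<^sub>o b) m)\<dagger>\<^bsub>M\<^esub> \<bullet> (Idn C c \<unrhd> (MAsc M d b m)\<dagger>\<^bsub>M\<^esub>) \<bullet> (MAsc M c d (b \<rhd> m) \<bullet> (Idn C (c \<otimes>\<^sub>o d) \<unrhd> t)) \<bullet> MAsc M (c \<otimes>\<^sub>o d) a m"
    unfolding p by simp
  also have "\<dots> = (MAsc M c (d \<otimes>\<^sub>o b) m)\<dagger>\<^bsub>M\<^esub> \<bullet> (Idn C c \<unrhd> ((MAsc M d b m)\<dagger>\<^bsub>M\<^esub> \<bullet> (Idn C d \<unrhd> t))) \<bullet> (MAsc M c d (a \<rhd> m) \<bullet> MAsc M (c \<otimes>\<^sub>o d) a m)"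
    unfolding n by (simp add: act_interchange_head)
  also have "\<dots> = ((MAsc M c (d \<otimes>\<^sub>o b) m)\<dagger>\<^bsub>M\<^esub> \<bullet> (Idn C c \<unrhd> ((MAsc M d b m)\<dagger>\<^bsub>M\<^esub> \<bullet> (Idn C d \<unrhd> t) \<bullet> MAsc M d a m)) \<bullet> MAsc M c (d \<otimes>\<^sub>o a) m) \<bullet> (Asc C c d a \<unrhd> Idn M m)"
    by (subst M.module_pentagon[symmetric]) (simp_all add: act_interchange_head)
  finally show "orb_J (Asc C c d (tgt orb T)) \<cdot>\<^bsub>orb\<^esub> orb_act (c \<otimes>\<^sub>o d) T = orb_act c (orb_act d T) \<cdot>\<^bsub>orb\<^esub> orb_J (Asc C c d (src orb T))"
    unfolding T(2,3) by (simp add: T(1) orb_act_def orb_J_def)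
next
  fix T assume "arr orb T"
  then obtain a b t where T: "T = (a, b, t)" "src orb T = a" "tgt orb T = b"
    and [simp]: "a \<in> Obj C" "b \<in> Obj C" "arr M t" "src M t = a \<rhd> m" "tgt M t = b \<rhd> m" by (elim arr_orbE)
  let ?I = "Unt C"
  have "(LUn C b \<unrhd> Idn M m) \<bullet> (MAsc M ?I b m)\<dagger>\<^bsub>M\<^esub> \<bullet> (Idn C ?I \<unrhd> t) \<bullet> MAsc M ?I a m
      = (MUn M (b \<rhd> m) \<bullet> (Idn C ?I \<unrhd> t)) \<bullet> MAsc M ?I a m"
    by (simp flip: MUn_act)
  also have "\<dots> = t \<bullet> (LUn C a \<unrhd> Idn M m)"
    by (simp add: MUn_nat flip: MUn_act)
  finally show "orb_J (LUn C (tgt orb T)) \<cdot>\<^bsub>orb\<^esub> orb_act ?I T = T \<cdot>\<^bsub>orb\<^esub> orb_J (LUn C (src orb T))"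
    unfolding T(2,3) by (simp add: T(1) orb_act_def orb_J_def)
qed

lemma orbit_dagger_orb: "orbit_dagger C orb orb_J orb_act orb_dag"
proof (intro orbit_dagger.intro orbit_dagger_axioms.intro orbit_category_orb)
  fix a b assume ab [simp]: "a \<in> Obj C" "b \<in> Obj C"
  have "conj_linear_map (hom_space orb a b) (hom_space orb b a) (\<lambda>T. (b, a, (snd (snd T))\<dagger>\<^bsub>M\<^esub>))"
    using conj_linear_map_comp(2)[OF conj_linear_map_comp(1)[OF tag_linear(2)[OF ab] M.Dag_conj_linear] tag_linear(1)[of b a]] by simp
  then show "conj_linear_map (hom_space orb a b) (hom_space orb b a) orb_dag"
    by (rule semilinear_map_cong)
      (use linear_category.hom_vector_space[OF linear_category_orb] in \<open>auto simp: orb_dag_def hom_space_def\<close>)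
next
  fix T assume "arr orb T"
  then show "orb_dag (orb_dag T) = T" by (elim arr_orbE) (simp add: orb_dag_def)
next
  fix S T assume "arr orb T" "arr orb S" "tgt orb T = src orb S"
  then show "orb_dag (S \<cdot>\<^bsub>orb\<^esub> T) = orb_dag T \<cdot>\<^bsub>orb\<^esub> orb_dag S"
    by (elim arr_orbE) (simp add: orb_dag_def)
next
  fix f assume "arr C f"
  then show "orb_dag (orb_J f) = orb_J (f\<dagger>)" by (simp add: orb_dag_def orb_J_def)
next
  fix c T assume "c \<in> Obj C" "arr orb T"
  then show "orb_dag (orb_act c T) = orb_act c (orb_dag T)"
    by (elim arr_orbE) (simp add: orb_dag_def orb_act_def)
qed

end

section \<open>Module functors and orbit functors\<close>

locale rigid_module_pair = X: rigid_module C M + Y: rigid_module C N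
  for C :: "('o, 'a, 'z) rigid_cat_scheme" (structure)
    and M :: "('m, 'y, 'o, 'a, 'w) mod_cat_scheme"
    and N :: "('n, 'x, 'o, 'a, 'v) mod_cat_scheme"
begin

abbreviation Ncomp :: "'x \<Rightarrow> 'x \<Rightarrow> 'x"  (infixr \<open>\<diamondop>\<close> 70) where "g \<diamondop> f \<equiv> g \<cdot>\<^bsub>N\<^esub> f"
abbreviation NactO :: "'o \<Rightarrow> 'n \<Rightarrow> 'n"  (infixr \<open>\<succ>\<close> 75) where "c \<succ> x \<equiv> c \<triangleright>\<^sub>o\<^bsub>N\<^esub> x"
abbreviation NactA :: "'a \<Rightarrow> 'x \<Rightarrow> 'x"  (infixr \<open>\<succeq>\<close> 75) where "f \<succeq> g \<equiv> f \<triangleright>\<^sub>a\<^bsub>N\<^esub> g"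
abbreviation "m \<equiv> Base M"
abbreviation "n \<equiv> Base N"

end

locale rigid_module_functor = rigid_module_pair C M N + F: cyclic_module_dagger_functor C M N F
  for C :: "('o, 'a, 'z) rigid_cat_scheme" (structure)
    and M :: "('m, 'y, 'o, 'a, 'w) mod_cat_scheme"
    and N :: "('n, 'x, 'o, 'a, 'v) mod_cat_scheme"
    and F :: "('m, 'y, 'n, 'x, 'o) mod_fun"
begin

lemma FOb_Obj [simp]: "x \<in> Obj M \<Longrightarrow> FOb F x \<in> Obj N" by (rule F.Fo_in)

lemma typed_FAr [simp]:
  assumes "arr M f"
  shows "arr N (FAr F f)" "src N (FAr F f) = FOb F (src M f)" "tgt N (FAr F f) = FOb F (tgt M f)"
  using F.Fa_in[of "src M f" "tgt M f" f] X.M.arr_in_Hom[OF assms] by (simp_all add: Y.M.Hom_iff)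

lemma FAr_Idn [simp]: "x \<in> Obj M \<Longrightarrow> FAr F (Idn M x) = Idn N (FOb F x)" by (rule F.Fa_Idn)

lemma FAr_comp: "\<lbrakk>arr M f; arr M g; tgt M f = src M g\<rbrakk> \<Longrightarrow> FAr F (g \<bullet> f) = FAr F g \<diamondop> FAr F f"
  using F.Fa_Cmp[of "src M f" "tgt M f" "tgt M g" f g] X.M.arr_in_Hom[of f] X.M.arr_in_Hom[of g] by simp

lemma FAr_dag: "arr M f \<Longrightarrow> FAr F (f\<dagger>\<^bsub>M\<^esub>) = (FAr F f)\<dagger>\<^bsub>N\<^esub>"
  using F.FAr_Dag[of "src M f" "tgt M f" f] X.M.arr_in_Hom[of f] by simp

lemma typed_FOm [simp]:
  assumes "c \<in> Obj C" "x \<in> Obj M"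
  shows "arr N (FOm F c x)" "src N (FOm F c x) = c \<succ> FOb F x" "tgt N (FOm F c x) = FOb F (c \<rhd> x)"
    "(FOm F c x)\<dagger>\<^bsub>N\<^esub> \<diamondop> FOm F c x = Idn N (c \<succ> FOb F x)" "FOm F c x \<diamondop> (FOm F c x)\<dagger>\<^bsub>N\<^esub> = Idn N (FOb F (c \<rhd> x))"
  using F.FOm_unitary[OF assms] assms by (simp_all add: Y.M.unitary_iff)

lemma typed_FBs [simp]:
  "arr N (FBs F)" "src N (FBs F) = n" "tgt N (FBs F) = FOb F m"
  "(FBs F)\<dagger>\<^bsub>N\<^esub> \<diamondop> FBs F = Idn N n" "FBs F \<diamondop> (FBs F)\<dagger>\<^bsub>N\<^esub> = Idn N (FOb F m)"
  using F.FBs_unitary by (simp_all add: Y.M.unitary_iff)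

lemma FOm_nat:
  "\<lbrakk>arr C f; arr M g; c = src C f; d = tgt C f; x = src M g; y = tgt M g\<rbrakk>
    \<Longrightarrow> FAr F (f \<unrhd> g) \<diamondop> FOm F c x = FOm F d y \<diamondop> (f \<succeq> FAr F g)"
  using F.FOm_natural[of "src C f" "tgt C f" "src M g" "tgt M g" f g] X.arr_in_Hom[of f] X.M.arr_in_Hom[of g] by simp

text \<open>The comparison between the orbit of the basepoint of \<open>N\<close> and the image of that of \<open>M\<close>.\<close>

definition cmp :: "'o \<Rightarrow> 'x" where
  "cmp c = FOm F c m \<diamondop> (Idn C c \<succeq> FBs F)"

lemma typed_cmp [simp]:
  assumes "c \<in> Obj C"
  shows "arr N (cmp c)" "src N (cmp c) = c \<succ> n" "tgt N (cmp c) = FOb F (c \<rhd> m)"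
    "(cmp c)\<dagger>\<^bsub>N\<^esub> \<diamondop> cmp c = Idn N (c \<succ> n)" "cmp c \<diamondop> (cmp c)\<dagger>\<^bsub>N\<^esub> = Idn N (FOb F (c \<rhd> m))"
proof -
  have w: "unitary_arr N (c \<succ> n) (c \<succ> FOb F m) (Idn C c \<succeq> FBs F)"
    using assms by (simp add: Y.M.unitary_iff Y.act_interchange)
  have "unitary_arr N (c \<succ> n) (FOb F (c \<rhd> m)) (cmp c)"
    unfolding cmp_def by (rule Y.M.unitary_Cmp[OF _ _ _ w F.FOm_unitary]) (use assms in simp_all)
  then show "arr N (cmp c)" "src N (cmp c) = c \<succ> n" "tgt N (cmp c) = FOb F (c \<rhd> m)"
    "(cmp c)\<dagger>\<^bsub>N\<^esub> \<diamondop> cmp c = Idn N (c \<succ> n)" "cmp c \<diamondop> (cmp c)\<dagger>\<^bsub>N\<^esub> = Idn N (FOb F (c \<rhd> m))"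
    using assms by (simp_all add: Y.M.unitary_iff)
qed

lemma cmp_cancel [simp]:
  "\<lbrakk>c \<in> Obj C; arr N k; tgt N k = c \<succ> n\<rbrakk> \<Longrightarrow> (cmp c)\<dagger>\<^bsub>N\<^esub> \<diamondop> (cmp c \<diamondop> k) = k"
  "\<lbrakk>c \<in> Obj C; arr N k; tgt N k = FOb F (c \<rhd> m)\<rbrakk> \<Longrightarrow> cmp c \<diamondop> ((cmp c)\<dagger>\<^bsub>N\<^esub> \<diamondop> k) = k"
  by (rule Y.M.comp_inverse_cancel; simp)+

lemma FOm_cancel [simp]:
  "\<lbrakk>c \<in> Obj C; x \<in> Obj M; arr N k; tgt N k = c \<succ> FOb F x\<rbrakk> \<Longrightarrow> (FOm F c x)\<dagger>\<^bsub>N\<^esub> \<diamondop> (FOm F c x \<diamondop> k) = k"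
  "\<lbrakk>c \<in> Obj C; x \<in> Obj M; arr N k; tgt N k = FOb F (c \<rhd> x)\<rbrakk> \<Longrightarrow> FOm F c x \<diamondop> ((FOm F c x)\<dagger>\<^bsub>N\<^esub> \<diamondop> k) = k"
  by (rule Y.M.comp_inverse_cancel; simp)+

lemma cmp_J:
  assumes [simp]: "arr C f"
  shows "FAr F (f \<unrhd> Idn M m) \<diamondop> cmp (src C f) = cmp (tgt C f) \<diamondop> (f \<succeq> Idn N n)"
proof -
  have "FAr F (f \<unrhd> Idn M m) \<diamondop> cmp (src C f)
      = (FAr F (f \<unrhd> Idn M m) \<diamondop> FOm F (src C f) m) \<diamondop> (Idn C (src C f) \<succeq> FBs F)"
    by (simp add: cmp_def)
  also have "\<dots> = cmp (tgt C f) \<diamondop> (f \<succeq> Idn N n)"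
    by (subst FOm_nat[of f "Idn M m" "src C f" "tgt C f" m m]) (simp_all add: cmp_def Y.act_merge)
  finally show ?thesis .
qed

lemma cmp_MAsc:
  assumes [simp]: "c \<in> Obj C" "a \<in> Obj C"
  shows "FAr F (MAsc M c a m) \<diamondop> cmp (c \<otimes>\<^sub>o a) = FOm F c (a \<rhd> m) \<diamondop> (Idn C c \<succeq> cmp a) \<diamondop> MAsc N c a n"
proof -
  have 1: "MAsc N c a (FOb F m) \<diamondop> (Idn C (c \<otimes>\<^sub>o a) \<succeq> FBs F) = (Idn C c \<succeq> (Idn C a \<succeq> FBs F)) \<diamondop> MAsc N c a n"
    using Y.MAsc_nat[of "Idn C c" "Idn C a" "FBs F"] by simp
  have "FAr F (MAsc M c a m) \<diamondop> cmp (c \<otimes>\<^sub>o a) = (FAr F (MAsc M c a m) \<diamondop> FOm F (c \<otimes>\<^sub>o a) m) \<diamondop> (Idn C (c \<otimes>\<^sub>o a) \<succeq> FBs F)"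
    by (simp add: cmp_def)
  also have "\<dots> = FOm F c (a \<rhd> m) \<diamondop> (Idn C c \<succeq> FOm F a m) \<diamondop> (MAsc N c a (FOb F m) \<diamondop> (Idn C (c \<otimes>\<^sub>o a) \<succeq> FBs F))"
    by (subst F.FOm_assoc) simp_all
  also have "\<dots> = FOm F c (a \<rhd> m) \<diamondop> (Idn C c \<succeq> cmp a) \<diamondop> MAsc N c a n"
    unfolding 1 by (simp add: cmp_def Y.act_interchange_head)
  finally show ?thesis .
qed

definition orbit_map :: "'o \<times> 'o \<times> 'y \<Rightarrow> 'o \<times> 'o \<times> 'x" where
  "orbit_map T = (fst T, fst (snd T), (cmp (fst (snd T)))\<dagger>\<^bsub>N\<^esub> \<diamondop> FAr F (snd (snd T)) \<diamondop> cmp (fst T))"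

lemma orbit_functor_orbit_map:
  "orbit_functor C X.orb X.orb_J X.orb_act Y.orb Y.orb_J Y.orb_act orbit_map"
proof (intro orbit_functor.intro orbit_functor_axioms.intro orbit_pair.intro X.orbit_category_orb Y.orbit_category_orb)
  fix a b assume ab [simp]: "a \<in> Obj C" "b \<in> Obj C"
  have 1: "linear_map (hom_space M (a \<rhd> m) (b \<rhd> m)) (hom_space N (FOb F (a \<rhd> m)) (FOb F (b \<rhd> m))) (FAr F)"
    by (rule F.Fa_linear) simp_all
  have 2: "linear_map (hom_space N (FOb F (a \<rhd> m)) (FOb F (b \<rhd> m))) (hom_space N (a \<succ> n) (FOb F (b \<rhd> m))) (\<lambda>f. f \<diamondop> cmp a)"
    using Y.M.comp_right_linear[of "cmp a" "FOb F (b \<rhd> m)"] by simp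
  have 3: "linear_map (hom_space N (a \<succ> n) (FOb F (b \<rhd> m))) (hom_space N (a \<succ> n) (b \<succ> n)) (\<lambda>f. (cmp b)\<dagger>\<^bsub>N\<^esub> \<diamondop> f)"
    using Y.M.comp_left_linear[of "(cmp b)\<dagger>\<^bsub>N\<^esub>" "a \<succ> n"] by simp
  have "linear_map (hom_space X.orb a b) (hom_space Y.orb a b) (\<lambda>T. (a, b, (cmp b)\<dagger>\<^bsub>N\<^esub> \<diamondop> FAr F (snd (snd T)) \<diamondop> cmp a))"
    by (rule linear_map_comp[OF linear_map_comp[OF linear_map_comp[OF linear_map_comp[OF X.tag_linear(2)[OF ab] 1] 2] 3] Y.tag_linear(1)[OF ab]])
  then show "linear_map (hom_space X.orb a b) (hom_space Y.orb a b) orbit_map"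
    by (rule semilinear_map_cong)
      (use linear_category.hom_vector_space[OF X.linear_category_orb] in \<open>auto simp: orbit_map_def hom_space_def\<close>)
next
  fix T S assume "arr X.orb T" "arr X.orb S" "tgt X.orb T = src X.orb S"
  then show "orbit_map (S \<cdot>\<^bsub>X.orb\<^esub> T) = orbit_map S \<cdot>\<^bsub>Y.orb\<^esub> orbit_map T"
    by (elim X.arr_orbE) (simp add: orbit_map_def FAr_comp)
next
  fix f assume "arr C f"
  then show "orbit_map (X.orb_J f) = Y.orb_J f"
    using cmp_J[of f] by (simp add: orbit_map_def X.orb_J_def Y.orb_J_def)
next
  fix c T assume [simp]: "c \<in> Obj C" and "arr X.orb T"
  then obtain a b t where T: "T = (a, b, t)" and [simp]: "a \<in> Obj C" "b \<in> Obj C" "arr M t" "src M t = a \<rhd> m" "tgt M t = b \<rhd> m"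
    by (elim X.arr_orbE)
  have 1: "(cmp (c \<otimes>\<^sub>o b))\<dagger>\<^bsub>N\<^esub> \<diamondop> FAr F ((MAsc M c b m)\<dagger>\<^bsub>M\<^esub>)
      = (MAsc N c b n)\<dagger>\<^bsub>N\<^esub> \<diamondop> (Idn C c \<succeq> (cmp b)\<dagger>\<^bsub>N\<^esub>) \<diamondop> (FOm F c (b \<rhd> m))\<dagger>\<^bsub>N\<^esub>"
  proof -
    have "(FAr F (MAsc M c b m) \<diamondop> cmp (c \<otimes>\<^sub>o b))\<dagger>\<^bsub>N\<^esub>
        = (FOm F c (b \<rhd> m) \<diamondop> (Idn C c \<succeq> cmp b) \<diamondop> MAsc N c b n)\<dagger>\<^bsub>N\<^esub>"
      by (simp only: cmp_MAsc \<open>c \<in> Obj C\<close> \<open>b \<in> Obj C\<close>)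
    then show ?thesis by (simp add: FAr_dag)
  qed
  have 2: "FAr F (Idn C c \<unrhd> t) \<diamondop> FOm F c (a \<rhd> m) = FOm F c (b \<rhd> m) \<diamondop> (Idn C c \<succeq> FAr F t)"
    using FOm_nat[of "Idn C c" t] by simp
  have "(cmp (c \<otimes>\<^sub>o b))\<dagger>\<^bsub>N\<^esub> \<diamondop> FAr F ((MAsc M c b m)\<dagger>\<^bsub>M\<^esub> \<bullet> (Idn C c \<unrhd> t) \<bullet> MAsc M c a m) \<diamondop> cmp (c \<otimes>\<^sub>o a)
      = ((cmp (c \<otimes>\<^sub>o b))\<dagger>\<^bsub>N\<^esub> \<diamondop> FAr F ((MAsc M c b m)\<dagger>\<^bsub>M\<^esub>)) \<diamondop> FAr F (Idn C c \<unrhd> t) \<diamondop> (FAr F (MAsc M c a m) \<diamondop> cmp (c \<otimes>\<^sub>o a))"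
    by (simp add: FAr_comp)
  also have "\<dots> = (MAsc N c b n)\<dagger>\<^bsub>N\<^esub> \<diamondop> (Idn C c \<succeq> (cmp b)\<dagger>\<^bsub>N\<^esub>) \<diamondop> (FOm F c (b \<rhd> m))\<dagger>\<^bsub>N\<^esub> \<diamondop>
      (FAr F (Idn C c \<unrhd> t) \<diamondop> FOm F c (a \<rhd> m)) \<diamondop> (Idn C c \<succeq> cmp a) \<diamondop> MAsc N c a n"
    unfolding 1 by (simp add: cmp_MAsc)
  also have "\<dots> = (MAsc N c b n)\<dagger>\<^bsub>N\<^esub> \<diamondop> (Idn C c \<succeq> ((cmp b)\<dagger>\<^bsub>N\<^esub> \<diamondop> FAr F t \<diamondop> cmp a)) \<diamondop> MAsc N c a n"
    unfolding 2 by (simp add: Y.act_interchange_head)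
  finally show "orbit_map (X.orb_act c T) = Y.orb_act c (orbit_map T)"
    by (simp add: T orbit_map_def X.orb_act_def Y.orb_act_def)
qed

lemma orbit_map_dag: "arr X.orb T \<Longrightarrow> orbit_map (X.orb_dag T) = Y.orb_dag (orbit_map T)"
  by (elim X.arr_orbE) (simp add: orbit_map_def X.orb_dag_def Y.orb_dag_def FAr_dag)

end

text \<open>
  Two cyclic module dagger functors are isomorphic exactly if they induce the same map of orbits: the only
  candidate for the isomorphism at \<open>c \<triangleright> Base M\<close> is the composite of the two comparison maps.
\<close>

lemma mod_fun_iso_orbit_map:
  fixes C :: "('o, 'a, 'z) rigid_cat_scheme" (structure) and F G :: "('m, 'y, 'n, 'x, 'o) mod_fun"
  assumes "rigid_module_functor C M N F" "rigid_module_functor C M N G"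
    and iso: "mod_fun_iso C M N F G" and T: "arr (rigid_module.orb C M) T"
  shows "rigid_module_functor.orbit_map C M N F T = rigid_module_functor.orbit_map C M N G T"
proof -
  interpret F: rigid_module_functor C M N F by fact
  interpret G: rigid_module_functor C M N G by fact
  obtain \<theta> where nat: "natural_iso M N (FOb F) (FAr F) (FOb G) (FAr G) \<theta>"
    and uni: "\<forall>x\<in>Obj M. unitary_arr N (FOb F x) (FOb G x) (\<theta> x)"
    and mod: "\<forall>c\<in>Obj C. \<forall>x\<in>Obj M. \<theta> (c \<triangleright>\<^sub>o\<^bsub>M\<^esub> x) \<cdot>\<^bsub>N\<^esub> FOm F c x = FOm G c x \<cdot>\<^bsub>N\<^esub> (Idn C c \<triangleright>\<^sub>a\<^bsub>N\<^esub> \<theta> x)"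
    and base: "\<theta> (Base M) \<cdot>\<^bsub>N\<^esub> FBs F = FBs G"
    using iso by (auto simp: mod_fun_iso_def)
  have th [simp]: "arr N (\<theta> x)" "src N (\<theta> x) = FOb F x" "tgt N (\<theta> x) = FOb G x" 
      "(\<theta> x)\<dagger>\<^bsub>N\<^esub> \<cdot>\<^bsub>N\<^esub> \<theta> x = Idn N (FOb F x)" if "x \<in> Obj M" for x
    using uni that F.Y.M.unitary_iff[of "FOb F x" "FOb G x" "\<theta> x"] by simp_all
  have cmp: "\<theta> (c \<triangleright>\<^sub>o\<^bsub>M\<^esub> Base M) \<cdot>\<^bsub>N\<^esub> F.cmp c = G.cmp c" if [simp]: "c \<in> Obj C" for c
  proof -
    have "\<theta> (c \<triangleright>\<^sub>o\<^bsub>M\<^esub> Base M) \<cdot>\<^bsub>N\<^esub> F.cmp c = (\<theta> (c \<triangleright>\<^sub>o\<^bsub>M\<^esub> Base M) \<cdot>\<^bsub>N\<^esub> FOm F c (Base M)) \<cdot>\<^bsub>N\<^esub> (Idn C c \<triangleright>\<^sub>a\<^bsub>N\<^esub> FBs F)"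
      by (simp add: F.cmp_def)
    also have "\<dots> = G.cmp c"
      using mod by (simp add: G.cmp_def F.Y.act_interchange base)
    finally show ?thesis .
  qed
  from T obtain a b t where T: "T = (a, b, t)" and [simp]: "a \<in> Obj C" "b \<in> Obj C" "arr M t"
    "src M t = a \<triangleright>\<^sub>o\<^bsub>M\<^esub> Base M" "tgt M t = b \<triangleright>\<^sub>o\<^bsub>M\<^esub> Base M" by (elim F.X.arr_orbE)
  let ?b = "b \<triangleright>\<^sub>o\<^bsub>M\<^esub> Base M" and ?a = "a \<triangleright>\<^sub>o\<^bsub>M\<^esub> Base M"
  have sq: "FAr G t \<cdot>\<^bsub>N\<^esub> \<theta> ?a = \<theta> ?b \<cdot>\<^bsub>N\<^esub> FAr F t"
    using nat by (simp add: natural_iso_def F.X.M.Hom_iff)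
  have "(G.cmp b)\<dagger>\<^bsub>N\<^esub> \<cdot>\<^bsub>N\<^esub> FAr G t \<cdot>\<^bsub>N\<^esub> G.cmp a = (F.cmp b)\<dagger>\<^bsub>N\<^esub> \<cdot>\<^bsub>N\<^esub> (\<theta> ?b)\<dagger>\<^bsub>N\<^esub> \<cdot>\<^bsub>N\<^esub> (FAr G t \<cdot>\<^bsub>N\<^esub> \<theta> ?a) \<cdot>\<^bsub>N\<^esub> F.cmp a"
    by (simp flip: cmp)
  also have "\<dots> = (F.cmp b)\<dagger>\<^bsub>N\<^esub> \<cdot>\<^bsub>N\<^esub> FAr F t \<cdot>\<^bsub>N\<^esub> F.cmp a"
    unfolding sq by (simp add: F.Y.M.comp_inverse_cancel[of "(\<theta> ?b)\<dagger>\<^bsub>N\<^esub>" "\<theta> ?b"])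
  finally show ?thesis by (simp add: T F.orbit_map_def G.orbit_map_def)
qed

lemma (in rigid_module) orbit_object:
  assumes "x \<in> Obj M"
  obtains c where "c \<in> Obj C" "x = c \<rhd> m"
  using assms M.cyclic by auto

lemma orbit_map_mod_fun_iso:
  fixes C :: "('o, 'a, 'z) rigid_cat_scheme" (structure) and F G :: "('m, 'y, 'n, 'x, 'o) mod_fun"
  assumes "rigid_module_functor C M N F" "rigid_module_functor C M N G"
    and eq: "\<And>T. arr (rigid_module.orb C M) T \<Longrightarrow>
      rigid_module_functor.orbit_map C M N F T = rigid_module_functor.orbit_map C M N G T"
  shows "mod_fun_iso C M N F G"
proof -
  interpret F: rigid_module_functor C M N F by fact
  interpret G: rigid_module_functor C M N G by fact
  define ch where "ch x = (SOME c. c \<in> Obj C \<and> x = c \<triangleright>\<^sub>o\<^bsub>M\<^esub> Base M)" for x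
  have ch: "ch x \<in> Obj C" "ch x \<triangleright>\<^sub>o\<^bsub>M\<^esub> Base M = x" if "x \<in> Obj M" for x
    using someI_ex[of "\<lambda>c. c \<in> Obj C \<and> x = c \<triangleright>\<^sub>o\<^bsub>M\<^esub> Base M"] F.X.orbit_object[OF that] unfolding ch_def by metis+
  define \<theta> where "\<theta> x = G.cmp (ch x) \<cdot>\<^bsub>N\<^esub> (F.cmp (ch x))\<dagger>\<^bsub>N\<^esub>" for x
  have sq: "G.cmp b \<cdot>\<^bsub>N\<^esub> (F.cmp b)\<dagger>\<^bsub>N\<^esub> \<cdot>\<^bsub>N\<^esub> FAr F t = FAr G t \<cdot>\<^bsub>N\<^esub> G.cmp a \<cdot>\<^bsub>N\<^esub> (F.cmp a)\<dagger>\<^bsub>N\<^esub>"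
    if [simp]: "a \<in> Obj C" "b \<in> Obj C" "arr M t" "src M t = a \<triangleright>\<^sub>o\<^bsub>M\<^esub> Base M" "tgt M t = b \<triangleright>\<^sub>o\<^bsub>M\<^esub> Base M" for a b t
  proof -
    have "(F.cmp b)\<dagger>\<^bsub>N\<^esub> \<cdot>\<^bsub>N\<^esub> FAr F t \<cdot>\<^bsub>N\<^esub> F.cmp a = (G.cmp b)\<dagger>\<^bsub>N\<^esub> \<cdot>\<^bsub>N\<^esub> FAr G t \<cdot>\<^bsub>N\<^esub> G.cmp a"
      using eq[of "(a, b, t)"] F.X.typed_orb(1)[of a b t] by (simp add: F.orbit_map_def G.orbit_map_def F.X.M.Hom_iff)
    then have "G.cmp b \<cdot>\<^bsub>N\<^esub> ((F.cmp b)\<dagger>\<^bsub>N\<^esub> \<cdot>\<^bsub>N\<^esub> FAr F t \<cdot>\<^bsub>N\<^esub> F.cmp a) \<cdot>\<^bsub>N\<^esub> (F.cmp a)\<dagger>\<^bsub>N\<^esub>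
        = G.cmp b \<cdot>\<^bsub>N\<^esub> ((G.cmp b)\<dagger>\<^bsub>N\<^esub> \<cdot>\<^bsub>N\<^esub> FAr G t \<cdot>\<^bsub>N\<^esub> G.cmp a) \<cdot>\<^bsub>N\<^esub> (F.cmp a)\<dagger>\<^bsub>N\<^esub>" by (rule arg_cong)
    then show ?thesis by simp
  qed
  have th: "\<theta> (c \<triangleright>\<^sub>o\<^bsub>M\<^esub> Base M) = G.cmp c \<cdot>\<^bsub>N\<^esub> (F.cmp c)\<dagger>\<^bsub>N\<^esub>" if c [simp]: "c \<in> Obj C" for c
    using sq[of c "ch (c \<triangleright>\<^sub>o\<^bsub>M\<^esub> Base M)" "Idn M (c \<triangleright>\<^sub>o\<^bsub>M\<^esub> Base M)"] ch[of "c \<triangleright>\<^sub>o\<^bsub>M\<^esub> Base M"]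
    by (simp add: \<theta>_def)
  have nat: "FAr G f \<cdot>\<^bsub>N\<^esub> \<theta> x = \<theta> y \<cdot>\<^bsub>N\<^esub> FAr F f" if "x \<in> Obj M" "y \<in> Obj M" "f \<in> Hom M x y" for x y f
    using sq[of "ch x" "ch y" f] ch[of x] ch[of y] that by (simp add: \<theta>_def F.X.M.Hom_iff)
  have uni: "unitary_arr N (FOb F x) (FOb G x) (\<theta> x)" if "x \<in> Obj M" for x
    using ch[OF that] that by (simp add: F.Y.M.unitary_iff \<theta>_def)
  have [simp]: "arr N (\<theta> x)" "src N (\<theta> x) = FOb F x" "tgt N (\<theta> x) = FOb G x" if "x \<in> Obj M" for x
    using uni[OF that] that by (simp_all add: F.Y.M.unitary_iff)
  have mod: "\<theta> (c \<triangleright>\<^sub>o\<^bsub>M\<^esub> x) \<cdot>\<^bsub>N\<^esub> FOm F c x = FOm G c x \<cdot>\<^bsub>N\<^esub> (Idn C c \<triangleright>\<^sub>a\<^bsub>N\<^esub> \<theta> x)"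
    if c [simp]: "c \<in> Obj C" and "x \<in> Obj M" for c x
  proof -
    obtain d where d [simp]: "d \<in> Obj C" and x: "x = d \<triangleright>\<^sub>o\<^bsub>M\<^esub> Base M" using F.X.orbit_object[OF \<open>x \<in> Obj M\<close>] .
    let ?x = "d \<triangleright>\<^sub>o\<^bsub>M\<^esub> Base M"
    have FM: "FOm F c ?x = FAr F (MAsc M c d (Base M)) \<cdot>\<^bsub>N\<^esub> F.cmp (c \<otimes>\<^sub>o d) \<cdot>\<^bsub>N\<^esub> (MAsc N c d (Base N))\<dagger>\<^bsub>N\<^esub> \<cdot>\<^bsub>N\<^esub> (Idn C c \<triangleright>\<^sub>a\<^bsub>N\<^esub> (F.cmp d)\<dagger>\<^bsub>N\<^esub>)"
      (is "_ = _ \<cdot>\<^bsub>N\<^esub> _ \<cdot>\<^bsub>N\<^esub> ?k")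
    proof -
      have "FAr F (MAsc M c d (Base M)) \<cdot>\<^bsub>N\<^esub> F.cmp (c \<otimes>\<^sub>o d) \<cdot>\<^bsub>N\<^esub> ?k = (FAr F (MAsc M c d (Base M)) \<cdot>\<^bsub>N\<^esub> F.cmp (c \<otimes>\<^sub>o d)) \<cdot>\<^bsub>N\<^esub> ?k"
        by simp
      also have "\<dots> = FOm F c ?x"
        unfolding F.cmp_MAsc[OF c d] by (simp add: F.Y.act_interchange)
      finally show ?thesis ..
    qed
    have GM: "FOm G c ?x \<cdot>\<^bsub>N\<^esub> (Idn C c \<triangleright>\<^sub>a\<^bsub>N\<^esub> G.cmp d) = FAr G (MAsc M c d (Base M)) \<cdot>\<^bsub>N\<^esub> G.cmp (c \<otimes>\<^sub>o d) \<cdot>\<^bsub>N\<^esub> (MAsc N c d (Base N))\<dagger>\<^bsub>N\<^esub>"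
      using F.Y.M.rewrite_head[OF G.cmp_MAsc[OF c d], of "(MAsc N c d (Base N))\<dagger>\<^bsub>N\<^esub>"] by simp
    have nt: "\<theta> (c \<triangleright>\<^sub>o\<^bsub>M\<^esub> ?x) \<cdot>\<^bsub>N\<^esub> FAr F (MAsc M c d (Base M)) = FAr G (MAsc M c d (Base M)) \<cdot>\<^bsub>N\<^esub> \<theta> ((c \<otimes>\<^sub>o d) \<triangleright>\<^sub>o\<^bsub>M\<^esub> Base M)"
      by (rule nat[symmetric]) (simp_all add: F.X.M.Hom_iff)
    have "\<theta> (c \<triangleright>\<^sub>o\<^bsub>M\<^esub> ?x) \<cdot>\<^bsub>N\<^esub> FOm F c ?x = (\<theta> (c \<triangleright>\<^sub>o\<^bsub>M\<^esub> ?x) \<cdot>\<^bsub>N\<^esub> FAr F (MAsc M c d (Base M))) \<cdot>\<^bsub>N\<^esub>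
        F.cmp (c \<otimes>\<^sub>o d) \<cdot>\<^bsub>N\<^esub> (MAsc N c d (Base N))\<dagger>\<^bsub>N\<^esub> \<cdot>\<^bsub>N\<^esub> (Idn C c \<triangleright>\<^sub>a\<^bsub>N\<^esub> (F.cmp d)\<dagger>\<^bsub>N\<^esub>)"
      unfolding FM by simp
    also have "\<dots> = FAr G (MAsc M c d (Base M)) \<cdot>\<^bsub>N\<^esub> (\<theta> ((c \<otimes>\<^sub>o d) \<triangleright>\<^sub>o\<^bsub>M\<^esub> Base M) \<cdot>\<^bsub>N\<^esub>
        F.cmp (c \<otimes>\<^sub>o d)) \<cdot>\<^bsub>N\<^esub> (MAsc N c d (Base N))\<dagger>\<^bsub>N\<^esub> \<cdot>\<^bsub>N\<^esub> (Idn C c \<triangleright>\<^sub>a\<^bsub>N\<^esub> (F.cmp d)\<dagger>\<^bsub>N\<^esub>)"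
      unfolding nt by simp
    also have "\<dots> = (FAr G (MAsc M c d (Base M)) \<cdot>\<^bsub>N\<^esub> G.cmp (c \<otimes>\<^sub>o d) \<cdot>\<^bsub>N\<^esub> (MAsc N c d (Base N))\<dagger>\<^bsub>N\<^esub>) \<cdot>\<^bsub>N\<^esub> (Idn C c \<triangleright>\<^sub>a\<^bsub>N\<^esub> (F.cmp d)\<dagger>\<^bsub>N\<^esub>)"
      by (simp add: th)
    also have "\<dots> = FOm G c ?x \<cdot>\<^bsub>N\<^esub> (Idn C c \<triangleright>\<^sub>a\<^bsub>N\<^esub> \<theta> ?x)"
      unfolding GM[symmetric] by (simp add: th F.Y.act_interchange)
    finally show ?thesis unfolding x .
  qed
  have base: "\<theta> (Base M) \<cdot>\<^bsub>N\<^esub> FBs F = FBs G"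
  proof -
    let ?m = "Base M" and ?n = "Base N" and ?I = "Unt C"
    have unit: "FAr H (MUn M ?m) \<cdot>\<^bsub>N\<^esub> rigid_module_functor.cmp C M N H ?I = FBs H \<cdot>\<^bsub>N\<^esub> MUn N ?n"
      if "rigid_module_functor C M N H" for H
    proof -
      interpret H: rigid_module_functor C M N H by fact
      have "FAr H (MUn M ?m) \<cdot>\<^bsub>N\<^esub> H.cmp ?I = (FAr H (MUn M ?m) \<cdot>\<^bsub>N\<^esub> FOm H ?I ?m) \<cdot>\<^bsub>N\<^esub> (Idn C ?I \<triangleright>\<^sub>a\<^bsub>N\<^esub> FBs H)"
        by (simp add: H.cmp_def)
      also have "\<dots> = FBs H \<cdot>\<^bsub>N\<^esub> MUn N ?n"
        by (simp add: H.F.FOm_unit F.Y.MUn_nat)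
      finally show ?thesis .
    qed
    have "\<theta> ?m \<cdot>\<^bsub>N\<^esub> FAr F (MUn M ?m) = FAr G (MUn M ?m) \<cdot>\<^bsub>N\<^esub> \<theta> (?I \<triangleright>\<^sub>o\<^bsub>M\<^esub> ?m)"
      by (rule nat[symmetric]) (simp_all add: F.X.M.Hom_iff)
    from F.Y.M.rewrite_head2[OF this, of "F.cmp ?I"]
    have "(\<theta> ?m \<cdot>\<^bsub>N\<^esub> FBs F) \<cdot>\<^bsub>N\<^esub> MUn N ?n = FBs G \<cdot>\<^bsub>N\<^esub> MUn N ?n"
      using unit[OF assms(1)] unit[OF assms(2)] by (simp add: th)
    then show ?thesis
      by (rule F.Y.M.epi_cancel[where g = "(MUn N ?n)\<dagger>\<^bsub>N\<^esub>"]) simp_all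
  qed
  have "iso_arr N (FOb F x) (FOb G x) (\<theta> x)" if "x \<in> Obj M" for x
    using uni[OF that] by (auto simp: iso_arr_def unitary_arr_def)
  then show ?thesis
    unfolding mod_fun_iso_def natural_iso_def using nat uni mod base by blast
qed

lemma mod_fun_id_simps [simp]:
  "FOb (mod_fun_id M) = id" "FAr (mod_fun_id M) = id"
  "FOm (mod_fun_id M) c x = Idn M (c \<triangleright>\<^sub>o\<^bsub>M\<^esub> x)" "FBs (mod_fun_id M) = Idn M (Base M)"
  by (simp_all add: mod_fun_id_def)

lemma (in rigid_module) mod_fun_id_functor: "cyclic_module_dagger_functor C M M (mod_fun_id M)"
proof (intro cyclic_module_dagger_functor.intro cyclic_module_functor.intro linear_functor.intro functor_between.intro
    linear_functor_axioms.intro cyclic_module_functor_axioms.intro cyclic_module_dagger_functor_axioms.intro)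
  have iso: "iso_arr M x y f" if "unitary_arr M x y f" for x y f
    using that by (auto simp: iso_arr_def unitary_arr_def)
  have u: "unitary_arr M x x (Idn M x)" if "x \<in> Obj M" for x using that by (rule M.unitary_Idn)
  show "iso_arr M (c \<rhd> FOb (mod_fun_id M) x) (FOb (mod_fun_id M) (c \<rhd> x)) (FOm (mod_fun_id M) c x)"
    if "c \<in> Obj C" "x \<in> Obj M" for c x using that by (simp add: iso u)
  show "iso_arr M m (FOb (mod_fun_id M) m) (FBs (mod_fun_id M))" by (simp add: iso u)
  fix c x assume "c \<in> Obj C" "x \<in> Obj M"
  then show "unitary_arr M (c \<rhd> FOb (mod_fun_id M) x) (FOb (mod_fun_id M) (c \<rhd> x)) (FOm (mod_fun_id M) c x)"
    by (simp add: u)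
qed (auto simp: M.Hom_iff Hom_iff semilinear_map_def hom_space_def M.unitary_Idn)

context rigid_module
begin

lemma rigid_module_functor_id: "rigid_module_functor C M M (mod_fun_id M)"
  by (intro rigid_module_functor.intro rigid_module_pair.intro rigid_module_axioms mod_fun_id_functor)

lemma orbit_map_id:
  assumes "arr orb T"
  shows "rigid_module_functor.orbit_map C M M (mod_fun_id M) T = T"
proof -
  interpret I: rigid_module_functor C M M "mod_fun_id M" by (rule rigid_module_functor_id)
  have cmp: "I.cmp c = Idn M (c \<rhd> m)" if "c \<in> Obj C" for c
    using that by (simp add: I.cmp_def)
  show ?thesis
    using assms by (elim arr_orbE) (simp add: I.orbit_map_def cmp)
qed

end

locale rigid_module_functors = G1: rigid_module_functor C M N F + G2: rigid_module_functor C N P G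
  for C :: "('o, 'a, 'z) rigid_cat_scheme" (structure)
    and M :: "('m, 'y, 'o, 'a, 'w) mod_cat_scheme" and N :: "('n, 'x, 'o, 'a, 'v) mod_cat_scheme"
    and P :: "('p, 'q, 'o, 'a, 'u) mod_cat_scheme"
    and F :: "('m, 'y, 'n, 'x, 'o) mod_fun" and G :: "('n, 'x, 'p, 'q, 'o) mod_fun"
begin

abbreviation "H \<equiv> mod_fun_comp P G F"

lemma comp_simps [simp]:
  "FOb H x = FOb G (FOb F x)" "FAr H f = FAr G (FAr F f)"
  "FOm H c x = FAr G (FOm F c x) \<cdot>\<^bsub>P\<^esub> FOm G c (FOb F x)" "FBs H = FAr G (FBs F) \<cdot>\<^bsub>P\<^esub> FBs G"
  by (simp_all add: mod_fun_comp_def)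

lemma unitary_image:
  assumes "x \<in> Obj N" "y \<in> Obj N" "unitary_arr N x y u"
  shows "unitary_arr P (FOb G x) (FOb G y) (FAr G u)"
  using assms by (simp add: G1.Y.M.unitary_iff G2.Y.M.unitary_iff flip: G2.FAr_comp G2.FAr_dag)

lemma mod_fun_comp_functor: "cyclic_module_dagger_functor C M P H"
proof (intro cyclic_module_dagger_functor.intro cyclic_module_functor.intro linear_functor.intro functor_between.intro
    linear_functor_axioms.intro cyclic_module_functor_axioms.intro cyclic_module_dagger_functor_axioms.intro)
  have iso: "iso_arr P x y f" if "unitary_arr P x y f" for x y f
    using that by (auto simp: iso_arr_def unitary_arr_def)
  show om: "unitary_arr P (c \<triangleright>\<^sub>o\<^bsub>P\<^esub> FOb H x) (FOb H (c \<triangleright>\<^sub>o\<^bsub>M\<^esub> x)) (FOm H c x)" if "c \<in> Obj C" "x \<in> Obj M" for c x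
    using that unitary_image[OF _ _ G1.F.FOm_unitary[OF that]] G2.F.FOm_unitary[of c "FOb F x"]
    by (simp add: G2.Y.M.unitary_Cmp[of _ "FOb G (c \<triangleright>\<^sub>o\<^bsub>N\<^esub> FOb F x)"])
  show bs: "unitary_arr P (Base P) (FOb H (Base M)) (FBs H)"
    using unitary_image[OF _ _ G1.F.FBs_unitary] G2.F.FBs_unitary
    by (simp add: G2.Y.M.unitary_Cmp[of _ "FOb G (Base N)"])
  show "iso_arr P (c \<triangleright>\<^sub>o\<^bsub>P\<^esub> FOb H x) (FOb H (c \<triangleright>\<^sub>o\<^bsub>M\<^esub> x)) (FOm H c x)" if "c \<in> Obj C" "x \<in> Obj M" for c x
    by (rule iso[OF om[OF that]])
  show "iso_arr P (Base P) (FOb H (Base M)) (FBs H)" by (rule iso[OF bs])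
next
  fix a b assume "a \<in> Obj M" "b \<in> Obj M"
  then show "linear_map (hom_space M a b) (hom_space P (FOb H a) (FOb H b)) (FAr H)"
    using linear_map_comp[OF G1.F.Fa_linear G2.F.Fa_linear, of a b] by (simp add: mod_fun_comp_def o_def)
next
  fix c d x y f g assume "c \<in> Obj C" "d \<in> Obj C" "x \<in> Obj M" "y \<in> Obj M" "f \<in> Hom C c d" "g \<in> Hom M x y"
  then have [simp]: "c \<in> Obj C" "d \<in> Obj C" "x \<in> Obj M" "y \<in> Obj M" "arr C f" "src C f = c" "tgt C f = d"
    "arr M g" "src M g = x" "tgt M g = y"
    by (simp_all add: G1.X.Hom_iff G1.X.M.Hom_iff)
  have "FAr G (FAr F (f \<triangleright>\<^sub>a\<^bsub>M\<^esub> g)) \<cdot>\<^bsub>P\<^esub> FAr G (FOm F c x) \<cdot>\<^bsub>P\<^esub> FOm G c (FOb F x)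
      = FAr G (FAr F (f \<triangleright>\<^sub>a\<^bsub>M\<^esub> g) \<cdot>\<^bsub>N\<^esub> FOm F c x) \<cdot>\<^bsub>P\<^esub> FOm G c (FOb F x)"
    by (simp add: G2.FAr_comp)
  also have "\<dots> = FAr G (FOm F d y) \<cdot>\<^bsub>P\<^esub> (FAr G (f \<triangleright>\<^sub>a\<^bsub>N\<^esub> FAr F g) \<cdot>\<^bsub>P\<^esub> FOm G c (FOb F x))"
    by (subst G1.FOm_nat[of f g c d x y]) (simp_all add: G2.FAr_comp)
  also have "\<dots> = FAr G (FOm F d y) \<cdot>\<^bsub>P\<^esub> FOm G d (FOb F y) \<cdot>\<^bsub>P\<^esub> (f \<triangleright>\<^sub>a\<^bsub>P\<^esub> FAr G (FAr F g))"
    by (subst G2.FOm_nat[of f "FAr F g" c d "FOb F x" "FOb F y"]) simp_all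
  finally show "FAr H (f \<triangleright>\<^sub>a\<^bsub>M\<^esub> g) \<cdot>\<^bsub>P\<^esub> FOm H c x = FOm H d y \<cdot>\<^bsub>P\<^esub> (f \<triangleright>\<^sub>a\<^bsub>P\<^esub> FAr H g)" by simp
next
  fix a b x assume [simp]: "a \<in> Obj C" "b \<in> Obj C" "x \<in> Obj M"
  have 1: "FAr G (Idn C a \<triangleright>\<^sub>a\<^bsub>N\<^esub> FOm F b x) \<cdot>\<^bsub>P\<^esub> FOm G a (b \<triangleright>\<^sub>o\<^bsub>N\<^esub> FOb F x)
      = FOm G a (FOb F (b \<triangleright>\<^sub>o\<^bsub>M\<^esub> x)) \<cdot>\<^bsub>P\<^esub> (Idn C a \<triangleright>\<^sub>a\<^bsub>P\<^esub> FAr G (FOm F b x))"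
    by (rule G2.FOm_nat) simp_all
  have "FAr G (FAr F (MAsc M a b x)) \<cdot>\<^bsub>P\<^esub> FAr G (FOm F (a \<otimes>\<^sub>o b) x) \<cdot>\<^bsub>P\<^esub> FOm G (a \<otimes>\<^sub>o b) (FOb F x)
      = FAr G (FAr F (MAsc M a b x) \<cdot>\<^bsub>N\<^esub> FOm F (a \<otimes>\<^sub>o b) x) \<cdot>\<^bsub>P\<^esub> FOm G (a \<otimes>\<^sub>o b) (FOb F x)"
    by (simp add: G2.FAr_comp)
  also have "\<dots> = FAr G (FOm F a (b \<triangleright>\<^sub>o\<^bsub>M\<^esub> x)) \<cdot>\<^bsub>P\<^esub> FAr G (Idn C a \<triangleright>\<^sub>a\<^bsub>N\<^esub> FOm F b x) \<cdot>\<^bsub>P\<^esub>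
      (FAr G (MAsc N a b (FOb F x)) \<cdot>\<^bsub>P\<^esub> FOm G (a \<otimes>\<^sub>o b) (FOb F x))"
    by (subst G1.F.FOm_assoc) (simp_all add: G2.FAr_comp)
  also have "\<dots> = FAr G (FOm F a (b \<triangleright>\<^sub>o\<^bsub>M\<^esub> x)) \<cdot>\<^bsub>P\<^esub> (FAr G (Idn C a \<triangleright>\<^sub>a\<^bsub>N\<^esub> FOm F b x) \<cdot>\<^bsub>P\<^esub> FOm G a (b \<triangleright>\<^sub>o\<^bsub>N\<^esub> FOb F x)) \<cdot>\<^bsub>P\<^esub>
      (Idn C a \<triangleright>\<^sub>a\<^bsub>P\<^esub> FOm G b (FOb F x)) \<cdot>\<^bsub>P\<^esub> MAsc P a b (FOb G (FOb F x))"
    by (subst G2.F.FOm_assoc) simp_all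
  also have "\<dots> = (FAr G (FOm F a (b \<triangleright>\<^sub>o\<^bsub>M\<^esub> x)) \<cdot>\<^bsub>P\<^esub> FOm G a (FOb F (b \<triangleright>\<^sub>o\<^bsub>M\<^esub> x))) \<cdot>\<^bsub>P\<^esub>
      (Idn C a \<triangleright>\<^sub>a\<^bsub>P\<^esub> (FAr G (FOm F b x) \<cdot>\<^bsub>P\<^esub> FOm G b (FOb F x))) \<cdot>\<^bsub>P\<^esub> MAsc P a b (FOb G (FOb F x))"
    unfolding 1 by (simp add: G2.Y.act_interchange_head)
  finally show "FAr H (MAsc M a b x) \<cdot>\<^bsub>P\<^esub> FOm H (a \<otimes>\<^sub>o b) x
      = FOm H a (b \<triangleright>\<^sub>o\<^bsub>M\<^esub> x) \<cdot>\<^bsub>P\<^esub> (Idn C a \<triangleright>\<^sub>a\<^bsub>P\<^esub> FOm H b x) \<cdot>\<^bsub>P\<^esub> MAsc P a b (FOb H x)" by simp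
next
  fix x assume [simp]: "x \<in> Obj M"
  have "FAr G (FAr F (MUn M x)) \<cdot>\<^bsub>P\<^esub> FAr G (FOm F (Unt C) x) \<cdot>\<^bsub>P\<^esub> FOm G (Unt C) (FOb F x)
      = FAr G (FAr F (MUn M x) \<cdot>\<^bsub>N\<^esub> FOm F (Unt C) x) \<cdot>\<^bsub>P\<^esub> FOm G (Unt C) (FOb F x)"
    by (simp add: G2.FAr_comp)
  then show "FAr H (MUn M x) \<cdot>\<^bsub>P\<^esub> FOm H (Unt C) x = MUn P (FOb H x)"
    by (simp add: G1.F.FOm_unit G2.F.FOm_unit)
qed (simp_all add: G1.X.M.Hom_iff G2.Y.M.Hom_iff G1.FAr_comp G2.FAr_comp G1.FAr_dag G2.FAr_dag)

lemma rigid_module_functor_comp: "rigid_module_functor C M P H"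
  by (intro rigid_module_functor.intro rigid_module_pair.intro G1.X.rigid_module_axioms G2.Y.rigid_module_axioms mod_fun_comp_functor)

lemma orbit_map_comp:
  assumes "arr G1.X.orb T"
  shows "rigid_module_functor.orbit_map C M P H T = G2.orbit_map (G1.orbit_map T)"
proof -
  interpret H: rigid_module_functor C M P H by (rule rigid_module_functor_comp)
  have cmp: "H.cmp c = FAr G (G1.cmp c) \<cdot>\<^bsub>P\<^esub> G2.cmp c" if [simp]: "c \<in> Obj C" for c
  proof -
    have 1: "FAr G (Idn C c \<triangleright>\<^sub>a\<^bsub>N\<^esub> FBs F) \<cdot>\<^bsub>P\<^esub> FOm G c (Base N) = FOm G c (FOb F (Base M)) \<cdot>\<^bsub>P\<^esub> (Idn C c \<triangleright>\<^sub>a\<^bsub>P\<^esub> FAr G (FBs F))"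
      by (rule G2.FOm_nat) simp_all
    have "FAr G (G1.cmp c) \<cdot>\<^bsub>P\<^esub> G2.cmp c = FAr G (FOm F c (Base M)) \<cdot>\<^bsub>P\<^esub>
        (FAr G (Idn C c \<triangleright>\<^sub>a\<^bsub>N\<^esub> FBs F) \<cdot>\<^bsub>P\<^esub> FOm G c (Base N)) \<cdot>\<^bsub>P\<^esub> (Idn C c \<triangleright>\<^sub>a\<^bsub>P\<^esub> FBs G)"
      by (simp add: G1.cmp_def G2.cmp_def G2.FAr_comp)
    then show ?thesis unfolding 1 by (simp add: H.cmp_def G2.Y.act_interchange)
  qed
  show ?thesis
    using assms by (elim G1.X.arr_orbE)
      (simp add: H.orbit_map_def G1.orbit_map_def G2.orbit_map_def cmp G2.FAr_comp G2.FAr_dag)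
qed

end

text \<open>
  Conversely a dagger-preserving orbit functor extends to a module functor: every object is \<open>c \<triangleright> Base M\<close>
  for some chosen \<open>c\<close>, and is sent to \<open>c \<triangleright> Base N\<close>.
\<close>

locale orbit_module_map = rigid_module_pair C M N +
  O: orbit_functor C X.orb X.orb_J X.orb_act Y.orb Y.orb_J Y.orb_act \<Theta>
  for C :: "('o, 'a, 'z) rigid_cat_scheme" (structure)
    and M :: "('m, 'y, 'o, 'a, 'w) mod_cat_scheme"
    and N :: "('n, 'x, 'o, 'a, 'v) mod_cat_scheme"
    and \<Theta> :: "'o \<times> 'o \<times> 'y \<Rightarrow> 'o \<times> 'o \<times> 'x" +
  assumes Theta_orb_dag: "arr X.orb T \<Longrightarrow> \<Theta> (X.orb_dag T) = Y.orb_dag (\<Theta> T)"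
begin

definition comp_of :: "'o \<Rightarrow> 'o \<Rightarrow> 'y \<Rightarrow> 'x" where
  "comp_of a b f = snd (snd (\<Theta> (a, b, f)))"

lemma Theta_eq:
  assumes "a \<in> Obj C" "b \<in> Obj C" "arr M f" "src M f = a \<rhd> m" "tgt M f = b \<rhd> m"
  shows "\<Theta> (a, b, f) = (a, b, comp_of a b f)" "arr N (comp_of a b f)" "src N (comp_of a b f) = a \<succ> n" "tgt N (comp_of a b f) = b \<succ> n"
proof -
  have f: "f \<in> Hom M (a \<rhd> m) (b \<rhd> m)" using assms by (simp add: X.M.Hom_iff)
  have "arr Y.orb (\<Theta> (a, b, f))" "src Y.orb (\<Theta> (a, b, f)) = a" "tgt Y.orb (\<Theta> (a, b, f)) = b"
    using O.typed_Theta[of "(a, b, f)"] X.typed_orb[OF assms(1,2) f] by simp_all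
  then show "\<Theta> (a, b, f) = (a, b, comp_of a b f)" "arr N (comp_of a b f)" "src N (comp_of a b f) = a \<succ> n" "tgt N (comp_of a b f) = b \<succ> n"
    unfolding comp_of_def by (auto elim!: Y.arr_orbE)
qed

lemmas typed_comp_of [simp] = Theta_eq(2-4)

lemma comp_of_comp:
  assumes "a \<in> Obj C" "b \<in> Obj C" "c \<in> Obj C" "arr M f" "src M f = a \<rhd> m" "tgt M f = b \<rhd> m"
    "arr M g" "src M g = b \<rhd> m" "tgt M g = c \<rhd> m"
  shows "comp_of b c g \<diamondop> comp_of a b f = comp_of a c (g \<bullet> f)"
proof -
  have "\<Theta> ((b, c, g) \<cdot>\<^bsub>X.orb\<^esub> (a, b, f)) = \<Theta> (b, c, g) \<cdot>\<^bsub>Y.orb\<^esub> \<Theta> (a, b, f)"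
    by (rule O.Theta_comp) (use assms X.typed_orb in \<open>simp_all add: X.M.Hom_iff\<close>)
  then show ?thesis using assms by (simp add: Theta_eq)
qed

lemma comp_of_comp_head:
  assumes "a \<in> Obj C" "b \<in> Obj C" "c \<in> Obj C" "arr M f" "src M f = a \<rhd> m" "tgt M f = b \<rhd> m"
    "arr M g" "src M g = b \<rhd> m" "tgt M g = c \<rhd> m" "arr N k" "tgt N k = a \<succ> n"
  shows "comp_of b c g \<diamondop> (comp_of a b f \<diamondop> k) = comp_of a c (g \<bullet> f) \<diamondop> k"
  by (rule Y.M.rewrite_head[OF comp_of_comp]) (use assms in auto)

lemma comp_of_J:
  assumes "arr C h" "src C h = a" "tgt C h = b"
  shows "comp_of a b (h \<unrhd> Idn M m) = h \<succeq> Idn N n"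
proof -
  have "\<Theta> (X.orb_J h) = Y.orb_J h" using assms by (simp add: O.Theta_J)
  then show ?thesis using assms by (simp add: comp_of_def X.orb_J_def Y.orb_J_def)
qed

lemma comp_of_Idn: "a \<in> Obj C \<Longrightarrow> comp_of a a (Idn M (a \<rhd> m)) = Idn N (a \<succ> n)"
  using comp_of_J[of "Idn C a" a a] by simp

lemma comp_of_act:
  assumes "c \<in> Obj C" "a \<in> Obj C" "b \<in> Obj C" "arr M f" "src M f = a \<rhd> m" "tgt M f = b \<rhd> m"
  shows "(MAsc N c b n)\<dagger>\<^bsub>N\<^esub> \<diamondop> (Idn C c \<succeq> comp_of a b f) \<diamondop> MAsc N c a n
    = comp_of (c \<otimes>\<^sub>o a) (c \<otimes>\<^sub>o b) ((MAsc M c b m)\<dagger>\<^bsub>M\<^esub> \<bullet> (Idn C c \<unrhd> f) \<bullet> MAsc M c a m)"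
proof -
  have "\<Theta> (X.orb_act c (a, b, f)) = Y.orb_act c (\<Theta> (a, b, f))"
    by (rule O.Theta_act) (use assms X.typed_orb in \<open>simp_all add: X.M.Hom_iff\<close>)
  then show ?thesis using assms by (simp add: Theta_eq X.orb_act_def Y.orb_act_def)
qed

lemma comp_of_dag:
  assumes "a \<in> Obj C" "b \<in> Obj C" "arr M f" "src M f = a \<rhd> m" "tgt M f = b \<rhd> m"
  shows "(comp_of a b f)\<dagger>\<^bsub>N\<^esub> = comp_of b a (f\<dagger>\<^bsub>M\<^esub>)"
proof -
  have "\<Theta> (X.orb_dag (a, b, f)) = Y.orb_dag (\<Theta> (a, b, f))"
    by (rule Theta_orb_dag) (use assms X.typed_orb in \<open>simp add: X.M.Hom_iff\<close>)
  then show ?thesis using assms by (simp add: Theta_eq X.orb_dag_def Y.orb_dag_def)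
qed

lemma comp_of_unitary:
  assumes "a \<in> Obj C" "b \<in> Obj C" "unitary_arr M (a \<rhd> m) (b \<rhd> m) f"
  shows "unitary_arr N (a \<succ> n) (b \<succ> n) (comp_of a b f)"
  using assms by (simp add: X.M.unitary_iff Y.M.unitary_iff comp_of_dag comp_of_comp comp_of_Idn)

definition index :: "'m \<Rightarrow> 'o" where
  "index x = (SOME c. c \<in> Obj C \<and> x = c \<rhd> m)"

lemma index [simp]:
  assumes "x \<in> Obj M"
  shows "index x \<in> Obj C" "index x \<rhd> m = x"
proof -
  have "\<exists>c. c \<in> Obj C \<and> x = c \<rhd> m" using X.orbit_object[OF assms] by blast
  from someI_ex[OF this] show "index x \<in> Obj C" "index x \<rhd> m = x" by (auto simp: index_def)
qed

lemma comp_of_Idn_index: "x \<in> Obj M \<Longrightarrow> comp_of (index x) (index x) (Idn M x) = Idn N (index x \<succ> n)"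
  using comp_of_Idn[of "index x"] by simp

definition extend :: "('m, 'y, 'n, 'x, 'o) mod_fun" where
  "extend = \<lparr>FOb = (\<lambda>x. index x \<succ> n), FAr = (\<lambda>f. comp_of (index (src M f)) (index (tgt M f)) f),
     FOm = (\<lambda>c x. comp_of (c \<otimes>\<^sub>o index x) (index (c \<rhd> x)) (MAsc M c (index x) m) \<diamondop> (MAsc N c (index x) n)\<dagger>\<^bsub>N\<^esub>),
     FBs = comp_of (Unt C) (index m) (MUn M m) \<diamondop> (MUn N n)\<dagger>\<^bsub>N\<^esub>\<rparr>"

lemma extend_simps [simp]:
  "FOb extend x = index x \<succ> n" "FAr extend f = comp_of (index (src M f)) (index (tgt M f)) f"
  "FOm extend c x = comp_of (c \<otimes>\<^sub>o index x) (index (c \<rhd> x)) (MAsc M c (index x) m) \<diamondop> (MAsc N c (index x) n)\<dagger>\<^bsub>N\<^esub>"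
  "FBs extend = comp_of (Unt C) (index m) (MUn M m) \<diamondop> (MUn N n)\<dagger>\<^bsub>N\<^esub>"
  by (simp_all add: extend_def)

text \<open>Moving an action past the inverse associator, in the form in which it meets \<open>comp_of\<close>.\<close>

lemma act_comp_of:
  assumes "c \<in> Obj C" "a \<in> Obj C" "b \<in> Obj C" "arr M f" "src M f = a \<rhd> m" "tgt M f = b \<rhd> m"
  shows "(MAsc N c b n)\<dagger>\<^bsub>N\<^esub> \<diamondop> (Idn C c \<succeq> comp_of a b f)
    = comp_of (c \<otimes>\<^sub>o a) (c \<otimes>\<^sub>o b) ((MAsc M c b m)\<dagger>\<^bsub>M\<^esub> \<bullet> (Idn C c \<unrhd> f) \<bullet> MAsc M c a m) \<diamondop> (MAsc N c a n)\<dagger>\<^bsub>N\<^esub>"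
  using assms by (simp flip: comp_of_act)

lemma extend_functor: "cyclic_module_dagger_functor C M N extend"
proof (intro cyclic_module_dagger_functor.intro cyclic_module_functor.intro linear_functor.intro functor_between.intro
    linear_functor_axioms.intro cyclic_module_functor_axioms.intro cyclic_module_dagger_functor_axioms.intro
    X.M.linear_category_axioms Y.M.linear_category_axioms)
  have iso: "iso_arr N x y f" if "unitary_arr N x y f" for x y f
    using that by (auto simp: iso_arr_def unitary_arr_def)
  show om: "unitary_arr N (c \<succ> FOb extend x) (FOb extend (c \<rhd> x)) (FOm extend c x)" if [simp]: "c \<in> Obj C" "x \<in> Obj M" for c x
  proof -
    have "unitary_arr N ((c \<otimes>\<^sub>o index x) \<succ> n) (index (c \<rhd> x) \<succ> n) (comp_of (c \<otimes>\<^sub>o index x) (index (c \<rhd> x)) (MAsc M c (index x) m))"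
      using X.M.MAsc_unitary[of c "index x" m] by (intro comp_of_unitary) simp_all
    then show ?thesis
      using Y.M.unitary_Cmp[OF _ _ _ Y.M.unitary_Dag[OF _ _ Y.M.MAsc_unitary[of c "index x" n]]] by simp
  qed
  show bs: "unitary_arr N n (FOb extend m) (FBs extend)"
  proof -
    have "unitary_arr N (Unt C \<succ> n) (index m \<succ> n) (comp_of (Unt C) (index m) (MUn M m))"
      using X.M.MUn_unitary[of m] by (intro comp_of_unitary) simp_all
    then show ?thesis
      using Y.M.unitary_Cmp[OF _ _ _ Y.M.unitary_Dag[OF _ _ Y.M.MUn_unitary[of n]]] by simp
  qed
  show "iso_arr N (c \<succ> FOb extend x) (FOb extend (c \<rhd> x)) (FOm extend c x)" if "c \<in> Obj C" "x \<in> Obj M" for c x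
    by (rule iso[OF om[OF that]])
  show "iso_arr N n (FOb extend m) (FBs extend)" by (rule iso[OF bs])
next
  fix a b assume [simp]: "a \<in> Obj M" "b \<in> Obj M"
  have "linear_map (hom_space M a b) (hom_space X.orb (index a) (index b)) (\<lambda>f. (index a, index b, f))"
    using X.tag_linear(1)[of "index a" "index b"] by simp
  then have "linear_map (hom_space M a b) (hom_space N (index a \<succ> n) (index b \<succ> n)) (\<lambda>f. comp_of (index a) (index b) f)"
    unfolding comp_of_def by (intro linear_map_comp[OF linear_map_comp[OF _ O.Theta_linear] Y.tag_linear(2)]) simp_all
  then have "linear_map (hom_space M a b) (hom_space N (index a \<succ> n) (index b \<succ> n)) (FAr extend)"
    by (rule semilinear_map_cong[OF _ X.M.hom_vector_space]) (auto simp: hom_space_def X.M.Hom_iff)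
  then show "linear_map (hom_space M a b) (hom_space N (FOb extend a) (FOb extend b)) (FAr extend)" by simp
next
  fix c d x y f g assume "c \<in> Obj C" "d \<in> Obj C" "x \<in> Obj M" "y \<in> Obj M" "f \<in> Hom C c d" "g \<in> Hom M x y"
  then have [simp]: "c \<in> Obj C" "d \<in> Obj C" "x \<in> Obj M" "y \<in> Obj M" "arr C f" "src C f = c" "tgt C f = d"
    "arr M g" "src M g = x" "tgt M g = y"
    by (simp_all add: X.Hom_iff X.M.Hom_iff)
  let ?h = "comp_of (index x) (index y) g"
  have 1: "(MAsc N d (index x) n)\<dagger>\<^bsub>N\<^esub> \<diamondop> (f \<succeq> Idn N (index x \<succ> n)) = ((f \<otimes>\<^sub>a Idn C (index x)) \<succeq> Idn N n) \<diamondop> (MAsc N c (index x) n)\<dagger>\<^bsub>N\<^esub>"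
    using Y.MAsc_nat_conj[of f "Idn C (index x)" "Idn N n" c "index x" n d "index x" n, symmetric] by simp
  have 2: "MAsc M d (index x) m \<bullet> ((f \<otimes>\<^sub>a Idn C (index x)) \<unrhd> Idn M m) = (f \<unrhd> Idn M x) \<bullet> MAsc M c (index x) m"
    using X.MAsc_nat[of f "Idn C (index x)" "Idn M m" c "index x" m d "index x" m] by simp
  have "FOm extend d y \<diamondop> (f \<succeq> FAr extend g)
      = comp_of (d \<otimes>\<^sub>o index y) (index (d \<rhd> y)) (MAsc M d (index y) m) \<diamondop> ((MAsc N d (index y) n)\<dagger>\<^bsub>N\<^esub> \<diamondop> (Idn C d \<succeq> ?h)) \<diamondop> (f \<succeq> Idn N (index x \<succ> n))"
    by (simp add: Y.act_interchange)
  also have "\<dots> = comp_of (d \<otimes>\<^sub>o index x) (index (d \<rhd> y)) ((Idn C d \<unrhd> g) \<bullet> MAsc M d (index x) m) \<diamondop>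
      ((MAsc N d (index x) n)\<dagger>\<^bsub>N\<^esub> \<diamondop> (f \<succeq> Idn N (index x \<succ> n)))"
    by (simp add: act_comp_of comp_of_comp_head)
  also have "\<dots> = comp_of (d \<otimes>\<^sub>o index x) (index (d \<rhd> y)) ((Idn C d \<unrhd> g) \<bullet> MAsc M d (index x) m) \<diamondop>
      comp_of (c \<otimes>\<^sub>o index x) (d \<otimes>\<^sub>o index x) ((f \<otimes>\<^sub>a Idn C (index x)) \<unrhd> Idn M m) \<diamondop> (MAsc N c (index x) n)\<dagger>\<^bsub>N\<^esub>"
    unfolding 1 by (simp add: comp_of_J)
  also have "\<dots> = comp_of (c \<otimes>\<^sub>o index x) (index (d \<rhd> y)) ((f \<unrhd> g) \<bullet> MAsc M c (index x) m) \<diamondop> (MAsc N c (index x) n)\<dagger>\<^bsub>N\<^esub>"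
    by (simp add: comp_of_comp_head 2 X.act_interchange_head)
  also have "\<dots> = FAr extend (f \<unrhd> g) \<diamondop> FOm extend c x"
    by (simp add: comp_of_comp_head)
  finally show "FAr extend (f \<unrhd> g) \<diamondop> FOm extend c x = FOm extend d y \<diamondop> (f \<succeq> FAr extend g)" ..
next
  fix a b x assume [simp]: "a \<in> Obj C" "b \<in> Obj C" "x \<in> Obj M"
  let ?p = "index x" and ?q = "index (b \<rhd> x)" and ?r = "index (a \<rhd> b \<rhd> x)"
  let ?I = "Idn C a"
  have pentN: "(MAsc N a (b \<otimes>\<^sub>o ?p) n)\<dagger>\<^bsub>N\<^esub> \<diamondop> (?I \<succeq> (MAsc N b ?p n)\<dagger>\<^bsub>N\<^esub>) \<diamondop> MAsc N a b (?p \<succ> n)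
      = (Asc C a b ?p \<succeq> Idn N n) \<diamondop> (MAsc N (a \<otimes>\<^sub>o b) ?p n)\<dagger>\<^bsub>N\<^esub>"
  proof -
    have "(?I \<succeq> (MAsc N b ?p n)\<dagger>\<^bsub>N\<^esub>) \<diamondop> (MAsc N a b (?p \<succ> n) \<diamondop> MAsc N (a \<otimes>\<^sub>o b) ?p n)
        = MAsc N a (b \<otimes>\<^sub>o ?p) n \<diamondop> (Asc C a b ?p \<succeq> Idn N n)"
      by (subst Y.M.module_pentagon[symmetric]) (simp_all add: Y.act_interchange_head)
    then have "(MAsc N a (b \<otimes>\<^sub>o ?p) n)\<dagger>\<^bsub>N\<^esub> \<diamondop> ((?I \<succeq> (MAsc N b ?p n)\<dagger>\<^bsub>N\<^esub>) \<diamondop> (MAsc N a b (?p \<succ> n) \<diamondop> MAsc N (a \<otimes>\<^sub>o b) ?p n))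
        \<diamondop> (MAsc N (a \<otimes>\<^sub>o b) ?p n)\<dagger>\<^bsub>N\<^esub> = (Asc C a b ?p \<succeq> Idn N n) \<diamondop> (MAsc N (a \<otimes>\<^sub>o b) ?p n)\<dagger>\<^bsub>N\<^esub>" by simp
    then show ?thesis by simp
  qed
  have pentM: "(?I \<unrhd> MAsc M b ?p m) \<bullet> MAsc M a (b \<otimes>\<^sub>o ?p) m \<bullet> (Asc C a b ?p \<unrhd> Idn M m) = MAsc M a b x \<bullet> MAsc M (a \<otimes>\<^sub>o b) ?p m"
    using X.M.module_pentagon[of a b ?p m] by simp
  have "FOm extend a (b \<rhd> x) \<diamondop> (?I \<succeq> FOm extend b x) \<diamondop> MAsc N a b (FOb extend x)
      = comp_of (a \<otimes>\<^sub>o ?q) ?r (MAsc M a ?q m) \<diamondop> ((MAsc N a ?q n)\<dagger>\<^bsub>N\<^esub> \<diamondop> (?I \<succeq> comp_of (b \<otimes>\<^sub>o ?p) ?q (MAsc M b ?p m))) \<diamondop>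
        (?I \<succeq> (MAsc N b ?p n)\<dagger>\<^bsub>N\<^esub>) \<diamondop> MAsc N a b (?p \<succ> n)"
    by (simp add: Y.act_interchange_head)
  also have "\<dots> = comp_of (a \<otimes>\<^sub>o (b \<otimes>\<^sub>o ?p)) ?r ((?I \<unrhd> MAsc M b ?p m) \<bullet> MAsc M a (b \<otimes>\<^sub>o ?p) m) \<diamondop>
        ((MAsc N a (b \<otimes>\<^sub>o ?p) n)\<dagger>\<^bsub>N\<^esub> \<diamondop> (?I \<succeq> (MAsc N b ?p n)\<dagger>\<^bsub>N\<^esub>) \<diamondop> MAsc N a b (?p \<succ> n))"
    by (simp add: act_comp_of comp_of_comp_head)
  also have "\<dots> = comp_of (a \<otimes>\<^sub>o (b \<otimes>\<^sub>o ?p)) ?r ((?I \<unrhd> MAsc M b ?p m) \<bullet> MAsc M a (b \<otimes>\<^sub>o ?p) m) \<diamondop>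
        comp_of ((a \<otimes>\<^sub>o b) \<otimes>\<^sub>o ?p) (a \<otimes>\<^sub>o (b \<otimes>\<^sub>o ?p)) (Asc C a b ?p \<unrhd> Idn M m) \<diamondop> (MAsc N (a \<otimes>\<^sub>o b) ?p n)\<dagger>\<^bsub>N\<^esub>"
    unfolding pentN by (simp add: comp_of_J)
  also have "\<dots> = FAr extend (MAsc M a b x) \<diamondop> FOm extend (a \<otimes>\<^sub>o b) x"
    by (simp add: comp_of_comp_head pentM)
  finally show "FAr extend (MAsc M a b x) \<diamondop> FOm extend (a \<otimes>\<^sub>o b) x
    = FOm extend a (b \<rhd> x) \<diamondop> (?I \<succeq> FOm extend b x) \<diamondop> MAsc N a b (FOb extend x)" ..
next
  fix x assume [simp]: "x \<in> Obj M"
  let ?p = "index x" and ?I = "Unt C"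
  have "FAr extend (MUn M x) \<diamondop> FOm extend ?I x = comp_of (?I \<otimes>\<^sub>o ?p) ?p (MUn M (?p \<rhd> m) \<bullet> MAsc M ?I ?p m) \<diamondop> (MAsc N ?I ?p n)\<dagger>\<^bsub>N\<^esub>"
    by (simp add: comp_of_comp_head)
  also have "\<dots> = (LUn C ?p \<succeq> Idn N n) \<diamondop> (MAsc N ?I ?p n)\<dagger>\<^bsub>N\<^esub>"
    by (subst X.MUn_act) (simp_all add: comp_of_J del: index(2))
  also have "\<dots> = MUn N (FOb extend x)"
    by (simp flip: Y.MUn_act)
  finally show "FAr extend (MUn M x) \<diamondop> FOm extend ?I x = MUn N (FOb extend x)" .
qed (simp_all add: X.M.Hom_iff Y.M.Hom_iff comp_of_comp comp_of_dag comp_of_Idn_index)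

lemma rigid_module_functor_extend: "rigid_module_functor C M N extend"
  by (intro rigid_module_functor.intro rigid_module_pair_axioms extend_functor)

lemma orbit_map_extend:
  assumes T: "arr X.orb T"
  shows "rigid_module_functor.orbit_map C M N extend T = \<Theta> T"
proof -
  interpret E: rigid_module_functor C M N extend by (rule rigid_module_functor_extend)
  have cmp: "E.cmp a = comp_of a (index (a \<rhd> m)) (Idn M (a \<rhd> m))" if [simp]: "a \<in> Obj C" for a
  proof -
    let ?p = "index m" and ?q = "index (a \<rhd> m)" and ?I = "Unt C"
    have 1: "(MAsc N a ?I n)\<dagger>\<^bsub>N\<^esub> \<diamondop> (Idn C a \<succeq> (MUn N n)\<dagger>\<^bsub>N\<^esub>) = (RUn C a)\<dagger> \<succeq> Idn N n"
    proof -
      have "((Idn C a \<succeq> MUn N n) \<diamondop> MAsc N a ?I n)\<dagger>\<^bsub>N\<^esub> = (RUn C a \<succeq> Idn N n)\<dagger>\<^bsub>N\<^esub>"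
        by (subst Y.M.module_triangle) simp_all
      then show ?thesis by simp
    qed
    have 2: "(Idn C a \<unrhd> MUn M m) \<bullet> MAsc M a ?I m \<bullet> ((RUn C a)\<dagger> \<unrhd> Idn M m) = Idn M (a \<rhd> m)"
    proof -
      have "((Idn C a \<unrhd> MUn M m) \<bullet> MAsc M a ?I m) \<bullet> ((RUn C a)\<dagger> \<unrhd> Idn M m) = Idn M (a \<rhd> m)"
        by (subst X.M.module_triangle) (simp_all add: X.act_interchange)
      then show ?thesis by simp
    qed
    have "E.cmp a = comp_of (a \<otimes>\<^sub>o ?p) ?q (MAsc M a ?p m) \<diamondop> ((MAsc N a ?p n)\<dagger>\<^bsub>N\<^esub> \<diamondop> (Idn C a \<succeq> comp_of ?I ?p (MUn M m))) \<diamondop> (Idn C a \<succeq> (MUn N n)\<dagger>\<^bsub>N\<^esub>)"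
      by (simp add: E.cmp_def Y.act_interchange)
    also have "\<dots> = comp_of (a \<otimes>\<^sub>o ?I) ?q ((Idn C a \<unrhd> MUn M m) \<bullet> MAsc M a ?I m) \<diamondop> ((MAsc N a ?I n)\<dagger>\<^bsub>N\<^esub> \<diamondop> (Idn C a \<succeq> (MUn N n)\<dagger>\<^bsub>N\<^esub>))"
      by (simp add: act_comp_of comp_of_comp_head)
    also have "\<dots> = comp_of (a \<otimes>\<^sub>o ?I) ?q ((Idn C a \<unrhd> MUn M m) \<bullet> MAsc M a ?I m) \<diamondop> comp_of a (a \<otimes>\<^sub>o ?I) ((RUn C a)\<dagger> \<unrhd> Idn M m)"
      unfolding 1 by (simp add: comp_of_J)
    also have "\<dots> = comp_of a ?q (Idn M (a \<rhd> m))"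
      by (simp add: comp_of_comp 2)
    finally show ?thesis .
  qed
  from T obtain a b t where T: "T = (a, b, t)" and [simp]: "a \<in> Obj C" "b \<in> Obj C" "arr M t"
    "src M t = a \<rhd> m" "tgt M t = b \<rhd> m" by (elim X.arr_orbE)
  show ?thesis
    by (simp add: T E.orbit_map_def cmp comp_of_dag comp_of_comp Theta_eq)
qed

end

section \<open>Realising an orbit category by a cyclic module dagger category\<close>

context orbit_category
begin

text \<open>The action of arrows of \<open>C\<close> on arrows of \<open>K\<close>, combining \<open>J\<close> and \<open>act\<close>.\<close>

definition whisk :: "'a \<Rightarrow> 'y \<Rightarrow> 'y" where
  "whisk f T = J (f \<otimes>\<^sub>a Idn C (tgt K T)) \<star> act (src C f) T"

lemma typed_whisk [simp]:
  assumes "arr C f" "arr K T"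
  shows "arr K (whisk f T)" "src K (whisk f T) = src C f \<otimes>\<^sub>o src K T" "tgt K (whisk f T) = tgt C f \<otimes>\<^sub>o tgt K T"
  using assms by (simp_all add: whisk_def)

lemma whisk_comp:
  assumes [simp]: "arr C f" "arr C g" "tgt C f = src C g" "arr K T" "arr K S" "tgt K T = src K S"
  shows "whisk (g \<cdot> f) (S \<star> T) = whisk g S \<star> whisk f T"
proof -
  have 1: "J (f \<otimes>\<^sub>a Idn C (tgt K S)) \<star> act (src C f) S = act (src C g) S \<star> J (f \<otimes>\<^sub>a Idn C (src K S))"
    using J_act[of f S] by simp
  have "whisk (g \<cdot> f) (S \<star> T) = J (g \<otimes>\<^sub>a Idn C (tgt K S)) \<star> (J (f \<otimes>\<^sub>a Idn C (tgt K S)) \<star> act (src C f) S) \<star> act (src C f) T"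
    by (simp add: whisk_def whisker_right J_Cmp act_Cmp)
  also have "\<dots> = whisk g S \<star> whisk f T"
    unfolding 1 by (simp add: whisk_def)
  finally show ?thesis .
qed

lemma whisk_J: "\<lbrakk>arr C f; arr C g\<rbrakk> \<Longrightarrow> whisk f (J g) = J (f \<otimes>\<^sub>a g)"
  by (simp add: whisk_def act_J J_comp interchange)

lemma whisk_Idn: "\<lbrakk>c \<in> Obj C; arr K T\<rbrakk> \<Longrightarrow> whisk (Idn C c) T = act c T"
  by (simp add: whisk_def J_Idn)

lemma whisk_TOb:
  assumes [simp]: "arr C f" "arr C g" "arr K T"
  shows "J (Asc C (tgt C f) (tgt C g) (tgt K T)) \<star> whisk (f \<otimes>\<^sub>a g) T
    = whisk f (whisk g T) \<star> J (Asc C (src C f) (src C g) (src K T))"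
proof -
  let ?y = "tgt K T"
  have 1: "Asc C (tgt C f) (tgt C g) ?y \<cdot> ((f \<otimes>\<^sub>a g) \<otimes>\<^sub>a Idn C ?y) = (f \<otimes>\<^sub>a (g \<otimes>\<^sub>a Idn C ?y)) \<cdot> Asc C (src C f) (src C g) ?y"
    by (rule Asc_nat) simp_all
  have "J (Asc C (tgt C f) (tgt C g) ?y) \<star> whisk (f \<otimes>\<^sub>a g) T
      = J (f \<otimes>\<^sub>a (g \<otimes>\<^sub>a Idn C ?y)) \<star> (J (Asc C (src C f) (src C g) ?y) \<star> act (src C f \<otimes>\<^sub>o src C g) T)"
    by (simp add: whisk_def J_comp_head 1)
  also have "\<dots> = whisk f (whisk g T) \<star> J (Asc C (src C f) (src C g) (src K T))"
    by (subst act_TOb) (simp_all add: whisk_def act_Cmp act_J J_comp_head interchange)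
  finally show ?thesis .
qed

lemma whisk_linear_right:
  assumes [simp]: "arr C f" "a \<in> Obj C" "b \<in> Obj C"
  shows "linear_map (hom_space K a b) (hom_space K (src C f \<otimes>\<^sub>o a) (tgt C f \<otimes>\<^sub>o b)) (whisk f)"
proof -
  have 1: "linear_map (hom_space K (src C f \<otimes>\<^sub>o a) (src C f \<otimes>\<^sub>o b)) (hom_space K (src C f \<otimes>\<^sub>o a) (tgt C f \<otimes>\<^sub>o b)) (\<lambda>g. J (f \<otimes>\<^sub>a Idn C b) \<star> g)"
    using K.comp_left_linear[of "J (f \<otimes>\<^sub>a Idn C b)" "src C f \<otimes>\<^sub>o a"] by simp
  have "linear_map (hom_space K a b) (hom_space K (src C f \<otimes>\<^sub>o a) (tgt C f \<otimes>\<^sub>o b)) (\<lambda>T. J (f \<otimes>\<^sub>a Idn C b) \<star> act (src C f) T)"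
    by (rule linear_map_comp[OF act_linear 1]) simp_all
  then show ?thesis
    by (rule semilinear_map_cong) (use K.hom_vector_space in \<open>auto simp: hom_space_def Hom_K_iff whisk_def\<close>)
qed

lemma whisk_linear_left:
  assumes [simp]: "arr K T" "c \<in> Obj C" "d \<in> Obj C"
  shows "linear_map (hom_space C c d) (hom_space K (c \<otimes>\<^sub>o src K T) (d \<otimes>\<^sub>o tgt K T)) (\<lambda>f. whisk f T)"
proof -
  let ?b = "tgt K T"
  have 1: "linear_map (hom_space C c d) (hom_space C (c \<otimes>\<^sub>o ?b) (d \<otimes>\<^sub>o ?b)) (\<lambda>f. f \<otimes>\<^sub>a Idn C ?b)"
    using TAr_bilinear[of c d ?b ?b] Idn_in[of ?b] by (simp add: bilinear_map_def hom_space_def)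
  have 2: "linear_map (hom_space C (c \<otimes>\<^sub>o ?b) (d \<otimes>\<^sub>o ?b)) (hom_space K (c \<otimes>\<^sub>o ?b) (d \<otimes>\<^sub>o ?b)) J"
    by (rule J_linear) simp_all
  have 3: "linear_map (hom_space K (c \<otimes>\<^sub>o ?b) (d \<otimes>\<^sub>o ?b)) (hom_space K (c \<otimes>\<^sub>o src K T) (d \<otimes>\<^sub>o ?b)) (\<lambda>g. g \<star> act c T)"
    using K.comp_right_linear[of "act c T" "d \<otimes>\<^sub>o ?b"] by simp
  show ?thesis
    by (rule semilinear_map_cong[OF linear_map_comp[OF linear_map_comp[OF 1 2] 3] hom_vector_space])
      (auto simp: hom_space_def Hom_iff whisk_def)
qed

end

context orbit_dagger
begin

lemma dag_whisk:
  assumes [simp]: "arr C f" "arr K T"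
  shows "dag (whisk f T) = whisk (f\<dagger>) (dag T)"
  using J_act[of "f\<dagger>" "dag T"] by (simp add: whisk_def dag_comp' dag_J dag_act)

end

text \<open>
  The object \<open>c\<close> of the orbit category stands for \<open>c \<triangleright> m\<close>, where the basepoint \<open>m\<close> is the unit. So that every
  object has this form on the nose, \<open>c\<close> acts on the unit by \<open>c\<close> instead of the isomorphic \<open>c \<otimes> 1\<close>.
  The arrows are named by an injection \<open>\<kappa>\<close>.
\<close>

locale realisation = orbit_dagger +
  fixes e :: "'a \<Rightarrow> 'm" and \<kappa> :: "'d \<Rightarrow> 'v"
  assumes inj_e: "inj_on e (Obj C)"
    and inj_kappa: "\<lbrakk>a \<in> Obj C; b \<in> Obj C\<rbrakk> \<Longrightarrow> inj_on \<kappa> (Hom K a b)"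
begin

definition obj_of :: "'m \<Rightarrow> 'a" where "obj_of = inv_into (Obj C) e"

definition enc :: "'d \<Rightarrow> 'm \<times> 'm \<times> 'v" where
  "enc T = (e (src K T), e (tgt K T), \<kappa> T)"

definition dec :: "'m \<times> 'm \<times> 'v \<Rightarrow> 'd" where
  "dec f = inv_into (Hom K (obj_of (fst f)) (obj_of (fst (snd f)))) \<kappa> (snd (snd f))"

definition ten :: "'a \<Rightarrow> 'a \<Rightarrow> 'a" where
  "ten c d = (if d = Unt C then c else c \<otimes>\<^sub>o d)"

text \<open>The whole structure is transported along these unitaries from \<open>c \<otimes> d\<close> to \<open>ten c d\<close>.\<close>

definition ten_iso :: "'a \<Rightarrow> 'a \<Rightarrow> 'b" where
  "ten_iso c d = (if d = Unt C then RUn C c else Idn C (c \<otimes>\<^sub>o d))"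

definition actT :: "'b \<Rightarrow> 'd \<Rightarrow> 'd" where
  "actT h T = J (ten_iso (tgt C h) (tgt K T)) \<star> whisk h T \<star> J ((ten_iso (src C h) (src K T))\<dagger>)"

definition massoc :: "'a \<Rightarrow> 'a \<Rightarrow> 'a \<Rightarrow> 'b" where
  "massoc a b d = ten_iso a (ten b d) \<cdot> (Idn C a \<otimes>\<^sub>a ten_iso b d) \<cdot> Asc C a b d \<cdot> (ten_iso (a \<otimes>\<^sub>o b) d)\<dagger>"

definition munit :: "'a \<Rightarrow> 'b" where
  "munit d = LUn C d \<cdot> (ten_iso (Unt C) d)\<dagger>"

definition realise :: "('m, 'v, 'a, 'b) tagged_mod_cat" where
  "realise = \<lparr>Obj = e ` Obj C, Hom = (\<lambda>p q. enc ` Hom K (obj_of p) (obj_of q)),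
     Idn = (\<lambda>p. enc (Idn K (obj_of p))), Cmp = (\<lambda>g f. enc (dec g \<star> dec f)),
     HZero = (\<lambda>p q. enc (HZero K (obj_of p) (obj_of q))), HAdd = (\<lambda>f g. enc (HAdd K (dec f) (dec g))),
     HScale = (\<lambda>z f. enc (HScale K z (dec f))), Dag = (\<lambda>f. enc (dag (dec f))),
     ActOb = (\<lambda>c p. e (ten c (obj_of p))), ActAr = (\<lambda>h f. enc (actT h (dec f))),
     MAsc = (\<lambda>a b p. enc (J (massoc a b (obj_of p)))), MUn = (\<lambda>p. enc (J (munit (obj_of p)))),
     Base = e (Unt C)\<rparr>"

lemma obj_of_e [simp]: "a \<in> Obj C \<Longrightarrow> obj_of (e a) = a"
  using inj_e by (simp add: obj_of_def)

lemma dec_enc [simp]: "arr K T \<Longrightarrow> dec (enc T) = T"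
  using inj_kappa[of "src K T" "tgt K T"] by (simp add: dec_def enc_def Hom_K_iff)

lemma enc_eq_iff [simp]: "\<lbrakk>arr K S; arr K T\<rbrakk> \<Longrightarrow> enc S = enc T \<longleftrightarrow> S = T"
  using dec_enc by metis

lemma ten_Obj [simp]: "\<lbrakk>c \<in> Obj C; d \<in> Obj C\<rbrakk> \<Longrightarrow> ten c d \<in> Obj C"
  by (simp add: ten_def)

lemma typed_ten_iso [simp]:
  assumes "c \<in> Obj C" "d \<in> Obj C"
  shows "arr C (ten_iso c d)" "src C (ten_iso c d) = c \<otimes>\<^sub>o d" "tgt C (ten_iso c d) = ten c d"
    "(ten_iso c d)\<dagger> \<cdot> ten_iso c d = Idn C (c \<otimes>\<^sub>o d)" "ten_iso c d \<cdot> (ten_iso c d)\<dagger> = Idn C (ten c d)"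
  using assms by (auto simp: ten_iso_def ten_def)

lemma ten_iso_cancel [simp]:
  "\<lbrakk>c \<in> Obj C; d \<in> Obj C; arr C k; tgt C k = c \<otimes>\<^sub>o d\<rbrakk> \<Longrightarrow> (ten_iso c d)\<dagger> \<cdot> (ten_iso c d \<cdot> k) = k"
  "\<lbrakk>c \<in> Obj C; d \<in> Obj C; arr C k; tgt C k = ten c d\<rbrakk> \<Longrightarrow> ten_iso c d \<cdot> ((ten_iso c d)\<dagger> \<cdot> k) = k"
  by (rule comp_inverse_cancel; simp)+

lemma realise_simps [simp]:
  "Obj realise = e ` Obj C" "Hom realise p q = enc ` Hom K (obj_of p) (obj_of q)" "Idn realise p = enc (Idn K (obj_of p))"
  "g \<cdot>\<^bsub>realise\<^esub> f = enc (dec g \<star> dec f)" "f\<dagger>\<^bsub>realise\<^esub> = enc (dag (dec f))"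
  "c \<triangleright>\<^sub>o\<^bsub>realise\<^esub> p = e (ten c (obj_of p))" "h \<triangleright>\<^sub>a\<^bsub>realise\<^esub> f = enc (actT h (dec f))"
  "MAsc realise a b p = enc (J (massoc a b (obj_of p)))" "MUn realise p = enc (J (munit (obj_of p)))" "Base realise = e (Unt C)"
  by (simp_all add: realise_def)

lemma typed_actT [simp]:
  assumes "arr C h" "arr K T"
  shows "arr K (actT h T)" "src K (actT h T) = ten (src C h) (src K T)" "tgt K (actT h T) = ten (tgt C h) (tgt K T)"
  using assms by (simp_all add: actT_def)

lemma typed_massoc [simp]:
  assumes "a \<in> Obj C" "b \<in> Obj C" "d \<in> Obj C"
  shows "arr C (massoc a b d)" "src C (massoc a b d) = ten (a \<otimes>\<^sub>o b) d" "tgt C (massoc a b d) = ten a (ten b d)"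
    "(massoc a b d)\<dagger> \<cdot> massoc a b d = Idn C (ten (a \<otimes>\<^sub>o b) d)"
    "massoc a b d \<cdot> (massoc a b d)\<dagger> = Idn C (ten a (ten b d))"
  using assms by (simp_all add: massoc_def interchange_head)

lemma typed_munit [simp]:
  assumes "d \<in> Obj C"
  shows "arr C (munit d)" "src C (munit d) = ten (Unt C) d" "tgt C (munit d) = d"
    "(munit d)\<dagger> \<cdot> munit d = Idn C (ten (Unt C) d)" "munit d \<cdot> (munit d)\<dagger> = Idn C d"
  using assms by (simp_all add: munit_def)

lemma actT_comp:
  assumes [simp]: "arr C f" "arr C g" "tgt C f = src C g" "arr K T" "arr K S" "tgt K T = src K S"
  shows "actT (g \<cdot> f) (S \<star> T) = actT g S \<star> actT f T"
  by (simp add: actT_def whisk_comp J_merge J_Idn)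

lemma actT_J: "\<lbrakk>arr C f; arr C g\<rbrakk> \<Longrightarrow> actT f (J g) = J (ten_iso (tgt C f) (tgt C g) \<cdot> (f \<otimes>\<^sub>a g) \<cdot> (ten_iso (src C f) (src C g))\<dagger>)"
  by (simp add: actT_def whisk_J J_Cmp)

lemma actT_Idn: "\<lbrakk>c \<in> Obj C; a \<in> Obj C\<rbrakk> \<Longrightarrow> actT (Idn C c) (Idn K a) = Idn K (ten c a)"
  using actT_J[of "Idn C c" "Idn C a"] by (simp add: J_Idn)

lemma actT_massoc:
  assumes [simp]: "arr C f" "arr C g" "arr K T"
  shows "J (massoc (tgt C f) (tgt C g) (tgt K T)) \<star> actT (f \<otimes>\<^sub>a g) T
    = actT f (actT g T) \<star> J (massoc (src C f) (src C g) (src K T))"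
proof -
  let ?a = "src C f" and ?a' = "tgt C f" and ?b = "src C g" and ?b' = "tgt C g" and ?x = "src K T" and ?x' = "tgt K T"
  have 1: "whisk f (actT g T) = J (Idn C ?a' \<otimes>\<^sub>a ten_iso ?b' ?x') \<star> whisk f (whisk g T) \<star> J (Idn C ?a \<otimes>\<^sub>a (ten_iso ?b ?x)\<dagger>)"
  proof -
    have "whisk f (actT g T) = whisk (Idn C ?a') (J (ten_iso ?b' ?x')) \<star> whisk f (whisk g T \<star> J ((ten_iso ?b ?x)\<dagger>))"
      using whisk_comp[of f "Idn C ?a'" "whisk g T \<star> J ((ten_iso ?b ?x)\<dagger>)" "J (ten_iso ?b' ?x')"] by (simp add: actT_def)
    also have "whisk f (whisk g T \<star> J ((ten_iso ?b ?x)\<dagger>)) = whisk f (whisk g T) \<star> whisk (Idn C ?a) (J ((ten_iso ?b ?x)\<dagger>))"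
      using whisk_comp[of "Idn C ?a" f "J ((ten_iso ?b ?x)\<dagger>)" "whisk g T"] by simp
    finally show ?thesis by (simp add: whisk_J)
  qed
  have "J (massoc ?a' ?b' ?x') \<star> actT (f \<otimes>\<^sub>a g) T
      = J (ten_iso ?a' (ten ?b' ?x') \<cdot> (Idn C ?a' \<otimes>\<^sub>a ten_iso ?b' ?x')) \<star> (J (Asc C ?a' ?b' ?x') \<star> whisk (f \<otimes>\<^sub>a g) T) \<star> J ((ten_iso (?a \<otimes>\<^sub>o ?b) ?x)\<dagger>)"
    by (simp add: massoc_def actT_def J_comp_head)
  also have "\<dots> = J (ten_iso ?a' (ten ?b' ?x') \<cdot> (Idn C ?a' \<otimes>\<^sub>a ten_iso ?b' ?x')) \<star> whisk f (whisk g T) \<star> J (Asc C ?a ?b ?x \<cdot> (ten_iso (?a \<otimes>\<^sub>o ?b) ?x)\<dagger>)"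
    by (subst whisk_TOb) (simp_all add: J_Cmp)
  also have "\<dots> = actT f (actT g T) \<star> J (massoc ?a ?b ?x)"
    unfolding actT_def[of f] by (simp add: 1 massoc_def J_comp interchange_head) (simp add: J_Cmp)
  finally show ?thesis .
qed

lemma actT_munit:
  assumes [simp]: "arr K T"
  shows "J (munit (tgt K T)) \<star> actT (Idn C (Unt C)) T = T \<star> J (munit (src K T))"
proof -
  have "J (munit (tgt K T)) \<star> actT (Idn C (Unt C)) T = (J (LUn C (tgt K T)) \<star> act (Unt C) T) \<star> J ((ten_iso (Unt C) (src K T))\<dagger>)"
    by (simp add: actT_def munit_def whisk_Idn J_comp_head)
  then show ?thesis unfolding act_Unt[OF assms] by (simp add: munit_def J_Cmp)
qed

lemma actT_pentagon:
  assumes [simp]: "a \<in> Obj C" "b \<in> Obj C" "c \<in> Obj C" "x \<in> Obj C"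
  shows "actT (Idn C a) (J (massoc b c x)) \<star> J (massoc a (b \<otimes>\<^sub>o c) x) \<star> actT (Asc C a b c) (Idn K x)
    = J (massoc a b (ten c x)) \<star> J (massoc (a \<otimes>\<^sub>o b) c x)"
proof -
  have 1: "Asc C a b (ten c x) \<cdot> (Idn C (a \<otimes>\<^sub>o b) \<otimes>\<^sub>a ten_iso c x) = (Idn C a \<otimes>\<^sub>a (Idn C b \<otimes>\<^sub>a ten_iso c x)) \<cdot> Asc C a b (c \<otimes>\<^sub>o x)"
    using Asc_nat[of "Idn C a" "Idn C b" "ten_iso c x" a b "c \<otimes>\<^sub>o x" a b "ten c x"] by simp
  have p: "Asc C a b (c \<otimes>\<^sub>o x) \<cdot> Asc C (a \<otimes>\<^sub>o b) c x
      = (Idn C a \<otimes>\<^sub>a Asc C b c x) \<cdot> Asc C a (b \<otimes>\<^sub>o c) x \<cdot> (Asc C a b c \<otimes>\<^sub>a Idn C x)"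
    by (simp add: pentagon)
  let ?z = "(ten_iso ((a \<otimes>\<^sub>o b) \<otimes>\<^sub>o c) x)\<dagger>" and ?S = "ten_iso a (ten b (ten c x)) \<cdot> (Idn C a \<otimes>\<^sub>a ten_iso b (ten c x))"
  have "massoc a b (ten c x) \<cdot> massoc (a \<otimes>\<^sub>o b) c x
      = ?S \<cdot> (Asc C a b (ten c x) \<cdot> (Idn C (a \<otimes>\<^sub>o b) \<otimes>\<^sub>a ten_iso c x)) \<cdot> Asc C (a \<otimes>\<^sub>o b) c x \<cdot> ?z"
    by (simp add: massoc_def)
  also have "\<dots> = ?S \<cdot> (Idn C a \<otimes>\<^sub>a (Idn C b \<otimes>\<^sub>a ten_iso c x)) \<cdot> (Asc C a b (c \<otimes>\<^sub>o x) \<cdot> Asc C (a \<otimes>\<^sub>o b) c x) \<cdot> ?z"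
    unfolding 1 by simp
  also have "\<dots> = (ten_iso a (ten b (ten c x)) \<cdot> (Idn C a \<otimes>\<^sub>a massoc b c x) \<cdot> (ten_iso a (ten (b \<otimes>\<^sub>o c) x))\<dagger>) \<cdot> massoc a (b \<otimes>\<^sub>o c) x \<cdot>
      (ten_iso (a \<otimes>\<^sub>o (b \<otimes>\<^sub>o c)) x \<cdot> (Asc C a b c \<otimes>\<^sub>a Idn C x) \<cdot> ?z)"
    unfolding p by (simp add: massoc_def interchange_head)
  finally have eq: "massoc a b (ten c x) \<cdot> massoc (a \<otimes>\<^sub>o b) c x
     = (ten_iso a (ten b (ten c x)) \<cdot> (Idn C a \<otimes>\<^sub>a massoc b c x) \<cdot> (ten_iso a (ten (b \<otimes>\<^sub>o c) x))\<dagger>) \<cdot> massoc a (b \<otimes>\<^sub>o c) x \<cdot>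
      (ten_iso (a \<otimes>\<^sub>o (b \<otimes>\<^sub>o c)) x \<cdot> (Asc C a b c \<otimes>\<^sub>a Idn C x) \<cdot> ?z)" .
  have "actT (Asc C a b c) (Idn K x) = J (ten_iso (a \<otimes>\<^sub>o (b \<otimes>\<^sub>o c)) x \<cdot> (Asc C a b c \<otimes>\<^sub>a Idn C x) \<cdot> ?z)"
    using actT_J[of "Asc C a b c" "Idn C x"] by (simp add: J_Idn)
  then show ?thesis using eq by (simp add: actT_J J_comp)
qed

lemma actT_triangle:
  assumes [simp]: "a \<in> Obj C" "x \<in> Obj C"
  shows "actT (Idn C a) (J (munit x)) \<star> J (massoc a (Unt C) x) = actT (RUn C a) (Idn K x)"
proof -
  let ?I = "Unt C"
  have "(ten_iso a x \<cdot> (Idn C a \<otimes>\<^sub>a munit x) \<cdot> (ten_iso a (ten ?I x))\<dagger>) \<cdot> massoc a ?I x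
      = ten_iso a x \<cdot> ((Idn C a \<otimes>\<^sub>a LUn C x) \<cdot> Asc C a ?I x) \<cdot> (ten_iso (a \<otimes>\<^sub>o ?I) x)\<dagger>"
    by (simp add: massoc_def munit_def interchange_head)
  also have "\<dots> = ten_iso a x \<cdot> (RUn C a \<otimes>\<^sub>a Idn C x) \<cdot> (ten_iso (a \<otimes>\<^sub>o ?I) x)\<dagger>"
    by (subst triangle) simp_all
  finally show ?thesis
    using actT_J[of "RUn C a" "Idn C x"] by (simp add: actT_J J_comp J_Idn)
qed

lemma dag_actT: "\<lbrakk>arr C h; arr K T\<rbrakk> \<Longrightarrow> dag (actT h T) = actT (h\<dagger>) (dag T)"
  by (simp add: actT_def dag_comp' dag_J dag_whisk)

lemma Hom_realise:
  assumes "a \<in> Obj C" "b \<in> Obj C"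
  shows "f \<in> Hom realise (e a) (e b) \<longleftrightarrow> (\<exists>T. f = enc T \<and> arr K T \<and> src K T = a \<and> tgt K T = b)"
  using assms by (auto simp: Hom_K_iff)

lemma hom_space_realise:
  assumes [simp]: "a \<in> Obj C" "b \<in> Obj C"
  shows "bij_betw enc (carrier (hom_space K a b)) (carrier (hom_space realise (e a) (e b)))"
    "linear_map (hom_space K a b) (hom_space realise (e a) (e b)) enc"
    "\<zero>\<^bsub>hom_space realise (e a) (e b)\<^esub> = enc \<zero>\<^bsub>hom_space K a b\<^esub>"
proof -
  show "bij_betw enc (carrier (hom_space K a b)) (carrier (hom_space realise (e a) (e b)))"
    by (auto simp: bij_betw_def inj_on_def hom_space_def Hom_K_iff)
  show "linear_map (hom_space K a b) (hom_space realise (e a) (e b)) enc"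
    by (auto simp: semilinear_map_def hom_space_def Hom_K_iff) (auto simp: realise_def)
  show "\<zero>\<^bsub>hom_space realise (e a) (e b)\<^esub> = enc \<zero>\<^bsub>hom_space K a b\<^esub>"
    by (simp add: hom_space_def realise_def)
qed

lemma linear_realise:
  assumes [simp]: "a \<in> Obj C" "b \<in> Obj C" and "semilinear_map \<sigma> (hom_space K a b) W G"
    and "\<And>T. \<lbrakk>arr K T; src K T = a; tgt K T = b\<rbrakk> \<Longrightarrow> g (enc T) = G T"
  shows "semilinear_map \<sigma> (hom_space realise (e a) (e b)) W g"
proof (rule semilinear_on_image[OF hom_space_realise(1,2)[OF assms(1,2)]])
  show V: "cvector_space (hom_space K a b)" using K.hom_vector_space by simp
  show "semilinear_map \<sigma> (hom_space K a b) W (\<lambda>u. g (enc u))"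
    by (rule semilinear_map_cong[OF assms(3) V]) (use assms(4) in \<open>simp add: hom_space_def Hom_K_iff\<close>)
qed

lemma linear_category_realise: "linear_category realise"
proof (intro linear_category.intro linear_category_axioms.intro category.intro)
  fix p q assume "p \<in> Obj realise" "q \<in> Obj realise"
  then obtain a b where [simp]: "a \<in> Obj C" "b \<in> Obj C" "p = e a" "q = e b" by auto
  show "cvector_space (hom_space realise p q)"
    using cvector_space_image[OF _ hom_space_realise[of a b]] K.hom_vector_space by simp
next
  fix p q r assume "p \<in> Obj realise" "q \<in> Obj realise" "r \<in> Obj realise"
  then obtain a b c where [simp]: "a \<in> Obj C" "b \<in> Obj C" "c \<in> Obj C" "p = e a" "q = e b" "r = e c" by auto
  show "bilinear_map (hom_space realise q r) (hom_space realise p q) (hom_space realise p r) (\<lambda>g f. g \<cdot>\<^bsub>realise\<^esub> f)"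
    unfolding bilinear_map_def
  proof (intro conjI ballI)
    fix g assume "g \<in> carrier (hom_space realise q r)"
    then obtain S where [simp]: "arr K S" "src K S = b" "tgt K S = c" "g = enc S"
      by (auto simp: hom_space_def Hom_K_iff)
    have 1: "linear_map (hom_space K a b) (hom_space K a c) (\<lambda>T. S \<star> T)"
      using K.comp_left_linear[of S a] by simp
    have "linear_map (hom_space K a b) (hom_space realise p r) (\<lambda>T. enc (S \<star> T))"
      using linear_map_comp[OF 1 hom_space_realise(2)[of a c]] by simp
    then have "linear_map (hom_space realise (e a) (e b)) (hom_space realise p r) (\<lambda>f. g \<cdot>\<^bsub>realise\<^esub> f)"
      by (intro linear_realise) simp_all
    then show "linear_map (hom_space realise p q) (hom_space realise p r) (\<lambda>f. g \<cdot>\<^bsub>realise\<^esub> f)" by simp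
  next
    fix f assume "f \<in> carrier (hom_space realise p q)"
    then obtain T where [simp]: "arr K T" "src K T = a" "tgt K T = b" "f = enc T"
      by (auto simp: hom_space_def Hom_K_iff)
    have 1: "linear_map (hom_space K b c) (hom_space K a c) (\<lambda>S. S \<star> T)"
      using K.comp_right_linear[of T c] by simp
    have "linear_map (hom_space K b c) (hom_space realise p r) (\<lambda>S. enc (S \<star> T))"
      using linear_map_comp[OF 1 hom_space_realise(2)[of a c]] by simp
    then have "linear_map (hom_space realise (e b) (e c)) (hom_space realise p r) (\<lambda>g. g \<cdot>\<^bsub>realise\<^esub> f)"
      by (intro linear_realise) simp_all
    then show "linear_map (hom_space realise q r) (hom_space realise p r) (\<lambda>g. g \<cdot>\<^bsub>realise\<^esub> f)" by simp
  qed
next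
  fix p q p' q' f assume "p \<in> Obj realise" "q \<in> Obj realise" "p' \<in> Obj realise" "q' \<in> Obj realise"
    "f \<in> Hom realise p q" "f \<in> Hom realise p' q'"
  then show "p = p' \<and> q = q'" by (auto simp: Hom_K_iff)
qed (auto simp: Hom_K_iff intro!: image_eqI)

lemma dagger_category_realise: "dagger_category realise"
proof (intro dagger_category.intro dagger_category_axioms.intro linear_category_realise)
  fix p q assume "p \<in> Obj realise" "q \<in> Obj realise"
  then obtain a b where [simp]: "a \<in> Obj C" "b \<in> Obj C" "p = e a" "q = e b" by auto
  have "conj_linear_map (hom_space K a b) (hom_space realise q p) (\<lambda>T. enc (dag T))"
    using conj_linear_map_comp(2)[OF dag_conj_linear hom_space_realise(2)[of b a]] by simp
  then have "conj_linear_map (hom_space realise (e a) (e b)) (hom_space realise q p) (\<lambda>f. f\<dagger>\<^bsub>realise\<^esub>)"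
    by (intro linear_realise) simp_all
  then show "conj_linear_map (hom_space realise p q) (hom_space realise q p) (\<lambda>f. f\<dagger>\<^bsub>realise\<^esub>)" by simp
qed (auto simp: Hom_K_iff dag_dag' dag_comp')

lemma unitary_realise:
  assumes "arr C u" "src C u = a" "tgt C u = b" "u\<dagger> \<cdot> u = Idn C a" "u \<cdot> u\<dagger> = Idn C b"
  shows "unitary_arr realise (e a) (e b) (enc (J u))"
proof -
  have [simp]: "a \<in> Obj C" "b \<in> Obj C" using assms(1-3) by auto
  show ?thesis
    using assms unfolding unitary_arr_def mutually_inverse_def
    by (auto simp: Hom_K_iff dag_J J_comp J_Idn intro!: image_eqI)
qed

lemma module_category_realise: "module_category C realise"
proof (intro module_category.intro module_category_axioms.intro linear_category_realise)
  have iso: "iso_arr realise x y f" if "unitary_arr realise x y f" for x y f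
    using that unfolding iso_arr_def unitary_arr_def by blast
  show "iso_arr realise ((a \<otimes>\<^sub>o b) \<triangleright>\<^sub>o\<^bsub>realise\<^esub> p) (a \<triangleright>\<^sub>o\<^bsub>realise\<^esub> (b \<triangleright>\<^sub>o\<^bsub>realise\<^esub> p)) (MAsc realise a b p)"
    if "a \<in> Obj C" "b \<in> Obj C" "p \<in> Obj realise" for a b p
    using that by (auto intro!: iso unitary_realise)
  show "iso_arr realise (Unt C \<triangleright>\<^sub>o\<^bsub>realise\<^esub> p) p (MUn realise p)" if "p \<in> Obj realise" for p
    using that by (auto intro!: iso unitary_realise)
next
  fix c d p q assume "c \<in> Obj C" "d \<in> Obj C" "p \<in> Obj realise" "q \<in> Obj realise"
  then obtain a b where [simp]: "a \<in> Obj C" "b \<in> Obj C" "c \<in> Obj C" "d \<in> Obj C" "p = e a" "q = e b" by auto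
  let ?W = "hom_space realise (e (ten c a)) (e (ten d b))"
  have post: "linear_map (hom_space K (c \<otimes>\<^sub>o a) (d \<otimes>\<^sub>o b)) ?W (\<lambda>T. enc (J (ten_iso d b) \<star> (T \<star> J ((ten_iso c a)\<dagger>))))"
  proof -
    have 1: "linear_map (hom_space K (c \<otimes>\<^sub>o a) (d \<otimes>\<^sub>o b)) (hom_space K (ten c a) (d \<otimes>\<^sub>o b)) (\<lambda>T. T \<star> J ((ten_iso c a)\<dagger>))"
      using K.comp_right_linear[of "J ((ten_iso c a)\<dagger>)" "d \<otimes>\<^sub>o b"] by simp
    have 2: "linear_map (hom_space K (ten c a) (d \<otimes>\<^sub>o b)) (hom_space K (ten c a) (ten d b)) (\<lambda>T. J (ten_iso d b) \<star> T)"
      using K.comp_left_linear[of "J (ten_iso d b)" "ten c a"] by simp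
    show ?thesis by (rule linear_map_comp[OF linear_map_comp[OF 1 2] hom_space_realise(2)]) simp_all
  qed
  show "bilinear_map (hom_space C c d) (hom_space realise p q) (hom_space realise (c \<triangleright>\<^sub>o\<^bsub>realise\<^esub> p) (d \<triangleright>\<^sub>o\<^bsub>realise\<^esub> q))
      (\<lambda>f g. f \<triangleright>\<^sub>a\<^bsub>realise\<^esub> g)"
    unfolding bilinear_map_def
  proof (intro conjI ballI)
    fix f assume "f \<in> carrier (hom_space C c d)"
    then have [simp]: "arr C f" "src C f = c" "tgt C f = d" using Hom_iff[of c d f] by (simp_all add: hom_space_def)
    have "linear_map (hom_space K a b) ?W (\<lambda>T. enc (J (ten_iso d b) \<star> (whisk f T \<star> J ((ten_iso c a)\<dagger>))))"
      using linear_map_comp[OF whisk_linear_right[of f a b] _] post by simp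
    then have "linear_map (hom_space realise (e a) (e b)) ?W (\<lambda>g. f \<triangleright>\<^sub>a\<^bsub>realise\<^esub> g)"
      by (intro linear_realise) (simp_all add: actT_def)
    then show "linear_map (hom_space realise p q) (hom_space realise (c \<triangleright>\<^sub>o\<^bsub>realise\<^esub> p) (d \<triangleright>\<^sub>o\<^bsub>realise\<^esub> q)) (\<lambda>g. f \<triangleright>\<^sub>a\<^bsub>realise\<^esub> g)" by simp
  next
    fix g assume "g \<in> carrier (hom_space realise p q)"
    then obtain T where [simp]: "arr K T" "src K T = a" "tgt K T = b" "g = enc T"
      by (auto simp: hom_space_def Hom_K_iff)
    have "linear_map (hom_space C c d) ?W (\<lambda>f. enc (J (ten_iso d b) \<star> (whisk f T \<star> J ((ten_iso c a)\<dagger>))))"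
      using linear_map_comp[OF whisk_linear_left[of T c d] _] post by simp
    then have "linear_map (hom_space C c d) ?W (\<lambda>f. f \<triangleright>\<^sub>a\<^bsub>realise\<^esub> g)"
      by (rule semilinear_map_cong) (use hom_vector_space Hom_iff[of c d] in \<open>auto simp: hom_space_def actT_def\<close>)
    then show "linear_map (hom_space C c d) (hom_space realise (c \<triangleright>\<^sub>o\<^bsub>realise\<^esub> p) (d \<triangleright>\<^sub>o\<^bsub>realise\<^esub> q)) (\<lambda>f. f \<triangleright>\<^sub>a\<^bsub>realise\<^esub> g)" by simp
  qed
next
  fix a b p a' b' p' f g h
  assume "a \<in> Obj C" "b \<in> Obj C" "p \<in> Obj realise" "a' \<in> Obj C" "b' \<in> Obj C" "p' \<in> Obj realise"
    "f \<in> Hom C a a'" "g \<in> Hom C b b'" "h \<in> Hom realise p p'"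
  then show "MAsc realise a' b' p' \<cdot>\<^bsub>realise\<^esub> ((f \<otimes>\<^sub>a g) \<triangleright>\<^sub>a\<^bsub>realise\<^esub> h)
      = (f \<triangleright>\<^sub>a\<^bsub>realise\<^esub> (g \<triangleright>\<^sub>a\<^bsub>realise\<^esub> h)) \<cdot>\<^bsub>realise\<^esub> MAsc realise a b p"
    using actT_massoc[of f g "dec h"] by (auto simp: Hom_K_iff Hom_iff)
next
  fix p q h assume "p \<in> Obj realise" "q \<in> Obj realise" "h \<in> Hom realise p q"
  then show "MUn realise q \<cdot>\<^bsub>realise\<^esub> (Idn C (Unt C) \<triangleright>\<^sub>a\<^bsub>realise\<^esub> h) = h \<cdot>\<^bsub>realise\<^esub> MUn realise p"
    using actT_munit[of "dec h"] by (auto simp: Hom_K_iff)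
next
  fix a b c p assume "a \<in> Obj C" "b \<in> Obj C" "c \<in> Obj C" "p \<in> Obj realise"
  then show "(Idn C a \<triangleright>\<^sub>a\<^bsub>realise\<^esub> MAsc realise b c p) \<cdot>\<^bsub>realise\<^esub> MAsc realise a (b \<otimes>\<^sub>o c) p \<cdot>\<^bsub>realise\<^esub> (Asc C a b c \<triangleright>\<^sub>a\<^bsub>realise\<^esub> Idn realise p)
      = MAsc realise a b (c \<triangleright>\<^sub>o\<^bsub>realise\<^esub> p) \<cdot>\<^bsub>realise\<^esub> MAsc realise (a \<otimes>\<^sub>o b) c p"
    by (auto simp: actT_pentagon)
next
  fix a p assume "a \<in> Obj C" "p \<in> Obj realise"
  then show "(Idn C a \<triangleright>\<^sub>a\<^bsub>realise\<^esub> MUn realise p) \<cdot>\<^bsub>realise\<^esub> MAsc realise a (Unt C) p = RUn C a \<triangleright>\<^sub>a\<^bsub>realise\<^esub> Idn realise p"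
    by (auto simp: actT_triangle)
qed (auto simp: Hom_K_iff Hom_iff actT_Idn actT_comp)

lemma cyclic_module_dagger_category_realise: "cyclic_module_dagger_category C realise"
proof (intro cyclic_module_dagger_category.intro cyclic_module_dagger_category_axioms.intro module_dagger_category.intro
    module_dagger_category_axioms.intro module_category_realise dagger_category_realise)
  fix a b p assume "a \<in> Obj C" "b \<in> Obj C" "p \<in> Obj realise"
  then show "unitary_arr realise ((a \<otimes>\<^sub>o b) \<triangleright>\<^sub>o\<^bsub>realise\<^esub> p) (a \<triangleright>\<^sub>o\<^bsub>realise\<^esub> (b \<triangleright>\<^sub>o\<^bsub>realise\<^esub> p)) (MAsc realise a b p)"
    by (auto intro!: unitary_realise)
next
  fix p assume "p \<in> Obj realise"
  then show "unitary_arr realise (Unt C \<triangleright>\<^sub>o\<^bsub>realise\<^esub> p) p (MUn realise p)" by (auto intro!: unitary_realise)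
next
  show "Obj realise = (\<lambda>c. c \<triangleright>\<^sub>o\<^bsub>realise\<^esub> Base realise) ` Obj C"
    by (simp add: ten_def)
qed (auto simp: Hom_K_iff Hom_iff dag_actT)

lemma tagged_realise: "tagged_homs realise"
  by (auto simp: tagged_homs_def Hom_K_iff enc_def)

lemma rigid_module_realise: "rigid_module C realise"
  by (intro rigid_module.intro rigid_cstar_tensor_category_axioms cyclic_module_dagger_category_realise)

end

section \<open>Fully faithful and essentially surjective functors\<close>

text \<open>
  The inverse functor sends \<open>a\<close> to a chosen \<open>x\<close> with an isomorphism \<open>a \<rightarrow> Go x\<close>; its value on arrows and the
  second natural isomorphism are preimages under the bijections given by \<open>Ga\<close>.
\<close>

lemma equivalent_categories_if_fully_faithful:
  assumes "category C" "category D" and fG: "functor_between D C Go Ga"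
    and full: "\<And>x y f. \<lbrakk>x \<in> Obj D; y \<in> Obj D; f \<in> Hom C (Go x) (Go y)\<rbrakk> \<Longrightarrow> \<exists>g\<in>Hom D x y. Ga g = f"
    and faithful: "\<And>x y g g'. \<lbrakk>x \<in> Obj D; y \<in> Obj D; g \<in> Hom D x y; g' \<in> Hom D x y; Ga g = Ga g'\<rbrakk> \<Longrightarrow> g = g'"
    and surj: "\<And>a. a \<in> Obj C \<Longrightarrow> \<exists>x\<in>Obj D. \<exists>f. iso_arr C a (Go x) f"
  shows "equivalent_categories C D"
proof -
  interpret C: category C by fact
  interpret D: category D by fact
  interpret G: functor_between D C Go Ga by fact
  have "\<exists>x f g. x \<in> Obj D \<and> mutually_inverse C a (Go x) f g" if "a \<in> Obj C" for a
    using surj[OF that] by (auto simp: iso_arr_def)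
  then obtain Fo i k where inv: "\<And>a. a \<in> Obj C \<Longrightarrow> Fo a \<in> Obj D \<and> mutually_inverse C a (Go (Fo a)) (i a) (k a)"
    by metis
  have Go [simp]: "x \<in> Obj D \<Longrightarrow> Go x \<in> Obj C" for x by (rule G.Fo_in)
  have Fo [simp]: "a \<in> Obj C \<Longrightarrow> Fo a \<in> Obj D" for a using inv by simp
  have ik [simp]: "arr C (i a)" "src C (i a) = a" "tgt C (i a) = Go (Fo a)"
    "arr C (k a)" "src C (k a) = Go (Fo a)" "tgt C (k a) = a"
    "k a \<cdot>\<^bsub>C\<^esub> i a = Idn C a" "i a \<cdot>\<^bsub>C\<^esub> k a = Idn C (Go (Fo a))" if "a \<in> Obj C" for a
    using inv[OF that] that by (simp_all add: C.mutually_inverse_iff)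
  have ki [simp]: "k a \<cdot>\<^bsub>C\<^esub> (i a \<cdot>\<^bsub>C\<^esub> f) = f" if "a \<in> Obj C" "arr C f" "tgt C f = a" for a f
    using C.comp_inverse_cancel[of "k a" "i a" f] that by simp
  have GaI [simp]: "Ga (Idn D x) = Idn C (Go x)" if "x \<in> Obj D" for x by (rule G.Fa_Idn[OF that])
  have Ga [simp]: "arr C (Ga g)" "src C (Ga g) = Go (src D g)" "tgt C (Ga g) = Go (tgt D g)" if "arr D g" for g
    using G.Fa_in[OF D.arr_in_Hom[OF that]] that C.Hom_iff by auto
  have GaC: "Ga (h \<cdot>\<^bsub>D\<^esub> g) = Ga h \<cdot>\<^bsub>C\<^esub> Ga g" if "arr D g" "arr D h" "tgt D g = src D h" for g h
    using G.Fa_Cmp[of "src D g" "tgt D g" "tgt D h" g h] D.arr_in_Hom[OF that(1)] D.arr_in_Hom[OF that(2)] that(3) by simp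
  define pre where "pre x y = inv_into (Hom D x y) Ga" for x y
  have pre: "arr D (pre x y f) \<and> src D (pre x y f) = x \<and> tgt D (pre x y f) = y \<and> Ga (pre x y f) = f"
    if "x \<in> Obj D" "y \<in> Obj D" "arr C f" "src C f = Go x" "tgt C f = Go y" for x y f
  proof -
    have "f \<in> Ga ` Hom D x y" using full[OF that(1,2), of f] C.Hom_iff[of "Go x" "Go y" f] that by auto
    then show ?thesis
      using inv_into_into[of f Ga "Hom D x y"] f_inv_into_f[of f Ga "Hom D x y"] D.Hom_iff[of x y] that(1,2)
      by (simp add: pre_def)
  qed
  note [simp] = pre[THEN conjunct1] pre[THEN conjunct2, THEN conjunct1]
    pre[THEN conjunct2, THEN conjunct2, THEN conjunct1] pre[THEN conjunct2, THEN conjunct2, THEN conjunct2]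
  have eqI: "g = g'" if "Ga g = Ga g'" "arr D g" "arr D g'" "src D g = src D g'" "tgt D g = tgt D g'" for g g'
    by (rule faithful[of "src D g" "tgt D g"]) (use that D.arr_in_Hom[of g] D.arr_in_Hom[of g'] in auto)
  define Fa where "Fa f = pre (Fo (src C f)) (Fo (tgt C f)) (i (tgt C f) \<cdot>\<^bsub>C\<^esub> f \<cdot>\<^bsub>C\<^esub> k (src C f))" for f
  define \<epsilon> where "\<epsilon> x = pre (Fo (Go x)) x (k (Go x))" for x
  have Fa [simp]: "arr D (Fa f)" "src D (Fa f) = Fo (src C f)" "tgt D (Fa f) = Fo (tgt C f)"
    "Ga (Fa f) = i (tgt C f) \<cdot>\<^bsub>C\<^esub> f \<cdot>\<^bsub>C\<^esub> k (src C f)" if "arr C f" for f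
    using that by (simp_all add: Fa_def)
  have "functor_between C D Fo Fa"
  proof
    fix a assume "a \<in> Obj C"
    then show "Fa (Idn C a) = Idn D (Fo a)" by (intro eqI) simp_all
  next
    fix a b f assume "a \<in> Obj C" "b \<in> Obj C" "f \<in> Hom C a b"
    then show "Fa f \<in> Hom D (Fo a) (Fo b)" by (simp add: C.Hom_iff D.Hom_iff)
  next
    fix a b c f g assume "a \<in> Obj C" "b \<in> Obj C" "c \<in> Obj C" "f \<in> Hom C a b" "g \<in> Hom C b c"
    then show "Fa (g \<cdot>\<^bsub>C\<^esub> f) = Fa g \<cdot>\<^bsub>D\<^esub> Fa f" by (intro eqI) (simp_all add: C.Hom_iff GaC)
  qed simp
  moreover have "natural_iso C C id id (Go \<circ> Fo) (Ga \<circ> Fa) i"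
    unfolding natural_iso_def iso_arr_def using inv by (auto simp: C.Hom_iff)
  moreover have "natural_iso D D (Fo \<circ> Go) (Fa \<circ> Ga) id id \<epsilon>"
    unfolding natural_iso_def
  proof (intro conjI ballI)
    fix x assume [simp]: "x \<in> Obj D"
    have "mutually_inverse D (Fo (Go x)) x (\<epsilon> x) (pre x (Fo (Go x)) (i (Go x)))"
      by (auto simp: D.mutually_inverse_iff \<epsilon>_def GaC intro!: eqI)
    then show "iso_arr D ((Fo \<circ> Go) x) (id x) (\<epsilon> x)" by (auto simp: iso_arr_def)
  next
    fix x y g assume "x \<in> Obj D" "y \<in> Obj D" "g \<in> Hom D x y"
    then have "g \<cdot>\<^bsub>D\<^esub> \<epsilon> x = \<epsilon> y \<cdot>\<^bsub>D\<^esub> Fa (Ga g)"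
      by (intro eqI) (auto simp: D.Hom_iff \<epsilon>_def GaC)
    then show "id g \<cdot>\<^bsub>D\<^esub> \<epsilon> x = \<epsilon> y \<cdot>\<^bsub>D\<^esub> (Fa \<circ> Ga) g" by simp
  qed
  ultimately show ?thesis
    unfolding equivalent_categories_def using assms(1-3) by blast
qed

section \<open>Star algebra transformations and orbit functors\<close>

lemma (in star_algebra_transformation) transformation_eqI:
  assumes "\<tau> \<in> extensional (Obj C)" "\<And>a. a \<in> Obj C \<Longrightarrow> \<tau> a \<in> extensional (carrier (VOb A a))"
    and "\<And>a x. \<lbrakk>a \<in> Obj C; x \<in> carrier (VOb A a)\<rbrakk> \<Longrightarrow> \<tau> a x = \<theta> a x"
  shows "\<tau> = \<theta>"
proof (rule extensionalityI[OF assms(1) extensional(1)])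
  fix a assume a: "a \<in> Obj C"
  show "\<tau> a = \<theta> a"
    by (rule extensionalityI[OF assms(2)[OF a] extensional(2)[OF a] assms(3)[OF a]])
qed

text \<open>
  For two presented star algebra objects, star algebra transformations and orbit functors that preserve
  the stars correspond bijectively: restricting an orbit functor to the arrows to the unit is injective
  by \<open>orbit_functor_eqI\<close> and surjective because of \<open>extension\<close>.
\<close>

locale star_presentation_pair = P: star_presentation C K J act A \<pi> + Q: star_presentation C L J' act' B \<rho>
  for C :: "('o, 'a, 'z) rigid_cat_scheme" (structure)
    and K :: "('o, 'y, 'k) lin_cat_scheme" and J and act and A :: "('o, 'a, 'v) star_alg_object" and \<pi>
    and L :: "('o, 'x, 'l) lin_cat_scheme" and J' and act' and B :: "('o, 'a, 'v) star_alg_object" and \<rho>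
begin

definition restriction :: "('y \<Rightarrow> 'x) \<Rightarrow> 'o \<Rightarrow> 'v \<Rightarrow> 'v" where
  "restriction \<Theta> = (\<lambda>c\<in>Obj C. \<lambda>x\<in>carrier (VOb A c). \<rho> (\<Theta> (P.lift c x)))"

lemma restriction_pi [simp]:
  "\<lbrakk>arr K f; tgt K f = Unt C; src K f = c\<rbrakk> \<Longrightarrow> restriction \<Theta> c (\<pi> f) = \<rho> (\<Theta> f)"
  using P.src_tgt_K(1)[of f] by (auto simp: restriction_def)

lemma restriction_lift: "\<lbrakk>c \<in> Obj C; x \<in> carrier (VOb A c)\<rbrakk> \<Longrightarrow> restriction \<Theta> c x = \<rho> (\<Theta> (P.lift c x))"
  by (simp add: restriction_def)

lemma transformation_restriction:
  assumes "orbit_functor C K J act L J' act' \<Theta>"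
    and star: "\<And>f. \<lbrakk>arr K f; tgt K f = Unt C\<rbrakk> \<Longrightarrow> \<Theta> (P.star f) = Q.star (\<Theta> f)"
  shows "star_algebra_transformation C A B (restriction \<Theta>)"
proof -
  interpret T: orbit_functor C K J act L J' act' \<Theta> by fact
  have elem: "\<exists>f. arr K f \<and> src K f = c \<and> tgt K f = Unt C \<and> x = \<pi> f" if "c \<in> Obj C" "x \<in> carrier (VOb A c)" for c x
    using that by (intro exI[of _ "P.lift c x"]) simp
  show ?thesis
  proof
    fix c assume c [simp]: "c \<in> Obj C"
    show "linear_map (VOb A c) (VOb B c) (restriction \<Theta> c)"
      by (rule semilinear_map_cong[OF linear_map_comp[OF linear_map_comp[OF P.lift_linear[OF c] T.Theta_linear] Q.pi_linear]])
        (simp_all add: restriction_lift P.A.VOb_vector_space)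
  next
    fix a b f x assume "a \<in> Obj C" "b \<in> Obj C" "f \<in> Hom C a b" "x \<in> carrier (VOb A b)"
    then show "restriction \<Theta> a (VAr A f x) = VAr B f (restriction \<Theta> b x)"
      using elem[of b x] by (auto simp: P.Hom_iff T.Theta_comp T.Theta_J Q.pi_J simp flip: P.pi_J)
  next
    fix a b x y assume [simp]: "a \<in> Obj C" "b \<in> Obj C" and x: "x \<in> carrier (VOb A a)" and y: "y \<in> carrier (VOb A b)"
    obtain f where f: "arr K f" "src K f = a" "tgt K f = Unt C" "x = \<pi> f" using elem[OF _ x] by auto
    obtain g where g: "arr K g" "src K g = b" "tgt K g = Unt C" "y = \<pi> g" using elem[OF _ y] by auto
    have "AMul A a b x y = \<pi> (P.mul f g)" using f g P.pi_mul[of f g] by simp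
    moreover have "\<Theta> (P.mul f g) = Q.mul (\<Theta> f) (\<Theta> g)"
      using f g by (simp add: P.mul_def Q.mul_def T.Theta_comp T.Theta_J T.Theta_act)
    ultimately show "restriction \<Theta> (a \<otimes>\<^sub>o b) (AMul A a b x y) = AMul B a b (restriction \<Theta> a x) (restriction \<Theta> b y)"
      using f g Q.pi_mul[of "\<Theta> f" "\<Theta> g"] by simp
  next
    have "\<Theta> (Idn K (Unt C)) = Idn L (Unt C)"
      using T.Theta_J[of "Idn C (Unt C)"] by (simp add: P.J_Idn Q.J_Idn)
    then show "restriction \<Theta> (Unt C) (AUnit A) = AUnit B"
      using restriction_pi[of "Idn K (Unt C)" "Unt C" \<Theta>] by (simp add: P.pi_unit Q.pi_unit)
  next
    fix a x assume "a \<in> Obj C" "x \<in> carrier (VOb A a)"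
    then obtain f where f: "arr K f" "src K f = a" "tgt K f = Unt C" "x = \<pi> f" using elem by metis
    then show "restriction \<Theta> (Cj C a) (AStar A a x) = AStar B a (restriction \<Theta> a x)"
      using f restriction_pi[of "P.star f" "Cj C a" \<Theta>] by (simp add: star)
  qed (simp_all add: restriction_def)
qed

lemma restriction_inj:
  assumes "orbit_functor C K J act L J' act' \<Theta>" "orbit_functor C K J act L J' act' \<Theta>'"
    and eq: "restriction \<Theta> = restriction \<Theta>'" and "arr K T"
  shows "\<Theta> T = \<Theta>' T"
proof -
  interpret T: orbit_functor C K J act L J' act' \<Theta> by fact
  interpret T': orbit_functor C K J act L J' act' \<Theta>' by fact
  show ?thesis
  proof (rule T.orbit_functor_eqI[OF assms(2) _ assms(4)])
    fix f assume [simp]: "arr K f" "tgt K f = Unt C"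
    have "\<rho> (\<Theta> f) = \<rho> (\<Theta>' f)"
      using restriction_pi[of f "src K f" \<Theta>] restriction_pi[of f "src K f" \<Theta>'] by (simp add: eq)
    then show "\<Theta> f = \<Theta>' f" by (rule Q.pi_inj) simp_all
  qed
qed

lemma transformation_extends:
  assumes "star_algebra_transformation C A B \<theta>"
  obtains \<Theta> where "orbit_functor C K J act L J' act' \<Theta>"
    "\<And>f. \<lbrakk>arr K f; tgt K f = Unt C\<rbrakk> \<Longrightarrow> \<Theta> (P.star f) = Q.star (\<Theta> f)" "restriction \<Theta> = \<theta>"
proof -
  interpret \<theta>: star_algebra_transformation C A B \<theta> by fact
  define \<theta>' where "\<theta>' f = Q.lift (src K f) (\<theta> (src K f) (\<pi> f))" for f
  have th [simp]: "\<theta> c x \<in> carrier (VOb B c)" if "c \<in> Obj C" "x \<in> carrier (VOb A c)" for c x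
    using \<theta>.linear[OF that(1)] that by (auto simp: semilinear_map_def)
  have th' [simp]: "arr L (\<theta>' f)" "src L (\<theta>' f) = src K f" "tgt L (\<theta>' f) = Unt C" "\<rho> (\<theta>' f) = \<theta> (src K f) (\<pi> f)"
    if "arr K f" "tgt K f = Unt C" for f
    using that by (simp_all add: \<theta>'_def)
  interpret M: orbit_algebra_map C K J act L J' act' \<theta>'
  proof
    fix c assume [simp]: "c \<in> Obj C"
    show "linear_map (hom_space K c (Unt C)) (hom_space L c (Unt C)) \<theta>'"
      by (rule semilinear_map_cong[OF linear_map_comp[OF linear_map_comp[OF P.pi_linear[of c] \<theta>.linear] Q.lift_linear]])
        (use P.K.hom_vector_space in \<open>simp_all add: hom_space_def P.Hom_K_iff \<theta>'_def\<close>)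
  next
    fix f h assume [simp]: "arr K f" "tgt K f = Unt C" "arr C h" "tgt C h = src K f"
    show "\<theta>' (f \<cdot>\<^bsub>K\<^esub> J h) = \<theta>' f \<cdot>\<^bsub>L\<^esub> J' h"
      by (rule Q.pi_inj) (use \<theta>.natural[of "src C h" "src K f" h "\<pi> f"] P.arr_in_Hom[of h] in \<open>simp_all add: P.pi_J Q.pi_J\<close>)
  next
    fix f g assume [simp]: "arr K f" "tgt K f = Unt C" "arr K g" "tgt K g = Unt C"
    show "\<theta>' (P.mul f g) = Q.mul (\<theta>' f) (\<theta>' g)"
      by (rule Q.pi_inj) (use \<theta>.multiplicative[of "src K f" "src K g" "\<pi> f" "\<pi> g"] in \<open>simp_all add: P.pi_mul Q.pi_mul\<close>)
  next
    show "\<theta>' (Idn K (Unt C)) = Idn L (Unt C)"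
      by (rule Q.pi_inj) (simp_all add: P.pi_unit Q.pi_unit \<theta>.unital)
  qed
  show thesis
  proof (rule that)
    show "orbit_functor C K J act L J' act' M.extension" by (rule M.orbit_functor_extension)
    fix f assume [simp]: "arr K f" "tgt K f = Unt C"
    have "\<theta>' (P.star f) = Q.star (\<theta>' f)"
      by (rule Q.pi_inj) (use \<theta>.star_preserving[of "src K f" "\<pi> f"] in simp_all)
    then show "M.extension (P.star f) = Q.star (M.extension f)" by (simp add: M.extension_restricts)
  next
    show "restriction M.extension = \<theta>"
      by (rule \<theta>.transformation_eqI)
        (simp_all add: restriction_lift M.extension_restricts, simp_all add: restriction_def)
  qed
qed

end

section \<open>Realisation recovers the orbit category\<close>

lemma (in orbit_functor) orbit_functor_inverse:
  assumes left: "\<And>T. arr K T \<Longrightarrow> \<Psi> (\<Theta> T) = T" and onto: "\<And>S. arr L S \<Longrightarrow> \<exists>T. arr K T \<and> S = \<Theta> T"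
  shows "orbit_functor C L J' act' K J act \<Psi>"
proof unfold_locales
  fix a b assume [simp]: "a \<in> Obj C" "b \<in> Obj C"
  show "linear_map (hom_space L a b) (hom_space K a b) \<Psi>"
  proof (rule semilinear_on_image[OF _ Theta_linear])
    have "inj_on \<Theta> (Hom K a b)" by (rule inj_on_inverseI[of _ \<Psi>]) (simp add: K.Hom_K_iff left)
    moreover have "\<Theta> ` Hom K a b = Hom L a b"
      using onto by (force simp: K.Hom_K_iff L.Hom_K_iff)
    ultimately show "bij_betw \<Theta> (carrier (hom_space K a b)) (carrier (hom_space L a b))"
      by (simp add: bij_betw_def hom_space_def)
    show V: "cvector_space (hom_space K a b)" using K.K.hom_vector_space by simp
    have "linear_map (hom_space K a b) (hom_space K a b) (\<lambda>u. u)"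
      by (auto simp: semilinear_map_def)
    then show "linear_map (hom_space K a b) (hom_space K a b) (\<lambda>u. \<Psi> (\<Theta> u))"
      by (rule semilinear_map_cong[OF _ V]) (simp add: hom_space_def K.Hom_K_iff left)
  qed simp_all
next
  fix T S assume "arr L T" "arr L S" and ts: "tgt L T = src L S"
  then obtain T' S' where [simp]: "arr K T'" "T = \<Theta> T'" "arr K S'" "S = \<Theta> S'" using onto by metis
  have "tgt K T' = src K S'" using ts by simp
  then show "\<Psi> (S \<cdot>\<^bsub>L\<^esub> T) = \<Psi> S \<cdot>\<^bsub>K\<^esub> \<Psi> T" by (simp add: left flip: Theta_comp)
next
  fix f assume "arr C f"
  then show "\<Psi> (J' f) = J f" by (simp add: left flip: Theta_J)
next
  fix c T assume [simp]: "c \<in> Obj C" and "arr L T"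
  then obtain T' where [simp]: "arr K T'" "T = \<Theta> T'" using onto by metis
  show "\<Psi> (act' c T) = act c (\<Psi> T)" by (simp add: left flip: Theta_act)
qed

context realisation
begin

interpretation R: rigid_module C realise by (rule rigid_module_realise)

definition name :: "'d \<Rightarrow> 'a \<times> 'a \<times> 'm \<times> 'm \<times> 'v" where
  "name T = (src K T, tgt K T, enc T)"

lemma ten_unit [simp]: "ten c (Unt C) = c"
  by (simp add: ten_def)

lemma massoc_unit: 
  assumes [simp]: "c \<in> Obj C" "b \<in> Obj C"
  shows "massoc c b (Unt C) = ten_iso c b"
proof -
  have "massoc c b (Unt C) = ten_iso c b \<cdot> ((Idn C c \<otimes>\<^sub>a RUn C b) \<cdot> Asc C c b (Unt C)) \<cdot> (RUn C (c \<otimes>\<^sub>o b))\<dagger>"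
    by (simp add: massoc_def ten_iso_def)
  also have "(Idn C c \<otimes>\<^sub>a RUn C b) \<cdot> Asc C c b (Unt C) = RUn C (c \<otimes>\<^sub>o b)" by (simp add: RUn_TOb)
  finally show ?thesis by simp
qed

text \<open>
  Because \<open>c\<close> acts on the basepoint by \<open>e c\<close> exactly, the orbit of the realisation has the same arrows as \<open>K\<close>.
  The isomorphisms \<open>ten_iso c 1 = RUn C c\<close> by which the action was modified cancel by naturality of \<open>RUn\<close>.
\<close>

lemma orbit_functor_name: "orbit_functor C K J act R.orb R.orb_J R.orb_act name"
proof (intro orbit_functor.intro orbit_functor_axioms.intro orbit_pair.intro orbit_category_axioms R.orbit_category_orb)
  fix a b assume [simp]: "a \<in> Obj C" "b \<in> Obj C"
  have V: "cvector_space (hom_space K a b)" using K.hom_vector_space by simp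
  have "linear_map (hom_space K a b) (hom_space R.orb a b) (\<lambda>T. (a, b, enc T))"
    using linear_map_comp[OF hom_space_realise(2)[of a b] R.tag_linear(1)[of a b, simplified]] by simp
  then show "linear_map (hom_space K a b) (hom_space R.orb a b) name"
    by (rule semilinear_map_cong[OF _ V]) (simp add: hom_space_def Hom_K_iff name_def)
next
  fix T S assume "arr K T" "arr K S" "tgt K T = src K S"
  then show "name (S \<star> T) = name S \<cdot>\<^bsub>R.orb\<^esub> name T" by (simp add: name_def)
next
  fix f assume [simp]: "arr C f"
  have "RUn C (tgt C f) \<cdot> (f \<otimes>\<^sub>a Idn C (Unt C)) \<cdot> (RUn C (src C f))\<dagger> = (RUn C (tgt C f) \<cdot> (f \<otimes>\<^sub>a Idn C (Unt C))) \<cdot> (RUn C (src C f))\<dagger>"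
    by simp
  also have "\<dots> = (f \<cdot> RUn C (src C f)) \<cdot> (RUn C (src C f))\<dagger>"
    by (subst RUn_nat) (rule refl | simp)+
  also have "\<dots> = f" by simp
  finally have "actT f (Idn K (Unt C)) = J f"
    using actT_J[of f "Idn C (Unt C)"] by (simp add: J_Idn ten_iso_def)
  then show "name (J f) = R.orb_J f" by (simp add: name_def R.orb_J_def)
next
  fix c T assume [simp]: "c \<in> Obj C" "arr K T"
  have "J ((ten_iso c (tgt K T))\<dagger>) \<star> actT (Idn C c) T \<star> J (ten_iso c (src K T)) = act c T"
    by (simp add: actT_def whisk_Idn J_merge J_Idn)
  then show "name (act c T) = R.orb_act c (name T)"
    by (simp add: name_def R.orb_act_def massoc_unit dag_J)
qed

lemma name_dag: "arr K T \<Longrightarrow> name (dag T) = R.orb_dag (name T)"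
  by (simp add: name_def R.orb_dag_def)

lemma name_surj:
  assumes "arr R.orb S"
  shows "\<exists>T. arr K T \<and> S = name T"
proof -
  obtain a b f where S: "S = (a, b, f)" and ab: "a \<in> Obj C" "b \<in> Obj C"
    and f: "arr realise f" "src realise f = e a" "tgt realise f = e b"
    by (rule R.arr_orbE[OF assms]) (use that in simp)
  have "f \<in> Hom realise (e a) (e b)" using R.M.arr_in_Hom[OF f(1)] unfolding f(2,3) by simp
  then show ?thesis using Hom_realise[OF ab] by (auto simp: S name_def)
qed

end

section \<open>The star algebra object of a cyclic module dagger category\<close>

locale tagged_module = rigid_module C M
  for C :: "('o, 'a, 'z) rigid_cat_scheme" (structure) and M :: "('m, 'v, 'o, 'a) tagged_mod_cat" +
  assumes tagged: "tagged_homs M"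

sublocale tagged_module \<subseteq> O: orbit_dagger C orb orb_J orb_act orb_dag
  by (rule orbit_dagger_orb)

sublocale tagged_module \<subseteq> S: orbit_star C orb orb_J orb_act "\<lambda>f. O.flat (orb_dag f)"
  by (rule O.orbit_star_flat_dag)

text \<open>
  The vector underlying an arrow of the orbit category of a tagged module category: \<open>f\<close> carries its source and
  target once in \<open>C\<close> and once in the module category, and both are known for an arrow \<open>c \<rightarrow> 1\<close>.
\<close>

definition coord :: "'o \<times> 'o \<times> 'm \<times> 'm \<times> 'v \<Rightarrow> 'v" where
  "coord f = snd (snd (snd (snd f)))"

context tagged_module
begin

definition alg :: "('o, 'a, 'v) star_alg_object" where
  "alg = O.orbit_algebra coord (\<lambda>f. O.flat (orb_dag f))"

lemma inj_coord:
  assumes c: "c \<in> Obj C"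
  shows "inj_on coord (Hom orb c (Unt C))"
proof -
  have "Hom M (c \<rhd> m) (Unt C \<rhd> m) \<subseteq> {c \<rhd> m} \<times> {Unt C \<rhd> m} \<times> UNIV"
    using tagged c unfolding tagged_homs_def by simp
  then show ?thesis by (auto simp: inj_on_def coord_def)
qed

end

sublocale tagged_module \<subseteq> P: star_presentation C orb orb_J orb_act alg coord
  unfolding alg_def by (rule S.star_presentation_orbit_algebra[OF inj_coord])

context tagged_module
begin

lemma star_alg:
  assumes [simp]: "arr orb f" "tgt orb f = Unt C"
  shows "P.star f = O.flat (orb_dag f)"
proof (rule P.pi_inj)
  show "coord (P.star f) = coord (O.flat (orb_dag f))"
    using S.orbit_algebra_simps(5)[OF inj_coord, of f "src orb f"] by (simp flip: alg_def)
qed simp_all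

end

section \<open>The category of star algebra objects\<close>

lemma star_algebra_category_simps [simp]:
  "Obj (star_algebra_category C) = {A. star_algebra_object C A}"
  "Hom (star_algebra_category C) A B = {(A, B, \<theta>) | \<theta>. star_algebra_transformation C A B \<theta>}"
  "Idn (star_algebra_category C) A = (A, A, \<lambda>a\<in>Obj C. \<lambda>x\<in>carrier (VOb A a). x)"
  "(B', D, \<tau>) \<cdot>\<^bsub>star_algebra_category C\<^esub> (A, B, \<theta>) = (A, D, \<lambda>a\<in>Obj C. \<lambda>x\<in>carrier (VOb A a). \<tau> a (\<theta> a x))"
  by (simp_all add: star_algebra_category_def)

lemma (in star_algebra_transformation) component_closed:
  "\<lbrakk>a \<in> Obj C; x \<in> carrier (VOb A a)\<rbrakk> \<Longrightarrow> \<theta> a x \<in> carrier (VOb B a)"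
  using linear[of a] by (auto simp: semilinear_map_def)

context rigid_cstar_tensor_category
begin

lemma star_algebra_closed:
  assumes "star_algebra_object C A"
  shows "a \<in> Obj C \<Longrightarrow> cvector_space (VOb A a)"
    and "\<lbrakk>a \<in> Obj C; b \<in> Obj C; f \<in> Hom C a b; x \<in> carrier (VOb A b)\<rbrakk> \<Longrightarrow> VAr A f x \<in> carrier (VOb A a)"
    and "\<lbrakk>a \<in> Obj C; b \<in> Obj C; x \<in> carrier (VOb A a); y \<in> carrier (VOb A b)\<rbrakk> \<Longrightarrow> AMul A a b x y \<in> carrier (VOb A (a \<otimes>\<^sub>o b))"
    and "AUnit A \<in> carrier (VOb A (Unt C))"
    and "\<lbrakk>a \<in> Obj C; x \<in> carrier (VOb A a)\<rbrakk> \<Longrightarrow> AStar A a x \<in> carrier (VOb A (Cj C a))"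
proof -
  interpret A: star_algebra_object C A by fact
  show "a \<in> Obj C \<Longrightarrow> cvector_space (VOb A a)" by (rule A.VOb_vector_space)
  show "AUnit A \<in> carrier (VOb A (Unt C))" by (rule A.AUnit_in)
  show "VAr A f x \<in> carrier (VOb A a)" if "a \<in> Obj C" "b \<in> Obj C" "f \<in> Hom C a b" "x \<in> carrier (VOb A b)"
    using A.VAr_bilinear[OF that(1,2)] that(3,4) by (auto simp: bilinear_map_def semilinear_map_def hom_space_def)
  show "AMul A a b x y \<in> carrier (VOb A (a \<otimes>\<^sub>o b))"
    if "a \<in> Obj C" "b \<in> Obj C" "x \<in> carrier (VOb A a)" "y \<in> carrier (VOb A b)"
    using A.AMul_bilinear[OF that(1,2)] that(3,4) by (auto simp: bilinear_map_def semilinear_map_def)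
  show "AStar A a x \<in> carrier (VOb A (Cj C a))" if "a \<in> Obj C" "x \<in> carrier (VOb A a)"
    using A.AStar_conj_linear[OF that(1)] that(2) by (auto simp: semilinear_map_def)
qed

lemma category_star_algebra_category: "category (star_algebra_category C)"
proof
  fix A assume "A \<in> Obj (star_algebra_category C)"
  then have A: "star_algebra_object C A" by simp
  note [simp] = star_algebra_closed[OF A]
  have "star_algebra_transformation C A A (\<lambda>a\<in>Obj C. \<lambda>x\<in>carrier (VOb A a). x)"
    by unfold_locales (auto simp: semilinear_map_def cvector_spaceD)
  then show "Idn (star_algebra_category C) A \<in> Hom (star_algebra_category C) A A" by simp
next
  fix A B D f g assume A: "A \<in> Obj (star_algebra_category C)" and B: "B \<in> Obj (star_algebra_category C)"
    and "f \<in> Hom (star_algebra_category C) A B" "g \<in> Hom (star_algebra_category C) B D"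
  then obtain \<theta> \<tau> where f: "f = (A, B, \<theta>)" "star_algebra_transformation C A B \<theta>"
    and g: "g = (B, D, \<tau>)" "star_algebra_transformation C B D \<tau>" by auto
  interpret \<theta>: star_algebra_transformation C A B \<theta> by (rule f)
  interpret \<tau>: star_algebra_transformation C B D \<tau> by (rule g)
  from A B have "star_algebra_object C A" by simp
  note [simp] = star_algebra_closed[OF this] \<theta>.component_closed
  let ?c = "\<lambda>a\<in>Obj C. \<lambda>x\<in>carrier (VOb A a). \<tau> a (\<theta> a x)"
  have "star_algebra_transformation C A D ?c"
  proof
    fix a assume a: "a \<in> Obj C"
    show "linear_map (VOb A a) (VOb D a) (?c a)"
      by (rule semilinear_map_cong[OF linear_map_comp[OF \<theta>.linear[OF a] \<tau>.linear[OF a]]]) (use a in simp_all)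
  qed (simp_all add: \<theta>.natural \<tau>.natural \<theta>.multiplicative \<tau>.multiplicative \<theta>.unital \<tau>.unital
      \<theta>.star_preserving \<tau>.star_preserving)
  then show "g \<cdot>\<^bsub>star_algebra_category C\<^esub> f \<in> Hom (star_algebra_category C) A D" by (simp add: f(1) g(1))
next
  fix A B f assume "A \<in> Obj (star_algebra_category C)" "f \<in> Hom (star_algebra_category C) A B"
  then obtain \<theta> where f: "f = (A, B, \<theta>)" "star_algebra_transformation C A B \<theta>" by auto
  interpret \<theta>: star_algebra_transformation C A B \<theta> by (rule f)
  show "Idn (star_algebra_category C) B \<cdot>\<^bsub>star_algebra_category C\<^esub> f = f"
    "f \<cdot>\<^bsub>star_algebra_category C\<^esub> Idn (star_algebra_category C) A = f"
    by (auto simp: f(1) \<theta>.component_closed intro!: \<theta>.transformation_eqI)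
next
  fix A B D E f g h assume "f \<in> Hom (star_algebra_category C) A B" "g \<in> Hom (star_algebra_category C) B D"
    "h \<in> Hom (star_algebra_category C) D E"
  then obtain \<theta> \<tau> \<sigma> where f: "f = (A, B, \<theta>)" "star_algebra_transformation C A B \<theta>"
    and g: "g = (B, D, \<tau>)" and h: "h = (D, E, \<sigma>)" by auto
  show "(h \<cdot>\<^bsub>star_algebra_category C\<^esub> g) \<cdot>\<^bsub>star_algebra_category C\<^esub> f
      = h \<cdot>\<^bsub>star_algebra_category C\<^esub> (g \<cdot>\<^bsub>star_algebra_category C\<^esub> f)"
    by (auto simp: f(1) g h star_algebra_transformation.component_closed[OF f(2)] intro!: restrict_ext)
qed auto

end

section \<open>The category of cyclic module dagger categories\<close>

lemma module_category_simps [simp]: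
  "Obj (category_of_cyclic_module_dagger_categories C) = {M. cyclic_module_dagger_category C M \<and> tagged_homs M}"
  "Hom (category_of_cyclic_module_dagger_categories C) M N
    = {(M, N, mod_fun_class C M N F) | F. cyclic_module_dagger_functor C M N F}"
  "Idn (category_of_cyclic_module_dagger_categories C) M = (M, M, mod_fun_class C M M (mod_fun_id M))"
  "(N', P, Y) \<cdot>\<^bsub>category_of_cyclic_module_dagger_categories C\<^esub> (M, N, X)
    = (M, P, \<Union>G\<in>Y. \<Union>F\<in>X. mod_fun_class C M P (mod_fun_comp P G F))"
  by (simp_all add: category_of_cyclic_module_dagger_categories_def)

context rigid_cstar_tensor_category
begin

context
  fixes M :: "('m, 'y, 'o, 'a, 'w) mod_cat_scheme" and N :: "('n, 'x, 'o, 'a, 'v) mod_cat_scheme"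
  assumes M: "cyclic_module_dagger_category C M" and N: "cyclic_module_dagger_category C N"
begin

lemma rigid_module_functorI:
  assumes "cyclic_module_dagger_functor C M N F"
  shows "rigid_module_functor C M N F"
  by (intro rigid_module_functor.intro rigid_module_pair.intro rigid_module.intro rigid_cstar_tensor_category_axioms M N assms)

lemma mod_fun_iso_iff:
  assumes "cyclic_module_dagger_functor C M N F" "cyclic_module_dagger_functor C M N G"
  shows "mod_fun_iso C M N F G \<longleftrightarrow> (\<forall>T. arr (rigid_module.orb C M) T \<longrightarrow>
    rigid_module_functor.orbit_map C M N F T = rigid_module_functor.orbit_map C M N G T)"
  using mod_fun_iso_orbit_map[OF assms[THEN rigid_module_functorI]] orbit_map_mod_fun_iso[OF assms[THEN rigid_module_functorI]]
  by blast

lemma mod_fun_class_eq_iff: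
  assumes "cyclic_module_dagger_functor C M N F" "cyclic_module_dagger_functor C M N G"
  shows "mod_fun_class C M N F = mod_fun_class C M N G \<longleftrightarrow> mod_fun_iso C M N F G"
proof
  assume "mod_fun_class C M N F = mod_fun_class C M N G"
  moreover have "G \<in> mod_fun_class C M N G" using assms by (simp add: mod_fun_class_def mod_fun_iso_iff)
  ultimately have "G \<in> mod_fun_class C M N F" by blast
  then show "mod_fun_iso C M N F G" by (simp add: mod_fun_class_def)
next
  assume FG: "mod_fun_iso C M N F G"
  have "mod_fun_iso C M N F H \<longleftrightarrow> mod_fun_iso C M N G H" if "cyclic_module_dagger_functor C M N H" for H
    using FG unfolding mod_fun_iso_iff[OF assms] mod_fun_iso_iff[OF assms(1) that] mod_fun_iso_iff[OF assms(2) that] by metis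
  then show "mod_fun_class C M N F = mod_fun_class C M N G" by (auto simp: mod_fun_class_def)
qed

lemma self_in_mod_fun_class: "cyclic_module_dagger_functor C M N F \<Longrightarrow> F \<in> mod_fun_class C M N F"
  by (simp add: mod_fun_class_def mod_fun_iso_iff)

end

lemma mod_fun_comp_functor:
  assumes M: "cyclic_module_dagger_category C M" and N: "cyclic_module_dagger_category C N" and P: "cyclic_module_dagger_category C P"
    and F: "cyclic_module_dagger_functor C M N F" and G: "cyclic_module_dagger_functor C N P G"
  shows "cyclic_module_dagger_functor C M P (mod_fun_comp P G F)"
    "arr (rigid_module.orb C M) T \<Longrightarrow> rigid_module_functor.orbit_map C M P (mod_fun_comp P G F) T
      = rigid_module_functor.orbit_map C N P G (rigid_module_functor.orbit_map C M N F T)"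
proof -
  interpret rigid_module_functors C M N P F G
    by (intro rigid_module_functors.intro rigid_module_functorI assms)
  show "cyclic_module_dagger_functor C M P (mod_fun_comp P G F)" by (rule mod_fun_comp_functor)
  show "arr (rigid_module.orb C M) T \<Longrightarrow> rigid_module_functor.orbit_map C M P (mod_fun_comp P G F) T
      = rigid_module_functor.orbit_map C N P G (rigid_module_functor.orbit_map C M N F T)" by (rule orbit_map_comp)
qed

lemma orbit_map_arr:
  assumes "cyclic_module_dagger_category C M" "cyclic_module_dagger_category C N" "cyclic_module_dagger_functor C M N F"
    and T: "arr (rigid_module.orb C M) T"
  shows "arr (rigid_module.orb C N) (rigid_module_functor.orbit_map C M N F T)"
proof -
  interpret F: rigid_module_functor C M N F by (intro rigid_module_functorI assms)
  interpret orbit_functor C F.X.orb F.X.orb_J F.X.orb_act F.Y.orb F.Y.orb_J F.Y.orb_act F.orbit_map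
    by (rule F.orbit_functor_orbit_map)
  show ?thesis using T by simp
qed

text \<open>
  The orbit map of a composite is the composite of the orbit maps, so all composites of representatives
  lie in one class.
\<close>

lemma mod_fun_class_comp:
  assumes M: "cyclic_module_dagger_category C M" and N: "cyclic_module_dagger_category C N" and P: "cyclic_module_dagger_category C P"
    and F: "cyclic_module_dagger_functor C M N F" and G: "cyclic_module_dagger_functor C N P G"
  shows "(\<Union>G'\<in>mod_fun_class C N P G. \<Union>F'\<in>mod_fun_class C M N F. mod_fun_class C M P (mod_fun_comp P G' F'))
    = mod_fun_class C M P (mod_fun_comp P G F)"
proof -
  have "mod_fun_class C M P (mod_fun_comp P G' F') = mod_fun_class C M P (mod_fun_comp P G F)"
    if "G' \<in> mod_fun_class C N P G" "F' \<in> mod_fun_class C M N F" for G' F'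
  proof -
    have F': "cyclic_module_dagger_functor C M N F'" "mod_fun_iso C M N F F'"
      and G': "cyclic_module_dagger_functor C N P G'" "mod_fun_iso C N P G G'"
      using that by (auto simp: mod_fun_class_def)
    note comp = mod_fun_comp_functor[OF M N P F G] and comp' = mod_fun_comp_functor[OF M N P F'(1) G'(1)]
    show ?thesis
      unfolding mod_fun_class_eq_iff[OF M P comp'(1) comp(1)] mod_fun_iso_iff[OF M P comp'(1) comp(1)]
    proof (intro allI impI)
      fix T assume T: "arr (rigid_module.orb C M) T"
      show "rigid_module_functor.orbit_map C M P (mod_fun_comp P G' F') T = rigid_module_functor.orbit_map C M P (mod_fun_comp P G F) T"
        unfolding comp(2)[OF T] comp'(2)[OF T]
        using F'(2)[unfolded mod_fun_iso_iff[OF M N F F'(1)], rule_format, OF T]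
          G'(2)[unfolded mod_fun_iso_iff[OF N P G G'(1)], rule_format, OF orbit_map_arr[OF M N F T]] by simp
    qed
  qed
  moreover have "mod_fun_class C N P G \<noteq> {}" "mod_fun_class C M N F \<noteq> {}"
    using self_in_mod_fun_class[OF M N F] self_in_mod_fun_class[OF N P G] by blast+
  ultimately show ?thesis by simp
qed

lemma category_category_of_cyclic_module_dagger_categories:
  "category (category_of_cyclic_module_dagger_categories C)" (is "category ?D")
proof
  have id: "cyclic_module_dagger_functor C M M (mod_fun_id M)"
    "arr (rigid_module.orb C M) T \<Longrightarrow> rigid_module_functor.orbit_map C M M (mod_fun_id M) T = T"
    if "cyclic_module_dagger_category C M" for M :: "('m, 'm \<times> 'm \<times> 'v, 'o, 'a) mod_cat" and T
  proof -
    interpret rigid_module C M by (intro rigid_module.intro that rigid_cstar_tensor_category_axioms)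
    show "cyclic_module_dagger_functor C M M (mod_fun_id M)" by (rule mod_fun_id_functor)
    show "arr orb T \<Longrightarrow> rigid_module_functor.orbit_map C M M (mod_fun_id M) T = T" by (rule orbit_map_id)
  qed
  show "Idn ?D M \<in> Hom ?D M M" if "M \<in> Obj ?D" for M using that id by auto
  fix M N f assume "M \<in> Obj ?D" "N \<in> Obj ?D" "f \<in> Hom ?D M N"
  then obtain F where M: "cyclic_module_dagger_category C M" and N: "cyclic_module_dagger_category C N"
    and f: "f = (M, N, mod_fun_class C M N F)" and F: "cyclic_module_dagger_functor C M N F" by auto
  note FI = mod_fun_comp_functor[OF M M N id(1)[OF M] F] and IF = mod_fun_comp_functor[OF M N N F id(1)[OF N]]
  show "Idn ?D N \<cdot>\<^bsub>?D\<^esub> f = f"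
    by (simp add: f mod_fun_class_comp M N F id mod_fun_class_eq_iff mod_fun_iso_iff IF orbit_map_arr)
  show "f \<cdot>\<^bsub>?D\<^esub> Idn ?D M = f"
    by (simp add: f mod_fun_class_comp M N F id mod_fun_class_eq_iff mod_fun_iso_iff FI)
  fix P g assume "P \<in> Obj ?D" "g \<in> Hom ?D N P"
  then obtain G where P: "cyclic_module_dagger_category C P"
    and g: "g = (N, P, mod_fun_class C N P G)" and G: "cyclic_module_dagger_functor C N P G" by auto
  note GF = mod_fun_comp_functor[OF M N P F G]
  show "g \<cdot>\<^bsub>?D\<^esub> f \<in> Hom ?D M P" using GF by (auto simp: f g mod_fun_class_comp M N P F G)
  fix Q h assume "Q \<in> Obj ?D" "h \<in> Hom ?D P Q"
  then obtain H where Q: "cyclic_module_dagger_category C Q"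
    and h: "h = (P, Q, mod_fun_class C P Q H)" and H: "cyclic_module_dagger_functor C P Q H" by auto
  note HG = mod_fun_comp_functor[OF N P Q G H]
  note HGF = mod_fun_comp_functor[OF M N Q F HG(1)] mod_fun_comp_functor[OF M P Q GF(1) H]
  show "(h \<cdot>\<^bsub>?D\<^esub> g) \<cdot>\<^bsub>?D\<^esub> f = h \<cdot>\<^bsub>?D\<^esub> (g \<cdot>\<^bsub>?D\<^esub> f)"
    by (simp add: f g h mod_fun_class_comp M N P Q F G H GF HG(1) mod_fun_class_eq_iff mod_fun_iso_iff HGF HG(2) orbit_map_arr)
qed auto

end

section \<open>The equivalence\<close>

lemma (in orbit_functor) Theta_flat:
  "\<lbrakk>arr K h; src K h = Unt C\<rbrakk> \<Longrightarrow> \<Theta> (K.flat h) = L.flat (\<Theta> h)"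
  by (simp add: K.flat_def L.flat_def Theta_comp Theta_J Theta_act)

locale tagged_module_pair = X: tagged_module C M + Y: tagged_module C N
  for C :: "('o, 'a, 'z) rigid_cat_scheme" (structure)
    and M N :: "('m, 'v, 'o, 'a) tagged_mod_cat"

sublocale tagged_module_pair \<subseteq> Z: star_presentation_pair C X.orb X.orb_J X.orb_act X.alg coord Y.orb Y.orb_J Y.orb_act Y.alg coord ..

context tagged_module_pair
begin

definition algebra_map :: "('m, 'v, 'o) tagged_mod_fun \<Rightarrow> 'o \<Rightarrow> 'v \<Rightarrow> 'v" where
  "algebra_map F = Z.restriction (rigid_module_functor.orbit_map C M N F)"

lemma rigid_module_functor_tagged: "cyclic_module_dagger_functor C M N F \<Longrightarrow> rigid_module_functor C M N F"
  by (rule X.rigid_module_functorI[OF X.M.cyclic_module_dagger_category_axioms Y.M.cyclic_module_dagger_category_axioms])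

lemma mod_fun_iso_iff':
  assumes "cyclic_module_dagger_functor C M N F" "cyclic_module_dagger_functor C M N G"
  shows "mod_fun_iso C M N F G \<longleftrightarrow> (\<forall>T. arr X.orb T \<longrightarrow>
    rigid_module_functor.orbit_map C M N F T = rigid_module_functor.orbit_map C M N G T)"
  by (rule X.mod_fun_iso_iff[OF X.M.cyclic_module_dagger_category_axioms Y.M.cyclic_module_dagger_category_axioms assms])

lemma transformation_algebra_map:
  assumes "cyclic_module_dagger_functor C M N F"
  shows "star_algebra_transformation C X.alg Y.alg (algebra_map F)"
  unfolding algebra_map_def
proof (rule Z.transformation_restriction)
  interpret F: rigid_module_functor C M N F by (rule rigid_module_functor_tagged[OF assms])
  show functorial: "orbit_functor C X.orb X.orb_J X.orb_act Y.orb Y.orb_J Y.orb_act F.orbit_map"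
    by (rule F.orbit_functor_orbit_map)
  interpret T: orbit_functor C X.orb X.orb_J X.orb_act Y.orb Y.orb_J Y.orb_act F.orbit_map by (rule functorial)
  fix f assume "arr X.orb f" "tgt X.orb f = Unt C"
  then show "F.orbit_map (X.P.star f) = Y.P.star (F.orbit_map f)"
    by (simp add: X.star_alg Y.star_alg T.Theta_flat F.orbit_map_dag)
qed

lemma algebra_map_eq_iff:
  assumes "cyclic_module_dagger_functor C M N F" "cyclic_module_dagger_functor C M N G"
  shows "algebra_map F = algebra_map G \<longleftrightarrow> mod_fun_iso C M N F G"
proof -
  interpret F: rigid_module_functor C M N F by (rule rigid_module_functor_tagged[OF assms(1)])
  interpret G: rigid_module_functor C M N G by (rule rigid_module_functor_tagged[OF assms(2)])
  have "F.orbit_map T = G.orbit_map T" if "algebra_map F = algebra_map G" "arr X.orb T" for T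
    using Z.restriction_inj[OF F.orbit_functor_orbit_map G.orbit_functor_orbit_map] that by (simp add: algebra_map_def)
  moreover have "algebra_map F = algebra_map G" if "\<And>T. arr X.orb T \<Longrightarrow> F.orbit_map T = G.orbit_map T"
    unfolding algebra_map_def Z.restriction_def by (intro restrict_ext) (simp add: that)
  ultimately show ?thesis using mod_fun_iso_iff'[OF assms] by blast
qed

lemma transformation_is_algebra_map:
  assumes "star_algebra_transformation C X.alg Y.alg \<theta>"
  shows "\<exists>F. cyclic_module_dagger_functor C M N F \<and> algebra_map F = \<theta>"
proof -
  obtain \<Theta> where \<Theta>: "orbit_functor C X.orb X.orb_J X.orb_act Y.orb Y.orb_J Y.orb_act \<Theta>"
    and star: "\<And>f. \<lbrakk>arr X.orb f; tgt X.orb f = Unt C\<rbrakk> \<Longrightarrow> \<Theta> (X.P.star f) = Y.P.star (\<Theta> f)"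
    and res: "Z.restriction \<Theta> = \<theta>"
    by (rule Z.transformation_extends[OF assms]) blast
  interpret T: orbit_functor C X.orb X.orb_J X.orb_act Y.orb Y.orb_J Y.orb_act \<Theta> by (rule \<Theta>)
  interpret E: orbit_module_map C M N \<Theta>
  proof unfold_locales
    fix T assume "arr X.orb T"
    then show "\<Theta> (X.orb_dag T) = Y.orb_dag (\<Theta> T)"
      by (rule T.Theta_dag[OF X.orbit_dagger_orb Y.orbit_dagger_orb, rotated])
        (use star in \<open>simp add: X.star_alg Y.star_alg\<close>)
  qed
  have "algebra_map E.extend = \<theta>"
    unfolding res[symmetric] algebra_map_def Z.restriction_def
    by (intro restrict_ext) (simp add: E.orbit_map_extend)
  then show ?thesis using E.extend_functor by blast
qed

end

context rigid_cstar_tensor_category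
begin

lemma tagged_moduleI:
  "\<lbrakk>cyclic_module_dagger_category C M; tagged_homs M\<rbrakk> \<Longrightarrow> tagged_module C M"
  by (intro tagged_module.intro rigid_module.intro rigid_cstar_tensor_category_axioms tagged_module_axioms.intro)

text \<open>
  A morphism is a class of isomorphic module functors. They have the same orbit map, so the choice of a
  representative does not matter.
\<close>

definition algebra_arrow where
  "algebra_arrow = (\<lambda>(M, N, X). (tagged_module.alg C M, tagged_module.alg C N,
     tagged_module_pair.algebra_map C M N (SOME F. F \<in> X)))"

lemma algebra_arrow_class:
  assumes M: "cyclic_module_dagger_category C M" "tagged_homs M" and N: "cyclic_module_dagger_category C N" "tagged_homs N"
    and F: "cyclic_module_dagger_functor C M N F"
  shows "algebra_arrow (M, N, mod_fun_class C M N F)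
    = (tagged_module.alg C M, tagged_module.alg C N, tagged_module_pair.algebra_map C M N F)"
proof -
  interpret tagged_module_pair C M N by (intro tagged_module_pair.intro tagged_moduleI M N)
  have "(SOME G. G \<in> mod_fun_class C M N F) \<in> mod_fun_class C M N F"
    using self_in_mod_fun_class[OF M(1) N(1) F] by (rule someI)
  then have "algebra_map F = algebra_map (SOME G. G \<in> mod_fun_class C M N F)"
    by (subst algebra_map_eq_iff[OF F]) (simp_all add: mod_fun_class_def)
  then show ?thesis by (simp add: algebra_arrow_def)
qed

lemma functor_algebra_arrow:
  "functor_between (category_of_cyclic_module_dagger_categories C) (star_algebra_category C) (tagged_module.alg C) algebra_arrow"
  (is "functor_between ?D ?A _ _")
proof
  fix M assume "M \<in> Obj ?D"
  then have M: "cyclic_module_dagger_category C M" "tagged_homs M" by auto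
  interpret X: tagged_module C M by (intro tagged_moduleI M)
  interpret pair: tagged_module_pair C M M ..
  show "tagged_module.alg C M \<in> Obj ?A" using X.P.star_algebra_object_axioms by simp
  have "pair.algebra_map (mod_fun_id M) = (\<lambda>a\<in>Obj C. \<lambda>x\<in>carrier (VOb X.alg a). x)"
    unfolding pair.algebra_map_def pair.Z.restriction_def by (intro restrict_ext) (simp add: X.orbit_map_id)
  then show "algebra_arrow (Idn ?D M) = Idn ?A (tagged_module.alg C M)"
    by (simp add: algebra_arrow_class[OF M M X.mod_fun_id_functor])
next
  fix M N f assume "M \<in> Obj ?D" "N \<in> Obj ?D" "f \<in> Hom ?D M N"
  then obtain F where M: "cyclic_module_dagger_category C M" "tagged_homs M" and N: "cyclic_module_dagger_category C N" "tagged_homs N"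
    and f: "f = (M, N, mod_fun_class C M N F)" and F: "cyclic_module_dagger_functor C M N F" by auto
  interpret MN: tagged_module_pair C M N by (intro tagged_module_pair.intro tagged_moduleI M N)
  show "algebra_arrow f \<in> Hom ?A (tagged_module.alg C M) (tagged_module.alg C N)"
    using MN.transformation_algebra_map[OF F] by (simp add: f algebra_arrow_class[OF M N F])
  fix P g assume "P \<in> Obj ?D" "g \<in> Hom ?D N P"
  then obtain G where P: "cyclic_module_dagger_category C P" "tagged_homs P"
    and g: "g = (N, P, mod_fun_class C N P G)" and G: "cyclic_module_dagger_functor C N P G" by auto
  interpret NP: tagged_module_pair C N P by (intro tagged_module_pair.intro tagged_moduleI N P)
  interpret MP: tagged_module_pair C M P by (intro tagged_module_pair.intro tagged_moduleI M P)
  note GF = mod_fun_comp_functor[OF M(1) N(1) P(1) F G]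
  interpret F: rigid_module_functor C M N F by (rule MN.rigid_module_functor_tagged[OF F])
  interpret T: orbit_functor C MN.X.orb MN.X.orb_J MN.X.orb_act MN.Y.orb MN.Y.orb_J MN.Y.orb_act F.orbit_map
    by (rule F.orbit_functor_orbit_map)
  have "MP.algebra_map (mod_fun_comp P G F)
      = (\<lambda>a\<in>Obj C. \<lambda>x\<in>carrier (VOb MN.X.alg a). NP.algebra_map G a (MN.algebra_map F a x))"
    unfolding MP.algebra_map_def MP.Z.restriction_def
    by (intro restrict_ext) (simp add: GF(2) NP.algebra_map_def MN.algebra_map_def MN.Z.restriction_lift)
  then show "algebra_arrow (g \<cdot>\<^bsub>?D\<^esub> f) = algebra_arrow g \<cdot>\<^bsub>?A\<^esub> algebra_arrow f"
    by (simp add: f g mod_fun_class_comp[OF M(1) N(1) P(1) F G] algebra_arrow_class[OF M P GF(1)]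
        algebra_arrow_class[OF M N F] algebra_arrow_class[OF N P G])
qed

lemma algebra_arrow_faithful:
  assumes "M \<in> Obj (category_of_cyclic_module_dagger_categories C)" "N \<in> Obj (category_of_cyclic_module_dagger_categories C)"
    "f \<in> Hom (category_of_cyclic_module_dagger_categories C) M N" "g \<in> Hom (category_of_cyclic_module_dagger_categories C) M N"
    "algebra_arrow f = algebra_arrow g"
  shows "f = g"
proof -
  from assms obtain F G where M: "cyclic_module_dagger_category C M" "tagged_homs M" and N: "cyclic_module_dagger_category C N" "tagged_homs N"
    and f: "f = (M, N, mod_fun_class C M N F)" and F: "cyclic_module_dagger_functor C M N F"
    and g: "g = (M, N, mod_fun_class C M N G)" and G: "cyclic_module_dagger_functor C M N G" by auto
  interpret tagged_module_pair C M N by (intro tagged_module_pair.intro tagged_moduleI M N)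
  show ?thesis
    using assms(5) by (simp add: f g algebra_arrow_class[OF M N] F G algebra_map_eq_iff mod_fun_class_eq_iff[OF M(1) N(1)])
qed

lemma algebra_arrow_full:
  assumes "M \<in> Obj (category_of_cyclic_module_dagger_categories C)" "N \<in> Obj (category_of_cyclic_module_dagger_categories C)"
    "h \<in> Hom (star_algebra_category C) (tagged_module.alg C M) (tagged_module.alg C N)"
  shows "\<exists>f\<in>Hom (category_of_cyclic_module_dagger_categories C) M N. algebra_arrow f = h"
proof -
  from assms have M: "cyclic_module_dagger_category C M" "tagged_homs M" and N: "cyclic_module_dagger_category C N" "tagged_homs N" by auto
  interpret tagged_module_pair C M N by (intro tagged_module_pair.intro tagged_moduleI M N)
  obtain \<theta> where h: "h = (X.alg, Y.alg, \<theta>)" "star_algebra_transformation C X.alg Y.alg \<theta>" using assms(3) by auto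
  obtain F where F: "cyclic_module_dagger_functor C M N F" "algebra_map F = \<theta>"
    using transformation_is_algebra_map[OF h(2)] by auto
  then show ?thesis using algebra_arrow_class[OF M N F(1)] by (auto simp: h(1))
qed

text \<open>
  The free module category on \<open>A\<close> presents \<open>A\<close>, the star of \<open>A\<close> makes it a dagger category, and its realisation
  is a cyclic module dagger category whose orbit category, and hence whose algebra object, is the same.
\<close>

lemma algebra_arrow_essentially_surjective:
  fixes e :: "'o \<Rightarrow> 'm" and A :: "('o, 'a, 'v) star_alg_object"
  assumes e: "inj_on e (Obj C)" and A: "star_algebra_object C A"
  shows "\<exists>M\<in>Obj (category_of_cyclic_module_dagger_categories C :: (('m, 'v, 'o, 'a) tagged_mod_cat, _) cat).
    \<exists>f. iso_arr (star_algebra_category C) A (tagged_module.alg C M) f"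
proof -
  interpret A: rigid_algebra C A
    by (intro rigid_algebra.intro rigid_cstar_tensor_category_axioms star_algebra_object.axioms(1)[OF A])
  interpret P: star_presentation C A.op_cat A.op_J A.op_act A A.op_elem
    by (intro star_presentation.intro A.orbit_presentation_op_cat A)
  interpret D: orbit_dagger C A.op_cat A.op_J A.op_act P.S.dagger by (rule P.S.orbit_dagger_dagger)
  interpret R: realisation C A.op_cat A.op_J A.op_act P.S.dagger e A.op_code
    by (intro realisation.intro realisation_axioms.intro D.orbit_dagger_axioms e A.inj_on_op_code)
  interpret M: tagged_module C R.realise
    by (intro tagged_moduleI R.cyclic_module_dagger_category_realise R.tagged_realise)
  interpret N: orbit_functor C A.op_cat A.op_J A.op_act M.orb M.orb_J M.orb_act R.name
    by (rule R.orbit_functor_name)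
  define \<Psi> where "\<Psi> = inv_into {T. arr A.op_cat T} R.name"
  have left: "\<Psi> (R.name T) = T" if "arr A.op_cat T" for T
    unfolding \<Psi>_def by (rule inv_into_f_f) (use that in \<open>auto simp: inj_on_def R.name_def\<close>)
  interpret N': orbit_functor C M.orb M.orb_J M.orb_act A.op_cat A.op_J A.op_act \<Psi>
    by (rule N.orbit_functor_inverse[OF left R.name_surj])
  interpret Z: star_presentation_pair C A.op_cat A.op_J A.op_act A A.op_elem M.orb M.orb_J M.orb_act M.alg coord ..
  interpret Z': star_presentation_pair C M.orb M.orb_J M.orb_act M.alg coord A.op_cat A.op_J A.op_act A A.op_elem ..
  have right: "R.name (\<Psi> S) = S" if "arr M.orb S" for S using R.name_surj[OF that] left by auto
  have star: "R.name (P.star f) = M.P.star (R.name f)" if [simp]: "arr A.op_cat f" "tgt A.op_cat f = Unt C" for f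
  proof -
    have "R.name (P.star f) = R.name (P.flat (P.S.dagger f))" by (simp add: P.S.flat_dagger)
    also have "\<dots> = M.P.star (R.name f)" by (simp add: N.Theta_flat R.name_dag M.star_alg)
    finally show ?thesis .
  qed
  have star': "\<Psi> (M.P.star g) = P.star (\<Psi> g)" if [simp]: "arr M.orb g" "tgt M.orb g = Unt C" for g
    using star[of "\<Psi> g"] left[of "P.star (\<Psi> g)"] by (simp add: right)
  let ?\<theta> = "Z.restriction R.name" and ?\<tau> = "Z'.restriction \<Psi>"
  have "star_algebra_transformation C A M.alg ?\<theta>" "star_algebra_transformation C M.alg A ?\<tau>"
    using Z.transformation_restriction[OF N.orbit_functor_axioms star]
      Z'.transformation_restriction[OF N'.orbit_functor_axioms star'] by auto
  moreover have "(\<lambda>a\<in>Obj C. \<lambda>x\<in>carrier (VOb A a). ?\<tau> a (?\<theta> a x)) = (\<lambda>a\<in>Obj C. \<lambda>x\<in>carrier (VOb A a). x)"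
    by (intro restrict_ext) (simp add: Z.restriction_lift left)
  moreover have "(\<lambda>a\<in>Obj C. \<lambda>x\<in>carrier (VOb M.alg a). ?\<theta> a (?\<tau> a x)) = (\<lambda>a\<in>Obj C. \<lambda>x\<in>carrier (VOb M.alg a). x)"
    by (intro restrict_ext) (simp add: Z'.restriction_lift right)
  ultimately have inverse: "mutually_inverse (star_algebra_category C) A M.alg (A, M.alg, ?\<theta>) (M.alg, A, ?\<tau>)"
    by (simp add: mutually_inverse_def)
  show ?thesis
    unfolding iso_arr_def by (intro bexI[of _ R.realise] exI, rule inverse)
      (simp add: M.M.cyclic_module_dagger_category_axioms M.tagged)
qed

end

theorem theorem3p20:
  fixes C :: "('o, 'a) rigid_cat"
  assumes "rigid_cstar_tensor_category C"
    and "\<exists>e :: 'o \<Rightarrow> 'm. inj_on e (Obj C)"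
  shows "equivalent_categories
    (star_algebra_category C ::
      (('o, 'a, 'v) star_alg_object,
       ('o, 'a, 'v) star_alg_object \<times> ('o, 'a, 'v) star_alg_object \<times> ('o \<Rightarrow> 'v \<Rightarrow> 'v)) cat)
    (category_of_cyclic_module_dagger_categories C ::
      (('m, 'v, 'o, 'a) tagged_mod_cat,
       ('m, 'v, 'o, 'a) tagged_mod_cat \<times> ('m, 'v, 'o, 'a) tagged_mod_cat \<times>
         ('m, 'v, 'o) tagged_mod_fun set) cat)"
proof -
  interpret rigid_cstar_tensor_category C by fact
  obtain e :: "'o \<Rightarrow> 'm" where e: "inj_on e (Obj C)" using assms(2) by auto
  show ?thesis
  proof (rule equivalent_categories_if_fully_faithful[OF category_star_algebra_category
        category_category_of_cyclic_module_dagger_categories functor_algebra_arrow])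
    fix A :: "('o, 'a, 'v) star_alg_object" assume "A \<in> Obj (star_algebra_category C)"
    then show "\<exists>M\<in>Obj (category_of_cyclic_module_dagger_categories C :: (('m, 'v, 'o, 'a) tagged_mod_cat, _) cat).
        \<exists>f. iso_arr (star_algebra_category C) A (tagged_module.alg C M) f"
      by (intro algebra_arrow_essentially_surjective[OF e]) simp
  qed (fact algebra_arrow_full algebra_arrow_faithful)+
qed

end
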